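(* Let $\pi:E\to M$ be an affine Lie algebroid with anchor maps $\lambda:E\to J^1M$ and $\rho:V\to VM$. Then the affine bundle $\pi_1:J^1_\lambda E\to E$, modelled on $\bar\pi_1:V_\rho E\to E$ and with base $E$ fibred over $\mathbb{R}$ by $\tau\circ\pi$, carries an affine Lie algebroid structure $[\cdot,\cdot]^1$ over $E$ with anchor maps $\lambda^1:J^1_\lambda E\to J^1E$ and $\rho^1:V_\rho E\to VE$. This bracket is determined by the following requirements (together with skew-symmetry and $\mathbb{R}$-bilinearity on $Sec(\bar\pi_1)$ and the linearity properties $[Z,\boldsymbol{V}_1+\boldsymbol{V}_2]^1=[Z,\boldsymbol{V}_1]^1+[Z,\boldsymbol{V}_2]^1$, $[Z+\boldsymbol{Z}',\boldsymbol{V}]^1=[Z,\boldsymbol{V}]^1+[\boldsymbol{Z}',\boldsymbol{V}]^1$): (i) for all $\boldsymbol{Z}_1,\boldsymbol{Z}_2,\boldsymbol{V}\in Sec(\bar\pi_1)$ and $Z\in Sec(\pi_1)$, $$\rho^1([\boldsymbol{Z}_1,\boldsymbol{Z}_2]^1)=[\rho^1(\boldsymbol{Z}_1),\rho^1(\boldsymbol{Z}_2)],\qquad \rho^1([Z,\boldsymbol{V}]^1)=[\lambda^1(Z),\rho^1(\boldsymbol{V})];$$ (ii) for all projectable $\boldsymbol{Z}_1,\boldsymbol{Z}_2,\boldsymbol{V}\in Sec(\bar\pi_1)$, projectable $Z\in Sec(\pi_1)$ and all $F_1,F_2,F\in C^\infty(E)$, $$\bar\pi_2([F_1\boldsymbol{Z}_1,F_2\boldsymbol{Z}_2]^1)=F_1F_2\,[\bar\pi_2(\boldsymbol{Z}_1),\bar\pi_2(\boldsymbol{Z}_2)]+F_1\,\rho^1(\boldsymbol{Z}_1)(F_2)\,\bar\pi_2(\boldsymbol{Z}_2)-F_2\,\rho^1(\boldsymbol{Z}_2)(F_1)\,\bar\pi_2(\boldsymbol{Z}_1),$$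 $$\bar\pi_2([Z,F\boldsymbol{V}]^1)=F\,[\pi_2(Z),\bar\pi_2(\boldsymbol{V})]+\lambda^1(Z)(F)\,\bar\pi_2(\boldsymbol{V}).$$
   Context: $M$ is a smooth manifold fibred over $\mathbb{R}$ by $\tau:M\to\mathbb{R}$, with $t$ the coordinate on $\mathbb{R}$. For any manifold $N$ fibred over $\mathbb{R}$, $VN\subset TN$ denotes the bundle of vectors vertical with respect to the projection to $\mathbb{R}$, and $J^1N\to N$ the first jet bundle of the fibration, an affine bundle modelled on $VN$, identified with $\{X\in TN: dt(X)=1\}$; sections of $J^1N$ and $VN$ are vector fields on $N$. This applies to $M$ (via $\tau$) and to $E$ (via $\tau\circ\pi$). $\pi:E\to M$ is an affine bundle modelled on the vector bundle $\bar\pi:V\to M$. Boldface denotes sections of the modelling vector bundles. Definition. An affine Lie algebroid over a manifold $N$ fibred over $\mathbb{R}$ is an affine bundle $p:A\to N$, modelled on $\bar p:W\to N$, together with: (1) a skew-symmetric $\mathbb{R}$-bilinear bracket $[\cdot,\cdot]$ on $Sec(\bar p)$; (2) an action $(\zeta,\boldsymbol{\sigma})\mapsto[\zeta,\boldsymbol{\sigma}]\in Sec(\bar p)$ of $Sec(p)$ on $Sec(\bar p)$ with $[\zeta,\boldsymbol{\sigma}_1+\boldsymbol{\sigma}_2]=[\zeta,\boldsymbol{\sigma}_1]+[\zeta,\boldsymbol{\sigma}_2]$, $[\zeta+\boldsymbol{\sigma},\boldsymbol{\eta}]=[\zeta,\boldsymbol{\eta}]+[\boldsymbol{\sigma},\boldsymbol{\eta}]$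 and $[\zeta,[\boldsymbol{\sigma},\boldsymbol{\eta}]]=[[\zeta,\boldsymbol{\sigma}],\boldsymbol{\eta}]+[\boldsymbol{\sigma},[\zeta,\boldsymbol{\eta}]]$; (3) an affine bundle map $\lambda:A\to J^1N$ over the identity of $N$, with linear part $\rho:W\to VN$, such that $[\zeta,f\boldsymbol{\sigma}]=f[\zeta,\boldsymbol{\sigma}]+\lambda(\zeta)(f)\boldsymbol{\sigma}$ for all $f\in C^\infty(N)$. $\lambda$ and $\rho$ are called the anchor maps. Prolonged bundle. With $T\pi:TE\to TM$ the tangent map of $\pi$, put $$J^1_\lambda E=\{(q,Z)\in E\times J^1E\mid \lambda(q)=T\pi(Z)\},\qquad V_\rho E=\{(\boldsymbol{v},\boldsymbol{V})\in V\times VE\mid \rho(\boldsymbol{v})=T\pi(\boldsymbol{V})\}.$$ The projections are $\pi_2(q,Z)=q$, $\lambda^1(q,Z)=Z$, $\bar\pi_2(\boldsymbol{v},\boldsymbol{V})=\boldsymbol{v}$, $\rho^1(\boldsymbol{v},\boldsymbol{V})=\boldsymbol{V}$; $\pi_1:J^1_\lambda E\to E$ sends $(q,Z)$ to the base point in $E$ of the tangent vector $Z$, and $\bar\pi_1:V_\rho E\to E$ sends $(\boldsymbol{v},\boldsymbol{V})$ to the base point of $\boldsymbol{V}$. For sections we write $\lambda^1(Z)=\lambda^1\circ Z$, $\rho^1(\boldsymbol{Z})=\rho^1\circ\boldsymbol{Z}$ (vector fields on $E$), and $\pi_2(Z)=\pi_2\circ Z:E\to E$, $\bar\pi_2(\boldsymbol{Z})=\bar\pi_2\circ\boldsymbol{Z}:E\to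 V$ (sections along $\pi$). A section is determined by these two projections. A section $\boldsymbol{Z}$ of $\bar\pi_1$ is projectable if there is $\boldsymbol{\zeta}\in Sec(\bar\pi)$ with $\bar\pi_2\circ\boldsymbol{Z}=\boldsymbol{\zeta}\circ\pi$; a section $Z$ of $\pi_1$ is projectable if there is $\zeta\in Sec(\pi)$ with $\pi_2\circ Z=\zeta\circ\pi$. For projectable sections, $[\bar\pi_2(\boldsymbol{Z}_1),\bar\pi_2(\boldsymbol{Z}_2)]$ means $[\boldsymbol{\zeta}_1,\boldsymbol{\zeta}_2]\circ\pi$, and $[\pi_2(Z),\bar\pi_2(\boldsymbol{V})]$ means $[\zeta,\boldsymbol{\sigma}]\circ\pi$, where $\boldsymbol{\zeta}_1,\boldsymbol{\zeta}_2,\zeta,\boldsymbol{\sigma}$ are the sections onto which $\boldsymbol{Z}_1,\boldsymbol{Z}_2,Z,\boldsymbol{V}$ project and the brackets are those of the given affine Lie algebroid $\pi$. Brackets of vector fields are Lie brackets. *)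

theory Defs
  imports "HOL-Analysis.Analysis"
begin

section \<open>Smooth maps between Euclidean spaces\<close>

primrec Ck_on :: "nat \<Rightarrow> 'a::euclidean_space set \<Rightarrow> ('a \<Rightarrow> 'b::real_normed_vector) \<Rightarrow> bool" where
  "Ck_on 0 S f \<longleftrightarrow> continuous_on S f"
| "Ck_on (Suc k) S f \<longleftrightarrow>
     f differentiable_on S \<and> (\<forall>v. Ck_on k S (\<lambda>x. frechet_derivative f (at x) v))"

text \<open>A map on an arbitrary subset of a Euclidean space is smooth if it extends, near every point
  of the subset, to a map that is smooth on an open set.  On an open subset this is ordinary
  smoothness.\<close>

definition smooth_within :: "'a::euclidean_space set \<Rightarrow> ('a \<Rightarrow> 'b::real_normed_vector) \<Rightarrow> bool" where
  "smooth_within S f \<longleftrightarrow>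
     (\<forall>x\<in>S. \<exists>O' g. open O' \<and> x \<in> O' \<and> (\<forall>k. Ck_on k O' g) \<and> (\<forall>y\<in>O' \<inter> S. g y = f y))"


section \<open>Manifolds\<close>

record ('p, 'c) manifold =
  pts :: "'p set"
  charts :: "('p set \<times> ('p \<Rightarrow> 'c)) set"

definition mtop :: "('p, 'c::euclidean_space) manifold \<Rightarrow> 'p topology" where
  "mtop N = topology (\<lambda>O'. O' \<subseteq> pts N \<and>
     (\<forall>(U, \<phi>)\<in>charts N. openin (top_of_set (\<phi> ` U)) (\<phi> ` (U \<inter> O'))))"

text \<open>Types of class \<open>euclidean_space\<close> have positive dimension.  In order not to exclude
  dimension (and, for bundles, rank) zero, the model space of an \<open>n\<close>-dimensional manifold
  is an \<open>n\<close>-dimensional linear subspace of such a type.\<close>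

locale smooth_manifold =
  fixes N :: "('p, 'c::euclidean_space) manifold"
  assumes chart_cover: "(\<Union>(U, \<phi>)\<in>charts N. U) = pts N"
    and chart_inj: "\<And>U \<phi>. (U, \<phi>) \<in> charts N \<Longrightarrow> inj_on \<phi> U"
    and chart_open: "\<exists>n. \<forall>(U, \<phi>)\<in>charts N.
          \<exists>H. subspace H \<and> dim H = n \<and> openin (top_of_set H) (\<phi> ` U)"
    and chart_compatible: "\<And>U \<phi> V \<psi>. (U, \<phi>) \<in> charts N \<Longrightarrow> (V, \<psi>) \<in> charts N \<Longrightarrow>
          openin (top_of_set (\<phi> ` U)) (\<phi> ` (U \<inter> V)) \<and>
          smooth_within (\<phi> ` (U \<inter> V)) (\<psi> \<circ> inv_into U \<phi>)"
    and hausdorff: "Hausdorff_space (mtop N)"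
    and second_countable: "second_countable (mtop N)"

definition euclid :: "('c::euclidean_space, 'c) manifold" where
  "euclid = \<lparr>pts = UNIV, charts = {(UNIV, id)}\<rparr>"

definition prod_mfd :: "('p, 'c::euclidean_space) manifold \<Rightarrow> ('q, 'd::euclidean_space) manifold \<Rightarrow>
    ('p \<times> 'q, 'c \<times> 'd) manifold" where
  "prod_mfd N P = \<lparr>pts = pts N \<times> pts P,
     charts = {(U \<times> V, map_prod \<phi> \<psi>) | U \<phi> V \<psi>. (U, \<phi>) \<in> charts N \<and> (V, \<psi>) \<in> charts P}\<rparr>"

text \<open>Smoothness on a subset \<open>S\<close> of \<open>N\<close>, in the sense of local extendability.
  For \<open>S = pts N\<close>, or \<open>S\<close> open in \<open>N\<close>, this is the usual notion.\<close>

definition smooth_map_on :: "('p, 'c::euclidean_space) manifold \<Rightarrow> 'p set \<Rightarrow>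
    ('q, 'd::euclidean_space) manifold \<Rightarrow> ('p \<Rightarrow> 'q) \<Rightarrow> bool" where
  "smooth_map_on N S P f \<longleftrightarrow>
     S \<subseteq> pts N \<and> f ` S \<subseteq> pts P \<and>
     continuous_map (subtopology (mtop N) S) (mtop P) f \<and>
     (\<forall>(U, \<phi>)\<in>charts N. \<forall>(V, \<psi>)\<in>charts P.
        smooth_within (\<phi> ` {x \<in> S \<inter> U. f x \<in> V}) (\<psi> \<circ> f \<circ> inv_into U \<phi>))"

abbreviation smooth_map ::
    "('p, 'c::euclidean_space) manifold \<Rightarrow> ('q, 'd::euclidean_space) manifold \<Rightarrow> ('p \<Rightarrow> 'q) \<Rightarrow> bool" where
  "smooth_map N P f \<equiv> smooth_map_on N (pts N) P f"

definition smooth_funs :: "('p, 'c::euclidean_space) manifold \<Rightarrow> ('p \<Rightarrow> real) set" where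
  "smooth_funs N = {f. smooth_map N euclid f}"

definition smooth_near :: "('p, 'c::euclidean_space) manifold \<Rightarrow> 'p \<Rightarrow> ('p \<Rightarrow> real) set" where
  "smooth_near N p = {f. \<exists>U. openin (mtop N) U \<and> p \<in> U \<and> smooth_map_on N U euclid f}"

text \<open>The structure induced on a subset \<open>S\<close> by the ambient manifold: its charts are all the
  diffeomorphisms from relatively open subsets of \<open>S\<close> onto open subsets of linear subspaces.
  \<open>S\<close> is an embedded submanifold precisely if the result is a \<open>smooth_manifold\<close>.\<close>

definition submfd :: "('p, 'c::euclidean_space) manifold \<Rightarrow> 'p set \<Rightarrow> ('p, 'c) manifold" where
  "submfd N S = \<lparr>pts = S,
     charts = {(U, \<phi>). openin (subtopology (mtop N) S) U \<and> inj_on \<phi> U \<and>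
       (\<exists>H. subspace H \<and> openin (top_of_set H) (\<phi> ` U)) \<and>
       smooth_map_on N U euclid \<phi> \<and> smooth_map_on euclid (\<phi> ` U) N (inv_into U \<phi>)}\<rparr>"


section \<open>Tangent vectors and vector fields\<close>

text \<open>A tangent vector is a base point together with a derivation on the functions that are smooth
  near that point.  Derivations are set to \<open>0\<close> on all other functions, so that equal tangent
  vectors are equal as HOL functions.\<close>

type_synonym 'p tvec = "'p \<times> (('p \<Rightarrow> real) \<Rightarrow> real)"

definition tangent_space ::
    "('p, 'c::euclidean_space) manifold \<Rightarrow> 'p \<Rightarrow> (('p \<Rightarrow> real) \<Rightarrow> real) set" where
  "tangent_space N p = {D.
     (\<forall>f\<in>smooth_near N p. \<forall>g\<in>smooth_near N p. D (\<lambda>x. f x + g x) = D f + D g) \<and>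
     (\<forall>c. \<forall>f\<in>smooth_near N p. D (\<lambda>x. c * f x) = c * D f) \<and>
     (\<forall>f\<in>smooth_near N p. \<forall>g\<in>smooth_near N p. D (\<lambda>x. f x * g x) = D f * g p + f p * D g) \<and>
     (\<forall>f. f \<notin> smooth_near N p \<longrightarrow> D f = 0)}"

definition tangent_bundle ::
    "('p, 'c::euclidean_space) manifold \<Rightarrow> ('p tvec, 'c \<times> 'c) manifold" where
  "tangent_bundle N = \<lparr>pts = Sigma (pts N) (tangent_space N),
     charts = {(Sigma U (tangent_space N),
                \<lambda>X. (\<phi> (fst X), \<Sum>b\<in>Basis. snd X (\<lambda>x. \<phi> x \<bullet> b) *\<^sub>R b)) | U \<phi>. (U, \<phi>) \<in> charts N}\<rparr>"

definition tangent_map :: "('q, 'd::euclidean_space) manifold \<Rightarrow> ('p \<Rightarrow> 'q) \<Rightarrow> 'p tvec \<Rightarrow> 'q tvec" where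
  "tangent_map P f X =
     (f (fst X), \<lambda>g. if g \<in> smooth_near P (f (fst X)) then snd X (g \<circ> f) else 0)"

text \<open>Fibrewise operations, meaningful for vectors with the same base point.\<close>

definition tadd :: "'p tvec \<Rightarrow> 'p tvec \<Rightarrow> 'p tvec" where
  "tadd X Y = (fst X, \<lambda>f. snd X f + snd Y f)"

definition tscale :: "real \<Rightarrow> 'p tvec \<Rightarrow> 'p tvec" where
  "tscale c X = (fst X, \<lambda>f. c * snd X f)"

definition lie_bracket ::
    "('p, 'c::euclidean_space) manifold \<Rightarrow> ('p \<Rightarrow> 'p tvec) \<Rightarrow> ('p \<Rightarrow> 'p tvec) \<Rightarrow> 'p \<Rightarrow> 'p tvec" where
  "lie_bracket N X Y = (\<lambda>p\<in>pts N. (p, \<lambda>f. if f \<in> smooth_near N p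
     then snd (X p) (\<lambda>x. snd (Y x) f) - snd (Y p) (\<lambda>x. snd (X x) f) else 0))"


section \<open>Manifolds fibred over the real line\<close>

text \<open>Fibred means: equipped with a surjective submersion \<open>t\<close>.\<close>

locale fibred_manifold = smooth_manifold N
  for N :: "('p, 'c::euclidean_space) manifold" and t :: "'p \<Rightarrow> real" +
  assumes t_smooth: "t \<in> smooth_funs N"
    and t_surj: "t ` pts N = UNIV"
    and t_submersion: "\<And>p. p \<in> pts N \<Longrightarrow> \<exists>D\<in>tangent_space N p. D t \<noteq> 0"

definition vertical :: "('p, 'c::euclidean_space) manifold \<Rightarrow> ('p \<Rightarrow> real) \<Rightarrow> 'p tvec set" where
  "vertical N t = {X \<in> pts (tangent_bundle N). snd X t = 0}"

definition first_jet :: "('p, 'c::euclidean_space) manifold \<Rightarrow> ('p \<Rightarrow> real) \<Rightarrow> 'p tvec set" where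
  "first_jet N t = {X \<in> pts (tangent_bundle N). snd X t = 1}"


section \<open>Vector bundles and affine bundles\<close>

record ('w, 'd, 'p) vec_bundle =
  vtot :: "('w, 'd) manifold"
  vproj :: "'w \<Rightarrow> 'p"
  vadd :: "'w \<Rightarrow> 'w \<Rightarrow> 'w"
  vscale :: "real \<Rightarrow> 'w \<Rightarrow> 'w"

record ('a, 'c, 'w, 'p) aff_bundle =
  atot :: "('a, 'c) manifold"
  aproj :: "'a \<Rightarrow> 'p"
  aplus :: "'a \<Rightarrow> 'w \<Rightarrow> 'a"

definition vfibre :: "('w, 'd, 'p) vec_bundle \<Rightarrow> 'p \<Rightarrow> 'w set" where
  "vfibre W x = {w \<in> pts (vtot W). vproj W w = x}"

definition afibre :: "('a, 'c, 'w, 'p) aff_bundle \<Rightarrow> 'p \<Rightarrow> 'a set" where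
  "afibre A x = {a \<in> pts (atot A). aproj A a = x}"

locale real_vector_space_on =
  fixes S :: "'w set" and add :: "'w \<Rightarrow> 'w \<Rightarrow> 'w" and scale :: "real \<Rightarrow> 'w \<Rightarrow> 'w"
  assumes add_closed: "\<lbrakk>u \<in> S; v \<in> S\<rbrakk> \<Longrightarrow> add u v \<in> S"
    and scale_closed: "u \<in> S \<Longrightarrow> scale c u \<in> S"
    and add_assoc: "\<lbrakk>u \<in> S; v \<in> S; w \<in> S\<rbrakk> \<Longrightarrow> add (add u v) w = add u (add v w)"
    and add_commute: "\<lbrakk>u \<in> S; v \<in> S\<rbrakk> \<Longrightarrow> add u v = add v u"
    and zero_neg: "\<exists>z\<in>S. (\<forall>u\<in>S. add u z = u) \<and> (\<forall>u\<in>S. \<exists>v\<in>S. add u v = z)"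
    and scale_add: "\<lbrakk>u \<in> S; v \<in> S\<rbrakk> \<Longrightarrow> scale c (add u v) = add (scale c u) (scale c v)"
    and add_scale: "u \<in> S \<Longrightarrow> scale (c + d) u = add (scale c u) (scale d u)"
    and scale_scale: "u \<in> S \<Longrightarrow> scale c (scale d u) = scale (c * d) u"
    and scale_one: "u \<in> S \<Longrightarrow> scale 1 u = u"

text \<open>\<open>\<Phi>\<close> is a diffeomorphism from the part of \<open>X\<close> over \<open>U\<close> onto
  \<open>U \<times> F\<close>, compatible with the projections.\<close>

definition local_triv :: "('p, 'b::euclidean_space) manifold \<Rightarrow> ('a, 'c::euclidean_space) manifold \<Rightarrow>
    ('a \<Rightarrow> 'p) \<Rightarrow> 'f::euclidean_space set \<Rightarrow> 'p set \<Rightarrow> ('a \<Rightarrow> 'p \<times> 'f) \<Rightarrow> bool" where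
  "local_triv N X pr F U \<Phi> \<longleftrightarrow> openin (mtop N) U \<and>
     (let XU = {a \<in> pts X. pr a \<in> U} in
        bij_betw \<Phi> XU (U \<times> F) \<and> (\<forall>a\<in>XU. fst (\<Phi> a) = pr a) \<and>
        smooth_map_on X XU (prod_mfd N euclid) \<Phi> \<and>
        smooth_map_on (prod_mfd N euclid) (U \<times> F) X (inv_into XU \<Phi>))"

definition linear_triv :: "('p, 'b::euclidean_space) manifold \<Rightarrow>
    ('w, 'd::euclidean_space, 'p) vec_bundle \<Rightarrow> 'f::euclidean_space set \<Rightarrow> 'p set \<Rightarrow>
    ('w \<Rightarrow> 'p \<times> 'f) \<Rightarrow> bool" where
  "linear_triv N W F U \<Psi> \<longleftrightarrow> local_triv N (vtot W) (vproj W) F U \<Psi> \<and>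
     (\<forall>x\<in>U. \<forall>v\<in>vfibre W x.
        (\<forall>w\<in>vfibre W x. snd (\<Psi> (vadd W v w)) = snd (\<Psi> v) + snd (\<Psi> w)) \<and>
        (\<forall>c. snd (\<Psi> (vscale W c v)) = c *\<^sub>R snd (\<Psi> v)))"

text \<open>The typical fibre \<open>F\<close> may be taken inside the model type of the total space, because its
  dimension does not exceed that of the total space.\<close>

locale vector_bundle =
  fixes N :: "('p, 'b::euclidean_space) manifold"
    and W :: "('w, 'd::euclidean_space, 'p) vec_bundle"
  assumes base_manifold: "smooth_manifold N"
    and total_manifold: "smooth_manifold (vtot W)"
    and proj_smooth: "smooth_map (vtot W) N (vproj W)"
    and fibre_vector_space:
      "\<And>x. x \<in> pts N \<Longrightarrow> real_vector_space_on (vfibre W x) (vadd W) (vscale W)"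
    and trivial: "\<exists>F::'d set. subspace F \<and>
      (\<forall>x\<in>pts N. \<exists>U \<Psi>. x \<in> U \<and> linear_triv N W F U \<Psi>)"

locale affine_bundle = vector_bundle N W
  for N :: "('p, 'b::euclidean_space) manifold"
    and W :: "('w, 'd::euclidean_space, 'p) vec_bundle" +
  fixes A :: "('a, 'c::euclidean_space, 'w, 'p) aff_bundle"
  assumes atotal_manifold: "smooth_manifold (atot A)"
    and aproj_smooth: "smooth_map (atot A) N (aproj A)"
    and fibre_nonempty: "\<And>x. x \<in> pts N \<Longrightarrow> afibre A x \<noteq> {}"
    and plus_closed: "\<And>x a v. \<lbrakk>x \<in> pts N; a \<in> afibre A x; v \<in> vfibre W x\<rbrakk> \<Longrightarrow>
      aplus A a v \<in> afibre A x"
    and plus_assoc: "\<And>x a v w. \<lbrakk>x \<in> pts N; a \<in> afibre A x; v \<in> vfibre W x; w \<in> vfibre W x\<rbrakk> \<Longrightarrow>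
      aplus A (aplus A a v) w = aplus A a (vadd W v w)"
    and plus_simply_transitive: "\<And>x a b. \<lbrakk>x \<in> pts N; a \<in> afibre A x; b \<in> afibre A x\<rbrakk> \<Longrightarrow>
      \<exists>!v. v \<in> vfibre W x \<and> aplus A a v = b"
    and affine_trivial: "\<exists>F::'c set. subspace F \<and>
      (\<forall>x\<in>pts N. \<exists>U \<Phi> \<Psi>. x \<in> U \<and> local_triv N (atot A) (aproj A) F U \<Phi> \<and> linear_triv N W F U \<Psi> \<and>
         (\<forall>y\<in>U. \<forall>a\<in>afibre A y. \<forall>v\<in>vfibre W y.
            snd (\<Phi> (aplus A a v)) = snd (\<Phi> a) + snd (\<Psi> v)))"

text \<open>Sections are \<open>undefined\<close> off the base, so that equality of sections is HOL equality.\<close>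

definition sections :: "('p, 'b::euclidean_space) manifold \<Rightarrow> ('a, 'c::euclidean_space) manifold \<Rightarrow>
    ('a \<Rightarrow> 'p) \<Rightarrow> ('p \<Rightarrow> 'a) set" where
  "sections N X pr = {s \<in> extensional (pts N). smooth_map N X s \<and> (\<forall>x\<in>pts N. pr (s x) = x)}"

definition vsec :: "('p, 'b::euclidean_space) manifold \<Rightarrow> ('w, 'd::euclidean_space, 'p) vec_bundle \<Rightarrow>
    ('p \<Rightarrow> 'w) set" where
  "vsec N W = sections N (vtot W) (vproj W)"

definition asec :: "('p, 'b::euclidean_space) manifold \<Rightarrow> ('a, 'c::euclidean_space, 'w, 'p) aff_bundle \<Rightarrow>
    ('p \<Rightarrow> 'a) set" where
  "asec N A = sections N (atot A) (aproj A)"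

definition sec_add :: "('p, 'b) manifold \<Rightarrow> ('w, 'd, 'p) vec_bundle \<Rightarrow>
    ('p \<Rightarrow> 'w) \<Rightarrow> ('p \<Rightarrow> 'w) \<Rightarrow> 'p \<Rightarrow> 'w" where
  "sec_add N W \<sigma> \<eta> = (\<lambda>x\<in>pts N. vadd W (\<sigma> x) (\<eta> x))"

definition sec_scale :: "('p, 'b) manifold \<Rightarrow> ('w, 'd, 'p) vec_bundle \<Rightarrow>
    ('p \<Rightarrow> real) \<Rightarrow> ('p \<Rightarrow> 'w) \<Rightarrow> 'p \<Rightarrow> 'w" where
  "sec_scale N W f \<sigma> = (\<lambda>x\<in>pts N. vscale W (f x) (\<sigma> x))"

definition sec_plus :: "('p, 'b) manifold \<Rightarrow> ('a, 'c, 'w, 'p) aff_bundle \<Rightarrow>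
    ('p \<Rightarrow> 'a) \<Rightarrow> ('p \<Rightarrow> 'w) \<Rightarrow> 'p \<Rightarrow> 'a" where
  "sec_plus N A \<zeta> \<sigma> = (\<lambda>x\<in>pts N. aplus A (\<zeta> x) (\<sigma> x))"


section \<open>Affine Lie algebroids\<close>

locale skew_bilinear_bracket =
  fixes N :: "('p, 'b::euclidean_space) manifold"
    and W :: "('w, 'd::euclidean_space, 'p) vec_bundle"
    and br :: "('p \<Rightarrow> 'w) \<Rightarrow> ('p \<Rightarrow> 'w) \<Rightarrow> 'p \<Rightarrow> 'w"
  assumes br_closed: "\<lbrakk>\<sigma> \<in> vsec N W; \<eta> \<in> vsec N W\<rbrakk> \<Longrightarrow> br \<sigma> \<eta> \<in> vsec N W"
    and br_skew: "\<lbrakk>\<sigma> \<in> vsec N W; \<eta> \<in> vsec N W\<rbrakk> \<Longrightarrow> br \<eta> \<sigma> = sec_scale N W (\<lambda>_. - 1) (br \<sigma> \<eta>)"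
    and br_add_left: "\<lbrakk>\<sigma>\<^sub>1 \<in> vsec N W; \<sigma>\<^sub>2 \<in> vsec N W; \<eta> \<in> vsec N W\<rbrakk> \<Longrightarrow>
      br (sec_add N W \<sigma>\<^sub>1 \<sigma>\<^sub>2) \<eta> = sec_add N W (br \<sigma>\<^sub>1 \<eta>) (br \<sigma>\<^sub>2 \<eta>)"
    and br_add_right: "\<lbrakk>\<sigma> \<in> vsec N W; \<eta>\<^sub>1 \<in> vsec N W; \<eta>\<^sub>2 \<in> vsec N W\<rbrakk> \<Longrightarrow>
      br \<sigma> (sec_add N W \<eta>\<^sub>1 \<eta>\<^sub>2) = sec_add N W (br \<sigma> \<eta>\<^sub>1) (br \<sigma> \<eta>\<^sub>2)"
    and br_scale_left: "\<lbrakk>\<sigma> \<in> vsec N W; \<eta> \<in> vsec N W\<rbrakk> \<Longrightarrow>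
      br (sec_scale N W (\<lambda>_. c) \<sigma>) \<eta> = sec_scale N W (\<lambda>_. c) (br \<sigma> \<eta>)"
    and br_scale_right: "\<lbrakk>\<sigma> \<in> vsec N W; \<eta> \<in> vsec N W\<rbrakk> \<Longrightarrow>
      br \<sigma> (sec_scale N W (\<lambda>_. c) \<eta>) = sec_scale N W (\<lambda>_. c) (br \<sigma> \<eta>)"

locale biadditive_action =
  fixes N :: "('p, 'b::euclidean_space) manifold"
    and W :: "('w, 'd::euclidean_space, 'p) vec_bundle"
    and A :: "('a, 'c::euclidean_space, 'w, 'p) aff_bundle"
    and br :: "('p \<Rightarrow> 'w) \<Rightarrow> ('p \<Rightarrow> 'w) \<Rightarrow> 'p \<Rightarrow> 'w"
    and act :: "('p \<Rightarrow> 'a) \<Rightarrow> ('p \<Rightarrow> 'w) \<Rightarrow> 'p \<Rightarrow> 'w"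
  assumes act_closed: "\<lbrakk>\<zeta> \<in> asec N A; \<sigma> \<in> vsec N W\<rbrakk> \<Longrightarrow> act \<zeta> \<sigma> \<in> vsec N W"
    and act_add: "\<lbrakk>\<zeta> \<in> asec N A; \<sigma>\<^sub>1 \<in> vsec N W; \<sigma>\<^sub>2 \<in> vsec N W\<rbrakk> \<Longrightarrow>
      act \<zeta> (sec_add N W \<sigma>\<^sub>1 \<sigma>\<^sub>2) = sec_add N W (act \<zeta> \<sigma>\<^sub>1) (act \<zeta> \<sigma>\<^sub>2)"
    and act_plus: "\<lbrakk>\<zeta> \<in> asec N A; \<sigma> \<in> vsec N W; \<eta> \<in> vsec N W\<rbrakk> \<Longrightarrow>
      act (sec_plus N A \<zeta> \<sigma>) \<eta> = sec_add N W (act \<zeta> \<eta>) (br \<sigma> \<eta>)"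

text \<open>The anchor \<open>\<lambda>\<close> (here \<open>lam\<close>) with linear part \<open>\<rho>\<close>
  (here \<open>rho\<close>).  Smoothness into \<open>J\<^sup>1N\<close> and \<open>VN\<close> is smoothness into the
  ambient tangent bundle.\<close>

locale anchor_maps =
  fixes N :: "('p, 'b::euclidean_space) manifold" and t :: "'p \<Rightarrow> real"
    and W :: "('w, 'd::euclidean_space, 'p) vec_bundle"
    and A :: "('a, 'c::euclidean_space, 'w, 'p) aff_bundle"
    and lam :: "'a \<Rightarrow> 'p tvec" and rho :: "'w \<Rightarrow> 'p tvec"
  assumes lam_smooth: "smooth_map (atot A) (tangent_bundle N) lam"
    and lam_jet: "a \<in> pts (atot A) \<Longrightarrow> lam a \<in> first_jet N t \<and> fst (lam a) = aproj A a"
    and rho_smooth: "smooth_map (vtot W) (tangent_bundle N) rho"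
    and rho_vertical: "w \<in> pts (vtot W) \<Longrightarrow> rho w \<in> vertical N t \<and> fst (rho w) = vproj W w"
    and rho_add: "\<lbrakk>x \<in> pts N; v \<in> vfibre W x; w \<in> vfibre W x\<rbrakk> \<Longrightarrow>
      rho (vadd W v w) = tadd (rho v) (rho w)"
    and rho_scale: "\<lbrakk>x \<in> pts N; v \<in> vfibre W x\<rbrakk> \<Longrightarrow> rho (vscale W c v) = tscale c (rho v)"
    and lam_plus: "\<lbrakk>x \<in> pts N; a \<in> afibre A x; v \<in> vfibre W x\<rbrakk> \<Longrightarrow>
      lam (aplus A a v) = tadd (lam a) (rho v)"

locale affine_lie_algebroid =
  fibred_manifold N t + affine_bundle N W A + skew_bilinear_bracket N W br +
  biadditive_action N W A br act + anchor_maps N t W A lam rho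
  for N :: "('p, 'b::euclidean_space) manifold" and t :: "'p \<Rightarrow> real"
    and W :: "('w, 'd::euclidean_space, 'p) vec_bundle"
    and A :: "('a, 'c::euclidean_space, 'w, 'p) aff_bundle"
    and br :: "('p \<Rightarrow> 'w) \<Rightarrow> ('p \<Rightarrow> 'w) \<Rightarrow> 'p \<Rightarrow> 'w"
    and act :: "('p \<Rightarrow> 'a) \<Rightarrow> ('p \<Rightarrow> 'w) \<Rightarrow> 'p \<Rightarrow> 'w"
    and lam :: "'a \<Rightarrow> 'p tvec" and rho :: "'w \<Rightarrow> 'p tvec" +
  assumes jacobi: "\<lbrakk>\<zeta> \<in> asec N A; \<sigma> \<in> vsec N W; \<eta> \<in> vsec N W\<rbrakk> \<Longrightarrow>
      act \<zeta> (br \<sigma> \<eta>) = sec_add N W (br (act \<zeta> \<sigma>) \<eta>) (br \<sigma> (act \<zeta> \<eta>))"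
    and leibniz: "\<lbrakk>\<zeta> \<in> asec N A; \<sigma> \<in> vsec N W; f \<in> smooth_funs N\<rbrakk> \<Longrightarrow>
      act \<zeta> (sec_scale N W f \<sigma>) =
        sec_add N W (sec_scale N W f (act \<zeta> \<sigma>)) (sec_scale N W (\<lambda>x. snd (lam (\<zeta> x)) f) \<sigma>)"


section \<open>The prolonged bundle\<close>

definition prolong_time :: "('p \<Rightarrow> real) \<Rightarrow> ('e, 'c, 'w, 'p) aff_bundle \<Rightarrow> 'e \<Rightarrow> real" where
  "prolong_time t E = t \<circ> aproj E"

definition prolong_jet_pts :: "('p, 'b::euclidean_space) manifold \<Rightarrow> ('p \<Rightarrow> real) \<Rightarrow>
    ('e, 'c::euclidean_space, 'w, 'p) aff_bundle \<Rightarrow> ('e \<Rightarrow> 'p tvec) \<Rightarrow> ('e \<times> 'e tvec) set" where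
  "prolong_jet_pts M t E lam = {(q, Z). q \<in> pts (atot E) \<and>
     Z \<in> first_jet (atot E) (prolong_time t E) \<and> lam q = tangent_map M (aproj E) Z}"

definition prolong_vert_pts :: "('p, 'b::euclidean_space) manifold \<Rightarrow> ('p \<Rightarrow> real) \<Rightarrow>
    ('w, 'd::euclidean_space, 'p) vec_bundle \<Rightarrow> ('e, 'c::euclidean_space, 'w, 'p) aff_bundle \<Rightarrow>
    ('w \<Rightarrow> 'p tvec) \<Rightarrow> ('w \<times> 'e tvec) set" where
  "prolong_vert_pts M t V E rho = {(v, X). v \<in> pts (vtot V) \<and>
     X \<in> vertical (atot E) (prolong_time t E) \<and> rho v = tangent_map M (aproj E) X}"

definition prolong_jet :: "('p, 'b::euclidean_space) manifold \<Rightarrow> ('p \<Rightarrow> real) \<Rightarrow>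
    ('e, 'c::euclidean_space, 'w, 'p) aff_bundle \<Rightarrow> ('e \<Rightarrow> 'p tvec) \<Rightarrow>
    ('e \<times> 'e tvec, 'c \<times> 'c \<times> 'c, 'w \<times> 'e tvec, 'e) aff_bundle" where
  "prolong_jet M t E lam =
     \<lparr>atot = submfd (prod_mfd (atot E) (tangent_bundle (atot E))) (prolong_jet_pts M t E lam),
      aproj = (\<lambda>(q, Z). fst Z),
      aplus = (\<lambda>(q, Z) (v, X). (aplus E q v, tadd Z X))\<rparr>"

definition prolong_vert :: "('p, 'b::euclidean_space) manifold \<Rightarrow> ('p \<Rightarrow> real) \<Rightarrow>
    ('w, 'd::euclidean_space, 'p) vec_bundle \<Rightarrow> ('e, 'c::euclidean_space, 'w, 'p) aff_bundle \<Rightarrow>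
    ('w \<Rightarrow> 'p tvec) \<Rightarrow> ('w \<times> 'e tvec, 'd \<times> 'c \<times> 'c, 'e) vec_bundle" where
  "prolong_vert M t V E rho =
     \<lparr>vtot = submfd (prod_mfd (vtot V) (tangent_bundle (atot E))) (prolong_vert_pts M t V E rho),
      vproj = (\<lambda>(v, X). fst X),
      vadd = (\<lambda>(v, X) (w, Y). (vadd V v w, tadd X Y)),
      vscale = (\<lambda>c (v, X). (vscale V c v, tscale c X))\<rparr>"

text \<open>The section \<open>Z\<close> of a prolonged bundle projects onto the section \<open>\<zeta>\<close> of the
  original one.  The first component of a point of either prolonged bundle is its projection
  \<open>\<pi>\<^sub>2\<close>, the second one its image under the prolonged anchor.\<close>

definition projects_onto :: "('e, 'c, 'w, 'p) aff_bundle \<Rightarrow> ('e \<Rightarrow> 'x \<times> 'e tvec) \<Rightarrow>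
    ('p \<Rightarrow> 'x) \<Rightarrow> bool" where
  "projects_onto E Z \<zeta> \<longleftrightarrow> (\<forall>e\<in>pts (atot E). fst (Z e) = \<zeta> (aproj E e))"

locale prolonged_bracket =
  skew_bilinear_bracket "atot E" "prolong_vert M t V E rho" br1 +
  biadditive_action "atot E" "prolong_vert M t V E rho" "prolong_jet M t E lam" br1 act1
  for M :: "('p, 'b::euclidean_space) manifold" and t :: "'p \<Rightarrow> real"
    and V :: "('v, 'd::euclidean_space, 'p) vec_bundle"
    and E :: "('e, 'c::euclidean_space, 'v, 'p) aff_bundle"
    and br :: "('p \<Rightarrow> 'v) \<Rightarrow> ('p \<Rightarrow> 'v) \<Rightarrow> 'p \<Rightarrow> 'v"
    and act :: "('p \<Rightarrow> 'e) \<Rightarrow> ('p \<Rightarrow> 'v) \<Rightarrow> 'p \<Rightarrow> 'v"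
    and lam :: "'e \<Rightarrow> 'p tvec" and rho :: "'v \<Rightarrow> 'p tvec"
    and br1 :: "('e \<Rightarrow> 'v \<times> 'e tvec) \<Rightarrow> ('e \<Rightarrow> 'v \<times> 'e tvec) \<Rightarrow> 'e \<Rightarrow> 'v \<times> 'e tvec"
    and act1 :: "('e \<Rightarrow> 'e \<times> 'e tvec) \<Rightarrow> ('e \<Rightarrow> 'v \<times> 'e tvec) \<Rightarrow> 'e \<Rightarrow> 'v \<times> 'e tvec" +
  assumes anchor_br: "\<And>Z\<^sub>1 Z\<^sub>2 e.
      \<lbrakk>Z\<^sub>1 \<in> vsec (atot E) (prolong_vert M t V E rho);
       Z\<^sub>2 \<in> vsec (atot E) (prolong_vert M t V E rho); e \<in> pts (atot E)\<rbrakk> \<Longrightarrow>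
      snd (br1 Z\<^sub>1 Z\<^sub>2 e) = lie_bracket (atot E) (snd \<circ> Z\<^sub>1) (snd \<circ> Z\<^sub>2) e"
    and anchor_act: "\<And>Z Y e.
      \<lbrakk>Z \<in> asec (atot E) (prolong_jet M t E lam);
       Y \<in> vsec (atot E) (prolong_vert M t V E rho); e \<in> pts (atot E)\<rbrakk> \<Longrightarrow>
      snd (act1 Z Y e) = lie_bracket (atot E) (snd \<circ> Z) (snd \<circ> Y) e"
    and proj_br: "\<And>Z\<^sub>1 Z\<^sub>2 \<zeta>\<^sub>1 \<zeta>\<^sub>2 F\<^sub>1 F\<^sub>2 e.
      \<lbrakk>Z\<^sub>1 \<in> vsec (atot E) (prolong_vert M t V E rho); \<zeta>\<^sub>1 \<in> vsec M V; projects_onto E Z\<^sub>1 \<zeta>\<^sub>1;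
       Z\<^sub>2 \<in> vsec (atot E) (prolong_vert M t V E rho); \<zeta>\<^sub>2 \<in> vsec M V; projects_onto E Z\<^sub>2 \<zeta>\<^sub>2;
       F\<^sub>1 \<in> smooth_funs (atot E); F\<^sub>2 \<in> smooth_funs (atot E); e \<in> pts (atot E)\<rbrakk> \<Longrightarrow>
      fst (br1 (sec_scale (atot E) (prolong_vert M t V E rho) F\<^sub>1 Z\<^sub>1)
               (sec_scale (atot E) (prolong_vert M t V E rho) F\<^sub>2 Z\<^sub>2) e) =
        vadd V (vadd V
          (vscale V (F\<^sub>1 e * F\<^sub>2 e) (br \<zeta>\<^sub>1 \<zeta>\<^sub>2 (aproj E e)))
          (vscale V (F\<^sub>1 e * snd (snd (Z\<^sub>1 e)) F\<^sub>2) (fst (Z\<^sub>2 e))))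
          (vscale V (- (F\<^sub>2 e * snd (snd (Z\<^sub>2 e)) F\<^sub>1)) (fst (Z\<^sub>1 e)))"
    and proj_act: "\<And>Z \<zeta> Y \<sigma> F e.
      \<lbrakk>Z \<in> asec (atot E) (prolong_jet M t E lam); \<zeta> \<in> asec M E; projects_onto E Z \<zeta>;
       Y \<in> vsec (atot E) (prolong_vert M t V E rho); \<sigma> \<in> vsec M V; projects_onto E Y \<sigma>;
       F \<in> smooth_funs (atot E); e \<in> pts (atot E)\<rbrakk> \<Longrightarrow>
      fst (act1 Z (sec_scale (atot E) (prolong_vert M t V E rho) F Y) e) =
        vadd V
          (vscale V (F e) (act \<zeta> \<sigma> (aproj E e)))
          (vscale V (snd (snd (Z e)) F) (fst (Y e)))"

end

theory Submission
  imports Defs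
begin

text \<open>
The points of both prolonged bundles are pairs \<open>(b, Z)\<close>: a point \<open>b\<close> of \<open>E\<close> or \<open>V\<close>, and a tangent vector
\<open>Z\<close> of \<open>E\<close> that projects to the image of \<open>b\<close> under the anchor. In adapted coordinates the projection
prescribes the component of \<open>Z\<close> along the base and leaves the component along the fibre free. The fibre
coordinate of \<open>b\<close>, the foot point of \<open>Z\<close> and the derivative of the fibre coordinate along \<open>Z\<close> are thus
coordinates of an embedded submanifold (\<open>pullback_chart\<close>), and of a bundle over \<open>E\<close>
(\<open>pullback_local_triv\<close>). The time conditions follow from those of the given anchors. This gives
\<open>vector_bundle_VE\<close> and \<open>affine_bundle_JE\<close>.

To write down the bracket, choose a section \<open>\<zeta>0\<close> of \<open>E\<close> (\<open>global_section\<close>) and finitely many global sections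
\<open>\<sigma> i\<close> of \<open>V\<close> with smooth, fibrewise linear functions \<open>\<theta> i\<close> such that \<open>v\<close> is always the sum of the
\<open>\<theta> i v \<sigma> i\<close> (\<open>frame_exists\<close>). Finiteness comes from a partition of unity with finitely many functions
(\<open>finite_partition\<close>) and avoids any localisation of the given bracket, which acts on global sections only.
Lifting the anchors of \<open>\<zeta>0\<close> and \<open>\<sigma> i\<close> to vector fields on \<open>E\<close> (\<open>lift_ex\<close>) gives projectable sections \<open>P0\<close> and
\<open>P\<^sub>i\<close>. Every section of the model bundle is the sum of its \<open>\<theta> i\<close>-coefficients times \<open>P\<^sub>i\<close> and of a section that
projects onto zero. Hence the sections \<open>F P\<close> with \<open>P\<close> projectable span (\<open>gen_induct\<close>), and requirements
(i) and (ii) leave at most one bracket (\<open>prolonged_unique\<close>).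

For existence, the second component of the bracket is the Lie bracket of vector fields, and the first one is
given by the coefficients that (ii) and the Leibniz rule impose (\<open>cf\<close>). The pair lies in the prolonged bundle
because the given anchors are morphisms of brackets (\<open>lam_act\<close>, \<open>rho_br_apply\<close>), itself a consequence of the
Jacobi identity and the Leibniz rule. On projectable sections the formula reproduces the bracket of \<open>E\<close>
(\<open>op_proj\<close>), and it satisfies the Leibniz rule (\<open>op_leib\<close>); together these are (ii).

The second component of the Jacobi identity is the one of vector fields. The first component of its failure is
linear over functions in the two vector arguments (\<open>J_scale\<close>, \<open>J_add\<close>), hence vanishes if it does so on
projectable sections, where it is the Jacobi identity of \<open>E\<close> (\<open>J_jet_proj\<close>). That covers a projectable affine
argument. An arbitrary one differs from it by a section of the model bundle, for which the cyclic symmetry of the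
Jacobi expression moves the projectable sections into the first place (\<open>J_vert\<close>).
\<close>

section \<open>Smooth functions on Euclidean spaces\<close>

abbreviation "FD \<equiv> frechet_derivative"

abbreviation Cinf :: "'a::euclidean_space set => ('a => 'b::real_normed_vector) => bool" where
 "Cinf S f \<equiv> \<forall>k. Ck_on k S f"

lemma Ck_on_cong:
 assumes "open S" and fg: "!!x. x \<in> S ==> f x = g x" and "Ck_on k S f"
 shows "Ck_on k S g"
 using fg \<open>Ck_on k S f\<close>
proof (induction k arbitrary: f g)
 case 0
 then show ?case by simp
next
 case (Suc k)
 have eq: "(f has_derivative D) (at x) = (g has_derivative D) (at x)" if "x \<in> S" for x D
  using has_derivative_transform_within_open[of f D x UNIV S g]
   has_derivative_transform_within_open[of g D x UNIV S f] \<open>open S\<close> that Suc.prems(1) by auto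
 then have "FD f (at x) = FD g (at x)" if "x \<in> S" for x
  using that by (simp add: frechet_derivative_def)
 moreover have "g differentiable_on S"
  using Suc.prems(2) eq \<open>open S\<close> by (auto simp: differentiable_on_eq_differentiable_at differentiable_def)
 ultimately show ?case
  using Suc.prems(2) Suc.IH[of "%x. FD f (at x) v" "%x. FD g (at x) v" for v]
  by simp
qed

lemma Ck_on_subset: "Ck_on k S f ==> T \<subseteq> S ==> Ck_on k T f"
 by (induction k arbitrary: f) (auto intro: continuous_on_subset differentiable_on_subset)

lemma Ck_on_Suc_intro:
 assumes "open S" "!!x. x \<in> S ==> (f has_derivative f' x) (at x)"
  and "!!v. Ck_on k S (%x. f' x v)"
 shows "Ck_on (Suc k) S f"
proof -
 have "f' x = FD f (at x)" if "x \<in> S" for x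
  using assms(2)[OF that] by (rule frechet_derivative_at)
 then have "Ck_on k S (%x. FD f (at x) v)" for v
  using Ck_on_cong[OF \<open>open S\<close> _ assms(3)[of v]] by simp
 moreover have "f differentiable_on S"
  using assms(1,2) by (auto simp: differentiable_on_eq_differentiable_at differentiable_def)
 ultimately show ?thesis by simp
qed

lemma Ck_on_has_derivative:
 "Ck_on (Suc k) S f ==> open S ==> x \<in> S ==>
  (f has_derivative FD f (at x)) (at x)"
 by (simp add: differentiable_on_eq_differentiable_at frechet_derivative_works[symmetric])

lemma Ck_on_pred: "Ck_on (Suc k) S f ==> Ck_on k S f"
 by (induction k arbitrary: f) (auto intro: differentiable_imp_continuous_on)

lemma Cinf_has_derivative:
 "Cinf S f ==> open S ==> x \<in> S ==> (f has_derivative FD f (at x)) (at x)"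
 by (rule Ck_on_has_derivative) auto

lemma Cinf_derivative: "Cinf S f ==> Cinf S (%x. FD f (at x) v)"
 by (metis Ck_on.simps(2))

lemma Cinf_continuous: "Cinf S f ==> continuous_on S f"
 by (metis Ck_on.simps(1))

lemma Ck_on_const: "open S ==> Ck_on k S (%_. c)"
proof (induction k arbitrary: c)
 case (Suc k)
 then show ?case by (intro Ck_on_Suc_intro[where f' = "%_ _. 0"]) auto
qed simp

lemma Ck_on_linear: "open S ==> bounded_linear h ==> Ck_on k S f ==> Ck_on k S (%x. h (f x))"
proof (induction k arbitrary: f)
 case 0
 then show ?case unfolding Ck_on.simps(1) by (intro bounded_linear.continuous_on[of h])
next
 case (Suc k)
 show ?case
 proof (rule Ck_on_Suc_intro)
  show "((%x. h (f x)) has_derivative (%v. h (FD f (at x) v))) (at x)" if "x \<in> S" for x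
   by (rule bounded_linear.has_derivative[OF Suc.prems(2) Ck_on_has_derivative[OF Suc.prems(3,1) that]])
 qed (use Suc in auto)
qed

lemma Ck_on_id: "open S ==> Ck_on k S (%x. x)"
 by (cases k) (auto intro!: Ck_on_Suc_intro[where f' = "%_ v. v"] Ck_on_const)

lemma Ck_on_blin: "open S ==> bounded_linear h ==> Ck_on k S h"
 using Ck_on_linear[of S h k "%x. x"] Ck_on_id by auto

lemma Ck_on_add: "open S ==> Ck_on k S f ==> Ck_on k S g ==> Ck_on k S (%x. f x + g x)"
proof (induction k arbitrary: f g)
 case (Suc k)
 show ?case
 proof (rule Ck_on_Suc_intro)
  show "((%x. f x + g x) has_derivative (%v. FD f (at x) v + FD g (at x) v)) (at x)"
   if "x \<in> S" for x
   by (rule has_derivative_add[OF Ck_on_has_derivative[OF Suc.prems(2,1) that] Ck_on_has_derivative[OF Suc.prems(3,1) that]])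
 qed (use Suc in auto)
qed (auto intro: continuous_intros)

lemma Ck_on_sum: "open S ==> (!!i. i \<in> I ==> Ck_on k S (f i)) ==> Ck_on k S (%x. \<Sum>i\<in>I. f i x)"
 by (induction I rule: infinite_finite_induct) (auto intro: Ck_on_add Ck_on_const)

lemma Ck_on_bilinear:
 assumes "bounded_bilinear pr" "open S" "Ck_on k S f" "Ck_on k S g"
 shows "Ck_on k S (%x. pr (f x) (g x))"
 using assms(3,4)
proof (induction k arbitrary: f g)
 case 0
 then show ?case unfolding Ck_on.simps(1) by (intro bounded_bilinear.continuous_on[OF assms(1)])
next
 case (Suc k)
 show ?case
 proof (rule Ck_on_Suc_intro)
  show "((%x. pr (f x) (g x)) has_derivative
    (%v. pr (f x) (FD g (at x) v) + pr (FD f (at x) v) (g x))) (at x)"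
   if "x \<in> S" for x
   by (rule bounded_bilinear.FDERIV[OF assms(1) Ck_on_has_derivative[OF Suc.prems(1) assms(2) that] Ck_on_has_derivative[OF Suc.prems(2) assms(2) that]])
  show "Ck_on k S (%x. pr (f x) (FD g (at x) v) + pr (FD f (at x) v) (g x))" for v
   using Suc.prems by (intro Ck_on_add[OF assms(2)] Suc.IH Ck_on_pred[OF Suc.prems(1)] Ck_on_pred[OF Suc.prems(2)]) simp_all
 qed fact
qed

lemmas Ck_on_mult = Ck_on_bilinear[OF bounded_bilinear_mult]
 and Ck_on_scaleR = Ck_on_bilinear[OF bounded_bilinear_scaleR]
 and Ck_on_inner = Ck_on_bilinear[OF bounded_bilinear_inner]

lemma Ck_on_Pair:
 assumes "open S" "Ck_on k S f" "Ck_on k S g"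
 shows "Ck_on k S (%x. (f x, g x))"
proof -
 have "bounded_linear (%u. (u, 0))" "bounded_linear (%u. (0, u))"
  by (intro bounded_linear_Pair bounded_linear_ident bounded_linear_zero)+
 from this[THEN Ck_on_linear[OF assms(1)]]
 have "Ck_on k S (%x. (f x, 0) + (0, g x))" using assms by (intro Ck_on_add) auto
 then show ?thesis by simp
qed

lemma linear_expand_basis: "linear h ==> h v = (\<Sum>b\<in>Basis. (v \<bullet> b) *\<^sub>R h b)"
proof -
 assume h: "linear h"
 have "h v = h (\<Sum>b\<in>Basis. (v \<bullet> b) *\<^sub>R b)" by (simp add: euclidean_representation)
 also have "\<dots> = (\<Sum>b\<in>Basis. (v \<bullet> b) *\<^sub>R h b)" by (simp add: linear_sum[OF h] linear_scale[OF h])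
 finally show ?thesis .
qed

lemma Ck_on_compose:
 assumes "open S" "open T" "f ` S \<subseteq> T" "Ck_on k S f" "Ck_on k T g"
 shows "Ck_on k S (%x. g (f x))"
 using assms(3-)
proof (induction k arbitrary: f g)
 case 0
 show ?case using continuous_on_compose2[of T g S f] 0 by simp
next
 case (Suc k)
 let ?F = "%x. FD f (at x)" and ?G = "%x. FD g (at x)"
 show ?case
 proof (rule Ck_on_Suc_intro)
  fix x assume x: "x \<in> S"
  have f: "(f has_derivative ?F x) (at x)"
   by (rule Ck_on_has_derivative[OF Suc.prems(2) assms(1) x])
  have g: "(g has_derivative ?G (f x)) (at (f x))"
   by (rule Ck_on_has_derivative[OF Suc.prems(3) assms(2)]) (use Suc.prems(1) x in auto)
  have e: "?G (f x) u = (\<Sum>b\<in>Basis. (u \<bullet> b) *\<^sub>R ?G (f x) b)" for u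
   using g by (intro linear_expand_basis) (rule has_derivative_linear)
  show "((%x. g (f x)) has_derivative
    (%v. \<Sum>b\<in>Basis. (?F x v \<bullet> b) *\<^sub>R ?G (f x) b)) (at x)"
   by (rule has_derivative_eq_rhs[OF has_derivative_compose[OF f g]]) (rule ext, rule e)
 next
  fix v
  have "Ck_on k S f" using Suc.prems Ck_on_pred by blast
  then have "Ck_on k S (%x. ?G (f x) b)" for b
   using Suc.IH[of f "%y. ?G y b"] Suc.prems by simp
  moreover have "Ck_on k S (%x. ?F x v \<bullet> b)" for b
   using Suc.prems by (intro Ck_on_linear[OF assms(1) bounded_linear_inner_left]) simp
  ultimately show "Ck_on k S (%x. \<Sum>b\<in>Basis. (?F x v \<bullet> b) *\<^sub>R ?G (f x) b)"
   using assms(1) by (intro Ck_on_sum Ck_on_scaleR) auto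
 qed fact
qed

lemma Ck_on_inverse: "open S ==> 0 \<notin> S ==> Ck_on k S (inverse :: real => real)"
proof (induction k)
 case 0
 then show ?case by (auto intro!: continuous_intros)
next
 case (Suc k)
 show ?case
 proof (rule Ck_on_Suc_intro)
  show "(inverse has_derivative (%v. - (inverse x * v * inverse x))) (at x)" if "x \<in> S" for x :: real
   using that Suc by (intro has_derivative_inverse') auto
  show "Ck_on k S (%x. - (inverse x * v * inverse x))" for v :: real
   using Suc Ck_on_linear[OF _ bounded_linear_minus[OF bounded_linear_ident]]
   by (intro Ck_on_linear[OF _ bounded_linear_minus[OF bounded_linear_ident]] Ck_on_mult Ck_on_const) auto
 qed (use Suc in auto)
qed

text \<open>The family is closed under differentiation up to linear combinations, because the derivative of
  \<open>exp (- 1 / x) / x ^ j\<close> is \<open>exp (- 1 / x) / x ^ (j + 2) - j * exp (- 1 / x) / x ^ (j + 1)\<close>.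
  Smoothness of all members is therefore a simultaneous induction.\<close>

definition flat_fun :: "nat => real => real" where
 "flat_fun j x = (if x > 0 then exp (- (1 / x)) / x ^ j else 0)"

lemma flat_fun_tendsto: "(flat_fun j \<longlongrightarrow> 0) (at 0)"
proof -
 have "((%y. y ^ j / exp y) \<longlongrightarrow> 0) (at_top :: real filter)"
  by (rule tendsto_power_div_exp_0)
 then have "((%x. inverse x ^ j / exp (inverse x)) \<longlongrightarrow> 0) (at_right (0::real))"
  using filterlim_compose filterlim_inverse_at_top_right by blast
 then have r: "(flat_fun j \<longlongrightarrow> 0) (at_right 0)"
  by (rule Lim_transform_eventually)
   (auto simp: flat_fun_def eventually_at_filter exp_minus field_simps power_inverse)
 have "(flat_fun j \<longlongrightarrow> 0) (at_left 0)"
  by (rule Lim_transform_eventually[OF tendsto_const])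
   (auto simp: flat_fun_def eventually_at_filter)
 with r show ?thesis by (rule filterlim_split_at[rotated])
qed

lemma flat_fun_deriv:
 "(flat_fun j has_real_derivative (flat_fun (j + 2) x - real j * flat_fun (j + 1) x)) (at x)"
proof -
 consider "x > 0" | "x < 0" | "x = 0" by linarith
 then show ?thesis
 proof cases
  case 1
  have "((%x. exp (- (1 / x)) / x ^ j) has_real_derivative
    (flat_fun (j + 2) x - real j * flat_fun (j + 1) x)) (at x)"
   using 1 by (auto intro!: derivative_eq_intros simp: flat_fun_def)
    (cases j; simp add: field_simps power2_eq_square)
  then show ?thesis
   by (rule has_field_derivative_transform_within_open[where S = "{0<..}"])
    (use 1 in \<open>auto simp: flat_fun_def\<close>)
 next
  case 2
  have "((%x. 0) has_real_derivative 0) (at x)" by simp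
  then have "(flat_fun j has_real_derivative 0) (at x)"
   by (rule has_field_derivative_transform_within_open[where S = "{..<0}"])
    (use 2 in \<open>auto simp: flat_fun_def\<close>)
  then show ?thesis using 2 by (simp add: flat_fun_def)
 next
  case 3
  have "((%h. (flat_fun j (0 + h) - flat_fun j 0) / h) \<longlongrightarrow> 0) (at 0)"
   by (rule Lim_transform_eventually[OF flat_fun_tendsto[of "Suc j"]])
    (auto simp: flat_fun_def eventually_at_filter field_simps)
  then show ?thesis using 3 by (simp add: DERIV_def flat_fun_def)
 qed
qed

lemma flat_fun_smooth: "Cinf UNIV (flat_fun j)"
proof
 fix k show "Ck_on k UNIV (flat_fun j)"
 proof (induction k arbitrary: j)
  case 0
  show ?case by (simp add: continuous_at_imp_continuous_on DERIV_isCont[OF flat_fun_deriv])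
 next
  case (Suc k)
  show ?case
  proof (rule Ck_on_Suc_intro)
   show "(flat_fun j has_derivative (%v. (flat_fun (j + 2) x - real j * flat_fun (j + 1) x) * v)) (at x)" for x
    using flat_fun_deriv[of j x] by (simp add: has_field_derivative_def)
   show "Ck_on k UNIV (%x. (flat_fun (j + 2) x - real j * flat_fun (j + 1) x) * v)" for v
   proof -
    have "Ck_on k UNIV (%x. (flat_fun (j + 2) x + (- real j) * flat_fun (j + 1) x) * v)"
     by (intro Ck_on_mult Ck_on_add Ck_on_const Suc) auto
    then show ?thesis by simp
   qed
  qed auto
 qed
qed

abbreviation flat :: "real => real" where "flat \<equiv> flat_fun 0"

lemma flat_pos_iff: "flat x > 0 \<longleftrightarrow> x > 0" by (simp add: flat_fun_def)
lemma flat_nonneg: "flat x \<ge> 0" by (simp add: flat_fun_def)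
lemma flat_zero_iff: "flat x = 0 \<longleftrightarrow> x \<le> 0" by (simp add: flat_fun_def)

text \<open>The integral \<open>\<integral> f (a + s (z - a)) ds\<close> over \<open>[0, 1]\<close> is smooth in \<open>z\<close>, by differentiation under the
  integral sign. Weights in \<open>s\<close> appear with each derivative.\<close>

lemma Cinf_ray_average:
 fixes h :: "'a::euclidean_space => real"
 assumes "Cinf (ball a r) h"
 shows "Ck_on k (ball a r) (%z. integral (cbox 0 1) (%s::real. s ^ j * h (a + s *\<^sub>R (z - a))))"
 using assms
proof (induction k arbitrary: h j)
 let ?B = "ball a r"
 have inB: "a + s *\<^sub>R (z - a) \<in> ?B" if "z \<in> ?B" "s \<in> cbox 0 1" for z and s :: real
 proof -
  have "norm (s *\<^sub>R (z - a)) \<le> norm (z - a)" using that by (simp add: mult_left_le_one_le)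
  then show ?thesis using that by (auto simp: dist_norm norm_minus_commute)
 qed
 have cont: "continuous_on (?B \<times> cbox 0 1) (%(z, s). s ^ j * h (a + s *\<^sub>R (z - a)))"
  if "continuous_on ?B h" for h :: "'a => real" and j :: nat
  unfolding case_prod_unfold
  by (intro continuous_intros continuous_on_compose2[OF that]) (use inB in auto)
 {
  case 0
  then show ?case
   using integral_continuous_on_param[OF cont[OF Cinf_continuous[OF 0]]] by simp
 next
  case (Suc k)
  let ?h = "%x. FD h (at x)"
  have hc: "continuous_on ?B (%x. ?h x v)" for v
   using Cinf_continuous[OF Cinf_derivative[OF Suc.prems]] .
  define fx where "fx z s = (\<Sum>b\<in>Basis. (s ^ Suc j * ?h (a + s *\<^sub>R (z - a)) b) *\<^sub>R blinfun_inner_left b)"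
   for z and s :: real
  have fx: "blinfun_apply (fx z s) v = s ^ Suc j * ?h (a + s *\<^sub>R (z - a)) v" if "z \<in> ?B" "s \<in> cbox 0 1" for z s v
  proof -
   have "linear (?h (a + s *\<^sub>R (z - a)))"
    using Cinf_has_derivative[OF Suc.prems open_ball inB[OF that]] by (rule has_derivative_linear)
   from linear_expand_basis[OF this, of v] show ?thesis
    by (simp add: fx_def blinfun.sum_left blinfun.scaleR_left sum_distrib_left mult_ac)
  qed
  have derw: "((%z. integral (cbox 0 1) (%s. s ^ j * h (a + s *\<^sub>R (z - a)))) has_derivative
    integral (cbox 0 1) (fx z)) (at z within ?B)" if z: "z \<in> ?B" for z
  proof (rule leibniz_rule[OF _ _ _ z convex_ball])
   fix z and s :: real assume zs: "z \<in> ?B" "s \<in> cbox 0 1"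
   have d: "(h has_derivative ?h (a + s *\<^sub>R (z - a))) (at (a + s *\<^sub>R (z - a)))"
    using Cinf_has_derivative[OF Suc.prems open_ball inB[OF zs]] .
   have l: "linear (?h (a + s *\<^sub>R (z - a)))" using d by (rule has_derivative_linear)
   have "((%z. a + s *\<^sub>R (z - a)) has_derivative (%v. s *\<^sub>R v)) (at z within ?B)"
    by (auto intro!: derivative_eq_intros)
   then have "((%z. s ^ j * h (a + s *\<^sub>R (z - a))) has_derivative
     (%v. s ^ j * ?h (a + s *\<^sub>R (z - a)) (s *\<^sub>R v))) (at z within ?B)"
    by (intro has_derivative_mult_right has_derivative_compose[where f = "%z. a + s *\<^sub>R (z - a)" and g = h, OF _ d])
   then show "((%z. s ^ j * h (a + s *\<^sub>R (z - a))) has_derivative blinfun_apply (fx z s)) (at z within ?B)"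
    by (rule has_derivative_eq_rhs) (auto simp: fx[OF zs] linear_scale[OF l])
  next
   fix z assume "z \<in> ?B"
   then show "(%s. s ^ j * h (a + s *\<^sub>R (z - a))) integrable_on cbox 0 1"
    by (intro integrable_continuous continuous_intros continuous_on_compose2[OF Cinf_continuous[OF Suc.prems]])
     (use inB in auto)
  next
   have "continuous_on (?B \<times> cbox 0 1) (%p. (case p of (z, s) => s ^ Suc j * ?h (a + s *\<^sub>R (z - a)) b))" for b
    by (rule cont[OF hc])
   then show "continuous_on (?B \<times> cbox 0 1) (%(z, s). fx z s)"
    unfolding fx_def case_prod_unfold by (intro continuous_on_sum continuous_on_scaleR continuous_on_const) 
  qed
  have der: "((%z. integral (cbox 0 1) (%s. s ^ j * h (a + s *\<^sub>R (z - a)))) has_derivative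
    blinfun_apply (integral (cbox 0 1) (fx z))) (at z)" if "z \<in> ?B" for z
   using derw[OF that] by (simp only: at_within_open[OF that open_ball])
  have app: "blinfun_apply (integral (cbox 0 1) (fx z)) v =
    integral (cbox 0 1) (%s. s ^ Suc j * ?h (a + s *\<^sub>R (z - a)) v)" if z: "z \<in> ?B" for z v
  proof -
   have "continuous_on (cbox 0 1) (fx z)"
    unfolding fx_def
    by (intro continuous_intros continuous_on_compose2[OF hc]) (use inB z in auto)
   then have "blinfun_apply (integral (cbox 0 1) (fx z)) v = integral (cbox 0 1) (%s. blinfun_apply (fx z s) v)"
    by (intro blinfun_apply_integral integrable_continuous)
   also have "\<dots> = integral (cbox 0 1) (%s. s ^ Suc j * ?h (a + s *\<^sub>R (z - a)) v)"
    using fx[OF z] by (intro Henstock_Kurzweil_Integration.integral_cong) auto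
   finally show ?thesis .
  qed
  show ?case
  proof (rule Ck_on_Suc_intro[OF open_ball der])
   fix v
   have "Ck_on k ?B (%z. integral (cbox 0 1) (%s. s ^ Suc j * (%x. ?h x v) (a + s *\<^sub>R (z - a))))"
    by (rule Suc.IH[OF Cinf_derivative[OF Suc.prems]])
   then show "Ck_on k ?B (%z. blinfun_apply (integral (cbox 0 1) (fx z)) v)"
    by (rule Ck_on_cong[OF open_ball, rotated]) (simp only: app)
  qed
 }
qed

text \<open>Hadamard's lemma: the coefficients are the averages of the partial derivatives along rays.\<close>

lemma hadamard:
 fixes h :: "'a::euclidean_space => real"
 assumes "Cinf (ball a r) h" "r > 0"
 obtains g where "!!b. Cinf (ball a r) (g b)"
  "!!z. z \<in> ball a r ==> h z = h a + (\<Sum>b\<in>Basis. ((z - a) \<bullet> b) * g b z)"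
  "!!b. g b a = FD h (at a) b"
proof
 let ?h = "%x. FD h (at x)"
 let ?g = "%b z. integral (cbox 0 1) (%s::real. ?h (a + s *\<^sub>R (z - a)) b)"
 show "Cinf (ball a r) (?g b)" for b
  using Cinf_ray_average[OF Cinf_derivative[OF assms(1)], of _ 0 b] by simp
 show "?g b a = ?h a b" for b by simp
 fix z assume z: "z \<in> ball a r"
 have inB: "a + s *\<^sub>R (z - a) \<in> ball a r" if "s \<in> cbox 0 1" for s :: real
 proof -
  have "norm (s *\<^sub>R (z - a)) \<le> norm (z - a)" using that by (simp add: mult_left_le_one_le)
  then show ?thesis using z by (auto simp: dist_norm norm_minus_commute)
 qed
 have d: "(h has_derivative ?h (a + s *\<^sub>R (z - a))) (at (a + s *\<^sub>R (z - a)))" if "s \<in> cbox 0 1" for s :: real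
  using Cinf_has_derivative[OF assms(1) open_ball inB[OF that]] .
 have "((%s. ?h (a + s *\<^sub>R (z - a)) (z - a)) has_integral
   (h (a + 1 *\<^sub>R (z - a)) - h (a + 0 *\<^sub>R (z - a)))) {0..1::real}"
 proof (rule fundamental_theorem_of_calculus)
  fix s :: real assume s: "s \<in> {0..1}"
  have "((%s. a + s *\<^sub>R (z - a)) has_derivative (%v. v *\<^sub>R (z - a))) (at s within {0..1})"
   by (auto intro!: derivative_eq_intros)
  from has_derivative_compose[where f = "%s. a + s *\<^sub>R (z - a)" and g = h, OF this d] s
  have "((%s. h (a + s *\<^sub>R (z - a))) has_derivative (%v. ?h (a + s *\<^sub>R (z - a)) (v *\<^sub>R (z - a)))) (at s within {0..1})"
   by simp
  moreover have "linear (?h (a + s *\<^sub>R (z - a)))"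
   using d[of s] s by (auto intro: has_derivative_linear)
  ultimately show "((%s. h (a + s *\<^sub>R (z - a))) has_vector_derivative ?h (a + s *\<^sub>R (z - a)) (z - a)) (at s within {0..1})"
   by (simp add: has_vector_derivative_def linear_scale)
 qed simp
 then have 1: "h z - h a = integral (cbox 0 1) (%s::real. ?h (a + s *\<^sub>R (z - a)) (z - a))"
  by (simp add: integral_unique)
 also have "\<dots> = integral (cbox 0 1) (%s::real. \<Sum>b\<in>Basis. ((z - a) \<bullet> b) * ?h (a + s *\<^sub>R (z - a)) b)"
 proof (rule Henstock_Kurzweil_Integration.integral_cong)
  fix s :: real assume "s \<in> cbox 0 1"
  from linear_expand_basis[OF has_derivative_linear[OF d[OF this]], of "z - a"]
  show "?h (a + s *\<^sub>R (z - a)) (z - a) = (\<Sum>b\<in>Basis. ((z - a) \<bullet> b) * ?h (a + s *\<^sub>R (z - a)) b)" by simp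
 qed
 also have "\<dots> = (\<Sum>b\<in>Basis. integral (cbox 0 1) (%s::real. ((z - a) \<bullet> b) * ?h (a + s *\<^sub>R (z - a)) b))"
 proof (rule Henstock_Kurzweil_Integration.integral_sum)
  fix b :: 'a
  have "continuous_on (cbox 0 1) (%s::real. ?h (a + s *\<^sub>R (z - a)) b)"
   by (intro continuous_on_compose2[OF Cinf_continuous[OF Cinf_derivative[OF assms(1)]]] continuous_intros)
    (use inB in auto)
  then show "(%s::real. ((z - a) \<bullet> b) * ?h (a + s *\<^sub>R (z - a)) b) integrable_on cbox 0 1"
   by (intro integrable_continuous continuous_on_mult_left)
 qed auto
 finally show "h z = h a + (\<Sum>b\<in>Basis. ((z - a) \<bullet> b) * ?g b z)" by simp
qed

section \<open>Smoothness on atlases\<close>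

locale atlas =
 fixes N :: "('p, 'c::euclidean_space) manifold"
 assumes cover: "(\<Union>(U, \<phi>)\<in>charts N. U) = pts N"
  and inj: "!!U \<phi>. (U, \<phi>) \<in> charts N ==> inj_on \<phi> U"
  and compatible: "!!U \<phi> V \<psi>. (U, \<phi>) \<in> charts N ==> (V, \<psi>) \<in> charts N ==>
     openin (top_of_set (\<phi> ` U)) (\<phi> ` (U \<inter> V)) &
     smooth_within (\<phi> ` (U \<inter> V)) (\<psi> \<circ> inv_into U \<phi>)"

sublocale smooth_manifold \<subseteq> atlas
 using chart_cover chart_inj chart_compatible by unfold_locales auto

lemma smooth_manifold_atlas: "smooth_manifold N ==> atlas N"
proof -
 assume "smooth_manifold N"
 then interpret smooth_manifold N .
 show ?thesis by (rule atlas_axioms)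
qed

lemma Cinf_compose:
 assumes "open S" "open T" "Cinf S f" "Cinf T g"
 shows "open (S \<inter> f -` T)" "Cinf (S \<inter> f -` T) (%x. g (f x))"
proof -
 show o: "open (S \<inter> f -` T)"
  using assms Cinf_continuous continuous_open_preimage by blast
 show "Cinf (S \<inter> f -` T) (%x. g (f x))"
  using Ck_on_compose[OF o assms(2) _ Ck_on_subset[of _ S f]] assms(3,4) by auto
qed

text \<open>Smoothness is used in a pointwise form: one pair of charts and one local extension suffice. On an
  atlas this does not depend on the charts, and it composes without any bookkeeping of domains.\<close>

definition sm_at :: "('p, 'c::euclidean_space) manifold => 'p set =>
  ('q, 'd::euclidean_space) manifold => ('p => 'q) => 'p => bool" where
 "sm_at N S P f x \<longleftrightarrow> (\<exists>U \<phi> V \<psi> A g. (U, \<phi>) \<in> charts N & (V, \<psi>) \<in> charts P & x \<in> U & f x \<in> V &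
   open A & \<phi> x \<in> A & Cinf A g & (\<forall>y\<in>S \<inter> U. \<phi> y \<in> A --> f y \<in> V & \<psi> (f y) = g (\<phi> y)))"

abbreviation sma where "sma N \<equiv> sm_at N (pts N)"

lemma sm_atI:
 "[|(U, \<phi>) \<in> charts N; (V, \<psi>) \<in> charts P; x \<in> U; f x \<in> V; open A; \<phi> x \<in> A; Cinf A g;
  !!y. y \<in> S ==> y \<in> U ==> \<phi> y \<in> A ==> f y \<in> V & \<psi> (f y) = g (\<phi> y)|] ==> sm_at N S P f x"
 unfolding sm_at_def by blast

lemma smooth_withinD:
 "smooth_within S f ==> x \<in> S ==> \<exists>A g. open A & x \<in> A & Cinf A g & (\<forall>y\<in>A \<inter> S. g y = f y)"
 unfolding smooth_within_def by (rule bspec)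

context atlas
begin

lemma chart_at: "p \<in> pts N ==> \<exists>U \<phi>. (U, \<phi>) \<in> charts N & p \<in> U"
 using cover by blast

lemma chart_sub: "(U, \<phi>) \<in> charts N ==> U \<subseteq> pts N"
 using cover by blast

lemma transition:
 assumes "(U, \<phi>) \<in> charts N" "(V, \<psi>) \<in> charts N" "p \<in> U" "p \<in> V"
 shows "\<exists>A g. open A & \<phi> p \<in> A & Cinf A g & (\<forall>y\<in>U. \<phi> y \<in> A --> y \<in> V & \<psi> y = g (\<phi> y))"
proof -
 have in_iff: "\<phi> y \<in> \<phi> ` (U \<inter> V) \<longleftrightarrow> y \<in> V" "inv_into U \<phi> (\<phi> y) = y" if "y \<in> U" for y
  using inj[OF assms(1)] that by (auto dest: inj_onD)
 from compatible[OF assms(1,2)] obtain T where T: "open T" "\<phi> ` (U \<inter> V) = \<phi> ` U \<inter> T"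
  by (auto simp: openin_open)
 have "\<phi> p \<in> \<phi> ` (U \<inter> V)" using assms(3,4) by simp
 from smooth_withinD[OF conjunct2[OF compatible[OF assms(1,2)]] this]
 obtain B g where B: "open B" "\<phi> p \<in> B" "Cinf B g"
  "\<forall>y\<in>B \<inter> \<phi> ` (U \<inter> V). g y = (\<psi> \<circ> inv_into U \<phi>) y" by blast
 have "\<phi> p \<in> T" using T assms(3,4) by blast
 moreover have "y \<in> V & \<psi> y = g (\<phi> y)" if y: "y \<in> U" "\<phi> y \<in> B \<inter> T" for y
 proof -
  have "\<phi> y \<in> \<phi> ` (U \<inter> V)" using T y by blast
  then show ?thesis using B(4) y in_iff[OF y(1)] by auto
 qed
 moreover have "Cinf (B \<inter> T) g" using B(3) Ck_on_subset by blast
 ultimately show ?thesis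
  using B T by (intro exI[of _ "B \<inter> T"] exI[of _ g]) auto
qed

lemma openin_mtop:
 "openin (mtop N) W \<longleftrightarrow> W \<subseteq> pts N &
   (\<forall>(U, \<phi>)\<in>charts N. openin (top_of_set (\<phi> ` U)) (\<phi> ` (U \<inter> W)))"
proof -
 have "istopology (%W. W \<subseteq> pts N &
   (\<forall>(U, \<phi>)\<in>charts N. openin (top_of_set (\<phi> ` U)) (\<phi> ` (U \<inter> W))))"
  unfolding istopology_def
 proof (intro conjI allI impI)
  fix S T assume S: "S \<subseteq> pts N & (\<forall>(U, \<phi>)\<in>charts N. openin (top_of_set (\<phi> ` U)) (\<phi> ` (U \<inter> S)))"
   and T: "T \<subseteq> pts N & (\<forall>(U, \<phi>)\<in>charts N. openin (top_of_set (\<phi> ` U)) (\<phi> ` (U \<inter> T)))"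
  show "S \<inter> T \<subseteq> pts N" using S by blast
  show "\<forall>(U, \<phi>)\<in>charts N. openin (top_of_set (\<phi> ` U)) (\<phi> ` (U \<inter> (S \<inter> T)))"
  proof clarify
   fix U \<phi> assume c: "(U, \<phi>) \<in> charts N"
   have "\<phi> ` (U \<inter> (S \<inter> T)) = \<phi> ` (U \<inter> S) \<inter> \<phi> ` (U \<inter> T)"
    using inj[OF c] by (auto dest: inj_onD)
   then show "openin (top_of_set (\<phi> ` U)) (\<phi> ` (U \<inter> (S \<inter> T)))"
    using S T c by (auto intro!: openin_Int)
  qed
 next
  fix K assume K: "\<forall>S\<in>K. S \<subseteq> pts N & (\<forall>(U, \<phi>)\<in>charts N. openin (top_of_set (\<phi> ` U)) (\<phi> ` (U \<inter> S)))"
  then show "\<Union> K \<subseteq> pts N" by blast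
  show "\<forall>(U, \<phi>)\<in>charts N. openin (top_of_set (\<phi> ` U)) (\<phi> ` (U \<inter> \<Union> K))"
  proof clarify
   fix U \<phi> assume c: "(U, \<phi>) \<in> charts N"
   have "\<phi> ` (U \<inter> \<Union> K) = (\<Union>S\<in>K. \<phi> ` (U \<inter> S))" by blast
   then show "openin (top_of_set (\<phi> ` U)) (\<phi> ` (U \<inter> \<Union> K))"
    using K c by (auto intro!: openin_Union)
  qed
 qed
 from topology_inverse'[OF this] show ?thesis by (simp add: mtop_def)
qed

lemma openin_mtop_iff:
 "openin (mtop N) W \<longleftrightarrow> W \<subseteq> pts N & (\<forall>U \<phi> p. (U, \<phi>) \<in> charts N --> p \<in> W \<inter> U -->
   (\<exists>A. open A & \<phi> p \<in> A & (\<forall>y\<in>U. \<phi> y \<in> A --> y \<in> W)))" (is "?L = ?R")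
proof -
 have eq: "openin (top_of_set (\<phi> ` U)) (\<phi> ` (U \<inter> W)) \<longleftrightarrow>
   (\<forall>p\<in>W \<inter> U. \<exists>A. open A & \<phi> p \<in> A & (\<forall>y\<in>U. \<phi> y \<in> A --> y \<in> W))" (is "?l = ?r")
  if c: "(U, \<phi>) \<in> charts N" for U \<phi>
 proof
  assume ?l
  then obtain T where T: "open T" "\<phi> ` (U \<inter> W) = \<phi> ` U \<inter> T" by (auto simp: openin_open)
  have "y \<in> W" if "y \<in> U" "\<phi> y \<in> T" for y
  proof -
   have "\<phi> y \<in> \<phi> ` (U \<inter> W)" using T that by blast
   then show ?thesis using inj[OF c] that by (auto dest: inj_onD)
  qed
  then show ?r using T by blast
 next
  assume ?r
  then have "\<phi> ` (U \<inter> W) = \<phi> ` U \<inter> \<Union>{A. open A & (\<forall>y\<in>U. \<phi> y \<in> A --> y \<in> W)}" by blast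
  moreover have "open (\<Union>{A. open A & (\<forall>y\<in>U. \<phi> y \<in> A --> y \<in> W)})" by auto
  ultimately show ?l unfolding openin_open by blast
 qed
 show ?thesis
 proof
  assume L: ?L
  show ?R
  proof (intro conjI allI impI)
   show "W \<subseteq> pts N" using L openin_mtop by simp
   fix U \<phi> p assume c: "(U, \<phi>) \<in> charts N" and p: "p \<in> W \<inter> U"
   have "openin (top_of_set (\<phi> ` U)) (\<phi> ` (U \<inter> W))" using L c openin_mtop by auto
   from bspec[OF iffD1[OF eq[OF c] this] p]
   show "\<exists>A. open A & \<phi> p \<in> A & (\<forall>y\<in>U. \<phi> y \<in> A --> y \<in> W)" .
  qed
 next
  assume R: ?R
  have "openin (top_of_set (\<phi> ` U)) (\<phi> ` (U \<inter> W))" if c: "(U, \<phi>) \<in> charts N" for U \<phi>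
   using R c by (intro iffD2[OF eq[OF c]] ballI) simp
  then show ?L using R openin_mtop by auto
 qed
qed

lemma openin_mtopI:
 assumes "W \<subseteq> pts N" "!!p. p \<in> W ==> \<exists>U \<phi> A. (U, \<phi>) \<in> charts N & p \<in> U & open A & \<phi> p \<in> A &
   (\<forall>y\<in>U. \<phi> y \<in> A --> y \<in> W)"
 shows "openin (mtop N) W"
 unfolding openin_mtop_iff
proof (intro conjI allI impI)
 fix V \<psi> p assume V: "(V, \<psi>) \<in> charts N" and p: "p \<in> W \<inter> V"
 from assms(2) p obtain U \<phi> A where U: "(U, \<phi>) \<in> charts N" "p \<in> U" "open A" "\<phi> p \<in> A"
  "\<forall>y\<in>U. \<phi> y \<in> A --> y \<in> W" by (metis IntD1)
 from transition[OF V U(1) _ U(2)] p obtain B g where B: "open B" "\<psi> p \<in> B" "Cinf B g"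
  "\<forall>y\<in>V. \<psi> y \<in> B --> y \<in> U & \<phi> y = g (\<psi> y)" by auto
 have "open (B \<inter> g -` A)" using Cinf_continuous[OF B(3)] B(1) U(3) continuous_open_preimage by blast
 then show "\<exists>A. open A & \<psi> p \<in> A & (\<forall>y\<in>V. \<psi> y \<in> A --> y \<in> W)"
  using B U p by (intro exI[of _ "B \<inter> g -` A"]) auto
qed fact

lemma openin_chart: "(U, \<phi>) \<in> charts N ==> open A ==> openin (mtop N) {y \<in> U. \<phi> y \<in> A}"
 by (rule openin_mtopI) (use chart_sub in blast)+

lemma openin_chart_dom: "(U, \<phi>) \<in> charts N ==> openin (mtop N) U"
 using openin_chart[of U \<phi> UNIV] by simp

lemma topspace_mtop [simp]: "topspace (mtop N) = pts N"
proof
 show "topspace (mtop N) \<subseteq> pts N" using openin_topspace openin_mtop by blast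
 have "openin (mtop N) (pts N)" using chart_sub chart_at by (intro openin_mtopI) blast+
 then show "pts N \<subseteq> topspace (mtop N)" by (rule openin_subset)
qed

lemma openin_pts [simp]: "openin (mtop N) (pts N)"
 using openin_topspace[of "mtop N"] by simp

end

text \<open>Transition maps are checked pointwise, by local extensions as in the definition of smoothness at a point.
  Product, tangent and submanifold charts satisfy this without a description of the chart images.\<close>

lemma atlasI:
 assumes "(\<Union>(U, \<phi>)\<in>charts N. U) = pts N" "!!U \<phi>. (U, \<phi>) \<in> charts N ==> inj_on \<phi> U"
  and tr: "!!U \<phi> V \<psi> p. (U, \<phi>) \<in> charts N ==> (V, \<psi>) \<in> charts N ==> p \<in> U ==> p \<in> V ==>
    \<exists>A g. open A & \<phi> p \<in> A & Cinf A g & (\<forall>y\<in>U. \<phi> y \<in> A --> y \<in> V & \<psi> y = g (\<phi> y))"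
 shows "atlas N"
proof
 fix U \<phi> V \<psi> assume c: "(U, \<phi>) \<in> charts N" "(V, \<psi>) \<in> charts N"
 have "\<phi> ` (U \<inter> V) = \<phi> ` U \<inter> \<Union>{A. open A & (\<forall>y\<in>U. \<phi> y \<in> A --> y \<in> V)}"
 proof (intro equalityI subsetI)
  fix z assume "z \<in> \<phi> ` (U \<inter> V)"
  then obtain p where p: "p \<in> U" "p \<in> V" "z = \<phi> p" by auto
  from tr[OF c p(1,2)] p(1,3)
  show "z \<in> \<phi> ` U \<inter> \<Union>{A. open A & (\<forall>y\<in>U. \<phi> y \<in> A --> y \<in> V)}" by auto
 qed auto
 moreover have "open (\<Union>{A. open A & (\<forall>y\<in>U. \<phi> y \<in> A --> y \<in> V)})" by auto
 ultimately have "openin (top_of_set (\<phi> ` U)) (\<phi> ` (U \<inter> V))" unfolding openin_open by blast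
 moreover have "smooth_within (\<phi> ` (U \<inter> V)) (\<psi> \<circ> inv_into U \<phi>)"
  unfolding smooth_within_def
 proof
  fix z assume "z \<in> \<phi> ` (U \<inter> V)"
  then obtain p where p: "p \<in> U" "p \<in> V" "z = \<phi> p" by auto
  from tr[OF c p(1,2)] obtain A g where A: "open A" "\<phi> p \<in> A" "Cinf A g"
   "\<forall>y\<in>U. \<phi> y \<in> A --> y \<in> V & \<psi> y = g (\<phi> y)" by blast
  then have "\<forall>y\<in>A \<inter> \<phi> ` (U \<inter> V). g y = (\<psi> \<circ> inv_into U \<phi>) y"
   using assms(2)[OF c(1)] by auto
  then show "\<exists>O' g. open O' & z \<in> O' & Cinf O' g & (\<forall>y\<in>O' \<inter> \<phi> ` (U \<inter> V). g y = (\<psi> \<circ> inv_into U \<phi>) y)"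
   using A p by blast
 qed
 ultimately show "openin (top_of_set (\<phi> ` U)) (\<phi> ` (U \<inter> V)) &
     smooth_within (\<phi> ` (U \<inter> V)) (\<psi> \<circ> inv_into U \<phi>)" ..
qed (use assms in auto)

lemma sm_at_charts:
 assumes "atlas N" "atlas P" "sm_at N S P f x" "x \<in> S"
  and c: "(U, \<phi>) \<in> charts N" "x \<in> U" "(V, \<psi>) \<in> charts P" "f x \<in> V"
 shows "\<exists>A g. open A & \<phi> x \<in> A & Cinf A g & (\<forall>y\<in>S \<inter> U. \<phi> y \<in> A --> f y \<in> V & \<psi> (f y) = g (\<phi> y))"
proof -
 interpret N: atlas N by fact
 interpret P: atlas P by fact
 from assms(3) obtain U0 \<phi>0 V0 \<psi>0 A0 g0 where 0: "(U0, \<phi>0) \<in> charts N" "(V0, \<psi>0) \<in> charts P"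
  "x \<in> U0" "f x \<in> V0" "open A0" "\<phi>0 x \<in> A0" "Cinf A0 g0"
  "!!y. y \<in> S ==> y \<in> U0 ==> \<phi>0 y \<in> A0 ==> f y \<in> V0 & \<psi>0 (f y) = g0 (\<phi>0 y)"
  unfolding sm_at_def by blast
 from N.transition[OF c(1) 0(1) c(2) 0(3)] obtain B h where B: "open B" "\<phi> x \<in> B" "Cinf B h"
  "!!y. y \<in> U ==> \<phi> y \<in> B ==> y \<in> U0 & \<phi>0 y = h (\<phi> y)" by blast
 from P.transition[OF 0(2) c(3) 0(4) c(4)] obtain C k where C: "open C" "\<psi>0 (f x) \<in> C" "Cinf C k"
  "!!y. y \<in> V0 ==> \<psi>0 y \<in> C ==> y \<in> V & \<psi> y = k (\<psi>0 y)" by blast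
 note gh = Cinf_compose[OF B(1) 0(5) B(3) 0(7)]
 note kgh = Cinf_compose[OF gh(1) C(1) gh(2) C(3)]
 let ?A = "B \<inter> h -` A0 \<inter> (%x. g0 (h x)) -` C"
 have key: "f y \<in> V & \<psi> (f y) = k (g0 (h (\<phi> y)))" if "y \<in> S" "y \<in> U" "\<phi> y \<in> ?A" for y
  using B(4)[of y] 0(8)[of y] C(4)[of "f y"] that by auto
 have "\<phi> x \<in> ?A" using B(4)[of x] 0(8)[of x] C(2) B(2) 0(3,6) c assms(4) by auto
 with key kgh show ?thesis by (intro exI[of _ ?A] exI[of _ "%x. k (g0 (h x))"]) blast
qed

lemma sm_at_nbhd_mono:
 assumes "atlas N" "sm_at N (S \<inter> W) P f x" "openin (mtop N) W" "x \<in> W"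
 shows "sm_at N S P f x"
proof -
 interpret N: atlas N by fact
 from assms(2) obtain U \<phi> V \<psi> A g where c: "(U, \<phi>) \<in> charts N" "(V, \<psi>) \<in> charts P" "x \<in> U" "f x \<in> V"
  "open A" "\<phi> x \<in> A" "Cinf A g" "\<forall>y\<in>S \<inter> W \<inter> U. \<phi> y \<in> A --> f y \<in> V & \<psi> (f y) = g (\<phi> y)"
  unfolding sm_at_def by blast
 from assms(3,4) c(1,3) obtain B where B: "open B" "\<phi> x \<in> B" "\<forall>y\<in>U. \<phi> y \<in> B --> y \<in> W"
  unfolding N.openin_mtop_iff by blast
 have "Cinf (A \<inter> B) g" using c(7) Ck_on_subset by blast
 then show ?thesis
  using c B by (intro sm_atI[of U \<phi> N V \<psi> P x f "A \<inter> B" g]) auto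
qed

lemma sm_at_subset: "sm_at N S P f x ==> T \<subseteq> S ==> sm_at N T P f x"
 unfolding sm_at_def by (elim exE conjE, intro exI conjI) (assumption+, auto)

lemma sm_at_cong: "sm_at N S P f x ==> x \<in> S ==> (!!y. y \<in> S ==> f y = f' y) ==> sm_at N S P f' x"
 unfolding sm_at_def by (metis IntD1)

lemma sm_at_eq_near:
 assumes "atlas N" "sm_at N S P f x" "openin (mtop N) W" "x \<in> W" "x \<in> S"
  "!!y. y \<in> S ==> y \<in> W ==> f y = f' y"
 shows "sm_at N S P f' x"
proof -
 have "sm_at N (S \<inter> W) P f x" using assms(2) by (rule sm_at_subset) auto
 then have "sm_at N (S \<inter> W) P f' x" by (rule sm_at_cong) (use assms in auto)
 then show ?thesis by (rule sm_at_nbhd_mono[OF assms(1) _ assms(3,4)])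
qed

lemma sm_at_pts: "atlas P ==> sm_at N S P f x ==> f x \<in> pts P"
 unfolding sm_at_def using atlas.chart_sub by blast

text \<open>The local extension of the coordinate expression is continuous, and charts are homeomorphisms.\<close>

lemma sm_at_continuous:
 assumes "atlas N" "atlas P" "sm_at N S P f x" "x \<in> S" "openin (mtop P) W" "f x \<in> W"
 shows "\<exists>Q. openin (mtop N) Q & x \<in> Q & f ` (S \<inter> Q) \<subseteq> W"
proof -
 interpret N: atlas N by fact
 interpret P: atlas P by fact
 from assms(3) obtain U \<phi> V \<psi> A g where c: "(U, \<phi>) \<in> charts N" "(V, \<psi>) \<in> charts P" "x \<in> U" "f x \<in> V"
  "open A" "\<phi> x \<in> A" "Cinf A g" "\<forall>y\<in>S \<inter> U. \<phi> y \<in> A --> f y \<in> V & \<psi> (f y) = g (\<phi> y)"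
  unfolding sm_at_def by blast
 from assms(5,6) c(2,4) obtain B where B: "open B" "\<psi> (f x) \<in> B" "\<forall>y\<in>V. \<psi> y \<in> B --> y \<in> W"
  unfolding P.openin_mtop_iff by blast
 have "open (A \<inter> g -` B)" using Cinf_continuous[OF c(7)] c(5) B(1) continuous_open_preimage by blast
 then have "openin (mtop N) {y \<in> U. \<phi> y \<in> A \<inter> g -` B}" using N.openin_chart[OF c(1)] by blast
 then show ?thesis
  using c B assms(4) by (intro exI[of _ "{y \<in> U. \<phi> y \<in> A \<inter> g -` B}"]) auto
qed

lemma smooth_map_on_iff:
 assumes "atlas N" "atlas P"
 shows "smooth_map_on N S P f \<longleftrightarrow> S \<subseteq> pts N & (\<forall>x\<in>S. sm_at N S P f x)" (is "?L \<longleftrightarrow> ?R")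
proof -
 interpret N: atlas N by fact
 interpret P: atlas P by fact
 show ?thesis
 proof
  assume L: ?L
  have "sm_at N S P f x" if x: "x \<in> S" for x
  proof -
   have "x \<in> pts N" "f x \<in> pts P" using L x unfolding smooth_map_on_def by auto
   then obtain U \<phi> V \<psi> where c: "(U, \<phi>) \<in> charts N" "x \<in> U"
    "(V, \<psi>) \<in> charts P" "f x \<in> V" using N.chart_at P.chart_at by blast
   have "openin (subtopology (mtop N) S) {y \<in> topspace (subtopology (mtop N) S). f y \<in> V}"
    using L P.openin_chart_dom[OF c(3)] unfolding smooth_map_on_def continuous_map_def by blast
   moreover have "topspace (subtopology (mtop N) S) = S" using L by (auto simp: smooth_map_on_def)
   ultimately obtain Q where Q: "openin (mtop N) Q" "{y \<in> S. f y \<in> V} = Q \<inter> S"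
    by (auto simp: openin_subtopology)
   with x c have "x \<in> Q" by blast
   with Q(1) c(1,2) obtain B where B: "open B" "\<phi> x \<in> B" "\<forall>y\<in>U. \<phi> y \<in> B --> y \<in> Q"
    unfolding N.openin_mtop_iff by blast
   from L c have sw: "smooth_within (\<phi> ` {x \<in> S \<inter> U. f x \<in> V}) (\<psi> \<circ> f \<circ> inv_into U \<phi>)"
    unfolding smooth_map_on_def by blast
   have "\<phi> x \<in> \<phi> ` {x \<in> S \<inter> U. f x \<in> V}" using x c by simp
   from smooth_withinD[OF sw this] obtain A g where A: "open A" "\<phi> x \<in> A" "Cinf A g"
    "\<forall>y\<in>A \<inter> \<phi> ` {x \<in> S \<inter> U. f x \<in> V}. g y = (\<psi> \<circ> f \<circ> inv_into U \<phi>) y"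
    by blast
   have "f y \<in> V & \<psi> (f y) = g (\<phi> y)" if y: "y \<in> S" "y \<in> U" "\<phi> y \<in> A \<inter> B" for y
   proof -
    have "f y \<in> V" using B(3) Q(2) y by blast
    moreover have "inv_into U \<phi> (\<phi> y) = y" using N.inj[OF c(1)] y by simp
    ultimately show ?thesis using A(4) y by force
   qed
   moreover have "Cinf (A \<inter> B) g" using A(3) Ck_on_subset by blast
   ultimately show ?thesis
    using c A B by (intro sm_atI[of U \<phi> N V \<psi> P x f "A \<inter> B" g]) auto
  qed
  then show ?R using L by (auto simp: smooth_map_on_def)
 next
  assume R: ?R
  have fP: "f ` S \<subseteq> pts P"
  proof (rule image_subsetI)
   fix x assume "x \<in> S"
   then have "sm_at N S P f x" using R by simp
   then show "f x \<in> pts P" by (rule sm_at_pts[OF assms(2)])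
  qed
  have "continuous_map (subtopology (mtop N) S) (mtop P) f"
   unfolding continuous_map_def
  proof (intro conjI allI impI)
   show "f \<in> topspace (subtopology (mtop N) S) \<rightarrow> topspace (mtop P)" using fP by auto
   fix W assume W: "openin (mtop P) W"
   have ts: "topspace (subtopology (mtop N) S) = S" using R by auto
   show "openin (subtopology (mtop N) S) {x \<in> topspace (subtopology (mtop N) S). f x \<in> W}"
    unfolding ts
   proof (subst openin_subopen, clarify)
    fix x assume x: "x \<in> S" "f x \<in> W"
    have "sm_at N S P f x" using R x by simp
    from sm_at_continuous[OF assms this x(1) W x(2)] obtain Q where
     "openin (mtop N) Q" "x \<in> Q" "f ` (S \<inter> Q) \<subseteq> W" by blast
    then show "\<exists>T. openin (subtopology (mtop N) S) T & x \<in> T & T \<subseteq> {x \<in> S. f x \<in> W}"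
     using x by (intro exI[of _ "Q \<inter> S"]) (auto simp: openin_subtopology)
   qed
  qed
  moreover have "smooth_within (\<phi> ` {x \<in> S \<inter> U. f x \<in> V}) (\<psi> \<circ> f \<circ> inv_into U \<phi>)"
   if c: "(U, \<phi>) \<in> charts N" "(V, \<psi>) \<in> charts P" for U \<phi> V \<psi>
   unfolding smooth_within_def
  proof
   fix z assume "z \<in> \<phi> ` {x \<in> S \<inter> U. f x \<in> V}"
   then obtain x where x: "x \<in> S" "x \<in> U" "f x \<in> V" "z = \<phi> x" by auto
   have "sm_at N S P f x" using R x by simp
   from sm_at_charts[OF assms this x(1) c(1) x(2) c(2) x(3)] obtain A g where
    A: "open A" "\<phi> x \<in> A" "Cinf A g" "\<forall>y\<in>S \<inter> U. \<phi> y \<in> A --> f y \<in> V & \<psi> (f y) = g (\<phi> y)" by blast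
   have "\<forall>y\<in>A \<inter> \<phi> ` {x \<in> S \<inter> U. f x \<in> V}. g y = (\<psi> \<circ> f \<circ> inv_into U \<phi>) y"
    using A(4) N.inj[OF c(1)] by auto
   then show "\<exists>O' g. open O' & z \<in> O' & Cinf O' g &
     (\<forall>y\<in>O' \<inter> \<phi> ` {x \<in> S \<inter> U. f x \<in> V}. g y = (\<psi> \<circ> f \<circ> inv_into U \<phi>) y)"
    using A x by blast
  qed
  ultimately show ?L using R fP by (auto simp: smooth_map_on_def)
 qed
qed

lemma sm_at_compose:
 assumes "atlas P" "atlas Q" "sm_at N S P f x" "sm_at P T Q g (f x)" "x \<in> S" "!!y. y \<in> S ==> f y \<in> T"
 shows "sm_at N S Q (%y. g (f y)) x"
proof -
 from assms(3) obtain U \<phi> V \<psi> A h where c: "(U, \<phi>) \<in> charts N" "(V, \<psi>) \<in> charts P" "x \<in> U" "f x \<in> V"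
  "open A" "\<phi> x \<in> A" "Cinf A h" "!!y. y \<in> S ==> y \<in> U ==> \<phi> y \<in> A ==> f y \<in> V & \<psi> (f y) = h (\<phi> y)"
  unfolding sm_at_def by blast
 from assms(4) obtain V' \<psi>' where V': "(V', \<psi>') \<in> charts Q" "g (f x) \<in> V'"
  unfolding sm_at_def by blast
 from sm_at_charts[OF assms(1,2,4) assms(6)[OF assms(5)] c(2,4) V'] obtain B k where
  B: "open B" "\<psi> (f x) \<in> B" "Cinf B k" "!!y. y \<in> T \<inter> V ==> \<psi> y \<in> B ==> g y \<in> V' & \<psi>' (g y) = k (\<psi> y)" by blast
 note kh = Cinf_compose[OF c(5) B(1) c(7) B(3)]
 have "g (f y) \<in> V' & \<psi>' (g (f y)) = k (h (\<phi> y))" if "y \<in> S" "y \<in> U" "\<phi> y \<in> A \<inter> h -` B" for y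
  using c(8)[of y] B(4)[of "f y"] assms(6)[of y] that by auto
 then show ?thesis
  using c(8)[OF assms(5) c(3) c(6)] c B(2) V'
  by (intro sm_atI[where f = "%y. g (f y)" and g = "%x. k (h x)", OF c(1) V'(1) c(3) V'(2) kh(1) _ kh(2)]) auto
qed

lemma sm_at_nbhd:
 assumes "atlas N" "sma N P f x"
 shows "\<exists>W. openin (mtop N) W & x \<in> W & (\<forall>y\<in>W. sma N P f y)"
proof -
 from assms(2) obtain U \<phi> V \<psi> A h where c: "(U, \<phi>) \<in> charts N" "(V, \<psi>) \<in> charts P" "x \<in> U" "f x \<in> V"
  "open A" "\<phi> x \<in> A" "Cinf A h" "\<forall>y\<in>pts N \<inter> U. \<phi> y \<in> A --> f y \<in> V & \<psi> (f y) = h (\<phi> y)"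
  unfolding sm_at_def by blast
 have "sma N P f y" if "y \<in> {y \<in> U. \<phi> y \<in> A}" for y
  using that c atlas.chart_sub[OF assms(1) c(1)] by (intro sm_atI[OF c(1,2) _ _ c(5) _ c(7)]) auto
 then show ?thesis using atlas.openin_chart[OF assms(1) c(1,5)] c by (intro exI[of _ "{y \<in> U. \<phi> y \<in> A}"]) blast
qed

lemma sm_at_open:
 "atlas N ==> openin (mtop N) S ==> x \<in> S ==> sm_at N S P f x \<longleftrightarrow> sma N P f x"
 using sm_at_nbhd_mono[of N "pts N" S P f x] sm_at_subset[of N "pts N" P f x S]
  openin_subset[of "mtop N" S] atlas.topspace_mtop[of N] by (metis inf.absorb2 inf_commute)

lemma smooth_on_open_iff:
 assumes "atlas N" "atlas P" "openin (mtop N) S"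
 shows "smooth_map_on N S P f \<longleftrightarrow> (\<forall>x\<in>S. sma N P f x)"
proof -
 have "(\<forall>x\<in>S. sm_at N S P f x) \<longleftrightarrow> (\<forall>x\<in>S. sma N P f x)" using sm_at_open[OF assms(1,3)] by blast
 moreover have "S \<subseteq> pts N"
  using openin_subset[OF assms(3)] atlas.topspace_mtop[OF assms(1)] by simp
 ultimately show ?thesis using smooth_map_on_iff[OF assms(1,2)] by simp
qed

lemma smooth_map_iff:
 "atlas N ==> atlas P ==> smooth_map N P f \<longleftrightarrow> (\<forall>x\<in>pts N. sma N P f x)"
 by (simp add: smooth_map_on_iff)

lemma sm_at_id: "atlas N ==> x \<in> pts N ==> sm_at N S N (%y. y) x"
 using atlas.chart_at[of N x] by (auto intro!: sm_atI[where A = UNIV and g = "%z. z"] Ck_on_id)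

lemma sm_at_const: "atlas N ==> atlas P ==> x \<in> pts N ==> c \<in> pts P ==> sm_at N S P (%_. c) x"
proof -
 assume a: "atlas N" "atlas P" "x \<in> pts N" "c \<in> pts P"
 then obtain U \<phi> V \<psi> where c: "(U, \<phi>) \<in> charts N" "x \<in> U" "(V, \<psi>) \<in> charts P" "c \<in> V"
  using atlas.chart_at by metis
 then show ?thesis by (intro sm_atI[OF c(1) c(3) c(2) c(4), of UNIV "%_. \<psi> c"]) (auto intro: Ck_on_const)
qed

section \<open>Euclidean spaces as manifolds, and products\<close>

lemma charts_euclid [simp]: "charts euclid = {(UNIV, id)}" and pts_euclid [simp]: "pts euclid = UNIV"
 by (simp_all add: euclid_def)

lemma atlas_euclid [simp]: "atlas euclid"
 by (rule atlasI) (auto intro!: exI[of _ UNIV] exI[of _ id] simp: id_def Ck_on_id)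

lemma openin_euclid [simp]: "openin (mtop euclid) W \<longleftrightarrow> open W"
 by (simp add: atlas.openin_mtop)

lemma mtop_euclid [simp]: "mtop euclid = euclidean"
 by (simp add: topology_eq)

lemma sma_euclid: "open A ==> z \<in> A ==> Cinf A g ==> sm_at euclid S euclid g z"
 by (rule sm_atI[of UNIV id _ UNIV id _ _ _ A g]) auto

lemma sm_at_euclid_iff:
 assumes "atlas N"
 shows "sm_at N S euclid f x \<longleftrightarrow> (\<exists>U \<phi> A g. (U, \<phi>) \<in> charts N & x \<in> U & open A & \<phi> x \<in> A & Cinf A g &
   (\<forall>y\<in>S \<inter> U. \<phi> y \<in> A --> f y = g (\<phi> y)))"
 unfolding sm_at_def by simp

lemma sm_at_Cinf:
 assumes "sm_at N S euclid f x" "x \<in> S" "open A" "f x \<in> A" "Cinf A g"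
 shows "sm_at N S euclid (%y. g (f y)) x"
 by (rule sm_at_compose[OF atlas_euclid atlas_euclid assms(1) sma_euclid[OF assms(3-5)] assms(2), of UNIV]) auto

lemma sm_at_chart: "atlas N ==> (U, \<phi>) \<in> charts N ==> x \<in> U ==> sm_at N S euclid \<phi> x"
 by (rule sm_atI[of U \<phi> _ UNIV id _ _ _ UNIV "%z. z"]) (auto intro: Ck_on_id)

lemma sm_at_chart_inv:
 "atlas N ==> (U, \<phi>) \<in> charts N ==> z \<in> \<phi> ` U ==> sm_at euclid (\<phi> ` U) N (inv_into U \<phi>) z"
 by (rule sm_atI[of UNIV id _ U \<phi> _ _ _ UNIV "%z. z"])
  (auto intro: Ck_on_id inv_into_into simp: f_inv_into_f)

lemma charts_prod: "charts (prod_mfd N P) =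
  {(U \<times> V, map_prod \<phi> \<psi>) | U \<phi> V \<psi>. (U, \<phi>) \<in> charts N & (V, \<psi>) \<in> charts P}"
 and pts_prod [simp]: "pts (prod_mfd N P) = pts N \<times> pts P"
 by (simp_all add: prod_mfd_def)

lemma Cinf_map_prod:
 assumes "open A" "open B" "Cinf A g" "Cinf B h"
 shows "Cinf (A \<times> B) (map_prod g h)"
proof
 fix k
 have o: "open (A \<times> B)" using assms by (intro open_Times)
 have "Ck_on k (A \<times> B) (%z. g (fst z))"
  by (rule Ck_on_compose[OF o assms(1) _ Ck_on_blin[OF o bounded_linear_fst]]) (use assms in auto)
 moreover have "Ck_on k (A \<times> B) (%z. h (snd z))"
  by (rule Ck_on_compose[OF o assms(2) _ Ck_on_blin[OF o bounded_linear_snd]]) (use assms in auto)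
 ultimately have "Ck_on k (A \<times> B) (%z. (g (fst z), h (snd z)))" by (rule Ck_on_Pair[OF o])
 then show "Ck_on k (A \<times> B) (map_prod g h)"
  by (simp add: map_prod_def case_prod_unfold)
qed

lemma atlas_prod [simp]:
 assumes "atlas N" "atlas P" shows "atlas (prod_mfd N P)"
proof (rule atlasI)
 interpret N: atlas N by fact
 interpret P: atlas P by fact
 show "(\<Union>(U, \<phi>)\<in>charts (prod_mfd N P). U) = pts (prod_mfd N P)"
  unfolding charts_prod pts_prod using N.chart_at P.chart_at N.chart_sub P.chart_sub by fast
 show "inj_on \<phi> U" if "(U, \<phi>) \<in> charts (prod_mfd N P)" for U \<phi>
  using that N.inj P.inj by (auto simp: charts_prod intro!: map_prod_inj_on)
 fix U \<phi> V \<psi> p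
 assume "(U, \<phi>) \<in> charts (prod_mfd N P)" "(V, \<psi>) \<in> charts (prod_mfd N P)" and p: "p \<in> U" "p \<in> V"
 then obtain U1 \<phi>1 U2 \<phi>2 V1 \<psi>1 V2 \<psi>2 where
  c: "(U1, \<phi>1) \<in> charts N" "(U2, \<phi>2) \<in> charts P" "(V1, \<psi>1) \<in> charts N" "(V2, \<psi>2) \<in> charts P"
  and e: "U = U1 \<times> U2" "\<phi> = map_prod \<phi>1 \<phi>2" "V = V1 \<times> V2" "\<psi> = map_prod \<psi>1 \<psi>2"
  unfolding charts_prod by blast
 obtain A g where A: "open A" "\<phi>1 (fst p) \<in> A" "Cinf A g" "\<forall>y\<in>U1. \<phi>1 y \<in> A --> y \<in> V1 & \<psi>1 y = g (\<phi>1 y)"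
  using N.transition[OF c(1,3), of "fst p"] p e by auto
 obtain B h where B: "open B" "\<phi>2 (snd p) \<in> B" "Cinf B h" "\<forall>y\<in>U2. \<phi>2 y \<in> B --> y \<in> V2 & \<psi>2 y = h (\<phi>2 y)"
  using P.transition[OF c(2,4), of "snd p"] p e by auto
 show "\<exists>A g. open A & \<phi> p \<in> A & Cinf A g & (\<forall>y\<in>U. \<phi> y \<in> A --> y \<in> V & \<psi> y = g (\<phi> y))"
  using A B Cinf_map_prod[OF A(1) B(1) A(3) B(3)] open_Times[OF A(1) B(1)] p
  unfolding e by (intro exI[of _ "A \<times> B"] exI[of _ "map_prod g h"]) (auto simp: mem_Times_iff)
qed

lemma sm_at_Pair:
 assumes "atlas N" "atlas P" "atlas Q" "x \<in> S" "sm_at N S P f x" "sm_at N S Q g x"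
 shows "sm_at N S (prod_mfd P Q) (%y. (f y, g y)) x"
proof -
 from assms(5) obtain U \<phi> V \<psi> A h where c: "(U, \<phi>) \<in> charts N" "(V, \<psi>) \<in> charts P" "x \<in> U" "f x \<in> V"
  "open A" "\<phi> x \<in> A" "Cinf A h" "\<forall>y\<in>S \<inter> U. \<phi> y \<in> A --> f y \<in> V & \<psi> (f y) = h (\<phi> y)"
  unfolding sm_at_def by blast
 from assms(6) obtain V' \<psi>' where V': "(V', \<psi>') \<in> charts Q" "g x \<in> V'"
  unfolding sm_at_def by blast
 from sm_at_charts[OF assms(1,3,6,4) c(1,3) V'] obtain B k where
  B: "open B" "\<phi> x \<in> B" "Cinf B k" "\<forall>y\<in>S \<inter> U. \<phi> y \<in> B --> g y \<in> V' & \<psi>' (g y) = k (\<phi> y)" by blast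
 have "Cinf (A \<inter> B) h" "Cinf (A \<inter> B) k" using c B Ck_on_subset by blast+
 then have "Cinf (A \<inter> B) (%z. (h z, k z))" using c B by (auto intro: Ck_on_Pair)
 moreover have "(V \<times> V', map_prod \<psi> \<psi>') \<in> charts (prod_mfd P Q)" using c V' by (auto simp: charts_prod)
 ultimately show ?thesis
  using c B V' by (intro sm_atI[of U \<phi> N "V \<times> V'" "map_prod \<psi> \<psi>'" _ _ _ "A \<inter> B"]) auto
qed

lemma sm_at_fst: "sm_at N S (prod_mfd P Q) h x ==> sm_at N S P (%y. fst (h y)) x"
 and sm_at_snd: "sm_at N S (prod_mfd P Q) h x ==> sm_at N S Q (%y. snd (h y)) x"
proof -
 assume "sm_at N S (prod_mfd P Q) h x"
 then obtain U \<phi> V0 \<psi>0 A g where c0: "(U, \<phi>) \<in> charts N" "(V0, \<psi>0) \<in> charts (prod_mfd P Q)"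
  "x \<in> U" "h x \<in> V0" "open A" "\<phi> x \<in> A" "Cinf A g"
  "\<forall>y\<in>S \<inter> U. \<phi> y \<in> A --> h y \<in> V0 & \<psi>0 (h y) = g (\<phi> y)"
  unfolding sm_at_def by blast
 from c0(2) obtain V \<psi> V' \<psi>' where e: "V0 = V \<times> V'" "\<psi>0 = map_prod \<psi> \<psi>'"
  "(V, \<psi>) \<in> charts P" "(V', \<psi>') \<in> charts Q" by (auto simp: charts_prod)
 note c = c0(1) e(3,4) c0(3-8)[unfolded e(1,2)]
 have m: "fst (map_prod \<psi> \<psi>' z) = \<psi> (fst z)" "snd (map_prod \<psi> \<psi>' z) = \<psi>' (snd z)" for z by auto
 have "Cinf A (%z. fst (g z))" "Cinf A (%z. snd (g z))"
  using Ck_on_linear[OF c(6) bounded_linear_fst] Ck_on_linear[OF c(6) bounded_linear_snd] c(8) by blast+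
 moreover have "fst (h y) \<in> V & \<psi> (fst (h y)) = fst (g (\<phi> y))"
  "snd (h y) \<in> V' & \<psi>' (snd (h y)) = snd (g (\<phi> y))" if "y \<in> S" "y \<in> U" "\<phi> y \<in> A" for y
 proof -
  have "h y \<in> V \<times> V'" "map_prod \<psi> \<psi>' (h y) = g (\<phi> y)" using c(9) that by blast+
  then show "fst (h y) \<in> V & \<psi> (fst (h y)) = fst (g (\<phi> y))"
   "snd (h y) \<in> V' & \<psi>' (snd (h y)) = snd (g (\<phi> y))" by (auto simp: m[symmetric])
 qed
 moreover have "fst (h x) \<in> V" "snd (h x) \<in> V'" using c(5) by auto
 ultimately show "sm_at N S P (%y. fst (h y)) x" "sm_at N S Q (%y. snd (h y)) x"
  using sm_atI[OF c(1,2) c(4) _ c(6,7), of "%y. fst (h y)" "%z. fst (g z)" S]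
   sm_atI[OF c(1,3) c(4) _ c(6,7), of "%y. snd (h y)" "%z. snd (g z)" S] by simp_all
qed

lemma sm_at_Pair_euclid:
 assumes "atlas N" "x \<in> S" "sm_at N S euclid f x" "sm_at N S euclid g x"
 shows "sm_at N S euclid (%y. (f y, g y)) x"
proof -
 from assms(3) obtain U \<phi> A h where c: "(U, \<phi>) \<in> charts N" "x \<in> U"
  "open A" "\<phi> x \<in> A" "Cinf A h" "\<forall>y\<in>S \<inter> U. \<phi> y \<in> A --> f y = h (\<phi> y)"
  unfolding sm_at_euclid_iff[OF assms(1)] by blast
 from sm_at_charts[OF assms(1) atlas_euclid assms(4,2) c(1,2), of UNIV id] obtain B k where
  B: "open B" "\<phi> x \<in> B" "Cinf B k" "\<forall>y\<in>S \<inter> U. \<phi> y \<in> B --> g y = k (\<phi> y)" by auto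
 have "Cinf (A \<inter> B) h" "Cinf (A \<inter> B) k" using c B Ck_on_subset by blast+
 then have "Cinf (A \<inter> B) (%z. (h z, k z))" using c B by (auto intro: Ck_on_Pair)
 then show ?thesis unfolding sm_at_euclid_iff[OF assms(1)] using c B 
  by (intro exI[of _ U] exI[of _ \<phi>] exI[of _ "A \<inter> B"] exI[of _ "%z. (h z, k z)"]) auto
qed

lemma sm_at_bilinear:
 assumes "bounded_bilinear pr" "atlas N" "x \<in> S" "sm_at N S euclid f x" "sm_at N S euclid g x"
 shows "sm_at N S euclid (%y. pr (f y) (g y)) x"
proof -
 have "Cinf UNIV (%z. pr (fst z) (snd z))"
  by (intro allI Ck_on_bilinear[OF assms(1)] Ck_on_blin bounded_linear_fst bounded_linear_snd) auto
 from sm_at_Cinf[OF sm_at_Pair_euclid[OF assms(2-)] assms(3) open_UNIV UNIV_I this] show ?thesis by simp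
qed

lemmas sm_at_mult = sm_at_bilinear[OF bounded_bilinear_mult]
 and sm_at_scaleR = sm_at_bilinear[OF bounded_bilinear_scaleR]

lemma sm_at_blin: "bounded_linear h ==> x \<in> S ==> sm_at N S euclid f x ==> sm_at N S euclid (%y. h (f y)) x"
 by (rule sm_at_Cinf[of N S f x UNIV h]) (auto intro: Ck_on_blin)

lemma sm_at_add:
 assumes "atlas N" "x \<in> S" "sm_at N S euclid f x" "sm_at N S euclid g x"
 shows "sm_at N S euclid (%y. f y + g y) x"
proof -
 have "Cinf UNIV (%z. fst z + snd z)"
  by (intro allI Ck_on_add Ck_on_blin bounded_linear_fst bounded_linear_snd) auto
 from sm_at_Cinf[OF sm_at_Pair_euclid[OF assms] assms(2) open_UNIV UNIV_I this] show ?thesis by simp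
qed

lemma sm_at_uminus: "x \<in> S ==> sm_at N S euclid f x ==> sm_at N S euclid (%y. - f y) x"
 using sm_at_blin[OF bounded_linear_minus[OF bounded_linear_ident]] .

lemma sm_at_diff:
 "atlas N ==> x \<in> S ==> sm_at N S euclid f x ==> sm_at N S euclid g x ==> sm_at N S euclid (%y. f y - g y) x"
 using sm_at_add[of N x S f "%y. - g y"] sm_at_uminus[of x S N g] by simp

lemma sm_at_sum:
 "atlas N ==> x \<in> S ==> x \<in> pts N ==> (!!i. i \<in> I ==> sm_at N S euclid (f i) x) ==>
  sm_at N S euclid (%y. \<Sum>i\<in>I. f i y) x"
 by (induction I rule: infinite_finite_induct) (auto intro: sm_at_add sm_at_const)

lemma sm_at_prod:
 fixes f :: "'i => 'p => real"
 shows "atlas N ==> x \<in> S ==> x \<in> pts N ==> (!!i. i \<in> I ==> sm_at N S euclid (f i) x) ==>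
  sm_at N S euclid (%y. \<Prod>i\<in>I. f i y) x"
 by (induction I rule: infinite_finite_induct) (auto intro: sm_at_mult sm_at_const)

text \<open>Both topologies are given by boxes of chart domains near a point.\<close>

lemma mtop_prod:
 assumes "atlas N" "atlas P"
 shows "mtop (prod_mfd N P) = prod_topology (mtop N) (mtop P)"
proof -
 interpret N: atlas N by fact
 interpret P: atlas P by fact
 interpret NP: atlas "prod_mfd N P" using assms by simp
 have "openin (mtop (prod_mfd N P)) W \<longleftrightarrow> openin (prod_topology (mtop N) (mtop P)) W" for W
 proof
  assume W: "openin (mtop (prod_mfd N P)) W"
  show "openin (prod_topology (mtop N) (mtop P)) W"
   unfolding openin_prod_topology_alt
  proof (intro allI impI)
   fix a b assume ab: "(a, b) \<in> W"
   then have "a \<in> pts N" "b \<in> pts P" using W NP.openin_mtop by auto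
   then obtain U \<phi> V \<psi> where c: "(U, \<phi>) \<in> charts N" "a \<in> U" "(V, \<psi>) \<in> charts P" "b \<in> V"
    using N.chart_at P.chart_at by metis
   then have "(U \<times> V, map_prod \<phi> \<psi>) \<in> charts (prod_mfd N P)" by (auto simp: charts_prod)
   with W ab c obtain A where A: "open A" "map_prod \<phi> \<psi> (a, b) \<in> A"
     "\<forall>y\<in>U \<times> V. map_prod \<phi> \<psi> y \<in> A --> y \<in> W"
    unfolding NP.openin_mtop_iff by (metis IntI SigmaI)
   obtain A1 A2 where "open A1" "open A2" "(\<phi> a, \<psi> b) \<in> A1 \<times> A2" "A1 \<times> A2 \<subseteq> A"
    by (rule open_prod_elim[OF A(1), of "(\<phi> a, \<psi> b)"]) (use A(2) in auto)
   then have A12: "open A1" "open A2" "\<phi> a \<in> A1" "\<psi> b \<in> A2" "A1 \<times> A2 \<subseteq> A" by auto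
   then show "\<exists>U V. openin (mtop N) U & openin (mtop P) V & a \<in> U & b \<in> V & U \<times> V \<subseteq> W"
    using N.openin_chart[OF c(1) A12(1)] P.openin_chart[OF c(3) A12(2)] A c
    by (intro exI[of _ "{y \<in> U. \<phi> y \<in> A1}"] exI[of _ "{y \<in> V. \<psi> y \<in> A2}"]) auto
  qed
 next
  assume W: "openin (prod_topology (mtop N) (mtop P)) W"
  show "openin (mtop (prod_mfd N P)) W"
  proof (rule NP.openin_mtopI)
   show "W \<subseteq> pts (prod_mfd N P)" using openin_subset[OF W] by simp
   fix p assume p: "p \<in> W"
   obtain a b where pab: "p = (a, b)" by (cases p)
   from W[unfolded openin_prod_topology_alt, rule_format, of a b] p pab
   obtain U1 V1 where 1: "openin (mtop N) U1" "openin (mtop P) V1" "a \<in> U1" "b \<in> V1" "U1 \<times> V1 \<subseteq> W"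
    by auto
   then have "a \<in> pts N" "b \<in> pts P" using N.openin_mtop P.openin_mtop by auto
   then obtain U \<phi> V \<psi> where c: "(U, \<phi>) \<in> charts N" "a \<in> U" "(V, \<psi>) \<in> charts P" "b \<in> V"
    using N.chart_at P.chart_at by metis
   obtain A where A: "open A" "\<phi> a \<in> A" "\<forall>y\<in>U. \<phi> y \<in> A --> y \<in> U1"
    using conjunct2[OF 1(1)[unfolded N.openin_mtop_iff], rule_format, OF c(1), of a] 1(3) c(2) by auto
   obtain B where B: "open B" "\<psi> b \<in> B" "\<forall>y\<in>V. \<psi> y \<in> B --> y \<in> V1"
    using conjunct2[OF 1(2)[unfolded P.openin_mtop_iff], rule_format, OF c(3), of b] 1(4) c(4) by auto
   show "\<exists>U \<phi> A. (U, \<phi>) \<in> charts (prod_mfd N P) & p \<in> U & open A & \<phi> p \<in> A & (\<forall>y\<in>U. \<phi> y \<in> A --> y \<in> W)"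
    using A B c 1 pab open_Times[OF A(1) B(1)]
    by (intro exI[of _ "U \<times> V"] exI[of _ "map_prod \<phi> \<psi>"] exI[of _ "A \<times> B"]) (auto simp: charts_prod)
  qed
 qed
 then show ?thesis by (simp add: topology_eq)
qed

lemma smooth_near_iff:
 assumes "atlas N" "p \<in> pts N"
 shows "f \<in> smooth_near N p \<longleftrightarrow> sma N euclid f p"
proof
 assume "f \<in> smooth_near N p"
 then show "sma N euclid f p"
  using smooth_on_open_iff[OF assms(1) atlas_euclid] unfolding smooth_near_def by blast
next
 assume "sma N euclid f p"
 from sm_at_nbhd[OF assms(1) this] show "f \<in> smooth_near N p"
  using smooth_on_open_iff[OF assms(1) atlas_euclid] unfolding smooth_near_def by blast
qed

lemma smooth_funs_iff: "atlas N ==> f \<in> smooth_funs N \<longleftrightarrow> (\<forall>x\<in>pts N. sma N euclid f x)"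
 by (simp add: smooth_funs_def smooth_map_iff)

section \<open>Tangent vectors in coordinates\<close>

abbreviation "TB \<equiv> tangent_bundle"

text \<open>A chart with values in an arbitrary Euclidean space.  Adapted coordinates on the total space
  of a bundle, with values in base times fibre, are of this kind.\<close>

definition gchart :: "('p, 'c::euclidean_space) manifold => 'p set => ('p => 'z::euclidean_space) => 'z set => bool" where
 "gchart N U \<kappa> H \<longleftrightarrow> openin (mtop N) U & inj_on \<kappa> U & subspace H & openin (top_of_set H) (\<kappa> ` U) &
   (\<forall>x\<in>U. sma N euclid \<kappa> x) & (\<forall>z\<in>\<kappa> ` U. sm_at euclid (\<kappa> ` U) N (inv_into U \<kappa>) z)"

lemma chart_gchart:
 assumes "atlas N" "(U, \<phi>) \<in> charts N" "subspace H" "openin (top_of_set H) (\<phi> ` U)"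
 shows "gchart N U \<phi> H"
 using assms atlas.openin_chart_dom[OF assms(1,2)] atlas.inj[OF assms(1,2)]
 by (simp add: gchart_def sm_at_chart sm_at_chart_inv)

lemma gchart_pts: "atlas N ==> gchart N U \<kappa> H ==> p \<in> U ==> p \<in> pts N"
 unfolding gchart_def using atlas.topspace_mtop[of N] openin_subset by blast

lemma gchart_extend:
 assumes "atlas N" "gchart N U \<kappa> H" "p \<in> U" "sma N euclid f p"
 shows "\<exists>A G. open A & \<kappa> p \<in> A & Cinf A G & (\<forall>y\<in>U. \<kappa> y \<in> A --> f y = G (\<kappa> y))"
proof -
 have inv: "inv_into U \<kappa> (\<kappa> y) = y" if "y \<in> U" for y
  using assms(2) that by (simp add: gchart_def)
 have "sm_at euclid (\<kappa> ` U) N (inv_into U \<kappa>) (\<kappa> p)" using assms(2,3) by (simp add: gchart_def)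
 then have "sm_at euclid (\<kappa> ` U) euclid (%z. f (inv_into U \<kappa> z)) (\<kappa> p)"
 proof (rule sm_at_compose[OF assms(1) atlas_euclid])
  show "sma N euclid f (inv_into U \<kappa> (\<kappa> p))" using assms(3,4) inv by simp
  show "inv_into U \<kappa> z \<in> pts N" if "z \<in> \<kappa> ` U" for z
   using that inv gchart_pts[OF assms(1,2)] by auto
 qed (use assms(3) in simp)
 then obtain A G where A: "open A" "\<kappa> p \<in> A" "Cinf A G" "\<forall>z\<in>\<kappa> ` U. z \<in> A --> f (inv_into U \<kappa> z) = G z"
  unfolding sm_at_euclid_iff[OF atlas_euclid] by auto
 then show ?thesis using inv by (intro exI[of _ A] exI[of _ G]) auto
qed

lemma gchart_openin:
 assumes "atlas N" "gchart N U \<kappa> H" "open A"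
 shows "openin (mtop N) {y \<in> U. \<kappa> y \<in> A}"
proof (subst openin_subopen, clarify)
 fix x assume x: "x \<in> U" "\<kappa> x \<in> A"
 have "sma N euclid \<kappa> x" using assms(2) x by (simp add: gchart_def)
 from sm_at_continuous[OF assms(1) atlas_euclid this gchart_pts[OF assms(1,2) x(1)], of A] x assms(3)
 obtain Q where Q: "openin (mtop N) Q" "x \<in> Q" "\<kappa> ` (pts N \<inter> Q) \<subseteq> A" by auto
 have "openin (mtop N) (Q \<inter> U)" using Q(1) assms(2) by (auto simp: gchart_def)
 then show "\<exists>T. openin (mtop N) T & x \<in> T & T \<subseteq> {y \<in> U. \<kappa> y \<in> A}"
  using Q x gchart_pts[OF assms(1,2)] by (intro exI[of _ "Q \<inter> U"]) auto
qed

lemma tan_add: "D \<in> tangent_space N p ==> f \<in> smooth_near N p ==> g \<in> smooth_near N p ==>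
  D (%x. f x + g x) = D f + D g"
 and tan_scale: "D \<in> tangent_space N p ==> f \<in> smooth_near N p ==> D (%x. c * f x) = c * D f"
 and tan_mult: "D \<in> tangent_space N p ==> f \<in> smooth_near N p ==> g \<in> smooth_near N p ==>
  D (%x. f x * g x) = D f * g p + f p * D g"
 and tan_zero: "D \<in> tangent_space N p ==> f \<notin> smooth_near N p ==> D f = 0"
 unfolding tangent_space_def by blast+

context
 fixes N :: "('p, 'c::euclidean_space) manifold" and p :: 'p
 assumes N: "atlas N" and p: "p \<in> pts N"
begin

lemma near_const: "(%_. c) \<in> smooth_near N p"
 and near_add: "f \<in> smooth_near N p ==> g \<in> smooth_near N p ==> (%x. f x + g x) \<in> smooth_near N p"
 and near_mult: "f \<in> smooth_near N p ==> g \<in> smooth_near N p ==> (%x. f x * g x) \<in> smooth_near N p"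
 and near_sum: "(!!i. i \<in> I ==> h i \<in> smooth_near N p) ==> (%x. \<Sum>i\<in>I. h i x) \<in> smooth_near N p"
 unfolding smooth_near_iff[OF N p] using p N
 by (auto intro: sm_at_add sm_at_mult sm_at_sum sm_at_const)

lemma tan_const:
 assumes D: "D \<in> tangent_space N p" shows "D (%_. c) = 0"
proof -
 have "D (%_. 1) = 0" using tan_mult[OF D near_const near_const, of 1 1] by simp
 then show ?thesis using tan_scale[OF D near_const, of c 1] by simp
qed

lemma tan_local:
 assumes D: "D \<in> tangent_space N p" and f: "f \<in> smooth_near N p" and g: "g \<in> smooth_near N p"
  and W: "openin (mtop N) W" "p \<in> W" "!!x. x \<in> W ==> f x = g x"
 shows "D f = D g"
proof -
 \<comment> \<open>Smoothness near \<open>p\<close> says nothing away from \<open>p\<close>, so an indicator function can be used as a cutoff.\<close>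
 let ?h = "%x. if x \<in> W then 1 else 0 :: real" and ?u = "%x. f x + (- 1) * g x"
 have h: "?h \<in> smooth_near N p"
  unfolding smooth_near_iff[OF N p]
  by (rule sm_at_eq_near[OF N sm_at_const[OF N atlas_euclid p, of 1] W(1,2) p]) auto
 have u: "?u \<in> smooth_near N p" using f g by (intro near_add near_mult near_const)
 have "(%x. ?h x * ?u x) = (%_. 0)" using W(3) by (intro ext) auto
 then have "D ?h * ?u p + ?h p * D ?u = 0"
  using tan_mult[OF D h u] tan_const[OF D] by simp
 then have "D ?u = 0" using W(2,3) by simp
 moreover have "D ?u = D f + (- 1) * D g"
  using tan_add[OF D f near_mult[OF near_const g], of "- 1"] tan_scale[OF D g, of "- 1"] by simp
 ultimately show ?thesis by simp
qed

lemma tan_sum: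
 assumes D: "D \<in> tangent_space N p" and "!!i. i \<in> I ==> h i \<in> smooth_near N p"
 shows "D (%x. \<Sum>i\<in>I. h i x) = (\<Sum>i\<in>I. D (h i))"
 using assms(2)
proof (induction I rule: infinite_finite_induct)
 case (insert i I)
 then show ?case using tan_add[OF D _ near_sum, of "h i" I h] by simp
qed (simp_all add: tan_const[OF D])

end

definition cvec :: "('p => 'z::euclidean_space) => (('p => real) => real) => 'z" where
 "cvec \<kappa> D = (\<Sum>b\<in>Basis. D (%x. \<kappa> x \<bullet> b) *\<^sub>R b)"

text \<open>The chain rule: a derivation acts through the derivative of the coordinate expression.  By
  Hadamard's lemma the terms of second order do not contribute.\<close>

lemma tan_coord:
 fixes \<kappa> :: "'p => 'z::euclidean_space"
 assumes N: "atlas N" and \<kappa>: "sma N euclid \<kappa> p" "p \<in> U" "openin (mtop N) U"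
  and D: "D \<in> tangent_space N p"
  and A: "open A" "\<kappa> p \<in> A" "Cinf A G" "!!y. y \<in> U ==> \<kappa> y \<in> A ==> f y = G (\<kappa> y)"
 shows "D f = FD G (at (\<kappa> p)) (cvec \<kappa> D)"
proof -
 interpret N: atlas N by fact
 have p: "p \<in> pts N" using \<kappa>(2,3) N.openin_mtop by auto
 obtain r where r: "r > 0" "ball (\<kappa> p) r \<subseteq> A" using A(1,2) open_contains_ball by blast
 let ?B = "ball (\<kappa> p) r"
 have GB: "Cinf ?B G" using A(3) Ck_on_subset r(2) by blast
 obtain g where g: "!!b. Cinf ?B (g b)"
  "!!z. z \<in> ?B ==> G z = G (\<kappa> p) + (\<Sum>b\<in>Basis. ((z - \<kappa> p) \<bullet> b) * g b z)"
  "!!b. g b (\<kappa> p) = FD G (at (\<kappa> p)) b"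
  by (rule hadamard[OF GB r(1)], rule that) assumption+
 from sm_at_continuous[OF N atlas_euclid \<kappa>(1) p, of ?B] r(1)
 obtain Q where Q: "openin (mtop N) Q" "p \<in> Q" "\<kappa> ` (pts N \<inter> Q) \<subseteq> ?B" by auto
 have W: "openin (mtop N) (Q \<inter> U)" "p \<in> Q \<inter> U" using Q \<kappa> by auto
 have "Q \<subseteq> pts N" using Q(1) N.openin_mtop by blast
 then have in_B: "\<kappa> y \<in> ?B" if "y \<in> Q \<inter> U" for y using that Q(3) by blast
 have kb: "(%x. \<kappa> x \<bullet> b) \<in> smooth_near N p" for b
  unfolding smooth_near_iff[OF N p] by (rule sm_at_blin[OF bounded_linear_inner_left p \<kappa>(1)])
 have gb: "(%x. g b (\<kappa> x)) \<in> smooth_near N p" for b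
  unfolding smooth_near_iff[OF N p] by (rule sm_at_Cinf[OF \<kappa>(1) p open_ball _ g(1)]) (use r in simp)
 have kb': "(%x. \<kappa> x \<bullet> b + (- (\<kappa> p \<bullet> b))) \<in> smooth_near N p" for b
  by (rule near_add[OF N p kb near_const[OF N p]])
 let ?F = "%x. G (\<kappa> p) + (\<Sum>b\<in>Basis. (\<kappa> x \<bullet> b + (- (\<kappa> p \<bullet> b))) * g b (\<kappa> x))"
 have F: "?F \<in> smooth_near N p"
  by (intro near_add[OF N p] near_const[OF N p] near_sum[OF N p] near_mult[OF N p] kb' gb)
 have fF: "f y = ?F y" if "y \<in> Q \<inter> U" for y
  using A(4)[of y] g(2)[OF in_B[OF that]] in_B[OF that] r(2) that
  by (auto simp: inner_diff_left)
 have f: "f \<in> smooth_near N p"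
  unfolding smooth_near_iff[OF N p]
  by (rule sm_at_eq_near[OF N F[unfolded smooth_near_iff[OF N p]] W p]) (simp add: fF)
 have "D f = D ?F" by (rule tan_local[OF N p D f F W fF])
 also have "\<dots> = D (%x. G (\<kappa> p)) + D (%x. \<Sum>b\<in>Basis. (\<kappa> x \<bullet> b + (- (\<kappa> p \<bullet> b))) * g b (\<kappa> x))"
  by (intro tan_add[OF D] near_const[OF N p] near_sum[OF N p] near_mult[OF N p] kb' gb)
 also have "\<dots> = (\<Sum>b\<in>Basis. D (%x. (\<kappa> x \<bullet> b + (- (\<kappa> p \<bullet> b))) * g b (\<kappa> x)))"
  unfolding tan_const[OF N p D] add_0 by (intro tan_sum[OF N p D] near_mult[OF N p] kb' gb)
 also have "\<dots> = (\<Sum>b\<in>Basis. D (%x. \<kappa> x \<bullet> b) * FD G (at (\<kappa> p)) b)"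
 proof (rule sum.cong[OF refl])
  fix b :: 'z
  have "D (%x. \<kappa> x \<bullet> b + (- (\<kappa> p \<bullet> b))) = D (%x. \<kappa> x \<bullet> b)"
   unfolding tan_add[OF D kb near_const[OF N p]] tan_const[OF N p D] by simp
  then show "D (%x. (\<kappa> x \<bullet> b + (- (\<kappa> p \<bullet> b))) * g b (\<kappa> x)) = D (%x. \<kappa> x \<bullet> b) * FD G (at (\<kappa> p)) b"
   using tan_mult[OF D kb' gb, of b b] g(3) by simp
 qed
 also have "\<dots> = FD G (at (\<kappa> p)) (cvec \<kappa> D)"
 proof -
  have "linear (FD G (at (\<kappa> p)))"
   using Cinf_has_derivative[OF A(3,1,2)] by (rule has_derivative_linear)
  then show ?thesis by (simp add: cvec_def linear_sum linear_scale)
 qed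
 finally show ?thesis .
qed

lemma tan_gchart:
 assumes "atlas N" "gchart N U \<kappa> H" "p \<in> U" "D \<in> tangent_space N p"
  and "open A" "\<kappa> p \<in> A" "Cinf A G" "!!y. y \<in> U ==> \<kappa> y \<in> A ==> f y = G (\<kappa> y)"
 shows "D f = FD G (at (\<kappa> p)) (cvec \<kappa> D)"
proof -
 have "sma N euclid \<kappa> p" "openin (mtop N) U" using assms(2,3) by (auto simp: gchart_def)
 with assms show ?thesis using tan_coord[of N \<kappa> p U D A G f] by blast
qed

text \<open>The coordinate functions in directions orthogonal to the model subspace vanish, and so do their derivatives.\<close>

lemma vec_in_subspace:
 fixes \<kappa> :: "'p => 'z::euclidean_space"
 assumes N: "atlas N" and \<kappa>: "gchart N U \<kappa> H" and p: "p \<in> U" and D: "D \<in> tangent_space N p"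
 shows "cvec \<kappa> D \<in> H"
proof -
 have pN: "p \<in> pts N" by (rule gchart_pts[OF N \<kappa> p])
 have H: "subspace H" "openin (top_of_set H) (\<kappa> ` U)" "openin (mtop N) U" "sma N euclid \<kappa> p"
  using \<kappa> p by (auto simp: gchart_def)
 have HU: "\<kappa> ` U \<subseteq> H" using openin_imp_subset[OF H(2)] .
 have kb: "(%x. \<kappa> x \<bullet> b) \<in> smooth_near N p" for b
  unfolding smooth_near_iff[OF N pN] by (rule sm_at_blin[OF bounded_linear_inner_left pN H(4)])
 have "cvec \<kappa> D \<bullet> n = 0" if n: "\<forall>h\<in>H. h \<bullet> n = 0" for n
 proof -
  have "cvec \<kappa> D \<bullet> n = (\<Sum>b\<in>Basis. (b \<bullet> n) * D (%x. \<kappa> x \<bullet> b))"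
   by (simp add: cvec_def inner_sum_left mult.commute)
  also have "\<dots> = (\<Sum>b\<in>Basis. D (%x. (b \<bullet> n) * (\<kappa> x \<bullet> b)))" by (simp add: tan_scale[OF D kb])
  also have "\<dots> = D (%x. \<Sum>b\<in>Basis. (b \<bullet> n) * (\<kappa> x \<bullet> b))"
   by (rule tan_sum[OF N pN D, symmetric]) (intro near_mult[OF N pN] near_const[OF N pN] kb)
  also have "(%x. \<Sum>b\<in>Basis. (b \<bullet> n) * (\<kappa> x \<bullet> b)) = (%x. \<kappa> x \<bullet> n)"
   by (intro ext, subst euclidean_inner) (simp add: inner_commute mult.commute)
  also have "D (%x. \<kappa> x \<bullet> n) = D (%_. 0)"
   by (rule tan_local[OF N pN D kb near_const[OF N pN] H(3) p]) (use n HU in auto)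
  finally show ?thesis using tan_const[OF N pN D] by simp
 qed
 then have "cvec \<kappa> D \<in> orthogonal_comp (orthogonal_comp H)"
  by (auto simp: orthogonal_comp_def orthogonal_def inner_commute)
 then show ?thesis using orthogonal_comp_self[OF H(1)] by simp
qed

text \<open>Conversely, a vector of the model subspace gives the tangent vector of a coordinate line.\<close>

definition pt_vec :: "('p, 'c::euclidean_space) manifold => 'p set => ('p => 'z::euclidean_space) =>
  'p => 'z => 'p tvec" where
 "pt_vec N U \<kappa> p h = (p, %f. if f \<in> smooth_near N p
   then deriv (%s. f (inv_into U \<kappa> (\<kappa> p + s *\<^sub>R h))) 0 else 0)"

lemma fst_pt_vec [simp]: "fst (pt_vec N U \<kappa> p h) = p"
 by (simp add: pt_vec_def)

lemma pt_vec_coord: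
 assumes N: "atlas N" and \<kappa>: "gchart N U \<kappa> H" and p: "p \<in> U" and h: "h \<in> H"
  and A: "open A" "\<kappa> p \<in> A" "Cinf A G" "!!y. y \<in> U ==> \<kappa> y \<in> A ==> f y = G (\<kappa> y)"
  and f: "f \<in> smooth_near N p"
 shows "snd (pt_vec N U \<kappa> p h) f = FD G (at (\<kappa> p)) h"
proof -
 let ?\<gamma> = "%s. \<kappa> p + s *\<^sub>R h"
 have H: "subspace H" "openin (top_of_set H) (\<kappa> ` U)" using \<kappa> by (auto simp: gchart_def)
 then obtain T where T: "open T" "\<kappa> ` U = H \<inter> T" by (auto simp: openin_open)
 have kpH: "\<kappa> p \<in> H" "\<kappa> p \<in> T" using T p by auto
 have "open (?\<gamma> -` (T \<inter> A))"
  using T A by (intro continuous_open_vimage open_Int continuous_intros) auto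
 moreover have "0 \<in> ?\<gamma> -` (T \<inter> A)" using kpH A by simp
 moreover have "f (inv_into U \<kappa> (?\<gamma> s)) = G (?\<gamma> s)" if "s \<in> ?\<gamma> -` (T \<inter> A)" for s
 proof -
  have "?\<gamma> s \<in> H" using kpH h H(1) by (intro subspace_add subspace_scale)
  with that T(2) have s: "?\<gamma> s \<in> \<kappa> ` U" by auto
  then show ?thesis using A(4)[of "inv_into U \<kappa> (?\<gamma> s)"] that
   by (simp add: f_inv_into_f[OF s] inv_into_into[OF s])
 qed
 moreover have "((%s. G (?\<gamma> s)) has_derivative (%t. FD G (at (\<kappa> p)) (t *\<^sub>R h))) (at 0)"
 proof -
  have "(?\<gamma> has_derivative (%t. t *\<^sub>R h)) (at 0)" by (auto intro!: derivative_eq_intros)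
  moreover have "(G has_derivative FD G (at (\<kappa> p))) (at (?\<gamma> 0))"
   using Cinf_has_derivative[OF A(3,1,2)] by simp
  ultimately show ?thesis by (rule has_derivative_compose)
 qed
 ultimately have "((%s. f (inv_into U \<kappa> (?\<gamma> s))) has_derivative
   (%t. FD G (at (\<kappa> p)) (t *\<^sub>R h))) (at 0)"
  using has_derivative_transform_within_open[of "%s. G (?\<gamma> s)" _ 0 UNIV "?\<gamma> -` (T \<inter> A)"] by simp
 moreover have "linear (FD G (at (\<kappa> p)))"
  using Cinf_has_derivative[OF A(3,1,2)] by (rule has_derivative_linear)
 ultimately have "DERIV (%s. f (inv_into U \<kappa> (?\<gamma> s))) 0 :> FD G (at (\<kappa> p)) h"
  by (simp add: has_field_derivative_def linear_scale mult.commute[of _ "FD G (at (\<kappa> p)) h"])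
 then show ?thesis using f by (simp add: pt_vec_def DERIV_imp_deriv)
qed

lemma frechet_add_mult:
 fixes G K :: "'a::euclidean_space => real"
 assumes "open A" "z \<in> A" "Cinf A G" "Cinf A K"
 shows "FD (%x. G x + K x) (at z) h = FD G (at z) h + FD K (at z) h"
  "FD (%x. G x * K x) (at z) h =
    G z * FD K (at z) h + FD G (at z) h * K z"
proof -
 note G = Cinf_has_derivative[OF assms(3,1,2)] and K = Cinf_has_derivative[OF assms(4,1,2)]
 show "FD (%x. G x + K x) (at z) h = FD G (at z) h + FD K (at z) h"
  using frechet_derivative_at[OF has_derivative_add[OF G K]] by metis
 show "FD (%x. G x * K x) (at z) h =
    G z * FD K (at z) h + FD G (at z) h * K z"
  using frechet_derivative_at[OF has_derivative_mult[OF G K]] by metis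
qed

lemma pt_vec_tangent:
 assumes N: "atlas N" and \<kappa>: "gchart N U \<kappa> H" and p: "p \<in> U" and h: "h \<in> H"
 shows "snd (pt_vec N U \<kappa> p h) \<in> tangent_space N p"
proof -
 have pN: "p \<in> pts N" by (rule gchart_pts[OF N \<kappa> p])
 note c = pt_vec_coord[OF N \<kappa> p h] and near = smooth_near_iff[OF N pN]
 let ?D = "snd (pt_vec N U \<kappa> p h)"
 have both: "?D (%x. f x + g x) = ?D f + ?D g & ?D (%x. f x * g x) = ?D f * g p + f p * ?D g"
  if f: "f \<in> smooth_near N p" and g: "g \<in> smooth_near N p" for f g
 proof -
  obtain A G where A: "open A" "\<kappa> p \<in> A" "Cinf A G" "\<forall>y\<in>U. \<kappa> y \<in> A --> f y = G (\<kappa> y)"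
   using gchart_extend[OF N \<kappa> p f[unfolded near]] by blast
  obtain B K where B: "open B" "\<kappa> p \<in> B" "Cinf B K" "\<forall>y\<in>U. \<kappa> y \<in> B --> g y = K (\<kappa> y)"
   using gchart_extend[OF N \<kappa> p g[unfolded near]] by blast
  have C: "open (A \<inter> B)" "\<kappa> p \<in> A \<inter> B" "Cinf (A \<inter> B) G" "Cinf (A \<inter> B) K"
   using A B Ck_on_subset by blast+
  have s: "Cinf (A \<inter> B) (%x. G x + K x)" "Cinf (A \<inter> B) (%x. G x * K x)"
   using C by (auto intro: Ck_on_add Ck_on_mult)
  have "?D f = FD G (at (\<kappa> p)) h" "?D g = FD K (at (\<kappa> p)) h"
   using c[OF A(1-3) _ f] A(4) c[OF B(1-3) _ g] B(4) by auto
  moreover have "?D (%x. f x + g x) = FD (%x. G x + K x) (at (\<kappa> p)) h"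
   by (rule c[OF C(1,2) s(1) _ near_add[OF N pN f g]]) (use A(4) B(4) in auto)
  moreover have "?D (%x. f x * g x) = FD (%x. G x * K x) (at (\<kappa> p)) h"
   by (rule c[OF C(1,2) s(2) _ near_mult[OF N pN f g]]) (use A(4) B(4) in auto)
  moreover have "f p = G (\<kappa> p)" "g p = K (\<kappa> p)" using A B p by auto
  ultimately show ?thesis using frechet_add_mult[OF C] by simp
 qed
 have const: "?D (%_. a) = 0" for a
  using c[OF open_UNIV UNIV_I _ _ near_const[OF N pN], of "%_. a" a] by (simp add: Ck_on_const)
 have "?D (%x. a * f x) = a * ?D f" if f: "f \<in> smooth_near N p" for a f
  using both[OF near_const[OF N pN, of a] f] const by simp
 then show ?thesis using both unfolding tangent_space_def by (auto simp: pt_vec_def)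
qed

lemma vec_pt_vec:
 assumes N: "atlas N" and \<kappa>: "gchart N U \<kappa> H" and p: "p \<in> U" and h: "h \<in> H"
 shows "cvec \<kappa> (snd (pt_vec N U \<kappa> p h)) = h"
proof -
 have pN: "p \<in> pts N" by (rule gchart_pts[OF N \<kappa> p])
 have "snd (pt_vec N U \<kappa> p h) (%x. \<kappa> x \<bullet> b) = h \<bullet> b" for b
 proof -
  have "sma N euclid \<kappa> p" using \<kappa> p by (simp add: gchart_def)
  then have "(%x. \<kappa> x \<bullet> b) \<in> smooth_near N p"
   unfolding smooth_near_iff[OF N pN] by (rule sm_at_blin[OF bounded_linear_inner_left pN])
  moreover have "Cinf UNIV (%z. z \<bullet> b)" by (auto intro: Ck_on_blin bounded_linear_inner_left)
  moreover have "FD (%z. z \<bullet> b) (at (\<kappa> p)) = (%z. z \<bullet> b)"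
   by (rule frechet_derivative_at[symmetric], rule bounded_linear_imp_has_derivative[OF bounded_linear_inner_left])
  ultimately show ?thesis using pt_vec_coord[OF N \<kappa> p h open_UNIV UNIV_I, of "%z. z \<bullet> b" "%x. \<kappa> x \<bullet> b"] by simp
 qed
 then show ?thesis by (simp add: cvec_def euclidean_representation)
qed

lemma pt_vec_vec:
 assumes N: "atlas N" and \<kappa>: "gchart N U \<kappa> H" and p: "p \<in> U" and D: "D \<in> tangent_space N p"
 shows "pt_vec N U \<kappa> p (cvec \<kappa> D) = (p, D)"
proof -
 have pN: "p \<in> pts N" by (rule gchart_pts[OF N \<kappa> p])
 have "snd (pt_vec N U \<kappa> p (cvec \<kappa> D)) f = D f" for f
 proof (cases "f \<in> smooth_near N p")
  case True
  then obtain A G where A: "open A" "\<kappa> p \<in> A" "Cinf A G" "\<forall>y\<in>U. \<kappa> y \<in> A --> f y = G (\<kappa> y)"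
   using gchart_extend[OF N \<kappa> p True[unfolded smooth_near_iff[OF N pN]]] by blast
  then show ?thesis
   using pt_vec_coord[OF N \<kappa> p vec_in_subspace[OF N \<kappa> p D] A(1-3) _ True] tan_gchart[OF N \<kappa> p D A(1-3)] by simp
 next
  case False
  then show ?thesis using tan_zero[OF D] by (simp add: pt_vec_def)
 qed
 then have "snd (pt_vec N U \<kappa> p (cvec \<kappa> D)) = D" by (rule ext)
 then show ?thesis by (metis fst_pt_vec prod.collapse)
qed

text \<open>Coordinates determine a tangent vector, so two derivations agree if they agree on the coordinate functions.\<close>

lemma tan_eqI:
 assumes "atlas N" "gchart N U \<kappa> H" "p \<in> U" "D \<in> tangent_space N p" "D' \<in> tangent_space N p" "cvec \<kappa> D = cvec \<kappa> D'"
 shows "D = D'"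
proof -
 have "(p, D) = pt_vec N U \<kappa> p (cvec \<kappa> D)" by (rule pt_vec_vec[OF assms(1-4), symmetric])
 also have "\<dots> = (p, D')" by (simp only: assms(6) pt_vec_vec[OF assms(1-3,5)])
 finally show ?thesis by simp
qed

section \<open>The tangent bundle as a manifold\<close>

lemma (in atlas) openin_mtopD:
 assumes "openin (mtop N) W" "(U, \<phi>) \<in> charts N" "p \<in> W" "p \<in> U"
 shows "\<exists>A. open A & \<phi> p \<in> A & (\<forall>y\<in>U. \<phi> y \<in> A --> y \<in> W)"
 using conjunct2[OF assms(1)[unfolded openin_mtop_iff], rule_format, OF assms(2), of p] assms(3,4) by simp

lemma second_countable_prod:
 assumes "second_countable X" "second_countable Y"
 shows "second_countable (prod_topology X Y)"
proof -
 obtain B where B: "countable B" "\<forall>V\<in>B. openin X V"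
  "\<forall>U x. openin X U & x \<in> U --> (\<exists>V\<in>B. x \<in> V & V \<subseteq> U)"
  using assms(1) unfolding second_countable_def by (elim exE conjE)
 obtain C where C: "countable C" "\<forall>V\<in>C. openin Y V"
  "\<forall>U x. openin Y U & x \<in> U --> (\<exists>V\<in>C. x \<in> V & V \<subseteq> U)"
  using assms(2) unfolding second_countable_def by (elim exE conjE)
 let ?D = "(%(U, V). U \<times> V) ` (B \<times> C)"
 show ?thesis
  unfolding second_countable_def
 proof (intro exI[of _ ?D] conjI ballI allI impI)
  show "countable ?D" using B(1) C(1) by auto
  show "openin (prod_topology X Y) V" if "V \<in> ?D" for V
   using that B(2) C(2) by (auto simp: openin_prod_Times_iff)
  fix W z assume W: "openin (prod_topology X Y) W & z \<in> W"
  obtain a b where z: "z = (a, b)" by (cases z)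
  obtain U V where 1: "openin X U" "openin Y V" "a \<in> U" "b \<in> V" "U \<times> V \<subseteq> W"
   using conjunct1[OF W, unfolded openin_prod_topology_alt, rule_format, of a b] W z by auto
  obtain U' where U': "U' \<in> B" "a \<in> U'" "U' \<subseteq> U" using B(3) 1(1,3) by blast
  obtain V' where V': "V' \<in> C" "b \<in> V'" "V' \<subseteq> V" using C(3) 1(2,4) by blast
  show "\<exists>V\<in>?D. z \<in> V & V \<subseteq> W"
   using U' V' 1(5) z by (intro bexI[of _ "U' \<times> V'"]) auto
 qed
qed

text \<open>This is the Lindelof property.\<close>

lemma countable_subcover:
 assumes "atlas N" "second_countable (mtop N)"
  and "!!p. p \<in> pts N ==> \<exists>W. openin (mtop N) W & p \<in> W & Q W"
 shows "\<exists>\<W>. countable \<W> & (\<forall>W\<in>\<W>. openin (mtop N) W & Q W) & \<Union>\<W> = pts N"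
proof -
 let ?U = "{W. openin (mtop N) W & Q W}"
 have "\<Union>?U = topspace (mtop N)"
 proof
  show "\<Union>?U \<subseteq> topspace (mtop N)" using openin_subset by blast
  show "topspace (mtop N) \<subseteq> \<Union>?U" using assms(3) atlas.topspace_mtop[OF assms(1)] by auto
 qed
 moreover have "\<forall>U\<in>?U. openin (mtop N) U" by simp
 ultimately obtain \<V> where "countable \<V>" "\<V> \<subseteq> ?U" "\<Union>\<V> = topspace (mtop N)"
  using second_countable_imp_Lindelof_space[OF assms(2)] unfolding Lindelof_space_def by meson
 then show ?thesis using atlas.topspace_mtop[OF assms(1)] by (intro exI[of _ \<V>]) auto
qed

lemma second_countable_charts:
 assumes "atlas Q" "countable \<C>" "\<C> \<subseteq> charts Q" "!!x. x \<in> pts Q ==> \<exists>(U, \<phi>)\<in>\<C>. x \<in> U"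
 shows "second_countable (mtop (Q :: ('q, 'c::euclidean_space) manifold))"
proof -
 interpret atlas Q by fact
 obtain B :: "'c set set" where B: "countable B" "topological_basis B" using ex_countable_basis by blast
 let ?D = "(%((U, \<phi>), A). {y \<in> U. \<phi> y \<in> A}) ` (\<C> \<times> B)"
 show ?thesis
  unfolding second_countable_def
 proof (intro exI[of _ ?D] conjI ballI allI impI)
  show "countable ?D" using B assms(2) by auto
  show "openin (mtop Q) V" if "V \<in> ?D" for V
   using that assms(3) B(2) openin_chart topological_basis_open by fastforce
  fix W x assume W: "openin (mtop Q) W & x \<in> W"
  then have "x \<in> pts Q" using openin_mtop by blast
  from assms(4)[OF this] obtain U \<phi> where c: "(U, \<phi>) \<in> \<C>" "x \<in> U" by auto
  with assms(3) have "(U, \<phi>) \<in> charts Q" by auto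
  with W c(2) obtain A where A: "open A" "\<phi> x \<in> A" "\<forall>y\<in>U. \<phi> y \<in> A --> y \<in> W"
   using openin_mtopD[of W U \<phi> x] by auto
  obtain A' where A': "A' \<in> B" "\<phi> x \<in> A'" "A' \<subseteq> A"
   by (rule topological_basisE[OF B(2) A(1,2)])
  show "\<exists>V\<in>?D. x \<in> V & V \<subseteq> W"
   using A A' c by (intro bexI[of _ "{y \<in> U. \<phi> y \<in> A'}"]) (auto intro!: rev_image_eqI[of "((U, \<phi>), A')"])
 qed
qed

lemma smooth_manifold_gchart:
 assumes "smooth_manifold N"
 shows "\<exists>n. \<forall>(U, \<phi>)\<in>charts N. \<exists>H. dim H = n & gchart N U \<phi> H"
proof -
 obtain n where n: "\<forall>(U, \<phi>)\<in>charts N. \<exists>H. subspace H & dim H = n & openin (top_of_set H) (\<phi> ` U)"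
  using smooth_manifold.chart_open[OF assms] by blast
 show ?thesis
 proof (intro exI[of _ n] ballI, clarify)
  fix U \<phi> assume c: "(U, \<phi>) \<in> charts N"
  with n obtain H where "subspace H" "dim H = n" "openin (top_of_set H) (\<phi> ` U)" by blast
  then show "\<exists>H. dim H = n & gchart N U \<phi> H"
   using chart_gchart[OF smooth_manifold_atlas[OF assms] c] by blast
 qed
qed

lemma chart_gchartE:
 assumes "smooth_manifold N" "(U, \<phi>) \<in> charts N"
 obtains H where "gchart N U \<phi> H"
 using smooth_manifold_gchart[OF assms(1)] assms(2) by blast

definition tchart :: "('p => 'c::euclidean_space) => 'p tvec => 'c \<times> 'c" where
 "tchart \<phi> X = (\<phi> (fst X), cvec \<phi> (snd X))"

lemma pts_tangent [simp]: "pts (TB N) = Sigma (pts N) (tangent_space N)"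
 and charts_tangent: "charts (TB N) = {(Sigma U (tangent_space N), tchart \<phi>) | U \<phi>. (U, \<phi>) \<in> charts N}"
proof -
 have "tchart \<phi> = (%X. (\<phi> (fst X), \<Sum>b\<in>Basis. snd X (%x. \<phi> x \<bullet> b) *\<^sub>R b))" for \<phi> :: "'a => 'b::euclidean_space"
  by (rule ext) (simp add: tchart_def cvec_def)
 then show "charts (TB N) = {(Sigma U (tangent_space N), tchart \<phi>) | U \<phi>. (U, \<phi>) \<in> charts N}"
  by (simp add: tangent_bundle_def)
qed (simp add: tangent_bundle_def)

lemma Cinf_frechet_apply:
 assumes "open A" "Cinf A g"
 shows "Cinf (A \<times> UNIV) (%z. FD g (at (fst z)) (snd z))"
proof
 fix k
 have o: "open (A \<times> (UNIV :: 'a set))" using assms by (intro open_Times) auto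
 have "Ck_on k (A \<times> (UNIV :: 'a set)) (%z. FD g (at (fst z)) b)" for b :: 'a
  by (rule Ck_on_compose[where g = "%y. FD g (at y) b" and f = fst,
     OF o assms(1) _ Ck_on_blin[OF o bounded_linear_fst]])
   (use Cinf_derivative[OF assms(2)] in auto)
 moreover have "Ck_on k (A \<times> UNIV) (%z. snd z \<bullet> b)" for b :: 'a
  by (rule Ck_on_linear[OF o bounded_linear_inner_left Ck_on_blin[OF o bounded_linear_snd]])
 ultimately have "Ck_on k (A \<times> UNIV) (%z. \<Sum>b\<in>Basis. (snd z \<bullet> b) *\<^sub>R FD g (at (fst z)) b)"
  by (intro Ck_on_sum[OF o] Ck_on_scaleR[OF o])
 then show "Ck_on k (A \<times> UNIV) (%z. FD g (at (fst z)) (snd z))"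
 proof (rule Ck_on_cong[OF o, rotated])
  fix z :: "'a \<times> 'a" assume "z \<in> A \<times> UNIV"
  then have "fst z \<in> A" by auto
  then have "linear (FD g (at (fst z)))"
   by (rule has_derivative_linear[OF Cinf_has_derivative[OF assms(2,1)]])
  from linear_expand_basis[OF this, of "snd z"]
  show "(\<Sum>b\<in>Basis. (snd z \<bullet> b) *\<^sub>R FD g (at (fst z)) b) = FD g (at (fst z)) (snd z)" ..
 qed
qed

text \<open>The transition map of the tangent bundle is a transition map of the base together with its derivative;
  both are smooth on the open set where an extension is defined.\<close>

lemma tchart_transition:
 assumes N: "smooth_manifold N" and c: "(U, \<phi>) \<in> charts N" "(V, \<psi>) \<in> charts N"
  and X: "X \<in> Sigma U (tangent_space N)" "X \<in> Sigma V (tangent_space N)"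
 shows "\<exists>A g. open A & tchart \<phi> X \<in> A & Cinf A g &
   (\<forall>Y\<in>Sigma U (tangent_space N). tchart \<phi> Y \<in> A --> Y \<in> Sigma V (tangent_space N) & tchart \<psi> Y = g (tchart \<phi> Y))"
proof -
 note at = smooth_manifold_atlas[OF N]
 have "fst X \<in> U" "fst X \<in> V" using X by auto
 from atlas.transition[OF at c this] obtain A g where A: "open A" "\<phi> (fst X) \<in> A" "Cinf A g"
  "\<forall>y\<in>U. \<phi> y \<in> A --> y \<in> V & \<psi> y = g (\<phi> y)" by blast
 obtain H where H: "gchart N U \<phi> H" using chart_gchartE[OF N c(1)] by blast
 let ?h = "%z. (g (fst z), FD g (at (fst z)) (snd z))"
 have o: "open (A \<times> (UNIV :: 'b set))" using A by (intro open_Times) auto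
 have "Ck_on k (A \<times> (UNIV :: 'b set)) (%z. g (fst z))" for k
  by (rule Ck_on_compose[where g = g and f = fst, OF o A(1) _ Ck_on_blin[OF o bounded_linear_fst]]) (use A in auto)
 then have "Cinf (A \<times> UNIV) ?h" using Cinf_frechet_apply[OF A(1,3)] by (auto intro: Ck_on_Pair o)
 moreover have "Y \<in> Sigma V (tangent_space N) & tchart \<psi> Y = ?h (tchart \<phi> Y)"
  if Y: "Y \<in> Sigma U (tangent_space N)" "tchart \<phi> Y \<in> A \<times> UNIV" for Y
 proof -
  let ?p = "fst Y"
  have p: "?p \<in> U" "\<phi> ?p \<in> A" "snd Y \<in> tangent_space N ?p" using Y by (auto simp: tchart_def)
  have "snd Y (%x. \<psi> x \<bullet> b) = FD g (at (\<phi> ?p)) (cvec \<phi> (snd Y)) \<bullet> b" for b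
  proof -
   have s: "Cinf A (%z. g z \<bullet> b)" using A(1,3) by (auto intro: Ck_on_linear bounded_linear_inner_left)
   have "snd Y (%x. \<psi> x \<bullet> b) = FD (%z. g z \<bullet> b) (at (\<phi> ?p)) (cvec \<phi> (snd Y))"
    by (rule tan_gchart[OF at H p(1,3) A(1) p(2) s]) (use A(4) in auto)
   also have "FD (%z. g z \<bullet> b) (at (\<phi> ?p)) = (%v. FD g (at (\<phi> ?p)) v \<bullet> b)"
    using bounded_linear.has_derivative[OF bounded_linear_inner_left Cinf_has_derivative[OF A(3,1) p(2)]]
    by (rule frechet_derivative_at[symmetric])
   finally show ?thesis .
  qed
  then have "cvec \<psi> (snd Y) = FD g (at (\<phi> ?p)) (cvec \<phi> (snd Y))"
   by (simp add: cvec_def[of \<psi>] euclidean_representation)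
  then show ?thesis using A(4) p Y by (auto simp: tchart_def)
 qed
 ultimately show ?thesis
  using o A(2) by (intro exI[of _ "A \<times> UNIV"] exI[of _ ?h]) (auto simp: tchart_def)
qed

lemma atlas_tangent [simp]:
 assumes N: "smooth_manifold N" shows "atlas (TB N)"
proof (rule atlasI)
 note at = smooth_manifold_atlas[OF N]
 show "(\<Union>(U, \<phi>)\<in>charts (TB N). U) = pts (TB N)"
  unfolding pts_tangent
 proof (intro equalityI subsetI)
  fix X assume "X \<in> (\<Union>(U, \<phi>)\<in>charts (TB N). U)"
  then show "X \<in> Sigma (pts N) (tangent_space N)"
   using atlas.chart_sub[OF at] by (auto simp: charts_tangent)
 next
  fix X assume X: "X \<in> Sigma (pts N) (tangent_space N)"
  then have "fst X \<in> pts N" by auto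
  then obtain U \<phi> where "(U, \<phi>) \<in> charts N" "fst X \<in> U" using atlas.chart_at[OF at] by blast
  then have "(Sigma U (tangent_space N), tchart \<phi>) \<in> charts (TB N)" "X \<in> Sigma U (tangent_space N)"
   using X by (auto simp: charts_tangent)
  then show "X \<in> (\<Union>(U, \<phi>)\<in>charts (TB N). U)" by blast
 qed
 show "inj_on \<psi> W" if W: "(W, \<psi>) \<in> charts (TB N)" for W \<psi>
 proof -
  obtain U \<phi> where e: "W = Sigma U (tangent_space N)" "\<psi> = tchart \<phi>" and c: "(U, \<phi>) \<in> charts N"
   using W by (auto simp: charts_tangent)
  obtain H where H: "gchart N U \<phi> H" using chart_gchartE[OF N c(1)] by blast
  show ?thesis unfolding e
  proof (rule inj_onI)
   fix X Y assume X: "X \<in> Sigma U (tangent_space N)" and Y: "Y \<in> Sigma U (tangent_space N)"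
    and eq: "tchart \<phi> X = tchart \<phi> Y"
   then have "fst X = fst Y" using atlas.inj[OF at c] by (auto simp: tchart_def dest: inj_onD)
   moreover from this have "snd X = snd Y"
    using X Y eq by (intro tan_eqI[OF at H, of "fst X"]) (auto simp: tchart_def)
   ultimately show "X = Y" by (rule prod_eqI)
  qed
 qed
 show "\<exists>A g. open A & \<phi>' X \<in> A & Cinf A g & (\<forall>y\<in>U'. \<phi>' y \<in> A --> y \<in> V' & \<psi>' y = g (\<phi>' y))"
  if c: "(U', \<phi>') \<in> charts (TB N)" "(V', \<psi>') \<in> charts (TB N)" and X: "X \<in> U'" "X \<in> V'"
  for U' \<phi>' V' \<psi>' X
 proof -
  obtain U \<phi> V \<psi> where e: "U' = Sigma U (tangent_space N)" "\<phi>' = tchart \<phi>" "V' = Sigma V (tangent_space N)" "\<psi>' = tchart \<psi>"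
   and cc: "(U, \<phi>) \<in> charts N" "(V, \<psi>) \<in> charts N"
   using c by (auto simp: charts_tangent)
  show ?thesis using tchart_transition[OF N cc X[unfolded e]] unfolding e .
 qed
qed

lemma sma_tangent_fst:
 assumes N: "smooth_manifold N" and X: "X \<in> pts (TB N)"
 shows "sm_at (TB N) S N fst X"
proof -
 have "fst X \<in> pts N" using X by auto
 then obtain U \<phi> where c: "(U, \<phi>) \<in> charts N" "fst X \<in> U"
  using atlas.chart_at[OF smooth_manifold_atlas[OF N]] by blast
 have "Cinf UNIV (fst :: 'b \<times> 'b => 'b)" by (auto intro: Ck_on_blin bounded_linear_fst)
 then show ?thesis
  using c X by (intro sm_atI[of "Sigma U (tangent_space N)" "tchart \<phi>" _ U \<phi> _ _ _ UNIV fst])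
   (auto simp: charts_tangent tchart_def)
qed

lemma sma_eval:
 assumes N: "smooth_manifold N" and X: "X \<in> pts (TB N)" and f: "sma N euclid f (fst X)"
 shows "sm_at (TB N) S euclid (%Z. snd Z f) X"
proof -
 note at = smooth_manifold_atlas[OF N]
 have "fst X \<in> pts N" using X by auto
 then obtain U \<phi> where c: "(U, \<phi>) \<in> charts N" "fst X \<in> U" using atlas.chart_at[OF at] by blast
 obtain H where H: "gchart N U \<phi> H" using chart_gchartE[OF N c(1)] by blast
 obtain A G where A: "open A" "\<phi> (fst X) \<in> A" "Cinf A G" "\<forall>y\<in>U. \<phi> y \<in> A --> f y = G (\<phi> y)"
  using gchart_extend[OF at H c(2) f] by blast
 have "snd Z f = FD G (at (fst (tchart \<phi> Z))) (snd (tchart \<phi> Z))"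
  if Z: "Z \<in> Sigma U (tangent_space N)" "tchart \<phi> Z \<in> A \<times> UNIV" for Z
  using tan_gchart[OF at H, of "fst Z" "snd Z" A G f] Z A by (auto simp: tchart_def)
 moreover have "open (A \<times> (UNIV :: 'b set))" using A by (intro open_Times) auto
 ultimately show ?thesis
  unfolding sm_at_euclid_iff[OF atlas_tangent[OF N]]
  using c X A Cinf_frechet_apply[OF A(1,3)]
  by (intro exI[of _ "Sigma U (tangent_space N)"] exI[of _ "tchart \<phi>"] exI[of _ "A \<times> UNIV"]
    exI[of _ "%z. FD G (at (fst z)) (snd z)"]) (auto simp: charts_tangent tchart_def)
qed

lemma sm_at_via_chart:
 assumes N: "atlas N" and x: "x \<in> S" and c: "(V, \<psi>) \<in> charts Q" "f x \<in> V"
  and s: "sm_at N S euclid (%y. \<psi> (f y)) x"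
  and W: "openin (mtop N) W" "x \<in> W" "!!y. y \<in> S ==> y \<in> W ==> f y \<in> V"
 shows "sm_at N S Q f x"
proof -
 obtain U \<phi> A g where 1: "(U, \<phi>) \<in> charts N" "x \<in> U" "open A" "\<phi> x \<in> A" "Cinf A g"
   "\<forall>y\<in>S \<inter> U. \<phi> y \<in> A --> \<psi> (f y) = g (\<phi> y)"
  using s unfolding sm_at_euclid_iff[OF N] by blast
 have "sm_at N (S \<inter> W) Q f x"
  by (rule sm_atI[where f = f and g = g, OF 1(1) c(1) 1(2) c(2) 1(3,4,5)]) (use 1(6) W(3) in auto)
 then show ?thesis by (rule sm_at_nbhd_mono[OF N _ W(1,2)])
qed

text \<open>A map into the tangent bundle is smooth as soon as its base map is smooth and it maps smooth
  functions to smooth functions.\<close>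

lemma sm_at_tangentI:
 assumes P: "atlas P" and N: "smooth_manifold N" and x: "x \<in> S"
  and X: "!!y. y \<in> S ==> X y \<in> pts (TB N)"
  and base: "sm_at P S N (%y. fst (X y)) x"
  and ev: "!!f. sma N euclid f (fst (X x)) ==> sm_at P S euclid (%y. snd (X y) f) x"
  and xP: "x \<in> pts P"
 shows "sm_at P S (TB N) X x"
proof -
 note at = smooth_manifold_atlas[OF N]
 have X': "fst (X y) \<in> pts N" "snd (X y) \<in> tangent_space N (fst (X y))" if "y \<in> S" for y
  using X[OF that] by auto
 obtain U \<phi> where c: "(U, \<phi>) \<in> charts N" "fst (X x) \<in> U" using atlas.chart_at[OF at X'(1)[OF x]] by blast
 have sphi: "sma N euclid \<phi> (fst (X x))" by (rule sm_at_chart[OF at c])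
 obtain W where W: "openin (mtop P) W" "x \<in> W" "(%y. fst (X y)) ` (S \<inter> W) \<subseteq> U"
  using sm_at_continuous[OF P at base x atlas.openin_chart_dom[OF at c(1)] c(2)] by blast
 have c': "(Sigma U (tangent_space N), tchart \<phi>) \<in> charts (TB N)"
  using c by (auto simp: charts_tangent)
 show ?thesis
 proof (rule sm_at_via_chart[OF P x c' _ _ W(1,2)])
  show "X y \<in> Sigma U (tangent_space N)" if y: "y \<in> S" "y \<in> W" for y
  proof -
   have "fst (X y) \<in> U" using W(3) y by auto
   with X'(2)[OF y(1)] show ?thesis by (metis SigmaI prod.collapse)
  qed
  from this[OF x W(2)] show "X x \<in> Sigma U (tangent_space N)" .
  have "sm_at P S euclid (%y. \<phi> (fst (X y))) x"
   by (rule sm_at_compose[OF at atlas_euclid base sphi x X'(1)])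
  moreover have "sm_at P S euclid (%y. cvec \<phi> (snd (X y))) x"
   unfolding cvec_def
  proof (rule sm_at_sum[OF P x xP])
   fix b :: 'd
   have "sma N euclid (%z. \<phi> z \<bullet> b) (fst (X x))"
    by (rule sm_at_blin[OF bounded_linear_inner_left X'(1)[OF x] sphi])
   from ev[OF this] show "sm_at P S euclid (%y. snd (X y) (%z. \<phi> z \<bullet> b) *\<^sub>R b) x"
    by (rule sm_at_blin[OF bounded_linear_scaleR_left x])
  qed
  ultimately show "sm_at P S euclid (%y. tchart \<phi> (X y)) x"
   unfolding tchart_def by (rule sm_at_Pair_euclid[OF P x])
 qed
qed

lemma sm_at_pt_vec:
 assumes P: "atlas P" and N: "smooth_manifold N" and \<kappa>: "gchart N U \<kappa> H" and x: "x \<in> S" "x \<in> pts P"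
  and e: "sm_at P S N e x" "!!y. y \<in> S ==> e y \<in> U"
  and h: "sm_at P S euclid h x" "!!y. y \<in> S ==> h y \<in> H"
 shows "sm_at P S (TB N) (%y. pt_vec N U \<kappa> (e y) (h y)) x"
proof (rule sm_at_tangentI[OF P N x(1)])
 note at = smooth_manifold_atlas[OF N]
 show "pt_vec N U \<kappa> (e y) (h y) \<in> pts (TB N)" if "y \<in> S" for y
  using pt_vec_tangent[OF at \<kappa> e(2) h(2)] gchart_pts[OF at \<kappa> e(2)] that
  by (simp add: mem_Times_iff Sigma_def) (metis fst_pt_vec prod.collapse)
 show "sm_at P S N (%y. fst (pt_vec N U \<kappa> (e y) (h y))) x" using e(1) by simp
 show "x \<in> pts P" by fact
 fix f :: "_ => real" assume "sma N euclid f (fst (pt_vec N U \<kappa> (e x) (h x)))"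
 then have f: "sma N euclid f (e x)" by simp
 obtain A G where A: "open A" "\<kappa> (e x) \<in> A" "Cinf A G" "\<forall>y\<in>U. \<kappa> y \<in> A --> f y = G (\<kappa> y)"
  using gchart_extend[OF at \<kappa> e(2)[OF x(1)] f] by blast
 obtain W where W: "openin (mtop N) W" "e x \<in> W" "\<forall>y\<in>W. sma N euclid f y"
  using sm_at_nbhd[OF at f] by blast
 have sk: "sma N euclid \<kappa> (e x)" using \<kappa> e(2)[OF x(1)] by (simp add: gchart_def)
 have ske: "sm_at P S euclid (%y. \<kappa> (e y)) x"
  by (rule sm_at_compose[OF at atlas_euclid e(1) sk x(1)]) (use gchart_pts[OF at \<kappa>] e(2) in blast)
 have oW: "openin (mtop N) ({y \<in> U. \<kappa> y \<in> A} \<inter> W)"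
  using gchart_openin[OF at \<kappa> A(1)] W(1) by blast
 obtain Q where Q: "openin (mtop P) Q" "x \<in> Q" "e ` (S \<inter> Q) \<subseteq> {y \<in> U. \<kappa> y \<in> A} \<inter> W"
  using sm_at_continuous[OF P at e(1) x(1) oW] A W e(2)[OF x(1)] by blast
 have "Cinf (A \<times> UNIV) (%z. FD G (at (fst z)) (snd z))"
  by (rule Cinf_frechet_apply[OF A(1,3)])
 from sm_at_Cinf[OF sm_at_Pair_euclid[OF P x(1) ske h(1)] x(1) open_Times[OF A(1) open_UNIV] _ this] A(2)
 have "sm_at P S euclid (%y. FD G (at (\<kappa> (e y))) (h y)) x" by simp
 then show "sm_at P S euclid (%y. snd (pt_vec N U \<kappa> (e y) (h y)) f) x"
 proof (rule sm_at_eq_near[OF P _ Q(1,2) x(1)])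
  fix y assume y: "y \<in> S" "y \<in> Q"
  then have ey: "e y \<in> U" "\<kappa> (e y) \<in> A" "e y \<in> W" using Q(3) by auto
  then have "f \<in> smooth_near N (e y)" using W(3) smooth_near_iff[OF at gchart_pts[OF at \<kappa> ey(1)]] by blast
  from pt_vec_coord[OF at \<kappa> ey(1) h(2)[OF y(1)] A(1) ey(2) A(3) _ this] A(4)
  show "FD G (at (\<kappa> (e y))) (h y) = snd (pt_vec N U \<kappa> (e y) (h y)) f" by simp
 qed
qed

lemma openin_tangent_fst:
 assumes N: "smooth_manifold N" and W: "openin (mtop N) W"
 shows "openin (mtop (TB N)) (Sigma W (tangent_space N))"
proof (subst openin_subopen, rule ballI)
 note at = smooth_manifold_atlas[OF N]
 fix X assume X: "X \<in> Sigma W (tangent_space N)"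
 have sub: "W \<subseteq> pts N" using W atlas.openin_mtop[OF at] by blast
 have XT: "X \<in> pts (TB N)" using X sub by auto
 obtain Q where Q: "openin (mtop (TB N)) Q" "X \<in> Q" "fst ` (pts (TB N) \<inter> Q) \<subseteq> W"
  using sm_at_continuous[OF atlas_tangent[OF N] at sma_tangent_fst[OF N XT] XT W] X by auto
 have "Q \<subseteq> pts (TB N)" using openin_subset[OF Q(1)] atlas.topspace_mtop[OF atlas_tangent[OF N]] by simp
 then have "Q \<subseteq> Sigma W (tangent_space N)" using Q(3) by fastforce
 then show "\<exists>T. openin (mtop (TB N)) T & X \<in> T & T \<subseteq> Sigma W (tangent_space N)" using Q by blast
qed

text \<open>Two tangent vectors with different base points are separated in the base, two with the same base point
  in a single chart. Countably many charts of the base give countably many charts here.\<close>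

lemma smooth_manifold_tangent:
 assumes N: "smooth_manifold N" shows "smooth_manifold (TB N)"
proof -
 note at = smooth_manifold_atlas[OF N]
 interpret T: atlas "TB N" using N by simp
 obtain n where n: "\<forall>(U, \<phi>)\<in>charts N. \<exists>H. dim H = n & gchart N U \<phi> H"
  using smooth_manifold_gchart[OF N] by blast
 show ?thesis
 proof
  show "(\<Union>(U, \<phi>)\<in>charts (TB N). U) = pts (TB N)" by (rule T.cover)
  show "inj_on \<phi> U" if "(U, \<phi>) \<in> charts (TB N)" for U \<phi> by (rule T.inj[OF that])
  show "openin (top_of_set (\<phi> ` U)) (\<phi> ` (U \<inter> V)) & smooth_within (\<phi> ` (U \<inter> V)) (\<psi> \<circ> inv_into U \<phi>)"
   if "(U, \<phi>) \<in> charts (TB N)" "(V, \<psi>) \<in> charts (TB N)" for U \<phi> V \<psi>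
   by (rule T.compatible[OF that])
  show "\<exists>n. \<forall>(U, \<phi>)\<in>charts (TB N).
     \<exists>H. subspace H & dim H = n & openin (top_of_set H) (\<phi> ` U)"
  proof (intro exI[of _ "n + n"] ballI, clarify)
   fix U' \<phi>' assume "(U', \<phi>') \<in> charts (TB N)"
   then obtain U \<phi> where e: "U' = Sigma U (tangent_space N)" "\<phi>' = tchart \<phi>" and c: "(U, \<phi>) \<in> charts N"
    by (auto simp: charts_tangent)
   from n c obtain H where H: "dim H = n" "gchart N U \<phi> H" by blast
   have "tchart \<phi> ` Sigma U (tangent_space N) = \<phi> ` U \<times> H"
   proof (intro equalityI subsetI)
    fix z assume "z \<in> tchart \<phi> ` Sigma U (tangent_space N)"
    then show "z \<in> \<phi> ` U \<times> H" using vec_in_subspace[OF at H(2)] by (auto simp: tchart_def)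
   next
    fix z assume "z \<in> \<phi> ` U \<times> H"
    then obtain p where p: "p \<in> U" "fst z = \<phi> p" "snd z \<in> H" by auto
    have "z = tchart \<phi> (pt_vec N U \<phi> p (snd z))"
     using vec_pt_vec[OF at H(2) p(1,3)] p(2) by (auto simp: tchart_def prod_eq_iff)
    moreover have "pt_vec N U \<phi> p (snd z) \<in> Sigma U (tangent_space N)"
     using pt_vec_tangent[OF at H(2) p(1,3)] p(1) by (metis SigmaI fst_pt_vec prod.collapse)
    ultimately show "z \<in> tchart \<phi> ` Sigma U (tangent_space N)" by (rule image_eqI)
   qed
   moreover have "subspace H" "openin (top_of_set H) (\<phi> ` U)" using H(2) by (auto simp: gchart_def)
   ultimately show "\<exists>H. subspace H & dim H = n + n & openin (top_of_set H) (\<phi>' ` U')"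
    unfolding e using H(1)
    by (intro exI[of _ "H \<times> H"]) (auto simp: dim_Times intro: subspace_Times openin_Times)
  qed
  show "Hausdorff_space (mtop (TB N))"
   unfolding Hausdorff_space_def T.topspace_mtop
  proof (intro allI impI, elim conjE)
   fix X Y assume X: "X \<in> pts (TB N)" and Y: "Y \<in> pts (TB N)" and ne: "X \<noteq> Y"
   show "\<exists>U V. openin (mtop (TB N)) U & openin (mtop (TB N)) V & X \<in> U & Y \<in> V & disjnt U V"
   proof (cases "fst X = fst Y")
    case False
    moreover have "fst X \<in> pts N" "fst Y \<in> pts N" using X Y by auto
    ultimately obtain U V where "openin (mtop N) U" "openin (mtop N) V" "fst X \<in> U" "fst Y \<in> V" "disjnt U V"
     using smooth_manifold.hausdorff[OF N] unfolding Hausdorff_space_def atlas.topspace_mtop[OF at] by blast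
    then show ?thesis using X Y openin_tangent_fst[OF N]
     by (intro exI[of _ "Sigma U (tangent_space N)"] exI[of _ "Sigma V (tangent_space N)"])
      (auto simp: disjnt_iff)
   next
    case True
    have "fst X \<in> pts N" using X by auto
    then obtain U \<phi> where c: "(U, \<phi>) \<in> charts N" "fst X \<in> U" using atlas.chart_at[OF at] by blast
    have c': "(Sigma U (tangent_space N), tchart \<phi>) \<in> charts (TB N)"
     using c by (auto simp: charts_tangent)
    have XU: "X \<in> Sigma U (tangent_space N)" "Y \<in> Sigma U (tangent_space N)" using c X Y True by auto
    then have "tchart \<phi> X \<noteq> tchart \<phi> Y" using T.inj[OF c'] ne by (auto dest: inj_onD)
    then obtain A B where AB: "open A" "open B" "tchart \<phi> X \<in> A" "tchart \<phi> Y \<in> B" "A \<inter> B = {}"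
     using Topological_Spaces.hausdorff[of "tchart \<phi> X" "tchart \<phi> Y"] by auto
    show ?thesis
     using T.openin_chart[OF c' AB(1)] T.openin_chart[OF c' AB(2)] AB XU
     by (intro exI[of _ "{Z \<in> Sigma U (tangent_space N). tchart \<phi> Z \<in> A}"]
      exI[of _ "{Z \<in> Sigma U (tangent_space N). tchart \<phi> Z \<in> B}"] conjI) (auto simp: disjnt_iff)
   qed
  qed
  have "\<exists>\<W>. countable \<W> & (\<forall>W\<in>\<W>. openin (mtop N) W & (\<exists>\<phi>. (W, \<phi>) \<in> charts N)) & \<Union>\<W> = pts N"
  proof (rule countable_subcover[OF at smooth_manifold.second_countable[OF N], of "%W. \<exists>\<phi>. (W, \<phi>) \<in> charts N"])
   fix p assume "p \<in> pts N"
   from atlas.chart_at[OF at this] obtain U \<phi> where c: "(U, \<phi>) \<in> charts N" "p \<in> U" by blast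
   then show "\<exists>W. openin (mtop N) W & p \<in> W & (\<exists>\<phi>. (W, \<phi>) \<in> charts N)"
    using atlas.openin_chart_dom[OF at c(1)] by (intro exI[of _ U]) auto
  qed
  then obtain \<W> where \<W>: "countable \<W>" "\<forall>W\<in>\<W>. openin (mtop N) W & (\<exists>\<phi>. (W, \<phi>) \<in> charts N)" "\<Union>\<W> = pts N"
   by (elim exE conjE)
  define ph where "ph W = (SOME \<phi>. (W, \<phi>) \<in> charts N)" for W
  have ph: "(W, ph W) \<in> charts N" if "W \<in> \<W>" for W
   unfolding ph_def by (rule someI_ex[OF conjunct2[OF bspec[OF \<W>(2) that]]])
  show "second_countable (mtop (TB N))"
  proof (rule second_countable_charts[OF T.atlas_axioms, of "(%W. (Sigma W (tangent_space N), tchart (ph W))) ` \<W>"])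
   show "countable ((%W. (Sigma W (tangent_space N), tchart (ph W))) ` \<W>)" using \<W>(1) by simp
   show "(%W. (Sigma W (tangent_space N), tchart (ph W))) ` \<W> \<subseteq> charts (TB N)"
    using ph by (auto simp: charts_tangent)
   show "\<exists>(U, \<phi>)\<in>(%W. (Sigma W (tangent_space N), tchart (ph W))) ` \<W>. X \<in> U" if "X \<in> pts (TB N)" for X
    using that \<W>(3) by auto
  qed
 qed
qed

section \<open>Embedded submanifolds\<close>

lemma smooth_within_continuous:
 assumes "smooth_within S f" shows "continuous_on S f"
 unfolding continuous_on_def
proof
 fix x assume x: "x \<in> S"
 from smooth_withinD[OF assms x] obtain A g where A: "open A" "x \<in> A" "Cinf A g" "\<forall>y\<in>A \<inter> S. g y = f y" by blast
 have "isCont g x" using Cinf_continuous[OF A(3)] A(1,2) continuous_on_eq_continuous_at by blast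
 then have "(g \<longlongrightarrow> g x) (at x within S)"
  by (simp add: continuous_at tendsto_within_subset[where S = UNIV])
 moreover have "\<forall>\<^sub>F y in at x within S. g y = f y"
  unfolding eventually_at_topological using A by (intro exI[of _ A]) auto
 ultimately have "(f \<longlongrightarrow> g x) (at x within S)" by (rule Lim_transform_eventually)
 then show "(f \<longlongrightarrow> f x) (at x within S)" using A(4) x A(2) by auto
qed

lemma pts_submfd [simp]: "pts (submfd N S) = S"
 by (simp add: submfd_def)

text \<open>All charts of the induced structure are smooth in both directions for the ambient manifold, so that only
  their existence near each point, with images of the same dimension, is required.\<close>

locale embedded =
 fixes N :: "('p, 'c::euclidean_space) manifold" and S :: "'p set" and H0 :: "'c set"
 assumes N: "smooth_manifold N" and S: "S \<subseteq> pts N" and H0: "subspace H0"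
  and adapted: "!!p. p \<in> S ==> \<exists>U \<kappa> H. (U, \<kappa>) \<in> charts (submfd N S) & p \<in> U & subspace H & dim H = dim H0 &
   openin (top_of_set H) (\<kappa> ` U)"
begin

lemma at: "atlas N" by (rule smooth_manifold_atlas[OF N])

lemma sub_chart:
 assumes "(U, \<kappa>) \<in> charts (submfd N S)"
 shows "U \<subseteq> S" "\<exists>Q. openin (mtop N) Q & U = Q \<inter> S" "inj_on \<kappa> U" "\<exists>H. subspace H & openin (top_of_set H) (\<kappa> ` U)"
  "!!p. p \<in> U ==> sm_at N U euclid \<kappa> p" "!!z. z \<in> \<kappa> ` U ==> sm_at euclid (\<kappa> ` U) N (inv_into U \<kappa>) z"
proof -
 have c: "openin (subtopology (mtop N) S) U" "inj_on \<kappa> U" "\<exists>H. subspace H & openin (top_of_set H) (\<kappa> ` U)"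
  "smooth_map_on N U euclid \<kappa>" "smooth_map_on euclid (\<kappa> ` U) N (inv_into U \<kappa>)"
  using assms by (auto simp: submfd_def)
 show "U \<subseteq> S" using openin_imp_subset[OF c(1)] .
 show "\<exists>Q. openin (mtop N) Q & U = Q \<inter> S" using c(1) by (auto simp: openin_subtopology)
 show "inj_on \<kappa> U" "\<exists>H. subspace H & openin (top_of_set H) (\<kappa> ` U)" by fact+
 show "sm_at N U euclid \<kappa> p" if "p \<in> U" for p
  using c(4) that smooth_map_on_iff[OF at atlas_euclid] by blast
 show "sm_at euclid (\<kappa> ` U) N (inv_into U \<kappa>) z" if "z \<in> \<kappa> ` U" for z
  using c(5) that smooth_map_on_iff[OF atlas_euclid at] by blast
qed

lemma sub_chart_nbhd:
 assumes c: "(U, \<kappa>) \<in> charts (submfd N S)" and p: "p \<in> U" and Q: "openin (mtop N) Q" "p \<in> Q"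
 shows "\<exists>B. open B & \<kappa> p \<in> B & (\<forall>y\<in>U. \<kappa> y \<in> B --> y \<in> Q)"
proof -
 have inv: "inv_into U \<kappa> (\<kappa> y) = y" if "y \<in> U" for y using sub_chart(3)[OF c] that by simp
 have "inv_into U \<kappa> (\<kappa> p) \<in> Q" using inv p Q by simp
 from sm_at_continuous[OF atlas_euclid at sub_chart(6)[OF c imageI[OF p]] imageI[OF p] Q(1) this]
 obtain B where B: "openin (mtop euclid) B" "\<kappa> p \<in> B" "inv_into U \<kappa> ` (\<kappa> ` U \<inter> B) \<subseteq> Q" by blast
 have "y \<in> Q" if "y \<in> U" "\<kappa> y \<in> B" for y
 proof -
  have "inv_into U \<kappa> (\<kappa> y) \<in> Q" using B(3) that by blast
  then show ?thesis using inv that by simp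
 qed
 then show ?thesis using B by auto
qed

lemma sub_atlas: "atlas (submfd N S)"
proof (rule atlasI)
 show "(\<Union>(U, \<phi>)\<in>charts (submfd N S). U) = pts (submfd N S)"
 proof (intro equalityI subsetI)
  fix p assume "p \<in> (\<Union>(U, \<phi>)\<in>charts (submfd N S). U)"
  then show "p \<in> pts (submfd N S)" using sub_chart(1) by auto
 next
  fix p assume "p \<in> pts (submfd N S)"
  then obtain U \<kappa> where "(U, \<kappa>) \<in> charts (submfd N S)" "p \<in> U" using adapted[of p] by auto
  then show "p \<in> (\<Union>(U, \<phi>)\<in>charts (submfd N S). U)" by blast
 qed
 show "inj_on \<kappa> U" if "(U, \<kappa>) \<in> charts (submfd N S)" for U \<kappa> by (rule sub_chart(3)[OF that])
 fix U \<phi> V \<psi> p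
 assume c: "(U, \<phi>) \<in> charts (submfd N S)" "(V, \<psi>) \<in> charts (submfd N S)" and p: "p \<in> U" "p \<in> V"
 have inv: "inv_into U \<phi> (\<phi> y) = y" if "y \<in> U" for y using sub_chart(3)[OF c(1)] that by simp
 obtain Q where Q: "openin (mtop N) Q" "V = Q \<inter> S" using sub_chart(2)[OF c(2)] by blast
 then obtain B where B: "open B" "\<phi> p \<in> B" "\<forall>y\<in>U. \<phi> y \<in> B --> y \<in> Q"
  using sub_chart_nbhd[OF c(1) p(1), of Q] p(2) by blast
 have "sm_at euclid (\<phi> ` (U \<inter> V)) N (inv_into U \<phi>) (\<phi> p)"
  by (rule sm_at_subset[OF sub_chart(6)[OF c(1) imageI[OF p(1)]]]) auto
 then have "sm_at euclid (\<phi> ` (U \<inter> V)) euclid (%z. \<psi> (inv_into U \<phi> z)) (\<phi> p)"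
 proof (rule sm_at_compose[OF at atlas_euclid])
  show "sm_at N V euclid \<psi> (inv_into U \<phi> (\<phi> p))" using sub_chart(5)[OF c(2) p(2)] inv[OF p(1)] by simp
  show "inv_into U \<phi> z \<in> V" if "z \<in> \<phi> ` (U \<inter> V)" for z using that inv by auto
 qed (use p in auto)
 then obtain A g where A: "open A" "\<phi> p \<in> A" "Cinf A g"
  "\<forall>z\<in>\<phi> ` (U \<inter> V). z \<in> A --> \<psi> (inv_into U \<phi> z) = g z"
  unfolding sm_at_euclid_iff[OF atlas_euclid] by auto
 have "y \<in> V & \<psi> y = g (\<phi> y)" if y: "y \<in> U" "\<phi> y \<in> A \<inter> B" for y
 proof -
  have yV: "y \<in> V" using B(3) y Q(2) sub_chart(1)[OF c(1)] by blast
  then have "\<psi> (inv_into U \<phi> (\<phi> y)) = g (\<phi> y)" using A(4) y by blast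
  then show ?thesis using yV inv[OF y(1)] by simp
 qed
 moreover have "Cinf (A \<inter> B) g" using A(3) Ck_on_subset by blast
 ultimately show "\<exists>A g. open A & \<phi> p \<in> A & Cinf A g & (\<forall>y\<in>U. \<phi> y \<in> A --> y \<in> V & \<psi> y = g (\<phi> y))"
  using A(1,2) B(1,2) by (intro exI[of _ "A \<inter> B"] exI[of _ g]) auto
qed

lemma adapted_dim:
 assumes c: "(U, \<phi>) \<in> charts (submfd N S)" "(V, \<psi>) \<in> charts (submfd N S)" and p: "p \<in> U" "p \<in> V"
  and H: "subspace H" "openin (top_of_set H) (\<phi> ` U)" and H': "subspace H'" "openin (top_of_set H') (\<psi> ` V)"
 shows "dim H \<le> dim H'"
proof (rule invariance_of_dimension_subspaces[OF _ H(1) H'(1)])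
 note comp = atlas.compatible[OF sub_atlas c]
 show "openin (top_of_set H) (\<phi> ` (U \<inter> V))" using openin_trans[OF conjunct1[OF comp] H(2)] .
 show "continuous_on (\<phi> ` (U \<inter> V)) (\<psi> \<circ> inv_into U \<phi>)" using smooth_within_continuous comp by blast
 have inv: "inv_into U \<phi> (\<phi> y) = y" if "y \<in> U" for y using sub_chart(3)[OF c(1)] that by simp
 show "\<psi> \<circ> inv_into U \<phi> \<in> \<phi> ` (U \<inter> V) \<rightarrow> H'"
  using inv openin_imp_subset[OF H'(2)] by auto
 show "inj_on (\<psi> \<circ> inv_into U \<phi>) (\<phi> ` (U \<inter> V))"
  using sub_chart(3)[OF c(2)] inv by (auto intro!: inj_onI dest: inj_onD)
 show "\<phi> ` (U \<inter> V) \<noteq> {}" using p by auto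
qed

lemma mtop_submfd: "mtop (submfd N S) = subtopology (mtop N) S"
proof -
 interpret sb: atlas "submfd N S" by (rule sub_atlas)
 have "openin (mtop (submfd N S)) W \<longleftrightarrow> openin (subtopology (mtop N) S) W" for W
 proof
  assume W: "openin (mtop (submfd N S)) W"
  show "openin (subtopology (mtop N) S) W"
  proof (subst openin_subopen, rule ballI)
   fix p assume p: "p \<in> W"
   then have pS: "p \<in> S" using W sb.openin_mtop by auto
   then obtain U \<kappa> where c: "(U, \<kappa>) \<in> charts (submfd N S)" "p \<in> U" using adapted by blast
   obtain A where A: "open A" "\<kappa> p \<in> A" "\<forall>y\<in>U. \<kappa> y \<in> A --> y \<in> W"
    using sb.openin_mtopD[OF W c(1) p c(2)] by blast
   obtain Q where Q: "openin (mtop N) Q" "U = Q \<inter> S" using sub_chart(2)[OF c(1)] by blast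
   have "openin (mtop euclid) A" using A by simp
   from sm_at_continuous[OF at atlas_euclid sub_chart(5)[OF c] c(2) this A(2)]
   obtain Q' where Q': "openin (mtop N) Q'" "p \<in> Q'" "\<kappa> ` (U \<inter> Q') \<subseteq> A" by blast
   have "openin (subtopology (mtop N) S) (Q \<inter> Q' \<inter> S)"
    using Q(1) Q'(1) by (auto simp: openin_subtopology)
   moreover have "Q \<inter> Q' \<inter> S \<subseteq> W" using A(3) Q(2) Q'(3) by blast
   ultimately show "\<exists>T. openin (subtopology (mtop N) S) T & p \<in> T & T \<subseteq> W"
    using Q' Q c(2) pS by (intro exI[of _ "Q \<inter> Q' \<inter> S"]) auto
  qed
 next
  assume "openin (subtopology (mtop N) S) W"
  then obtain Q where Q: "openin (mtop N) Q" "W = Q \<inter> S" by (auto simp: openin_subtopology)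
  show "openin (mtop (submfd N S)) W"
  proof (rule sb.openin_mtopI)
   show "W \<subseteq> pts (submfd N S)" using Q by simp
   fix p assume p: "p \<in> W"
   then obtain U \<kappa> where c: "(U, \<kappa>) \<in> charts (submfd N S)" "p \<in> U" using adapted[of p] Q by blast
   obtain B where "open B" "\<kappa> p \<in> B" "\<forall>y\<in>U. \<kappa> y \<in> B --> y \<in> Q"
    using sub_chart_nbhd[OF c Q(1)] p Q(2) by blast
   then show "\<exists>U \<phi> A. (U, \<phi>) \<in> charts (submfd N S) & p \<in> U & open A & \<phi> p \<in> A & (\<forall>y\<in>U. \<phi> y \<in> A --> y \<in> W)"
    using c Q(2) sub_chart(1)[OF c(1)] by (intro exI[of _ U] exI[of _ \<kappa>] exI[of _ B]) auto
  qed
 qed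
 then show ?thesis by (simp add: topology_eq)
qed

lemma sub_manifold: "smooth_manifold (submfd N S)"
proof -
 interpret sb: atlas "submfd N S" by (rule sub_atlas)
 show ?thesis
 proof
  show "(\<Union>(U, \<phi>)\<in>charts (submfd N S). U) = pts (submfd N S)" by (rule sb.cover)
  show "inj_on \<phi> U" if "(U, \<phi>) \<in> charts (submfd N S)" for U \<phi> by (rule sb.inj[OF that])
  show "openin (top_of_set (\<phi> ` U)) (\<phi> ` (U \<inter> V)) & smooth_within (\<phi> ` (U \<inter> V)) (\<psi> \<circ> inv_into U \<phi>)"
   if "(U, \<phi>) \<in> charts (submfd N S)" "(V, \<psi>) \<in> charts (submfd N S)" for U \<phi> V \<psi>
   by (rule sb.compatible[OF that])
  show "\<exists>n. \<forall>(U, \<phi>)\<in>charts (submfd N S). \<exists>H. subspace H & dim H = n & openin (top_of_set H) (\<phi> ` U)"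
  proof (intro exI[of _ "dim H0"] ballI, clarify)
   fix U \<phi> assume c: "(U, \<phi>) \<in> charts (submfd N S)"
   show "\<exists>H. subspace H & dim H = dim H0 & openin (top_of_set H) (\<phi> ` U)"
   proof (cases "U = {}")
    case True
    then show ?thesis using H0 by auto
   next
    case False
    then obtain p where p: "p \<in> U" by blast
    then have "p \<in> S" using sub_chart(1)[OF c] by blast
    then obtain V \<psi> H' where V: "(V, \<psi>) \<in> charts (submfd N S)" "p \<in> V" "subspace H'" "dim H' = dim H0"
     "openin (top_of_set H') (\<psi> ` V)" using adapted by blast
    obtain H where H: "subspace H" "openin (top_of_set H) (\<phi> ` U)" using sub_chart(4)[OF c] by blast
    have "dim H = dim H'"
     using adapted_dim[OF c V(1) p V(2) H V(3,5)] adapted_dim[OF V(1) c V(2) p V(3,5) H] by simp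
    then show ?thesis using H V(4) by auto
   qed
  qed
  show "Hausdorff_space (mtop (submfd N S))"
   unfolding mtop_submfd by (rule Hausdorff_space_subtopology[OF smooth_manifold.hausdorff[OF N]])
  show "second_countable (mtop (submfd N S))"
   unfolding mtop_submfd by (rule second_countable_subtopology[OF smooth_manifold.second_countable[OF N]])
 qed
qed

lemma sub_into: "p \<in> S ==> sm_at (submfd N S) S N (%y. y) p"
proof -
 assume p: "p \<in> S"
 then obtain U \<kappa> where c: "(U, \<kappa>) \<in> charts (submfd N S)" "p \<in> U" using adapted by blast
 have inv: "inv_into U \<kappa> (\<kappa> y) = y" if "y \<in> U" for y using sub_chart(3)[OF c(1)] that by simp
 have "sm_at (submfd N S) U euclid \<kappa> p" by (rule sm_at_chart[OF sub_atlas c])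
 from sm_at_compose[OF atlas_euclid at this sub_chart(6)[OF c(1) imageI[OF c(2)]] c(2) imageI]
 have "sm_at (submfd N S) U N (%y. inv_into U \<kappa> (\<kappa> y)) p" by blast
 then have "sm_at (submfd N S) U N (%y. y) p" by (rule sm_at_cong) (use c inv in auto)
 then have "sm_at (submfd N S) (S \<inter> U) N (%y. y) p" by (rule sm_at_subset) auto
 then show ?thesis by (rule sm_at_nbhd_mono[OF sub_atlas _ atlas.openin_chart_dom[OF sub_atlas c(1)] c(2)])
qed

lemma into_sub: "p \<in> S ==> sm_at N S (submfd N S) (%y. y) p"
proof -
 assume p: "p \<in> S"
 then obtain U \<kappa> where c: "(U, \<kappa>) \<in> charts (submfd N S)" "p \<in> U" using adapted by blast
 obtain Q where Q: "openin (mtop N) Q" "U = Q \<inter> S" using sub_chart(2)[OF c(1)] by blast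
 have "sm_at N U (submfd N S) (%y. y) p"
  by (rule sm_at_via_chart[OF at c(2) c(1) c(2) sub_chart(5)[OF c] Q(1)]) (use c Q in auto)
 then have "sm_at N (S \<inter> Q) (submfd N S) (%y. y) p" using Q(2) by (simp add: Int_commute)
 then show ?thesis by (rule sm_at_nbhd_mono[OF at _ Q(1)]) (use Q(2) c(2) in auto)
qed

lemma sm_at_to_sub:
 assumes "x \<in> T" "!!y. y \<in> T ==> f y \<in> S"
 shows "sm_at P T (submfd N S) f x \<longleftrightarrow> sm_at P T N f x"
proof
 assume "sm_at P T (submfd N S) f x"
 from sm_at_compose[OF sub_atlas at this sub_into assms(1)] assms
 show "sm_at P T N f x" by simp
next
 assume "sm_at P T N f x"
 from sm_at_compose[OF at sub_atlas this into_sub assms(1)] assms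
 show "sm_at P T (submfd N S) f x" by simp
qed

lemma sm_at_from_sub:
 assumes "atlas P" "T \<subseteq> S" "x \<in> T"
 shows "sm_at (submfd N S) T P f x \<longleftrightarrow> sm_at N T P f x"
proof -
 have x: "x \<in> S" using assms by blast
 have 1: "sm_at N T (submfd N S) (%y. y) x" "sm_at (submfd N S) T N (%y. y) x"
  using sm_at_subset[OF into_sub[OF x] assms(2)] sm_at_subset[OF sub_into[OF x] assms(2)] by auto
 show ?thesis
  using sm_at_compose[OF sub_atlas assms(1) 1(1), of T f] sm_at_compose[OF at assms(1) 1(2), of T f] assms(3) by auto
qed

end

section \<open>Tangent maps and Lie brackets\<close>

lemma tangent_map_mem:
 assumes "smooth_manifold N" "smooth_manifold P" and X: "X \<in> pts (TB N)" and f: "sma N P f (fst X)"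
 shows "tangent_map P f X \<in> pts (TB P)"
proof -
 note N = smooth_manifold_atlas[OF assms(1)] and P = smooth_manifold_atlas[OF assms(2)]
 have p: "fst X \<in> pts N" "snd X \<in> tangent_space N (fst X)" using X by auto
 have q: "f (fst X) \<in> pts P" by (rule sm_at_pts[OF P f])
 obtain W where W: "openin (mtop N) W" "fst X \<in> W" "\<forall>y\<in>W. sma N P f y" using sm_at_nbhd[OF N f] by blast
 have gf: "g \<circ> f \<in> smooth_near N (fst X)" if "g \<in> smooth_near P (f (fst X))" for g
 proof -
  have g: "sma P euclid g (f (fst X))" using that smooth_near_iff[OF P q] by simp
  have fW: "sm_at N W P f (fst X)" using f sm_at_open[OF N W(1,2)] by blast
  have "sm_at N W euclid (%y. g (f y)) (fst X)"
   by (rule sm_at_compose[OF P atlas_euclid fW g W(2)]) (rule sm_at_pts[OF P bspec[OF W(3)]])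
  then show ?thesis unfolding smooth_near_iff[OF N p(1)] comp_def using sm_at_open[OF N W(1,2)] by blast
 qed
 note D = p(2) and add = near_add[OF P q] and mult = near_mult[OF P q] and const = near_const[OF P q]
 have c: "(%x. g x + h x) \<circ> f = (%x. (g \<circ> f) x + (h \<circ> f) x)" "(%x. g x * h x) \<circ> f = (%x. (g \<circ> f) x * (h \<circ> f) x)"
  "(%x. k * h x) \<circ> f = (%x. k * (h \<circ> f) x)" for g h :: "'c => real" and k by auto
 have "snd (tangent_map P f X) \<in> tangent_space P (f (fst X))"
  unfolding tangent_space_def tangent_map_def
  using add mult mult[OF const] gf tan_add[OF D gf gf] tan_mult[OF D gf gf] tan_scale[OF D gf]
  by (auto simp: c comp_apply[of _ f "fst X"] simp del: comp_apply)
 then show ?thesis using q by (auto simp: tangent_map_def)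
qed

definition vector_field :: "('p, 'c::euclidean_space) manifold => ('p => 'p tvec) => bool" where
 "vector_field N X \<longleftrightarrow> (\<forall>p\<in>pts N. X p \<in> pts (TB N) & fst (X p) = p & sma N (TB N) X p)"

lemma vector_fieldD:
 assumes "vector_field N X" "p \<in> pts N"
 shows "X p \<in> pts (TB N)" "fst (X p) = p" "snd (X p) \<in> tangent_space N p" "sma N (TB N) X p"
proof -
 show 1: "X p \<in> pts (TB N)" "fst (X p) = p" "sma N (TB N) X p"
  using assms by (auto simp: vector_field_def)
 then show "snd (X p) \<in> tangent_space N p" by auto
qed

lemma sma_apply:
 assumes N: "smooth_manifold N" and X: "sm_at P S (TB N) X x" "!!y. y \<in> S ==> X y \<in> pts (TB N)"
  and x: "x \<in> S" and f: "sma N euclid f (fst (X x))"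
 shows "sm_at P S euclid (%y. snd (X y) f) x"
 by (rule sm_at_compose[OF atlas_tangent[OF N] atlas_euclid X(1) sma_eval[OF N X(2)[OF x] f] x X(2)])

lemma near_apply:
 assumes N: "smooth_manifold N" and X: "vector_field N X" and p: "p \<in> pts N" and f: "f \<in> smooth_near N p"
 shows "(%y. snd (X y) f) \<in> smooth_near N p"
proof -
 note at = smooth_manifold_atlas[OF N]
 have "sma N euclid f p" using f smooth_near_iff[OF at p] by simp
 then have "sma N euclid (%y. snd (X y) f) p"
  using vector_fieldD[OF X] p by (intro sma_apply[OF N]) auto
 then show ?thesis using smooth_near_iff[OF at p] by simp
qed

lemma near_nbhd:
 assumes at: "atlas N" and p: "p \<in> pts N" and f: "f \<in> smooth_near N p"
 shows "\<exists>W. openin (mtop N) W & p \<in> W & W \<subseteq> pts N & (\<forall>y\<in>W. f \<in> smooth_near N y)"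
proof -
 have "sma N euclid f p" using f smooth_near_iff[OF at p] by simp
 then obtain W where W: "openin (mtop N) W" "p \<in> W" "\<forall>y\<in>W. sma N euclid f y" using sm_at_nbhd[OF at] by blast
 moreover have "W \<subseteq> pts N" using openin_subset[OF W(1)] atlas.topspace_mtop[OF at] by simp
 ultimately show ?thesis using smooth_near_iff[OF at] by blast
qed

lemma lie_bracket_apply:
 "p \<in> pts N ==> f \<in> smooth_near N p ==> snd (lie_bracket N X Y p) f =
   snd (X p) (%x. snd (Y x) f) - snd (Y p) (%x. snd (X x) f)"
 and fst_lie_bracket: "p \<in> pts N ==> fst (lie_bracket N X Y p) = p"
 by (simp_all add: lie_bracket_def)

text \<open>The terms of second order cancel in the product rule. Smoothness follows by evaluating on functions.\<close>

lemma vector_field_lie_bracket: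
 assumes N: "smooth_manifold N" and X: "vector_field N X" and Y: "vector_field N Y"
 shows "vector_field N (lie_bracket N X Y)"
proof -
 note at = smooth_manifold_atlas[OF N]
 have tan: "lie_bracket N X Y p \<in> pts (TB N)" if p: "p \<in> pts N" for p
 proof -
  note near = near_add[OF at p] near_mult[OF at p] near_const[OF at p]
  note Xp = vector_fieldD(3)[OF X] and Yp = vector_fieldD(3)[OF Y]
  note Xn = near_apply[OF N X p] and Yn = near_apply[OF N Y p]
  let ?D = "snd (lie_bracket N X Y p)"
  note ap = lie_bracket_apply[OF p, of _ X Y]
  have "?D (%x. f x + g x) = ?D f + ?D g & ?D (%x. f x * g x) = ?D f * g p + f p * ?D g"
   if f: "f \<in> smooth_near N p" and g: "g \<in> smooth_near N p" for f g
  proof -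
   obtain W1 where W1: "openin (mtop N) W1" "p \<in> W1" "W1 \<subseteq> pts N" "\<forall>y\<in>W1. f \<in> smooth_near N y"
    using near_nbhd[OF at p f] by blast
   obtain W2 where W2: "openin (mtop N) W2" "p \<in> W2" "\<forall>y\<in>W2. g \<in> smooth_near N y"
    using near_nbhd[OF at p g] by blast
   have W: "openin (mtop N) (W1 \<inter> W2)" "p \<in> W1 \<inter> W2" using W1 W2 by auto
   have key: "snd (A p) (%x. snd (B x) (%x. f x + g x)) = snd (A p) (%x. snd (B x) f) + snd (A p) (%x. snd (B x) g) &
     snd (A p) (%x. snd (B x) (%x. f x * g x)) = snd (A p) (%x. snd (B x) f) * g p + snd (B p) f * snd (A p) g
      + (snd (A p) f * snd (B p) g + f p * snd (A p) (%x. snd (B x) g))"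
    if A: "vector_field N A" and B: "vector_field N B" for A B
   proof
    note Ap = vector_fieldD(3)[OF A p] and Bn = near_apply[OF N B p]
    have "snd (A p) (%x. snd (B x) (%x. f x + g x)) = snd (A p) (%x. snd (B x) f + snd (B x) g)"
     by (rule tan_local[OF at p Ap Bn[OF near(1)[OF f g]] near(1)[OF Bn[OF f] Bn[OF g]] W])
      (use W1 W2 in \<open>auto intro!: tan_add[OF vector_fieldD(3)[OF B]]\<close>)
    then show "snd (A p) (%x. snd (B x) (%x. f x + g x)) = snd (A p) (%x. snd (B x) f) + snd (A p) (%x. snd (B x) g)"
     using tan_add[OF Ap Bn[OF f] Bn[OF g]] by simp
    have "snd (A p) (%x. snd (B x) (%x. f x * g x)) = snd (A p) (%x. snd (B x) f * g x + f x * snd (B x) g)"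
     by (rule tan_local[OF at p Ap Bn[OF near(2)[OF f g]] near(1)[OF near(2)[OF Bn[OF f] g] near(2)[OF f Bn[OF g]]] W])
      (use W1 W2 in \<open>auto intro!: tan_mult[OF vector_fieldD(3)[OF B]]\<close>)
    then show "snd (A p) (%x. snd (B x) (%x. f x * g x)) = snd (A p) (%x. snd (B x) f) * g p + snd (B p) f * snd (A p) g
      + (snd (A p) f * snd (B p) g + f p * snd (A p) (%x. snd (B x) g))"
     using tan_add[OF Ap near(2)[OF Bn[OF f] g] near(2)[OF f Bn[OF g]]]
      tan_mult[OF Ap Bn[OF f] g] tan_mult[OF Ap f Bn[OF g]] by simp
   qed
   show ?thesis
    unfolding ap[OF near(1)[OF f g]] ap[OF near(2)[OF f g]] ap[OF f] ap[OF g]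
    using key[OF X Y] key[OF Y X] by (simp add: algebra_simps)
  qed
  note both = this
  have const: "?D (%_. a) = 0" for a
  proof -
   have "snd (A p) (%x. snd (B x) (%_. a)) = 0" if A: "vector_field N A" and B: "vector_field N B" for A B
   proof -
    have "snd (A p) (%x. snd (B x) (%_. a)) = snd (A p) (%_. 0)"
     by (rule tan_local[OF at p vector_fieldD(3)[OF A p] near_apply[OF N B p near(3)] near(3) atlas.openin_pts[OF at] p])
      (rule tan_const[OF at _ vector_fieldD(3)[OF B]], assumption+)
    then show ?thesis using tan_const[OF at p vector_fieldD(3)[OF A p]] by simp
   qed
   then show ?thesis using ap[OF near(3), of a] X Y by simp
  qed
  have "?D (%x. a * f x) = a * ?D f" if f: "f \<in> smooth_near N p" for a f
   using both[OF near(3)[of a] f] const by simp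
  then have "?D \<in> tangent_space N p"
   using both unfolding tangent_space_def by (auto simp: lie_bracket_def p)
  then show ?thesis using p fst_lie_bracket[OF p, of X Y] by (metis SigmaI prod.collapse pts_tangent)
 qed
 show ?thesis
  unfolding vector_field_def
 proof (intro ballI conjI tan fst_lie_bracket)
  fix p assume p: "p \<in> pts N"
  show "sma N (TB N) (lie_bracket N X Y) p"
  proof (rule sm_at_tangentI[OF at N p tan _ _ p])
   show "sma N N (%y. fst (lie_bracket N X Y y)) p"
    by (rule sm_at_cong[OF sm_at_id[OF at p] p]) (simp add: fst_lie_bracket)
   fix f :: "_ => real" assume "sma N euclid f (fst (lie_bracket N X Y p))"
   then have f: "f \<in> smooth_near N p" using fst_lie_bracket[OF p] smooth_near_iff[OF at p] by simp
   obtain W where W: "openin (mtop N) W" "p \<in> W" "W \<subseteq> pts N" "\<forall>y\<in>W. f \<in> smooth_near N y"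
    using near_nbhd[OF at p f] by blast
   have "sma N euclid (%y. snd (X y) (%x. snd (Y x) f) - snd (Y y) (%x. snd (X x) f)) p"
    using near_apply[OF N X p near_apply[OF N Y p f]] near_apply[OF N Y p near_apply[OF N X p f]]
    unfolding smooth_near_iff[OF at p] by (rule sm_at_diff[OF at p])
   then show "sma N euclid (%y. snd (lie_bracket N X Y y) f) p"
    by (rule sm_at_eq_near[OF at _ W(1,2) p]) (use W(4) lie_bracket_apply in force)
  qed
 qed
qed

section \<open>Local trivialisations and adapted coordinates\<close>

lemma mem_tangentI:
 "fst Z \<in> pts N ==> snd Z \<in> tangent_space N (fst Z) ==> Z \<in> pts (TB N)"
 by (cases Z) auto

locale triv =
 fixes N :: "('p, 'b::euclidean_space) manifold" and X :: "('a, 'c::euclidean_space) manifold"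
  and pr :: "'a => 'p" and F :: "'f::euclidean_space set" and U :: "'p set" and \<Phi> :: "'a => 'p \<times> 'f"
 assumes N: "smooth_manifold N" and X: "smooth_manifold X" and pr: "!!a. a \<in> pts X ==> sma X N pr a"
  and lt: "local_triv N X pr F U \<Phi>"
begin

abbreviation "XU \<equiv> {a \<in> pts X. pr a \<in> U}"
abbreviation "y \<equiv> (%a. snd (\<Phi> a))"

definition \<Theta> :: "'p => 'f => 'a" where "\<Theta> x f = inv_into XU \<Phi> (x, f)"

lemma atN: "atlas N" and atX: "atlas X"
 using smooth_manifold_atlas N X by auto

lemma openU: "openin (mtop N) U"
 using lt by (simp add: local_triv_def Let_def)

lemma pr_pts: "a \<in> pts X ==> pr a \<in> pts N"
 using sm_at_pts[OF atN pr] .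

lemma open_over: assumes Q: "openin (mtop N) Q" shows "openin (mtop X) {a \<in> pts X. pr a \<in> Q}"
proof (subst openin_subopen, rule ballI)
 fix a assume a: "a \<in> {a \<in> pts X. pr a \<in> Q}"
 then have "a \<in> pts X" "pr a \<in> Q" by auto
 from sm_at_continuous[OF atX atN pr[OF this(1)] this(1) Q this(2)]
 obtain T where T: "openin (mtop X) T" "a \<in> T" "pr ` (pts X \<inter> T) \<subseteq> Q" by blast
 moreover have "T \<subseteq> pts X" using openin_subset[OF T(1)] atlas.topspace_mtop[OF atX] by simp
 ultimately show "\<exists>T. openin (mtop X) T & a \<in> T & T \<subseteq> {a \<in> pts X. pr a \<in> Q}" by blast
qed

lemma bij: "bij_betw \<Phi> XU (U \<times> F)" and fst_triv: "a \<in> XU ==> fst (\<Phi> a) = pr a"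
 using lt by (auto simp: local_triv_def Let_def)

lemma triv_smooth: "a \<in> XU ==> sm_at X XU (prod_mfd N euclid) \<Phi> a"
 and triv_inv_smooth: "x \<in> U ==> f \<in> F ==> sm_at (prod_mfd N euclid) (U \<times> F) X (inv_into XU \<Phi>) (x, f)"
 using lt smooth_map_on_iff[OF atX atlas_prod[OF atN atlas_euclid], of XU \<Phi>]
  smooth_map_on_iff[OF atlas_prod[OF atN atlas_euclid] atX, of "U \<times> F" "inv_into XU \<Phi>"]
 by (auto simp: local_triv_def Let_def)

lemma y_smooth: "a \<in> XU ==> sma X euclid y a"
 using sm_at_snd[OF triv_smooth] sm_at_open[OF atX open_over[OF openU]] by blast

lemma y_in: "a \<in> XU ==> y a \<in> F"
 using bij_betwE[OF bij] by (metis mem_Times_iff)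

lemma \<Theta>: assumes "x \<in> U" "f \<in> F"
 shows "\<Theta> x f \<in> XU" "pr (\<Theta> x f) = x" "y (\<Theta> x f) = f"
proof -
 have m: "(x, f) \<in> \<Phi> ` XU" using bij assms by (simp add: bij_betw_def)
 show 1: "\<Theta> x f \<in> XU" unfolding \<Theta>_def by (rule inv_into_into[OF m])
 have "\<Phi> (\<Theta> x f) = (x, f)" unfolding \<Theta>_def by (rule f_inv_into_f[OF m])
 then show "pr (\<Theta> x f) = x" "y (\<Theta> x f) = f" using fst_triv[OF 1] by auto
qed

lemma \<Theta>_y: assumes "a \<in> XU" shows "\<Theta> (pr a) (y a) = a"
proof -
 have "(pr a, y a) = \<Phi> a" using fst_triv[OF assms] by (simp add: prod_eq_iff)
 then show ?thesis using bij assms by (simp add: \<Theta>_def bij_betw_def)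
qed

lemma triv_eqI: "a \<in> XU ==> a' \<in> XU ==> pr a = pr a' ==> y a = y a' ==> a = a'"
 using \<Theta>_y by metis

lemma \<Theta>_smooth:
 assumes P: "atlas P" and x: "x \<in> S" and u: "sm_at P S N u x" "sm_at P S euclid h x"
  and in_UF: "!!z. z \<in> S ==> u z \<in> U & h z \<in> F"
 shows "sm_at P S X (%z. \<Theta> (u z) (h z)) x"
 unfolding \<Theta>_def
proof (rule sm_at_compose[OF atlas_prod[OF atN atlas_euclid] atX])
 show "sm_at P S (prod_mfd N euclid) (%z. (u z, h z)) x"
  by (rule sm_at_Pair[OF P atN atlas_euclid x u])
 show "sm_at (prod_mfd N euclid) (U \<times> F) X (inv_into XU \<Phi>) (u x, h x)"
  using triv_inv_smooth in_UF[OF x] by simp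
qed (use x in_UF in auto)

lemma sm_at_trivI:
 assumes P: "atlas P" and x: "x \<in> S" and W: "openin (mtop P) W" "x \<in> W"
  and s: "!!z. z \<in> S ==> z \<in> W ==> s z \<in> XU"
  and b: "sm_at P S N (%z. pr (s z)) x" and v: "sm_at P S euclid (%z. y (s z)) x"
 shows "sm_at P S X s x"
proof -
 have sub: "sm_at P (S \<inter> W) N (%z. pr (s z)) x" "sm_at P (S \<inter> W) euclid (%z. y (s z)) x"
  using sm_at_subset[OF b] sm_at_subset[OF v] by auto
 have "sm_at P (S \<inter> W) X (%z. \<Theta> (pr (s z)) (y (s z))) x"
  by (rule \<Theta>_smooth[OF P _ sub]) (use x W s y_in in auto)
 then have "sm_at P (S \<inter> W) X s x"
  by (rule sm_at_cong) (use x W s \<Theta>_y in auto)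
 then show ?thesis by (rule sm_at_nbhd_mono[OF P _ W])
qed

lemma y_comp:
 assumes "x \<in> S" "sm_at P S X s x" "s x \<in> XU" "!!z. z \<in> S ==> s z \<in> pts X"
 shows "sm_at P S euclid (%z. y (s z)) x"
 by (rule sm_at_compose[OF atX atlas_euclid assms(2) y_smooth[OF assms(3)] assms(1,4)])

definition adapted :: "('p => 'b) => 'a => 'b \<times> 'f" where "adapted \<phi> a = (\<phi> (pr a), y a)"

lemma adapted_gchart:
 assumes c: "(U0, \<phi>) \<in> charts N" and H: "gchart N U0 \<phi> H" and F: "subspace F"
 shows "gchart X {a \<in> pts X. pr a \<in> U \<inter> U0} (adapted \<phi>) (H \<times> F)"
proof -
 let ?W = "{a \<in> pts X. pr a \<in> U \<inter> U0}"
 have oU: "openin (mtop N) (U \<inter> U0)" using openU H by (auto simp: gchart_def)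
 have inv: "inv_into U0 \<phi> (\<phi> x) = x" if "x \<in> U0" for x using H that by (simp add: gchart_def)
 have inj: "inj_on (adapted \<phi>) ?W"
 proof (rule inj_onI)
  fix a b assume "a \<in> ?W" "b \<in> ?W" "adapted \<phi> a = adapted \<phi> b"
  then show "a = b" using triv_eqI[of a b] inv by (auto simp: adapted_def) metis
 qed
 have img: "adapted \<phi> ` ?W = \<phi> ` (U0 \<inter> U) \<times> F"
 proof (intro equalityI subsetI)
  fix z assume "z \<in> \<phi> ` (U0 \<inter> U) \<times> F"
  then obtain x where x: "x \<in> U0" "x \<in> U" "fst z = \<phi> x" "snd z \<in> F" by auto
  then have "z = adapted \<phi> (\<Theta> x (snd z))" "\<Theta> x (snd z) \<in> ?W"
   using \<Theta>[OF x(2,4)] by (auto simp: adapted_def prod_eq_iff)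
  then show "z \<in> adapted \<phi> ` ?W" by (rule image_eqI)
 qed (use y_in in \<open>auto simp: adapted_def\<close>)
 have "openin (top_of_set (\<phi> ` U0)) (\<phi> ` (U0 \<inter> U))"
  using openU c unfolding atlas.openin_mtop[OF atN] by auto
 then have "openin (top_of_set H) (\<phi> ` (U0 \<inter> U))"
  using openin_trans H by (auto simp: gchart_def)
 then have open_img: "openin (top_of_set (H \<times> F)) (adapted \<phi> ` ?W)"
  unfolding img by (intro openin_Times) auto
 have sm: "sma X euclid (adapted \<phi>) a" if a: "a \<in> ?W" for a
  unfolding adapted_def
 proof (rule sm_at_Pair_euclid[OF atX])
  show "sma X euclid (%a. \<phi> (pr a)) a"
   by (rule sm_at_compose[OF atN atlas_euclid pr sm_at_chart[OF atN c, where S = "pts N"]]) (use a pr_pts in auto)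
 qed (use a y_smooth in auto)
 have "sm_at euclid (adapted \<phi> ` ?W) X (inv_into ?W (adapted \<phi>)) z" if z: "z \<in> adapted \<phi> ` ?W" for z
 proof -
  have eu: "sm_at euclid (adapted \<phi> ` ?W) euclid fst z" "sm_at euclid (adapted \<phi> ` ?W) euclid snd z"
   by (auto intro!: sma_euclid[OF open_UNIV] Ck_on_blin bounded_linear_fst bounded_linear_snd)
  have zin: "fst w \<in> \<phi> ` U0 & inv_into U0 \<phi> (fst w) \<in> U & snd w \<in> F" if "w \<in> adapted \<phi> ` ?W" for w
   using that inv unfolding img by auto
  have "sm_at euclid (adapted \<phi> ` ?W) X (%w. \<Theta> (inv_into U0 \<phi> (fst w)) (snd w)) z"
  proof (rule \<Theta>_smooth[OF atlas_euclid z _ eu(2)])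
   show "sm_at euclid (adapted \<phi> ` ?W) N (%w. inv_into U0 \<phi> (fst w)) z"
    by (rule sm_at_compose[OF atlas_euclid atN eu(1) sm_at_chart_inv[OF atN c] z]) (use zin z in auto)
  qed (use zin in auto)
  then show ?thesis
  proof (rule sm_at_cong[OF _ z])
   fix w assume "w \<in> adapted \<phi> ` ?W"
   then obtain a where a: "a \<in> ?W" "w = adapted \<phi> a" by blast
   then have "inv_into ?W (adapted \<phi>) w = a" using inj by simp
   then show "\<Theta> (inv_into U0 \<phi> (fst w)) (snd w) = inv_into ?W (adapted \<phi>) w"
    using a \<Theta>_y[of a] inv by (simp add: adapted_def)
  qed
 qed
 then show ?thesis
  unfolding gchart_def using open_over[OF oU] inj open_img sm H F
  by (auto simp: gchart_def intro: subspace_Times)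
qed

text \<open>In adapted coordinates the first component of a tangent vector is its projection to the base.
  Prescribing the projection therefore leaves the second component free.\<close>

lemma cvec_adapted:
 assumes Z: "Z \<in> pts (TB X)" and c: "(U0, \<phi>) \<in> charts N" and p: "pr (fst Z) \<in> U0"
 shows "fst (cvec (adapted \<phi>) (snd Z)) = cvec \<phi> (snd (tangent_map N pr Z))"
  "snd (cvec (adapted \<phi>) (snd Z)) = cvec y (snd Z)"
proof -
 have "pr (fst Z) \<in> pts N" using Z pr_pts by auto
 then have near: "(%x. \<phi> x \<bullet> b) \<in> smooth_near N (pr (fst Z))" for b
  using sm_at_blin[OF bounded_linear_inner_left _ sm_at_chart[OF atN c p]] smooth_near_iff[OF atN] by blast
 show "fst (cvec (adapted \<phi>) (snd Z)) = cvec \<phi> (snd (tangent_map N pr Z))"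
  unfolding cvec_def sum_Basis_prod_eq
  by (simp add: fst_sum adapted_def tangent_map_def near comp_def)
 show "snd (cvec (adapted \<phi>) (snd Z)) = cvec y (snd Z)"
  unfolding cvec_def sum_Basis_prod_eq
  by (simp add: snd_sum adapted_def)
qed

end

section \<open>Tangent vectors of the total space over prescribed tangent vectors of the base\<close>

text \<open>Both prolonged bundles are of the following form: pairs of a point \<open>b\<close> of a bundle with a
  map \<open>\<alpha>\<close> into the tangent bundle of the base, and a tangent vector of the total space that is
  projected to \<open>\<alpha> b\<close>.\<close>

definition pullback_pts :: "('p, 'b::euclidean_space) manifold => ('a, 'c::euclidean_space) manifold =>
  ('a => 'p) => ('q, 'd::euclidean_space) manifold => ('q => 'p tvec) => ('q \<times> 'a tvec) set" where
 "pullback_pts N X pr B \<alpha> = {(b, Z). b \<in> pts B & Z \<in> pts (TB X) & \<alpha> b = tangent_map N pr Z}"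

locale two_triv = X: triv N X pr F U \<Phi> + B: triv N B prB FB UB \<Phi>B
 for N :: "('p, 'b::euclidean_space) manifold" and X :: "('a, 'c::euclidean_space) manifold"
  and pr :: "'a => 'p" and F :: "'f::euclidean_space set" and U :: "'p set" and \<Phi> :: "'a => 'p \<times> 'f"
  and B :: "('q, 'd::euclidean_space) manifold" and prB :: "'q => 'p" and FB :: "'g::euclidean_space set"
  and UB :: "'p set" and \<Phi>B :: "'q => 'p \<times> 'g" +
 fixes \<alpha> :: "'q => 'p tvec" and U0 :: "'p set" and \<phi> :: "'p => 'b" and H :: "'b set"
 assumes \<alpha>: "!!b. b \<in> pts B ==> \<alpha> b \<in> pts (TB N) & fst (\<alpha> b) = prB b & sma B (TB N) \<alpha> b"
  and F: "subspace F" and c: "(U0, \<phi>) \<in> charts N" and H: "gchart N U0 \<phi> H"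
begin

abbreviation "PB \<equiv> pullback_pts N X pr B \<alpha>"
abbreviation "WX \<equiv> {a \<in> pts X. pr a \<in> U \<inter> U0}"
abbreviation "W \<equiv> {a \<in> pts X. pr a \<in> U \<inter> U0 \<inter> UB}"
abbreviation "BT \<equiv> prod_mfd B (TB X)"

lemmas gX = X.adapted_gchart[OF c H F]

lemma atBT: "atlas BT" using B.atX atlas_tangent[OF X.X] by simp

lemma openW: "openin (mtop X) W"
proof (rule X.open_over)
 show "openin (mtop N) (U \<inter> U0 \<inter> UB)" using X.openU B.openU H by (auto simp: gchart_def)
qed

lemma PB_D:
 assumes "(b, Z) \<in> PB"
 shows "b \<in> pts B" "Z \<in> pts (TB X)" "\<alpha> b = tangent_map N pr Z" "prB b = pr (fst Z)"
  "fst Z \<in> pts X" "snd Z \<in> tangent_space X (fst Z)"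
proof -
 show 1: "b \<in> pts B" "Z \<in> pts (TB X)" "\<alpha> b = tangent_map N pr Z"
  using assms by (auto simp: pullback_pts_def)
 have "fst (\<alpha> b) = prB b" using \<alpha>[OF 1(1)] by simp
 then show "prB b = pr (fst Z)" using 1(3) by (simp add: tangent_map_def)
 show "fst Z \<in> pts X" "snd Z \<in> tangent_space X (fst Z)" using 1(2) by auto
qed

text \<open>The inverse of the coordinates \<open>(e, f, g)\<close>: foot point of the tangent vector, fibre coordinate of
  \<open>b\<close>, and derivative of the fibre coordinate along the tangent vector. The component along the
  base is dictated by \<open>\<alpha> b\<close>.\<close>

definition \<Lambda> :: "'a => 'g => 'f => 'q \<times> 'a tvec" where
 "\<Lambda> e f g = (let b = B.\<Theta> (pr e) f in (b, pt_vec X WX (X.adapted \<phi>) e (cvec \<phi> (snd (\<alpha> b)), g)))"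

lemma \<alpha>_in_H: assumes "b \<in> pts B" "prB b \<in> U0" shows "cvec \<phi> (snd (\<alpha> b)) \<in> H"
proof (rule vec_in_subspace[OF X.atN H assms(2)])
 show "snd (\<alpha> b) \<in> tangent_space N (prB b)" using \<alpha>[OF assms(1)] by auto
qed

lemma \<Lambda>: assumes e: "e \<in> W" and f: "f \<in> FB" and g: "g \<in> F"
 shows "\<Lambda> e f g \<in> PB" "fst (snd (\<Lambda> e f g)) = e" "B.y (fst (\<Lambda> e f g)) = f"
  "cvec X.y (snd (snd (\<Lambda> e f g))) = g"
proof -
 let ?b = "B.\<Theta> (pr e) f"
 let ?\<xi> = "cvec \<phi> (snd (\<alpha> ?b))"
 let ?Z = "pt_vec X WX (X.adapted \<phi>) e (?\<xi>, g)"
 have pe: "pr e \<in> UB" "pr e \<in> U0" "e \<in> WX" "e \<in> pts X" using e by auto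
 note b = B.\<Theta>[OF pe(1) f]
 have \<xi>: "?\<xi> \<in> H" using \<alpha>_in_H[of ?b] b pe by auto
 then have h: "(?\<xi>, g) \<in> H \<times> F" using g by simp
 have Z: "snd ?Z \<in> tangent_space X e" by (rule pt_vec_tangent[OF X.atX gX pe(3) h])
 then have ZT: "?Z \<in> pts (TB X)" using pe(4) by (intro mem_tangentI) auto
 have cv: "cvec (X.adapted \<phi>) (snd ?Z) = (?\<xi>, g)" by (rule vec_pt_vec[OF X.atX gX pe(3) h])
 have pZ: "pr (fst ?Z) \<in> U0" using pe by simp
 have tm: "tangent_map N pr ?Z \<in> pts (TB N)"
  by (rule tangent_map_mem[OF X.X X.N ZT]) (use X.pr pe in simp)
 have f1: "fst (tangent_map N pr ?Z) = pr e" by (simp add: tangent_map_def)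
 have f2: "fst (\<alpha> ?b) = pr e" using \<alpha>[of ?b] b by auto
 have "snd (tangent_map N pr ?Z) = snd (\<alpha> ?b)"
 proof (rule tan_eqI[OF X.atN H pe(2)])
  show "snd (tangent_map N pr ?Z) \<in> tangent_space N (pr e)" using tm f1 by auto
  show "snd (\<alpha> ?b) \<in> tangent_space N (pr e)" using \<alpha>[of ?b] b f2 by auto
  show "cvec \<phi> (snd (tangent_map N pr ?Z)) = ?\<xi>" using X.cvec_adapted(1)[OF ZT c pZ] cv by simp
 qed
 then have "\<alpha> ?b = tangent_map N pr ?Z" using f1 f2 by (intro prod_eqI) auto
 then show "\<Lambda> e f g \<in> PB" using b ZT by (auto simp: \<Lambda>_def pullback_pts_def)
 show "fst (snd (\<Lambda> e f g)) = e" "B.y (fst (\<Lambda> e f g)) = f" using b by (auto simp: \<Lambda>_def Let_def)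
 show "cvec X.y (snd (snd (\<Lambda> e f g))) = g"
  using X.cvec_adapted(2)[OF ZT c pZ] cv by (simp add: \<Lambda>_def Let_def)
qed

lemma coords_in:
 assumes bZ: "(b, Z) \<in> PB" "fst Z \<in> W" shows "B.y b \<in> FB" "cvec X.y (snd Z) \<in> F" "prB b \<in> UB" "b \<in> B.XU"
proof -
 note d = PB_D[OF bZ(1)]
 show b: "prB b \<in> UB" "b \<in> B.XU" using d bZ(2) by auto
 show "B.y b \<in> FB" by (rule B.y_in[OF b(2)])
 have w: "fst Z \<in> WX" "pr (fst Z) \<in> U0" using bZ(2) by auto
 have "cvec (X.adapted \<phi>) (snd Z) \<in> H \<times> F" by (rule vec_in_subspace[OF X.atX gX w(1) d(6)])
 then show "cvec X.y (snd Z) \<in> F" using X.cvec_adapted(2)[OF d(2) c w(2)] by (metis mem_Times_iff)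
qed

lemma \<Lambda>_coords:
 assumes bZ: "(b, Z) \<in> PB" "fst Z \<in> W" shows "\<Lambda> (fst Z) (B.y b) (cvec X.y (snd Z)) = (b, Z)"
proof -
 note d = PB_D[OF bZ(1)] and ci = coords_in[OF bZ]
 have w: "fst Z \<in> WX" "pr (fst Z) \<in> U0" using bZ(2) by auto
 have b: "B.\<Theta> (pr (fst Z)) (B.y b) = b" using B.\<Theta>_y[OF ci(4)] d(4) by simp
 have "(cvec \<phi> (snd (\<alpha> b)), cvec X.y (snd Z)) = cvec (X.adapted \<phi>) (snd Z)"
  using X.cvec_adapted[OF d(2) c w(2)] d(3) by (simp add: prod_eq_iff)
 then have "pt_vec X WX (X.adapted \<phi>) (fst Z) (cvec \<phi> (snd (\<alpha> b)), cvec X.y (snd Z)) = Z"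
  using pt_vec_vec[OF X.atX gX w(1) d(6)] by simp
 then show ?thesis using b by (simp add: \<Lambda>_def)
qed

lemma \<Lambda>_smooth:
 assumes P: "atlas P" and x: "x \<in> S" "x \<in> pts P" and e: "sm_at P S X e x" and f: "sm_at P S euclid f x"
  and g: "sm_at P S euclid g x" and ins: "!!z. z \<in> S ==> e z \<in> W & f z \<in> FB & g z \<in> F"
 shows "sm_at P S BT (%z. \<Lambda> (e z) (f z) (g z)) x"
proof -
 have pre: "sm_at P S N (%z. pr (e z)) x"
  by (rule sm_at_compose[OF X.atX X.atN e X.pr x(1)]) (use ins x in auto)
 have b: "sm_at P S B (%z. B.\<Theta> (pr (e z)) (f z)) x"
  by (rule B.\<Theta>_smooth[OF P x(1) pre f]) (use ins in auto)
 have bin: "B.\<Theta> (pr (e z)) (f z) \<in> pts B & prB (B.\<Theta> (pr (e z)) (f z)) = pr (e z)" if "z \<in> S" for z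
  using B.\<Theta>[of "pr (e z)" "f z"] ins[OF that] by auto
 have \<alpha>b: "sm_at P S (TB N) (%z. \<alpha> (B.\<Theta> (pr (e z)) (f z))) x"
  by (rule sm_at_compose[OF B.atX atlas_tangent[OF X.N] b _ x(1)]) (use bin \<alpha> x in auto)
 have "sm_at P S euclid (%z. cvec \<phi> (snd (\<alpha> (B.\<Theta> (pr (e z)) (f z))))) x"
  unfolding cvec_def
 proof (rule sm_at_sum[OF P x(1,2)])
  fix i :: 'b
  have "sma N euclid (%q. \<phi> q \<bullet> i) (fst (\<alpha> (B.\<Theta> (pr (e x)) (f x))))"
  proof (rule sm_at_blin[OF bounded_linear_inner_left])
   have q: "fst (\<alpha> (B.\<Theta> (pr (e x)) (f x))) = pr (e x)" using \<alpha> bin[OF x(1)] by auto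
   then show "sma N euclid \<phi> (fst (\<alpha> (B.\<Theta> (pr (e x)) (f x))))"
    "fst (\<alpha> (B.\<Theta> (pr (e x)) (f x))) \<in> pts N"
    using sm_at_chart[OF X.atN c] ins[OF x(1)] X.pr_pts by auto
  qed
  from sma_apply[OF X.N \<alpha>b _ x(1) this] \<alpha> bin
  have "sm_at P S euclid (%z. snd (\<alpha> (B.\<Theta> (pr (e z)) (f z))) (%q. \<phi> q \<bullet> i)) x" by blast
  then show "sm_at P S euclid (%z. snd (\<alpha> (B.\<Theta> (pr (e z)) (f z))) (%q. \<phi> q \<bullet> i) *\<^sub>R i) x"
   by (rule sm_at_blin[OF bounded_linear_scaleR_left x(1)])
 qed
 note h = sm_at_Pair_euclid[OF P x(1) this g]
 have "sm_at P S (TB X) (%z. pt_vec X WX (X.adapted \<phi>) (e z)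
   (cvec \<phi> (snd (\<alpha> (B.\<Theta> (pr (e z)) (f z)))), g z)) x"
  by (rule sm_at_pt_vec[OF P X.X gX x e _ h]) (use ins \<alpha>_in_H bin in auto)
 from sm_at_Pair[OF P B.atX atlas_tangent[OF X.X] x(1) b this]
 show ?thesis unfolding \<Lambda>_def Let_def .
qed

lemma coords_smooth:
 assumes bZ: "p \<in> PB" "fst (snd p) \<in> W"
 shows "sm_at BT PB X (%p. fst (snd p)) p" "sm_at BT PB euclid (%p. B.y (fst p)) p"
  "sm_at BT PB euclid (%p. cvec X.y (snd (snd p))) p"
proof -
 have pd: "fst q \<in> pts B" "snd q \<in> pts (TB X)" "q \<in> pts BT" if "q \<in> PB" for q
  using that by (auto simp: pullback_pts_def)
 note pp = pd[OF bZ(1)]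
 have id: "sm_at BT PB BT (%q. q) p" by (rule sm_at_id[OF atBT pp(3)])
 note 1 = sm_at_fst[OF id] and 2 = sm_at_snd[OF id]
 show "sm_at BT PB X (%p. fst (snd p)) p"
  by (rule sm_at_compose[OF atlas_tangent[OF X.X] X.atX 2 sma_tangent_fst[OF X.X pp(2)] bZ(1) pd(2)])
 have "(fst p, snd p) \<in> PB" using bZ by simp
 from coords_in(4)[OF this bZ(2)]
 show "sm_at BT PB euclid (%p. B.y (fst p)) p"
  by (rule B.y_comp[OF bZ(1) 1 _ pd(1)])
 show "sm_at BT PB euclid (%p. cvec X.y (snd (snd p))) p"
  unfolding cvec_def
 proof (rule sm_at_sum[OF atBT bZ(1) pp(3)])
  fix i :: 'f
  have e: "fst (snd p) \<in> X.XU" using bZ(2) by auto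
  have "sma X euclid (%a. X.y a \<bullet> i) (fst (snd p))"
   by (rule sm_at_blin[OF bounded_linear_inner_left _ X.y_smooth[OF e]]) (use e in auto)
  from sma_apply[OF X.X 2 pd(2) bZ(1) this]
  show "sm_at BT PB euclid (%p. snd (snd p) (%a. X.y a \<bullet> i) *\<^sub>R i) p"
   by (rule sm_at_blin[OF bounded_linear_scaleR_left bZ(1)])
 qed
qed

end

section \<open>Pullbacks of tangent vectors as embedded submanifolds\<close>

context two_triv
begin

lemma PB_pts: assumes "q \<in> PB"
 shows "fst q \<in> pts B" "snd q \<in> pts (TB X)" "q \<in> pts BT" "fst (snd q) \<in> pts X"
 using assms by (auto simp: pullback_pts_def)

lemma \<Lambda>_coords': "q \<in> PB ==> fst (snd q) \<in> W ==>
  \<Lambda> (fst (snd q)) (B.y (fst q)) (cvec X.y (snd (snd q))) = q"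
 using \<Lambda>_coords[of "fst q" "snd q"] by simp

lemma coords_in': assumes "q \<in> PB" "fst (snd q) \<in> W"
 shows "B.y (fst q) \<in> FB" "cvec X.y (snd (snd q)) \<in> F"
 using coords_in[of "fst q" "snd q"] assms by auto

lemma open_PB_over:
 assumes Q: "openin (mtop X) Q" shows "openin (subtopology (mtop BT) PB) {p \<in> PB. fst (snd p) \<in> Q}"
proof -
 have "openin (mtop BT) (pts B \<times> Sigma Q (tangent_space X))"
  unfolding mtop_prod[OF B.atX atlas_tangent[OF X.X]] openin_prod_Times_iff
  using openin_tangent_fst[OF X.X Q] atlas.openin_pts[OF B.atX] by simp
 moreover have "{p \<in> PB. fst (snd p) \<in> Q} = (pts B \<times> Sigma Q (tangent_space X)) \<inter> PB"
  by (auto simp: pullback_pts_def)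
 ultimately show ?thesis by (auto simp: openin_subtopology)
qed

text \<open>The factor \<open>{0}\<close> only serves to place the typical fibre in the model type of the total space.\<close>

lemma pullback_local_triv:
 assumes em: "embedded BT PB H'"
 shows "local_triv X (submfd BT PB) (%(b, Z). fst Z) (FB \<times> F \<times> {0::'c}) W
   (%(b, Z). (fst Z, B.y b, cvec X.y (snd Z), 0))"
proof -
 interpret em: embedded BT PB H' by (rule em)
 let ?P = "%p :: 'q \<times> 'a tvec. fst (snd p)"
 let ?\<Psi> = "%p :: 'q \<times> 'a tvec. (fst (snd p), B.y (fst p), cvec X.y (snd (snd p)), 0::'c)"
 let ?XU = "{p \<in> PB. ?P p \<in> W}"
 let ?F = "FB \<times> F \<times> {0::'c}"
 have b: "bij_betw ?\<Psi> ?XU (W \<times> ?F)"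
 proof (rule bij_betw_imageI)
  show "inj_on ?\<Psi> ?XU"
  proof (rule inj_onI)
   fix p q assume "p \<in> ?XU" "q \<in> ?XU" "?\<Psi> p = ?\<Psi> q"
   then have pq: "p \<in> PB" "?P p \<in> W" "q \<in> PB" "?P q \<in> W" and e: "?P p = ?P q" "B.y (fst p) = B.y (fst q)"
    "cvec X.y (snd (snd p)) = cvec X.y (snd (snd q))" by blast+
   show "p = q" using \<Lambda>_coords'[OF pq(1,2)] unfolding e \<Lambda>_coords'[OF pq(3,4)] by (rule sym)
  qed
  show "?\<Psi> ` ?XU = W \<times> ?F"
  proof (intro equalityI subsetI)
   fix z assume "z \<in> ?\<Psi> ` ?XU"
   then show "z \<in> W \<times> ?F" using coords_in' by auto
  next
   fix z assume "z \<in> W \<times> ?F"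
   then obtain e f g where z: "z = (e, f, g, 0)" "e \<in> W" "f \<in> FB" "g \<in> F" by auto
   have "z = ?\<Psi> (\<Lambda> e f g)" "\<Lambda> e f g \<in> ?XU" using \<Lambda>[OF z(2-4)] z by auto
   then show "z \<in> ?\<Psi> ` ?XU" by (rule image_eqI)
  qed
 qed
 have inj: "inj_on ?\<Psi> ?XU" using b by (simp add: bij_betw_def)
 have s1: "smooth_map_on (submfd BT PB) ?XU (prod_mfd X euclid) ?\<Psi>"
  unfolding smooth_map_on_iff[OF em.sub_atlas atlas_prod[OF X.atX atlas_euclid]]
 proof (intro conjI ballI)
  fix p assume p: "p \<in> ?XU"
  then have pP: "p \<in> PB" "fst (snd p) \<in> W" by auto
  note cs = coords_smooth[OF pP]
  have "sm_at BT PB euclid (%p. (B.y (fst p), cvec X.y (snd (snd p)), 0::'c)) p"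
   by (intro sm_at_Pair_euclid[OF atBT pP(1)] cs(2,3) sm_at_const[OF atBT atlas_euclid PB_pts(3)[OF pP(1)]]) simp
  from sm_at_Pair[OF atBT X.atX atlas_euclid pP(1) cs(1) this]
  have "sm_at BT ?XU (prod_mfd X euclid) ?\<Psi> p" by (rule sm_at_subset) auto
  then show "sm_at (submfd BT PB) ?XU (prod_mfd X euclid) ?\<Psi> p"
   using em.sm_at_from_sub[OF atlas_prod[OF X.atX atlas_euclid], of ?XU p ?\<Psi>] p by auto
 qed auto
 have s2: "smooth_map_on (prod_mfd X euclid) (W \<times> ?F) (submfd BT PB) (inv_into ?XU ?\<Psi>)"
  unfolding smooth_map_on_iff[OF atlas_prod[OF X.atX atlas_euclid] em.sub_atlas]
 proof (intro conjI ballI)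
  note atP = atlas_prod[OF X.atX atlas_euclid]
  fix z assume z: "z \<in> W \<times> ?F"
  then have zp: "z \<in> pts (prod_mfd X euclid)" by auto
  have id: "sm_at (prod_mfd X euclid) (W \<times> ?F) (prod_mfd X euclid) (%w. w) z" by (rule sm_at_id[OF atP zp])
  note s = sm_at_snd[OF id]
  have "sm_at (prod_mfd X euclid) (W \<times> ?F) euclid (%w. fst (snd w)) z"
   by (rule sm_at_blin[OF bounded_linear_fst z s])
  moreover have "sm_at (prod_mfd X euclid) (W \<times> ?F) euclid (%w. fst (snd (snd w))) z"
   by (rule sm_at_blin[OF bounded_linear_fst z sm_at_blin[OF bounded_linear_snd z s]])
  ultimately have "sm_at (prod_mfd X euclid) (W \<times> ?F) BT (%w. \<Lambda> (fst w) (fst (snd w)) (fst (snd (snd w)))) z"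
   by (rule \<Lambda>_smooth[OF atP z zp sm_at_fst[OF id]]) auto
  then have "sm_at (prod_mfd X euclid) (W \<times> ?F) BT (inv_into ?XU ?\<Psi>) z"
  proof (rule sm_at_cong[OF _ z])
   fix w assume w: "w \<in> W \<times> ?F"
   then have "w \<in> ?\<Psi> ` ?XU" using b by (simp add: bij_betw_def)
   then obtain p where p: "p \<in> ?XU" "w = ?\<Psi> p" by blast
   then have "inv_into ?XU ?\<Psi> w = p" using inv_into_f_f[OF inj p(1)] by simp
   then show "\<Lambda> (fst w) (fst (snd w)) (fst (snd (snd w))) = inv_into ?XU ?\<Psi> w"
    using \<Lambda>_coords'[of p] p by simp
  qed
  moreover have "inv_into ?XU ?\<Psi> w \<in> PB" if "w \<in> W \<times> ?F" for w
  proof -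
   have "w \<in> ?\<Psi> ` ?XU" using b that by (simp add: bij_betw_def)
   from inv_into_into[OF this] show ?thesis by simp
  qed
  ultimately show "sm_at (prod_mfd X euclid) (W \<times> ?F) (submfd BT PB) (inv_into ?XU ?\<Psi>) z"
   using em.sm_at_to_sub[OF z] by blast
 qed auto
 show ?thesis
  unfolding local_triv_def Let_def pts_submfd case_prod_unfold
  using openW b s1 s2 by auto
qed

end

locale two_triv_model = two_triv N X pr F U \<Phi> B prB FB UB \<Phi>B \<alpha> U0 \<phi> H
 for N :: "('p, 'b::euclidean_space) manifold" and X :: "('a, 'c::euclidean_space) manifold"
  and pr :: "'a => 'p" and F :: "'c set" and U :: "'p set" and \<Phi> :: "'a => 'p \<times> 'c"
  and B :: "('q, 'd::euclidean_space) manifold" and prB :: "'q => 'p" and FB :: "'d set"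
  and UB :: "'p set" and \<Phi>B :: "'q => 'p \<times> 'd"
  and \<alpha> :: "'q => 'p tvec" and U0 :: "'p set" and \<phi> :: "'p => 'b" and H :: "'b set" +
 assumes FB: "subspace FB"
begin

text \<open>The model is \<open>FB \<times> HX \<times> F\<close>: the derivative along the base is a function of the other coordinates and
  drops out.\<close>

lemma pullback_chart:
 assumes cX: "(UX, \<phi>X) \<in> charts X" and HX: "gchart X UX \<phi>X HX"
 defines "U' \<equiv> {p \<in> PB. fst (snd p) \<in> W \<inter> UX}"
  and "\<kappa> \<equiv> (%p. (B.y (fst p), \<phi>X (fst (snd p)), cvec X.y (snd (snd p))))"
 shows "(U', \<kappa>) \<in> charts (submfd BT PB)" "openin (top_of_set (FB \<times> HX \<times> F)) (\<kappa> ` U')"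
proof -
 have inv: "inv_into UX \<phi>X (\<phi>X x) = x" if "x \<in> UX" for x using HX that by (simp add: gchart_def)
 have oW: "openin (mtop X) (W \<inter> UX)" using openW HX by (auto simp: gchart_def)
 have U'D: "p \<in> PB" "fst (snd p) \<in> W" "fst (snd p) \<in> UX" if "p \<in> U'" for p using that by (auto simp: U'_def)
 have inj: "inj_on \<kappa> U'"
 proof (rule inj_onI)
  fix p q assume p: "p \<in> U'" and q: "q \<in> U'" and eq: "\<kappa> p = \<kappa> q"
  have e3: "\<phi>X (fst (snd p)) = \<phi>X (fst (snd q))" using eq unfolding \<kappa>_def by blast
  have e: "fst (snd p) = fst (snd q)" by (metis e3 inv U'D(3) p q)
  have e1: "B.y (fst p) = B.y (fst q)" "cvec X.y (snd (snd p)) = cvec X.y (snd (snd q))"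
   using eq unfolding \<kappa>_def by blast+
  show "p = q" using \<Lambda>_coords'[OF U'D(1,2)[OF p]] unfolding e e1 \<Lambda>_coords'[OF U'D(1,2)[OF q]] by (rule sym)
 qed
 have img: "\<kappa> ` U' = FB \<times> \<phi>X ` (UX \<inter> W) \<times> F"
 proof (intro equalityI subsetI)
  fix z assume "z \<in> \<kappa> ` U'"
  then obtain p where "p \<in> U'" "z = \<kappa> p" by blast
  then show "z \<in> FB \<times> \<phi>X ` (UX \<inter> W) \<times> F"
   using U'D[of p] coords_in'[of p] by (auto simp: \<kappa>_def)
 next
  fix z assume "z \<in> FB \<times> \<phi>X ` (UX \<inter> W) \<times> F"
  then obtain f e g where z: "z = (f, \<phi>X e, g)" "f \<in> FB" "e \<in> UX" "e \<in> W" "g \<in> F" by auto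
  have "z = \<kappa> (\<Lambda> e f g)" "\<Lambda> e f g \<in> U'"
   using \<Lambda>[OF z(4,2,5)] z by (auto simp: \<kappa>_def U'_def)
  then show "z \<in> \<kappa> ` U'" by (rule image_eqI)
 qed
 have "openin (top_of_set (\<phi>X ` UX)) (\<phi>X ` (UX \<inter> W))"
  using openW cX unfolding atlas.openin_mtop[OF X.atX] by auto
 then have oX: "openin (top_of_set HX) (\<phi>X ` (UX \<inter> W))" using openin_trans HX by (auto simp: gchart_def)
 show oi: "openin (top_of_set (FB \<times> HX \<times> F)) (\<kappa> ` U')"
  unfolding img using oX by (intro openin_Times) auto
 have sub: "subspace (FB \<times> HX \<times> F)" using FB F HX by (auto simp: gchart_def intro!: subspace_Times)
 have "smooth_map_on BT U' euclid \<kappa>"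
  unfolding smooth_map_on_iff[OF atBT atlas_euclid]
 proof (intro conjI ballI)
  show "U' \<subseteq> pts BT" using U'D(1) PB_pts(3) by blast
  fix p assume p: "p \<in> U'"
  note cs = coords_smooth[OF U'D(1,2)[OF p]]
  have U'PB: "U' \<subseteq> PB" by (auto simp: U'_def)
  have "sm_at BT PB euclid (%p. \<phi>X (fst (snd p))) p"
   by (rule sm_at_compose[OF X.atX atlas_euclid cs(1) sm_at_chart[OF X.atX cX, where S = "pts X"]])
    (use U'D[OF p] PB_pts in auto)
  from this cs(2,3) have "sm_at BT PB euclid \<kappa> p"
   unfolding \<kappa>_def using U'D[OF p] by (intro sm_at_Pair_euclid[OF atBT]) auto
  then show "sm_at BT U' euclid \<kappa> p" using U'PB by (rule sm_at_subset)
 qed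
 moreover have "smooth_map_on euclid (\<kappa> ` U') BT (inv_into U' \<kappa>)"
  unfolding smooth_map_on_iff[OF atlas_euclid atBT]
 proof (intro conjI ballI)
  fix z assume z: "z \<in> \<kappa> ` U'"
  have zin: "fst w \<in> FB" "fst (snd w) \<in> \<phi>X ` UX" "inv_into UX \<phi>X (fst (snd w)) \<in> W" "snd (snd w) \<in> F"
   if "w \<in> \<kappa> ` U'" for w using that inv unfolding img by auto
  have eu: "sm_at euclid (\<kappa> ` U') euclid fst z" "sm_at euclid (\<kappa> ` U') euclid (%w. fst (snd w)) z"
   "sm_at euclid (\<kappa> ` U') euclid (%w. snd (snd w)) z"
   by (auto intro!: sma_euclid[OF open_UNIV] Ck_on_blin bounded_linear_fst bounded_linear_snd
     bounded_linear_compose[OF bounded_linear_fst bounded_linear_snd, unfolded comp_def]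
     bounded_linear_compose[OF bounded_linear_snd bounded_linear_snd, unfolded comp_def])
  have ei: "sm_at euclid (\<kappa> ` U') X (%w. inv_into UX \<phi>X (fst (snd w))) z"
   by (rule sm_at_compose[OF atlas_euclid X.atX eu(2) sm_at_chart_inv[OF X.atX cX] z]) (use zin z in auto)
  have "sm_at euclid (\<kappa> ` U') BT (%w. \<Lambda> (inv_into UX \<phi>X (fst (snd w))) (fst w) (snd (snd w))) z"
   by (rule \<Lambda>_smooth[OF atlas_euclid z _ ei eu(1,3)]) (use zin in auto)
  then show "sm_at euclid (\<kappa> ` U') BT (inv_into U' \<kappa>) z"
  proof (rule sm_at_cong[OF _ z])
   fix w assume "w \<in> \<kappa> ` U'"
   then obtain p where p: "p \<in> U'" "w = \<kappa> p" by blast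
   then have "inv_into U' \<kappa> w = p" using inj by simp
   then show "\<Lambda> (inv_into UX \<phi>X (fst (snd w))) (fst w) (snd (snd w)) = inv_into U' \<kappa> w"
    using \<Lambda>_coords'[OF U'D(1,2)[OF p(1)]] inv[OF U'D(3)[OF p(1)]] p(2) by (simp add: \<kappa>_def)
  qed
 qed simp
 moreover have "openin (subtopology (mtop BT) PB) U'" unfolding U'_def by (rule open_PB_over[OF oW])
 ultimately show "(U', \<kappa>) \<in> charts (submfd BT PB)"
  unfolding submfd_def using inj sub oi by auto
qed

end

locale pullback =
 fixes N :: "('p, 'b::euclidean_space) manifold" and X :: "('a, 'c::euclidean_space) manifold"
  and pr :: "'a => 'p" and F :: "'c set"
  and B :: "('q, 'd::euclidean_space) manifold" and prB :: "'q => 'p" and FB :: "'d set"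
  and \<alpha> :: "'q => 'p tvec"
 assumes N: "smooth_manifold N" and X: "smooth_manifold X" and B: "smooth_manifold B"
  and pr: "!!a. a \<in> pts X ==> sma X N pr a" and prB: "!!b. b \<in> pts B ==> sma B N prB b"
  and F: "subspace F" and FB: "subspace FB"
  and tX: "!!x. x \<in> pts N ==> \<exists>U \<Phi>. x \<in> U & local_triv N X pr F U \<Phi>"
  and tB: "!!x. x \<in> pts N ==> \<exists>U \<Phi>. x \<in> U & local_triv N B prB FB U \<Phi>"
  and \<alpha>: "!!b. b \<in> pts B ==> \<alpha> b \<in> pts (TB N) & fst (\<alpha> b) = prB b & sma B (TB N) \<alpha> b"
begin

abbreviation "PB \<equiv> pullback_pts N X pr B \<alpha>"
abbreviation "BT \<equiv> prod_mfd B (TB X)"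

lemma model:
 assumes "local_triv N X pr F U \<Phi>" "local_triv N B prB FB UB \<Phi>B" "(U0, \<phi>) \<in> charts N" "gchart N U0 \<phi> H"
 shows "two_triv_model N X pr F U \<Phi> B prB FB UB \<Phi>B \<alpha> U0 \<phi> H"
 by (intro two_triv_model.intro two_triv.intro triv.intro two_triv_axioms.intro two_triv_model_axioms.intro)
  (fact assms N X B pr prB F FB \<alpha>)+

lemma smooth_BT: "smooth_manifold BT"
proof -
 note T = smooth_manifold_tangent[OF X]
 note atB = smooth_manifold_atlas[OF B] and atT = smooth_manifold_atlas[OF T]
 interpret at: atlas BT using atB atT by simp
 obtain n where n: "\<forall>(U, \<phi>)\<in>charts B. \<exists>H. subspace H & dim H = n & openin (top_of_set H) (\<phi> ` U)"
  using smooth_manifold.chart_open[OF B] by blast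
 obtain m where m: "\<forall>(U, \<phi>)\<in>charts (TB X). \<exists>H. subspace H & dim H = m & openin (top_of_set H) (\<phi> ` U)"
  using smooth_manifold.chart_open[OF T] by blast
 show ?thesis
 proof
  show "(\<Union>(U, \<phi>)\<in>charts BT. U) = pts BT" by (rule at.cover)
  show "inj_on \<phi> U" if "(U, \<phi>) \<in> charts BT" for U \<phi> by (rule at.inj[OF that])
  show "openin (top_of_set (\<phi> ` U)) (\<phi> ` (U \<inter> V)) & smooth_within (\<phi> ` (U \<inter> V)) (\<psi> \<circ> inv_into U \<phi>)"
   if "(U, \<phi>) \<in> charts BT" "(V, \<psi>) \<in> charts BT" for U \<phi> V \<psi>
   by (rule at.compatible[OF that])
  show "\<exists>n. \<forall>(U, \<phi>)\<in>charts BT. \<exists>H. subspace H & dim H = n & openin (top_of_set H) (\<phi> ` U)"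
  proof (intro exI[of _ "n + m"] ballI, clarify)
   fix W \<kappa> assume "(W, \<kappa>) \<in> charts BT"
   then obtain U \<phi> V \<psi> where e: "W = U \<times> V" "\<kappa> = map_prod \<phi> \<psi>"
    and c: "(U, \<phi>) \<in> charts B" "(V, \<psi>) \<in> charts (TB X)" by (auto simp: charts_prod)
   from n c obtain H where H: "subspace H" "dim H = n" "openin (top_of_set H) (\<phi> ` U)" by blast
   from m c obtain K where K: "subspace K" "dim K = m" "openin (top_of_set K) (\<psi> ` V)" by blast
   have "map_prod \<phi> \<psi> ` (U \<times> V) = \<phi> ` U \<times> \<psi> ` V" by auto
   then show "\<exists>H. subspace H & dim H = n + m & openin (top_of_set H) (\<kappa> ` W)"
    unfolding e using H K
    by (intro exI[of _ "H \<times> K"]) (auto simp: dim_Times intro: subspace_Times openin_Times)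
  qed
  show "Hausdorff_space (mtop BT)"
   unfolding mtop_prod[OF atB atT] Hausdorff_space_prod_topology
   using smooth_manifold.hausdorff[OF B] smooth_manifold.hausdorff[OF T] by simp
  show "second_countable (mtop BT)"
   unfolding mtop_prod[OF atB atT]
   using smooth_manifold.second_countable[OF B] smooth_manifold.second_countable[OF T] by (rule second_countable_prod)
 qed
qed

lemma embedded_ex: "\<exists>H'. embedded BT PB H'"
proof -
 obtain n where n: "\<forall>(U, \<phi>)\<in>charts X. \<exists>H. dim H = n & gchart X U \<phi> H"
  using smooth_manifold_gchart[OF X] by blast
 have "\<exists>HX. subspace HX & (charts X \<noteq> {} --> dim (HX :: 'c set) = n)"
 proof (cases "charts X = {}")
  case True
  then show ?thesis by (intro exI[of _ UNIV]) auto
 next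
  case False
  then obtain U \<phi> where "(U, \<phi>) \<in> charts X" by auto
  with n obtain H where "dim H = n" "gchart X U \<phi> H" by blast
  then show ?thesis by (intro exI[of _ H]) (auto simp: gchart_def)
 qed
 then obtain HX :: "'c set" where HX: "subspace HX" "charts X \<noteq> {} ==> dim HX = n" by blast
 have "embedded BT PB (FB \<times> HX \<times> F)"
 proof (rule embedded.intro)
  show "smooth_manifold BT" by (rule smooth_BT)
  show "PB \<subseteq> pts BT" by (auto simp: pullback_pts_def)
  show "subspace (FB \<times> HX \<times> F)" using FB F HX by (intro subspace_Times)
  fix p assume p: "p \<in> PB"
  then have e: "fst (snd p) \<in> pts X" by (auto simp: pullback_pts_def)
  have x: "pr (fst (snd p)) \<in> pts N" by (rule sm_at_pts[OF smooth_manifold_atlas[OF N] pr[OF e]])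
  obtain U \<Phi> where U: "pr (fst (snd p)) \<in> U" "local_triv N X pr F U \<Phi>" using tX[OF x] by blast
  obtain UB \<Phi>B where UB: "pr (fst (snd p)) \<in> UB" "local_triv N B prB FB UB \<Phi>B" using tB[OF x] by blast
  obtain U0 \<phi> where c: "(U0, \<phi>) \<in> charts N" "pr (fst (snd p)) \<in> U0"
   using atlas.chart_at[OF smooth_manifold_atlas[OF N] x] by blast
  obtain H where H: "gchart N U0 \<phi> H" using chart_gchartE[OF N c(1)] by blast
  interpret m: two_triv_model N X pr F U \<Phi> B prB FB UB \<Phi>B \<alpha> U0 \<phi> H by (rule model[OF U(2) UB(2) c(1) H])
  obtain UX \<phi>X where cX: "(UX, \<phi>X) \<in> charts X" "fst (snd p) \<in> UX"
   using atlas.chart_at[OF smooth_manifold_atlas[OF X] e] by blast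
  with n obtain K where K: "dim K = n" "gchart X UX \<phi>X K" by blast
  note ch = m.pullback_chart[OF cX(1) K(2)]
  have "dim (FB \<times> K \<times> F) = dim (FB \<times> HX \<times> F)"
  proof -
   have "charts X \<noteq> {}" using cX by auto
   then have "dim K = dim HX" using K HX by simp
   moreover have "subspace K" using K by (simp add: gchart_def)
   ultimately show ?thesis using HX FB F by (simp add: dim_Times subspace_Times)
  qed
  moreover have "subspace (FB \<times> K \<times> F)" using FB F K by (auto simp: gchart_def intro!: subspace_Times)
  moreover have "p \<in> {p \<in> PB. fst (snd p) \<in> m.W \<inter> UX}" using p e U UB c cX by auto
  ultimately show "\<exists>U \<kappa> H. (U, \<kappa>) \<in> charts (submfd BT PB) & p \<in> U & subspace H &
    dim H = dim (FB \<times> HX \<times> F) & openin (top_of_set H) (\<kappa> ` U)"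
   using ch by blast
 qed
 then show ?thesis by blast
qed

lemma local_triv_at:
 fixes FB' :: "'g::euclidean_space set"
 assumes "local_triv N X pr F U \<Phi>" "local_triv N B prB FB' UB \<Phi>B" "(U0, \<phi>) \<in> charts N"
 shows "local_triv X (submfd BT PB) (%(b, Z). fst Z) (FB' \<times> F \<times> {0::'c}) {a \<in> pts X. pr a \<in> U \<inter> U0 \<inter> UB}
   (%(b, Z). (fst Z, snd (\<Phi>B b), cvec (%a. snd (\<Phi> a)) (snd Z), 0))"
proof -
 obtain H where H: "gchart N U0 \<phi> H" using chart_gchartE[OF N assms(3)] by blast
 obtain H' where em: "embedded BT PB H'" using embedded_ex by blast
 have "two_triv N X pr F U \<Phi> B prB FB' UB \<Phi>B \<alpha> U0 \<phi> H"
  by (intro two_triv.intro triv.intro two_triv_axioms.intro) (fact assms H N X B pr prB F \<alpha>)+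
 from two_triv.pullback_local_triv[OF this em] show ?thesis .
qed

text \<open>In adapted coordinates, the lift with vanishing derivative of the fibre coordinate does it.\<close>

lemma ex_over:
 assumes e: "e \<in> pts X" and b: "b \<in> pts B" "prB b = pr e"
 shows "\<exists>Z. (b, Z) \<in> PB & fst Z = e"
proof -
 have x: "pr e \<in> pts N" by (rule sm_at_pts[OF smooth_manifold_atlas[OF N] pr[OF e]])
 obtain U \<Phi> where U: "pr e \<in> U" "local_triv N X pr F U \<Phi>" using tX[OF x] by blast
 obtain UB \<Phi>B where UB: "pr e \<in> UB" "local_triv N B prB FB UB \<Phi>B" using tB[OF x] by blast
 obtain U0 \<phi> where c: "(U0, \<phi>) \<in> charts N" "pr e \<in> U0"
  using atlas.chart_at[OF smooth_manifold_atlas[OF N] x] by blast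
 obtain H where H: "gchart N U0 \<phi> H" using chart_gchartE[OF N c(1)] by blast
 interpret m: two_triv_model N X pr F U \<Phi> B prB FB UB \<Phi>B \<alpha> U0 \<phi> H by (rule model[OF U(2) UB(2) c(1) H])
 have eW: "e \<in> m.W" using e U UB c by auto
 have bU: "b \<in> m.B.XU" using b UB by auto
 have l: "m.\<Lambda> e (m.B.y b) 0 \<in> PB" "fst (snd (m.\<Lambda> e (m.B.y b) 0)) = e"
  using m.\<Lambda>[OF eW m.B.y_in[OF bU] subspace_0[OF F]] by auto
 have "fst (m.\<Lambda> e (m.B.y b) 0) = b" using m.B.\<Theta>_y[OF bU] b(2) by (simp add: m.\<Lambda>_def Let_def)
 then show ?thesis using l by (intro exI[of _ "snd (m.\<Lambda> e (m.B.y b) 0)"]) (metis prod.collapse)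
qed

end

section \<open>Bump functions and vectors in general position\<close>

lemma bump_function:
 assumes N: "smooth_manifold N" and Q: "openin (mtop N) Q" "p \<in> Q"
 shows "\<exists>b K. (\<forall>x\<in>pts N. sma N euclid b x) & (\<forall>x. b x \<ge> (0::real)) & b p > 0 &
   compactin (mtop N) K & K \<subseteq> Q & (\<forall>x. x \<notin> K --> b x = 0)"
proof -
 interpret at: atlas N by (rule smooth_manifold_atlas[OF N])
 note a = at.atlas_axioms
 have p: "p \<in> pts N" using Q at.openin_mtop by blast
 obtain U \<phi> where c: "(U, \<phi>) \<in> charts N" "p \<in> U" using at.chart_at[OF p] by blast
 obtain H where H: "gchart N U \<phi> H" using chart_gchartE[OF N c(1)] by blast
 have inv: "inv_into U \<phi> (\<phi> x) = x" if "x \<in> U" for x using H that by (simp add: gchart_def)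
 obtain A where A: "open A" "\<phi> p \<in> A" "\<forall>y\<in>U. \<phi> y \<in> A --> y \<in> Q" using at.openin_mtopD[OF Q(1) c(1) Q(2) c(2)] by blast
 obtain T where T: "open T" "\<phi> ` U = H \<inter> T" using H by (auto simp: gchart_def openin_open)
 have "open (A \<inter> T)" "\<phi> p \<in> A \<inter> T" using A T c by auto
 then obtain r where r: "r > 0" "cball (\<phi> p) r \<subseteq> A \<inter> T" by (meson open_contains_cball)
 let ?C = "cball (\<phi> p) r \<inter> H"
 have CU: "?C \<subseteq> \<phi> ` U" using r T by auto
 define K where "K = inv_into U \<phi> ` ?C"
 have K_iff: "x \<in> K \<longleftrightarrow> x \<in> U & \<phi> x \<in> cball (\<phi> p) r" for x
 proof
  assume "x \<in> K"
  then obtain z where z: "z \<in> ?C" "x = inv_into U \<phi> z" by (auto simp: K_def)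
  then have "z \<in> \<phi> ` U" using CU by blast
  with z show "x \<in> U & \<phi> x \<in> cball (\<phi> p) r" by (auto simp: inv_into_into f_inv_into_f)
 next
  assume x: "x \<in> U & \<phi> x \<in> cball (\<phi> p) r"
  then have "\<phi> x \<in> ?C" using T by auto
  then show "x \<in> K" using inv x unfolding K_def by (metis image_eqI)
 qed
 have "smooth_map_on euclid (\<phi> ` U) N (inv_into U \<phi>)"
  unfolding smooth_map_on_iff[OF atlas_euclid a] using H by (auto simp: gchart_def)
 then have cm: "continuous_map (top_of_set (\<phi> ` U)) (mtop N) (inv_into U \<phi>)" by (simp add: smooth_map_on_def)
 have "compact ?C" using H by (intro compact_Int_closed closed_subspace) (auto simp: gchart_def)
 then have "compactin (top_of_set (\<phi> ` U)) ?C" using CU by (simp add: compactin_subtopology)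
 then have K: "compactin (mtop N) K" unfolding K_def by (rule image_compactin[OF _ cm])
 have KQ: "K \<subseteq> Q" using K_iff A r by auto
 define b where "b x = (if x \<in> U then flat (r\<^sup>2 - (\<phi> x - \<phi> p) \<bullet> (\<phi> x - \<phi> p)) else 0)" for x
 have bK: "b x = 0" if "x \<notin> K" for x
 proof (cases "x \<in> U")
  case True
  then have "r < norm (\<phi> x - \<phi> p)" using that K_iff by (simp add: dist_norm norm_minus_commute)
  then have "r\<^sup>2 \<le> (norm (\<phi> x - \<phi> p))\<^sup>2" using r by (intro power_mono) auto
  then show ?thesis by (simp add: b_def flat_zero_iff power2_norm_eq_inner)
 qed (simp add: b_def)
 have cl: "openin (mtop N) (pts N - K)"
  using compactin_imp_closedin[OF smooth_manifold.hausdorff[OF N] K] by (simp add: closedin_def)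
 have "sma N euclid b x" if x: "x \<in> pts N" for x
 proof (cases "x \<in> U")
  case True
  have s: "sma N euclid \<phi> x" by (rule sm_at_chart[OF a c(1) True])
  have d: "sma N euclid (%x. \<phi> x - \<phi> p) x"
   by (rule sm_at_diff[OF a x s sm_at_const[OF a atlas_euclid x]]) simp
  have "sma N euclid (%x. r\<^sup>2 - (\<phi> x - \<phi> p) \<bullet> (\<phi> x - \<phi> p)) x"
   by (rule sm_at_diff[OF a x sm_at_const[OF a atlas_euclid x] sm_at_bilinear[OF bounded_bilinear_inner a x d d]]) simp
  from sm_at_Cinf[OF this x open_UNIV UNIV_I flat_fun_smooth]
  show ?thesis by (rule sm_at_eq_near[OF a _ at.openin_chart_dom[OF c(1)] True x]) (simp add: b_def)
 next
  case False
  then have "x \<in> pts N - K" using K_iff x by blast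
  then show ?thesis
   by (intro sm_at_eq_near[OF a sm_at_const[OF a atlas_euclid x, of 0] cl _ x]) (use bK in auto)
 qed
 moreover have "b p > 0" using c r by (simp add: b_def flat_pos_iff)
 moreover have "b x \<ge> 0" for x by (simp add: b_def flat_nonneg)
 ultimately show ?thesis using K KQ bK by blast
qed

text \<open>The vectors are chosen one after the other outside finitely many proper subspaces, which have measure zero.\<close>

lemma general_position:
 "\<exists>v :: nat => 'z::euclidean_space. \<forall>J. finite J --> card J \<le> DIM('z) --> inj_on v J & independent (v ` J)"
proof -
 let ?P = "%f n r. \<forall>J \<subseteq> {..<n}. card J < DIM('z) --> r \<notin> span ((f :: nat => 'z) ` J)"
 have "\<exists>f. \<forall>n. ?P f n (f n)"
 proof (rule dependent_wellorder_choice)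
  fix r :: 'z and f g :: "nat => 'z" and n
  assume "!!y. y < n ==> f y = g y"
  then have "f ` J = g ` J" if "J \<subseteq> {..<n}" for J using that by (intro image_cong) auto
  then show "?P f n r = ?P g n r" by auto
 next
  fix n and f :: "nat => 'z"
  let ?U = "\<Union>J \<in> {J. J \<subseteq> {..<n} & card J < DIM('z)}. span (f ` J)"
  have "negligible ?U"
  proof (rule negligible_Union)
   show "finite ((%J. span (f ` J)) ` {J. J \<subseteq> {..<n} & card J < DIM('z)})"
    by (rule finite_imageI, rule finite_subset[of _ "Pow {..<n}"]) auto
   fix T assume "T \<in> (%J. span (f ` J)) ` {J. J \<subseteq> {..<n} & card J < DIM('z)}"
   then obtain J where J: "T = span (f ` J)" "J \<subseteq> {..<n}" "card J < DIM('z)" by blast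
   have "finite J" using J(2) finite_subset by blast
   then have "dim (f ` J) \<le> card J" using dim_le_card'[of "f ` J"] card_image_le[of J f] by simp
   then show "negligible T" using J by (intro negligible_lowdim) (simp add: dim_span)
  qed
  then have "?U \<noteq> UNIV" using non_negligible_UNIV by metis
  then show "\<exists>r. ?P f n r" by blast
 qed
 then obtain v where "\<forall>n. ?P v n (v n)" by (rule exE)
 then have v: "!!n J. J \<subseteq> {..<n} ==> card J < DIM('z) ==> v n \<notin> span (v ` J)" by simp
 have "inj_on v J & independent (v ` J)" if "finite J" "card J \<le> DIM('z)" for J
  using that
 proof (induction J rule: finite_linorder_max_induct)
  case (insert b A)
  have bA: "b \<notin> A" "A \<subseteq> {..<b}" using insert(2) by auto
  then have "card A < DIM('z)" using insert by simp
  with bA v have "v b \<notin> span (v ` A)" by blast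
  moreover from this have "v b \<notin> v ` A" using span_base by metis
  ultimately show ?case using insert bA by (auto simp: independent_insert)
 qed (simp add: independent_empty)
 then show ?thesis by blast
qed

lemma dual_vectors:
 fixes v :: "nat => 'z::euclidean_space"
 assumes J: "finite J" "card J = DIM('z)" and v: "inj_on v J" "independent (v ` J)"
 shows "\<exists>d. \<forall>w. w = (\<Sum>k\<in>J. (w \<bullet> v k) *\<^sub>R d k)"
proof -
 obtain e where e: "bij_betw e J (Basis :: 'z set)" using J finite_same_card_bij[of J Basis] by auto
 let ?f = "%w. \<Sum>k\<in>J. (w \<bullet> v k) *\<^sub>R e k"
 have lin: "linear ?f" by (rule linearI) (simp_all add: inner_add_left scaleR_add_left sum.distrib scaleR_sum_right)
 have sp: "span (v ` J) = UNIV"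
 proof -
  have "dim (UNIV :: 'z set) \<le> card (v ` J)" using card_image[OF v(1)] J by simp
  from card_ge_dim_independent[OF _ v(2) this] show ?thesis by auto
 qed
 have "inj ?f"
 proof (rule iffD2[OF linear_injective_0[OF lin]], intro allI impI)
  fix w assume w: "?f w = 0"
  have "w \<bullet> v k = 0" if k: "k \<in> J" for k
  proof -
   have "?f w \<bullet> e k = (\<Sum>j\<in>J. if j = k then w \<bullet> v j else 0)"
    unfolding inner_sum_left
   proof (rule sum.cong[OF refl])
    fix j assume j: "j \<in> J"
    have "e j \<in> Basis" "e k \<in> Basis" "e j = e k \<longleftrightarrow> j = k"
     using e j k by (auto simp: bij_betw_def dest: inj_onD)
    then show "(w \<bullet> v j) *\<^sub>R e j \<bullet> e k = (if j = k then w \<bullet> v j else 0)" by (simp add: inner_Basis)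
   qed
   then show ?thesis using w k J(1) by simp
  qed
  then have "orthogonal w x" if "x \<in> v ` J" for x using that by (auto simp: orthogonal_def)
  then have "orthogonal w w" using orthogonal_to_span[of w "v ` J" w] sp by auto
  then show "w = 0" by (simp add: orthogonal_self)
 qed
 then obtain g where g: "linear g" "g \<circ> ?f = id" using linear_injective_left_inverse[OF lin] by blast
 have "w = (\<Sum>k\<in>J. (w \<bullet> v k) *\<^sub>R g (e k))" for w
  using fun_cong[OF g(2), of w] by (simp add: linear_sum[OF g(1)] linear_scale[OF g(1)])
 then show ?thesis by (intro exI[of _ "%k. g (e k)"]) blast
qed

section \<open>A partition of unity with finitely many functions\<close>

definition locally_finite_family :: "('p, 'b::euclidean_space) manifold => (nat => 'p => real) => bool" where
 "locally_finite_family N g \<longleftrightarrow> (\<forall>x\<in>pts N. \<exists>W. openin (mtop N) W & x \<in> W & finite {k. \<exists>y\<in>W. g k y \<noteq> 0})"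

lemma locally_finite_bumps:
 fixes N :: "('p, 'b::euclidean_space) manifold"
 assumes N: "smooth_manifold N" and ne: "pts N \<noteq> {}"
  and G: "\<forall>p\<in>pts N. \<exists>U. openin (mtop N) U & p \<in> U & G U"
 shows "\<exists>g K U. locally_finite_family N g & (\<forall>k. \<forall>x\<in>pts N. sma N euclid (g k) x) & (\<forall>k x. g k x \<ge> 0) &
   (\<forall>x\<in>pts N. \<exists>k. g k x > 0) & (\<forall>k. compactin (mtop N) (K k) & K k \<subseteq> U k & G (U k) & (\<forall>x. x \<notin> K k --> g k x = 0))"
proof -
 interpret at: atlas N by (rule smooth_manifold_atlas[OF N])
 note a = at.atlas_axioms
 let ?B = "%b K U. (\<forall>x\<in>pts N. sma N euclid b x) & (\<forall>x. b x \<ge> (0::real)) &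
   compactin (mtop N) K & K \<subseteq> U & G U & (\<forall>x. x \<notin> K --> b x = 0)"
 let ?Q = "%W. \<exists>b K U. ?B b K U & (\<forall>x\<in>W. b x > 0)"
 have pos_open: "openin (mtop N) {y \<in> pts N. b y > c}" if b: "!!x. x \<in> pts N ==> sma N euclid b x" for b and c :: real
 proof (subst openin_subopen, rule ballI)
  fix x assume x: "x \<in> {y \<in> pts N. b y > c}"
  then have "x \<in> pts N" "openin (mtop euclid) {c<..}" "b x \<in> {c<..}" by auto
  from sm_at_continuous[OF a atlas_euclid b[OF this(1)] this]
  obtain T where T: "openin (mtop N) T" "x \<in> T" "b ` (pts N \<inter> T) \<subseteq> {c<..}" by blast
  moreover have "T \<subseteq> pts N" using openin_subset[OF T(1)] by simp
  ultimately show "\<exists>T. openin (mtop N) T & x \<in> T & T \<subseteq> {y \<in> pts N. b y > c}" by (intro exI[of _ T]) auto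
 qed
 have "\<exists>\<W>. countable \<W> & (\<forall>W\<in>\<W>. openin (mtop N) W & ?Q W) & \<Union>\<W> = pts N"
 proof (rule countable_subcover[OF a smooth_manifold.second_countable[OF N]])
  fix p assume p: "p \<in> pts N"
  obtain U where U: "openin (mtop N) U" "p \<in> U" "G U" using bspec[OF G p] by blast
  from bump_function[OF N U(1,2)] obtain b K where b: "\<forall>x\<in>pts N. sma N euclid b x" "\<forall>x. b x \<ge> (0::real)" "b p > 0"
   "compactin (mtop N) K" "K \<subseteq> U" "\<forall>x. x \<notin> K --> b x = 0" by (elim exE conjE) rule
  have "?Q {y \<in> pts N. b y > 0}"
   by (rule exI[of _ b], rule exI[of _ K], rule exI[of _ U]) (use b U in auto)
  moreover have "openin (mtop N) {y \<in> pts N. b y > 0}" by (rule pos_open) (use b in blast)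
  ultimately show "\<exists>W. openin (mtop N) W & p \<in> W & ?Q W"
   using b(3) p by (intro exI[of _ "{y \<in> pts N. b y > 0}"]) simp
 qed
 then obtain \<W> where \<W>: "countable \<W>" "\<forall>W\<in>\<W>. openin (mtop N) W & ?Q W" "\<Union>\<W> = pts N" by (elim exE conjE) rule
 have "\<W> \<noteq> {}" using \<W>(3) ne by auto
 then have fn: "from_nat_into \<W> k \<in> \<W>" for k by (rule from_nat_into)
 have "\<forall>k. \<exists>b K U. ?B b K U & (\<forall>x\<in>from_nat_into \<W> k. b x > 0)" using \<W>(2) fn by simp
 then obtain b K U where bKU: "!!k. ?B (b k) (K k) (U k)" and bpos: "!!k x. x \<in> from_nat_into \<W> k ==> b k x > 0"
  by metis
 have bs: "sma N euclid (b k) x" if "x \<in> pts N" for k x using conjunct1[OF bKU[of k]] that by simp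
 have b0: "b k x \<ge> 0" for k x using conjunct1[OF conjunct2[OF bKU[of k]]] by simp
 have bcov: "\<exists>k. b k x > 0" if "x \<in> pts N" for x
 proof -
  from that have "x \<in> \<Union>\<W>" unfolding \<W>(3) .
  then obtain W where "W \<in> \<W>" "x \<in> W" by (rule UnionE)
  then show ?thesis using bpos from_nat_into_surj[OF \<W>(1)] by metis
 qed
 define g where "g k x = b k x * (\<Prod>j<k. flat (1 / Suc k - b j x))" for k x
 have "locally_finite_family N g"
  unfolding locally_finite_family_def
 proof
  fix x assume x: "x \<in> pts N"
  then obtain m where m: "b m x > 0" using bcov by blast
  let ?W = "{y \<in> pts N. b m y > b m x / 2}"
  obtain n where n: "1 / Suc n < b m x / 2" using m reals_Archimedean[of "b m x / 2"] by (auto simp: inverse_eq_divide)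
  have "g k y = 0" if y: "y \<in> ?W" and k: "k > max m n" for k y
  proof -
   have "1 / Suc k \<le> 1 / Suc n" using k by (intro divide_left_mono) auto
   then have "flat (1 / Suc k - b m y) = 0" using y n by (simp add: flat_zero_iff)
   then have "(\<Prod>j<k. flat (1 / Suc k - b j y)) = 0" using k by (intro prod_zero) auto
   then show ?thesis by (simp add: g_def)
  qed
  then have "{k. \<exists>y\<in>?W. g k y \<noteq> 0} \<subseteq> {..max m n}" by (auto simp: not_less[symmetric])
  then have "finite {k. \<exists>y\<in>?W. g k y \<noteq> 0}" by (rule finite_subset) simp
  then show "\<exists>W. openin (mtop N) W & x \<in> W & finite {k. \<exists>y\<in>W. g k y \<noteq> 0}"
   using pos_open[where c = "b m x / 2", OF bs[of _ m]] x m by (intro exI[of _ ?W] conjI) simp_all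
 qed
 moreover have "sma N euclid (g k) x" if x: "x \<in> pts N" for k x
 proof -
  have "sma N euclid (%y. flat (1 / Suc k - b j y)) x" for j
   by (rule sm_at_Cinf[OF sm_at_diff[OF a x sm_at_const[OF a atlas_euclid x] bs[OF x]] x open_UNIV UNIV_I flat_fun_smooth]) simp
  then show ?thesis unfolding g_def by (intro sm_at_mult[OF a x] bs[OF x] sm_at_prod[OF a x x])
 qed
 moreover have "g k x \<ge> 0" for k x by (simp add: g_def b0 flat_nonneg prod_nonneg)
 moreover have "\<exists>k. g k x > 0" if x: "x \<in> pts N" for x
 proof -
  define k where "k = (LEAST k. b k x > 0)"
  have k: "b k x > 0" unfolding k_def using bcov[OF x] by (rule LeastI_ex)
  have "flat (1 / Suc k - b j x) > 0" if "j < k" for j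
  proof -
   have "b j x = 0" using not_less_Least[of j "%k. b k x > 0"] that b0[of j x] by (auto simp: k_def)
   then show ?thesis by (simp add: flat_pos_iff)
  qed
  then have "g k x > 0" unfolding g_def using k by (intro mult_pos_pos prod_pos) auto
  then show ?thesis by blast
 qed
 moreover have "compactin (mtop N) (K k) & K k \<subseteq> U k & G (U k) & (\<forall>x. x \<notin> K k --> g k x = 0)" for k
  using bKU[of k] by (simp add: g_def)
 ultimately show ?thesis by blast
qed

text \<open>The constants are \<open>s k = exp (r \<bullet> v k)\<close> with vectors \<open>v k\<close> in general position in a space of
  dimension \<open>DIM + 2\<close>. A coincidence of \<open>DIM + 2\<close> functions at \<open>x\<close> with common value \<open>m\<close> determines
  \<open>r\<close> as a smooth function of \<open>x\<close> and \<open>m\<close>. These are \<open>DIM + 1\<close> parameters, so the bad \<open>r\<close> form a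
  countable union of null sets.\<close>

lemma generic_scaling:
 fixes N :: "('p, 'b::euclidean_space) manifold" and g :: "nat => 'p => real"
 assumes N: "smooth_manifold N" and gs: "\<forall>k. \<forall>x\<in>pts N. sma N euclid (g k) x"
 shows "\<exists>s. (\<forall>k. s k > (0::real)) & (\<forall>x\<in>pts N. \<forall>J m. finite J --> card J = DIM('b) + 2 --> m > 0 -->
   \<not> (\<forall>k\<in>J. g k x > 0 & s k * g k x = m))"
proof -
 interpret at: atlas N by (rule smooth_manifold_atlas[OF N])
 note a = at.atlas_axioms
 let ?D = "DIM('b \<times> real \<times> real)"
 have D: "?D = DIM('b) + 2" by simp
 obtain v :: "nat => 'b \<times> real \<times> real" where v: "!!J. finite J ==> card J \<le> ?D ==> inj_on v J & independent (v ` J)"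
  using general_position by blast
 have "\<exists>d. \<forall>w. w = (\<Sum>k\<in>J. (w \<bullet> v k) *\<^sub>R d k)" if "finite J" "card J = ?D" for J
 proof -
  have "card J \<le> ?D" using that(2) by simp
  with v[OF that(1)] have "inj_on v J" "independent (v ` J)" by blast+
  then show ?thesis by (rule dual_vectors[OF that])
 qed
 then obtain d where d: "!!J w. finite J ==> card J = ?D ==> w = (\<Sum>k\<in>J. (w \<bullet> v k) *\<^sub>R d J k)" by metis
 have "\<exists>\<W>. countable \<W> & (\<forall>W\<in>\<W>. openin (mtop N) W & (\<exists>\<phi>. (W, \<phi>) \<in> charts N)) & \<Union>\<W> = pts N"
 proof (rule countable_subcover[OF a smooth_manifold.second_countable[OF N], of "%W. \<exists>\<phi>. (W, \<phi>) \<in> charts N"])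
  fix p assume "p \<in> pts N"
  from at.chart_at[OF this] obtain U \<phi> where c: "(U, \<phi>) \<in> charts N" "p \<in> U" by blast
  then show "\<exists>W. openin (mtop N) W & p \<in> W & (\<exists>\<phi>. (W, \<phi>) \<in> charts N)"
   using at.openin_chart_dom[OF c(1)] by (intro exI[of _ U]) auto
 qed
 then obtain \<W> where \<W>: "countable \<W>" "\<forall>W\<in>\<W>. openin (mtop N) W & (\<exists>\<phi>. (W, \<phi>) \<in> charts N)" "\<Union>\<W> = pts N"
  by (elim exE conjE)
 define bad where "bad U J = {w. \<exists>x\<in>U. \<exists>m. \<forall>k\<in>J. g k x > 0 & w \<bullet> v k = m - ln (g k x)}" for U J
 have neg: "negligible (bad U J)" if U: "U \<in> \<W>" and J: "finite J" "card J = ?D" for U J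
 proof -
  obtain \<phi> where c: "(U, \<phi>) \<in> charts N" using \<W>(2) U by blast
  obtain H where H: "gchart N U \<phi> H" using chart_gchartE[OF N c(1)] by blast
  have inv: "inv_into U \<phi> (\<phi> x) = x" if "x \<in> U" for x using H that by (simp add: gchart_def)
  let ?S = "{(\<phi> x, m) | x m. x \<in> U & (\<forall>k\<in>J. g k x > 0)} :: ('b \<times> real) set"
  let ?f = "%z. \<Sum>k\<in>J. (snd z - ln (g k (inv_into U \<phi> (fst z)))) *\<^sub>R d J k"
  have "bad U J \<subseteq> ?f ` ?S"
  proof
   fix w assume "w \<in> bad U J"
   then obtain x m where x: "x \<in> U" and xm: "!!k. k \<in> J ==> g k x > 0 & w \<bullet> v k = m - ln (g k x)"
    by (auto simp: bad_def)
   have "w = ?f (\<phi> x, m)" using d[OF J, of w] xm inv[OF x] by simp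
   moreover have "(\<phi> x, m) \<in> ?S" using x xm by blast
   ultimately show "w \<in> ?f ` ?S" by blast
  qed
  moreover have "negligible (?f ` ?S)"
  proof (rule negligible_differentiable_image_lowdim)
   show "DIM('b \<times> real) < ?D" by simp
   show "?f differentiable_on ?S"
    unfolding differentiable_on_def
   proof
    fix z assume "z \<in> ?S"
    then obtain x m where x: "z = (\<phi> x, m)" "x \<in> U" "!!k. k \<in> J ==> g k x > 0" by blast
    have xN: "x \<in> pts N" using gchart_pts[OF a H x(2)] .
    have "(%z. (snd z - ln (g k (inv_into U \<phi> (fst z)))) *\<^sub>R d J k) differentiable at z within ?S" if k: "k \<in> J" for k
    proof -
     obtain A G where A: "open A" "\<phi> x \<in> A" "Cinf A G" "\<forall>y\<in>U. \<phi> y \<in> A --> g k y = G (\<phi> y)"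
      using gchart_extend[OF a H x(2) gs[rule_format, OF xN]] by blast
     have Gx: "G (fst z) > 0" using x A k by force
     have dG: "(G has_derivative FD G (at (fst z))) (at (fst z))"
      using Cinf_has_derivative[OF A(3,1,2)] x by simp
     have "((%z. G (fst z)) has_derivative (%v. FD G (at (fst z)) (fst v))) (at z within ?S)"
      using has_derivative_compose[where f = fst and g = G, OF bounded_linear_imp_has_derivative[OF bounded_linear_fst] dG] .
     from has_derivative_ln[OF Gx this]
     have "(%z. ln (G (fst z))) differentiable at z within ?S" by (rule differentiableI)
     then have "(%z. (snd z - ln (G (fst z))) *\<^sub>R d J k) differentiable at z within ?S"
      by (intro differentiable_scaleR differentiable_diff differentiable_const
        bounded_linear_imp_differentiable[OF bounded_linear_snd]) 
     moreover have "open (fst -` A :: ('b \<times> real) set)"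
      by (rule open_vimage_fst[OF A(1)])
     then obtain e where e: "e > 0" "ball z e \<subseteq> fst -` A" using A(2) x(1) open_contains_ball by (metis fst_conv vimage_eq)
     ultimately show ?thesis
     proof (rule_tac differentiable_transform_within[OF _ e(1)])
      show "z \<in> ?S" by fact
      fix y assume y: "y \<in> ?S" "dist y z < e"
      then obtain x' m' where x': "y = (\<phi> x', m')" "x' \<in> U" by blast
      have "fst y \<in> A" using y e by (auto simp: dist_commute)
      then show "(snd y - ln (G (fst y))) *\<^sub>R d J k = (snd y - ln (g k (inv_into U \<phi> (fst y)))) *\<^sub>R d J k"
       using A(4) x' inv by simp
     qed
    qed
    then show "?f differentiable at z within ?S" by (intro differentiable_sum J ballI)
   qed
  qed
  ultimately show ?thesis using negligible_subset by blast
 qed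
 let ?I = "\<W> \<times> {J :: nat set. finite J & card J = ?D}"
 have "countable {J :: nat set. finite J & card J = ?D}"
  by (rule countable_subset[OF _ countable_Collect_finite]) auto
 from countable_SIGMA[OF \<W>(1) this] have "countable ?I" .
 then have "negligible (\<Union>i\<in>?I. bad (fst i) (snd i))"
  by (intro negligible_countable_Union) (use neg in auto)
 then have "(\<Union>i\<in>?I. bad (fst i) (snd i)) \<noteq> UNIV" using non_negligible_UNIV by metis
 then obtain w where "w \<notin> (\<Union>i\<in>?I. bad (fst i) (snd i))" by blast
 then have w: "w \<notin> bad U J" if "U \<in> \<W>" "finite J" "card J = ?D" for U J using that by fastforce
 have "\<not> (\<forall>k\<in>J. g k x > 0 & exp (w \<bullet> v k) * g k x = m)"
  if x: "x \<in> pts N" and J: "finite J" "card J = DIM('b) + 2" and m: "m > 0" for x J m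
 proof
  assume A: "\<forall>k\<in>J. g k x > 0 & exp (w \<bullet> v k) * g k x = m"
  obtain U where U: "U \<in> \<W>" "x \<in> U" using \<W>(3) x by blast
  have "w \<bullet> v k = ln m - ln (g k x)" if "k \<in> J" for k
  proof -
   have gm: "g k x > 0" "m = exp (w \<bullet> v k) * g k x" using A that by auto
   then have "ln m = ln (exp (w \<bullet> v k)) + ln (g k x)" by (simp add: ln_mult_pos)
   then show ?thesis by simp
  qed
  then have "w \<in> bad U J" unfolding bad_def using A U(2) by blast
  then show False using w[OF U(1) J(1)] J(2) D by simp
 qed
 then show ?thesis by (intro exI[of _ "%k. exp (w \<bullet> v k)"]) auto
qed

text \<open>The partition of unity.  The functions \<open>\<eta> c * \<mu> c\<close> sum to one, and locally, where one of them
  does not vanish, the value \<open>\<kappa> c\<close> is a fixed good set.  The good sets used by one function are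
  thus glued along a disjoint union.  For each \<open>c\<close> the sets on which
  \<open>Suc c\<close> given functions exceed all the others are disjoint for different choices of these
  functions. The functions that attain the maximum at a point form such a choice, and by genericity
  there are at most \<open>DIM + 1\<close> of them, so that finitely many \<open>c\<close> suffice.\<close>

lemma finite_partition:
 fixes N :: "('p, 'b::euclidean_space) manifold"
 assumes N: "smooth_manifold N"
  and G: "\<forall>p\<in>pts N. \<exists>U. openin (mtop N) U & p \<in> U & G U"
 shows "\<exists>(m::nat) \<eta> \<mu> \<kappa>. (\<forall>c. \<forall>x\<in>pts N. sma N euclid (\<eta> c) x & sma N euclid (\<mu> c) x) &
   (\<forall>x\<in>pts N. (\<Sum>c<m. \<eta> c x * \<mu> c x) = (1::real)) &
   (\<forall>c. \<forall>x\<in>pts N. \<exists>W. openin (mtop N) W & x \<in> W &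
    ((\<exists>U. G U & W \<subseteq> U & (\<forall>y\<in>W. \<kappa> c y = U)) \<or> (\<forall>y\<in>W. \<eta> c y = 0 & \<mu> c y = 0)))"
proof (cases "pts N = {}")
 case True
 then show ?thesis by auto
next
 case False
 interpret at: atlas N by (rule smooth_manifold_atlas[OF N])
 note a = at.atlas_axioms
 from locally_finite_bumps[OF N False G] obtain g K U where lf: "locally_finite_family N g"
  and gKU: "\<forall>k. \<forall>x\<in>pts N. sma N euclid (g k) x" "\<forall>k x. g k x \<ge> 0" "\<forall>x\<in>pts N. \<exists>k. g k x > 0"
   "\<forall>k. compactin (mtop N) (K k) & K k \<subseteq> U k & G (U k) & (\<forall>x. x \<notin> K k --> g k x = 0)"
  by (elim exE conjE) rule
 have gs: "sma N euclid (g k) x" if "x \<in> pts N" for k x using gKU(1) that by simp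
 have g0: "g k x \<ge> 0" for k x using gKU(2) by simp
 have gpos: "\<exists>k. g k x > 0" if "x \<in> pts N" for x using gKU(3) that by simp
 have K: "compactin (mtop N) (K k)" "K k \<subseteq> U k" "G (U k)" "x \<notin> K k ==> g k x = 0" for k x using gKU(4) by simp_all
 from generic_scaling[OF N gKU(1)] obtain s where s: "\<forall>k. s k > (0::real)"
  and gen': "\<forall>x\<in>pts N. \<forall>J m. finite J --> card J = DIM('b) + 2 --> m > 0 --> \<not> (\<forall>k\<in>J. g k x > 0 & s k * g k x = m)"
  by (elim exE conjE) rule
 have gen: "\<not> (\<forall>k\<in>J. g k x > 0 & s k * g k x = m)"
  if "x \<in> pts N" "finite J" "card J = DIM('b) + 2" "m > 0" for x J m
  using bspec[OF gen' that(1), rule_format, OF that(2-4)] by simp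
 define h where "h k x = s k * g k x" for k x
 have h0: "h k x \<ge> 0" and hpos: "h k x > 0 \<longleftrightarrow> g k x > 0" and hz: "h k x = 0 \<longleftrightarrow> g k x = 0" for k x
  using s[rule_format, of k] g0[of k x] by (auto simp: h_def zero_less_mult_iff)
 have hs: "sma N euclid (h k) x" if "x \<in> pts N" for k x
  unfolding h_def by (rule sm_at_mult[OF a that sm_at_const[OF a atlas_euclid that] gs[OF that]]) simp
 have lfW: "\<exists>W. openin (mtop N) W & x \<in> W & W \<subseteq> pts N & finite {k. \<exists>y\<in>W. h k y \<noteq> 0}" if "x \<in> pts N" for x
 proof -
  obtain W where W: "openin (mtop N) W" "x \<in> W" "finite {k. \<exists>y\<in>W. g k y \<noteq> 0}"
   using lf \<open>x \<in> pts N\<close> unfolding locally_finite_family_def by blast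
  then show ?thesis using openin_subset[OF W(1)] by (intro exI[of _ W]) (simp add: hz)
 qed
 \<comment> \<open>Only finitely many functions interact with a given one, so that the products below are finite.\<close>
 define L where "L k = {l. \<exists>y\<in>K k. h l y \<noteq> 0}" for k
 have finL: "finite (L k)" for k
 proof -
  have "\<forall>x\<in>K k. \<exists>W. openin (mtop N) W & x \<in> W & finite {l. \<exists>y\<in>W. h l y \<noteq> 0}"
   using lfW compactin_subset_topspace[OF K(1)[of k]] by fastforce
  from bchoice[OF this] obtain Wf
   where Wf: "\<forall>x\<in>K k. openin (mtop N) (Wf x) & x \<in> Wf x & finite {l. \<exists>y\<in>Wf x. h l y \<noteq> 0}" ..
  obtain F where F: "finite F" "F \<subseteq> Wf ` K k" "K k \<subseteq> \<Union>F"
   using compactinD[OF K(1)[of k], of "Wf ` K k"] Wf by auto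
  have "L k \<subseteq> (\<Union>W\<in>F. {l. \<exists>y\<in>W. h l y \<noteq> 0})" using F(3) by (auto simp: L_def)
  moreover have "finite (\<Union>W\<in>F. {l. \<exists>y\<in>W. h l y \<noteq> 0})" using F(1,2) Wf by auto
  ultimately show ?thesis by (rule finite_subset)
 qed
 \<comment> \<open>Positive exactly where the functions indexed by \<open>J\<close> exceed all the others.\<close>
 define P where "P J x = (\<Prod>k\<in>J. h k x) * (\<Prod>k\<in>J. \<Prod>l\<in>(\<Union>k\<in>J. L k) - J. flat (h k x - h l x))" for J x
 have Ps: "sma N euclid (P J) x" if x: "x \<in> pts N" for J x
  unfolding P_def
  by (intro sm_at_mult[OF a x] sm_at_prod[OF a x x] hs[OF x]
    sm_at_Cinf[OF sm_at_diff[OF a x hs[OF x] hs[OF x]] x open_UNIV UNIV_I flat_fun_smooth])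
 have P0: "P J x \<ge> 0" for J x unfolding P_def by (intro mult_nonneg_nonneg prod_nonneg) (auto simp: h0 flat_nonneg)
 have Ppos: "P J x > 0 \<longleftrightarrow> (\<forall>k\<in>J. h k x > 0 & (\<forall>l. l \<notin> J --> h k x > h l x))" if J: "finite J" for J x
 proof
  assume "P J x > 0"
  then have nz: "(\<Prod>k\<in>J. h k x) \<noteq> 0" "(\<Prod>k\<in>J. \<Prod>l\<in>(\<Union>k\<in>J. L k) - J. flat (h k x - h l x)) \<noteq> 0"
   by (auto simp: P_def)
  have fin: "finite ((\<Union>k\<in>J. L k) - J)" using J finL by auto
  show "\<forall>k\<in>J. h k x > 0 & (\<forall>l. l \<notin> J --> h k x > h l x)"
  proof (intro ballI conjI allI impI)
   fix k l assume k: "k \<in> J"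
   have "h k x \<noteq> 0" using nz(1) J k by (simp add: prod_zero_iff)
   then show hk: "h k x > 0" using h0[of k x] by simp
   assume l: "l \<notin> J"
   show "h k x > h l x"
   proof (cases "l \<in> (\<Union>k\<in>J. L k)")
    case True
    then have "flat (h k x - h l x) \<noteq> 0" using nz(2) J k l fin by (auto simp: prod_zero_iff)
    then show ?thesis by (simp add: flat_zero_iff)
   next
    case False
    have "x \<in> K k" using K(4)[of x k] hk hpos by force
    then have "h l x = 0" using False k by (auto simp: L_def)
    then show ?thesis using hk by simp
   qed
  qed
 next
  assume "\<forall>k\<in>J. h k x > 0 & (\<forall>l. l \<notin> J --> h k x > h l x)"
  then show "P J x > 0" unfolding P_def by (intro mult_pos_pos prod_pos) (auto simp: flat_pos_iff)
 qed
 have uniq: "J = J'" if "finite J" "finite J'" "card J = card J'" "P J x > 0" "P J' x > 0" for J J' x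
 proof (rule ccontr)
  assume "J \<noteq> J'"
  then have "\<not> J \<subseteq> J'" "\<not> J' \<subseteq> J" using that(1-3) card_subset_eq by metis+
  then obtain k l where "k \<in> J" "k \<notin> J'" "l \<in> J'" "l \<notin> J" by blast
  then have "h k x > h l x" "h l x > h k x" using that Ppos by blast+
  then show False by simp
 qed
 define idx where "idx c x = (SOME J. finite J & card J = Suc c & P J x > 0)" for c x
 have idx: "idx c x = J" if "finite J" "card J = Suc c" "P J x > 0" for c x J
 proof -
  have "finite (idx c x) & card (idx c x) = Suc c & P (idx c x) x > 0"
   unfolding idx_def by (rule someI[of _ J]) (use that in blast)
  then show ?thesis using that by (intro uniq[of _ _ x]) auto
 qed
 define Q where "Q c x \<longleftrightarrow> (\<exists>J. finite J & card J = Suc c & P J x > 0)" for c x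
 define \<Phi> where "\<Phi> c x = (if Q c x then P (idx c x) x else 0)" for c x
 have \<Phi>0: "\<Phi> c x \<ge> 0" for c x by (simp add: \<Phi>_def P0)
 have \<Phi>pos: "\<Phi> c x > 0 \<longleftrightarrow> Q c x" for c x
  using idx by (auto simp: \<Phi>_def Q_def)
 have \<Phi>s: "sma N euclid (\<Phi> c) x" if x: "x \<in> pts N" for c x
 proof -
  obtain W where W: "openin (mtop N) W" "x \<in> W" "W \<subseteq> pts N" "finite {k. \<exists>y\<in>W. h k y \<noteq> 0}" using lfW[OF x] by blast
  let ?\<L> = "{J. J \<subseteq> {k. \<exists>y\<in>W. h k y \<noteq> 0} & card J = Suc c}"
  have fin: "finite ?\<L>" by (rule finite_subset[of _ "Pow {k. \<exists>y\<in>W. h k y \<noteq> 0}"]) (use W(4) in auto)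
  have "sma N euclid (%y. \<Sum>J\<in>?\<L>. P J y) x" by (rule sm_at_sum[OF a x x Ps[OF x]])
  then show ?thesis
  proof (rule sm_at_eq_near[OF a _ W(1,2) x])
   fix y assume y: "y \<in> W"
   have LJ: "finite J" "card J = Suc c" if "J \<in> ?\<L>" for J using that W(4) finite_subset by auto
   have sing: "(\<Sum>J\<in>?\<L>. P J y) = (\<Sum>J\<in>?\<L>. if J = J0 then P J0 y else 0)"
    if "finite J0" "card J0 = Suc c" "P J0 y > 0" for J0
   proof (rule sum.cong[OF refl])
    fix J assume J: "J \<in> ?\<L>"
    have "P J y = 0" if "J \<noteq> J0" using uniq[of J J0 y] LJ[OF J] \<open>finite J0\<close> \<open>card J0 = Suc c\<close> \<open>P J0 y > 0\<close> P0[of J y] that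
     by (metis le_less)
    then show "P J y = (if J = J0 then P J0 y else 0)" by auto
   qed
   show "(\<Sum>J\<in>?\<L>. P J y) = \<Phi> c y"
   proof (cases "Q c y")
    case True
    then obtain J0 where J0: "finite J0" "card J0 = Suc c" "P J0 y > 0" by (auto simp: Q_def)
    have "J0 \<subseteq> {k. \<exists>y\<in>W. h k y \<noteq> 0}" using Ppos[OF J0(1)] J0(3) y by force
    then have "J0 \<in> ?\<L>" using J0 by blast
    then show ?thesis using sing[OF J0] fin True idx[OF J0] by (simp add: \<Phi>_def)
   next
    case False
    then have "P J y = 0" if "J \<in> ?\<L>" for J using LJ[OF that] P0[of J y] unfolding Q_def by (metis le_less)
    then show ?thesis using False by (simp add: \<Phi>_def)
   qed
  qed
 qed
 let ?m = "DIM('b) + 1"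
 have cov: "\<exists>c<?m. Q c x" if x: "x \<in> pts N" for x
 proof -
  obtain W where W: "x \<in> W" "finite {k. \<exists>y\<in>W. h k y \<noteq> 0}" using lfW[OF x] by blast
  have fin: "finite {k. h k x \<noteq> 0}" by (rule finite_subset[OF _ W(2)]) (use W(1) in auto)
  obtain k0 where k0: "h k0 x > 0" using gpos[OF x] hpos by auto
  let ?M = "Max ((%k. h k x) ` {k. h k x \<noteq> 0})"
  have M: "h k x \<le> ?M" if "h k x \<noteq> 0" for k using fin that by (intro Max_ge) auto
  have Mpos: "?M > 0" using M[of k0] k0 by simp
  have Mle: "h k x \<le> ?M" for k using M[of k] Mpos by (cases "h k x = 0") auto
  let ?J = "{k. h k x = ?M}"
  have "?M \<in> (%k. h k x) ` {k. h k x \<noteq> 0}" using fin k0 by (intro Max_in) (auto intro!: exI[of _ k0])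
  then have ne: "?J \<noteq> {}" by force
  have Jfin: "finite ?J" by (rule finite_subset[OF _ fin]) (use Mpos in auto)
  have "card ?J < DIM('b) + 2"
  proof (rule ccontr)
   assume "\<not> card ?J < DIM('b) + 2"
   then have "DIM('b) + 2 \<le> card ?J" by simp
   then obtain J' where J': "J' \<subseteq> ?J" "card J' = DIM('b) + 2" "finite J'" by (rule obtain_subset_with_card_n)
   have "\<forall>k\<in>J'. g k x > 0 & s k * g k x = ?M"
   proof
    fix k assume "k \<in> J'"
    then have "h k x = ?M" using J'(1) by blast
    then show "g k x > 0 & s k * g k x = ?M" using Mpos hpos[of k x] by (simp add: h_def)
   qed
   then show False using gen[OF x J'(3,2) Mpos] by blast
  qed
  moreover have "card ?J > 0" using ne Jfin by (simp add: card_gt_0_iff)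
  moreover have "P ?J x > 0"
   unfolding Ppos[OF Jfin]
  proof (intro ballI conjI allI impI)
   fix k l assume k: "k \<in> ?J"
   then show "h k x > 0" using Mpos by simp
   assume "l \<notin> ?J"
   then have "h l x \<noteq> ?M" by simp
   then show "h k x > h l x" using k Mle[of l] by simp
  qed
  ultimately show ?thesis unfolding Q_def using Jfin by (intro exI[of _ "card ?J - 1"]) (auto intro!: exI[of _ ?J])
 qed
 define D where "D x = (\<Sum>c<?m. \<Phi> c x)" for x
 have Dpos: "D x > 0" if x: "x \<in> pts N" for x
 proof -
  obtain c where c: "c < ?m" "Q c x" using cov[OF x] by blast
  then have "0 < \<Phi> c x" using \<Phi>pos by simp
  also have "\<dots> \<le> D x" unfolding D_def using c(1) \<Phi>0 by (intro member_le_sum) auto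
  finally show ?thesis .
 qed
 have Ds: "sma N euclid D x" if x: "x \<in> pts N" for x unfolding D_def by (rule sm_at_sum[OF a x x \<Phi>s[OF x]])
 have inv_s: "sma N euclid (%y. inverse (f y)) x" if "x \<in> pts N" "sma N euclid f x" "f x > 0" for f :: "'p => real" and x
 proof -
  have ci: "Cinf {0<..} (inverse :: real => real)" using Ck_on_inverse[of "{0::real<..}"] by simp
  show ?thesis by (rule sm_at_Cinf[OF that(2,1) open_greaterThan _ ci]) (use that in simp)
 qed
 define \<delta> where "\<delta> = 1 / (2 * real ?m)"
 define \<psi> where "\<psi> c x = \<Phi> c x * inverse (D x)" for c x
 have \<psi>s: "sma N euclid (\<psi> c) x" if x: "x \<in> pts N" for c x
  unfolding \<psi>_def by (rule sm_at_mult[OF a x \<Phi>s[OF x] inv_s[OF x Ds[OF x] Dpos[OF x]]])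
 have sum\<psi>: "(\<Sum>c<?m. \<psi> c x) = 1" if x: "x \<in> pts N" for x
  using Dpos[OF x] unfolding \<psi>_def D_def by (simp add: sum_distrib_right[symmetric])
 \<comment> \<open>Subtracting \<open>\<delta>\<close> makes \<open>\<eta> c\<close> vanish near the boundary of the set where \<open>idx c\<close> is meaningful; some
  \<open>\<psi> c x\<close> is at least \<open>2 \<delta>\<close>, so the sum of squares stays positive.\<close>
 define \<eta> where "\<eta> c x = flat (\<psi> c x - \<delta>)" for c x
 have \<eta>s: "sma N euclid (\<eta> c) x" if x: "x \<in> pts N" for c x
  unfolding \<eta>_def
  by (rule sm_at_Cinf[OF sm_at_diff[OF a x \<psi>s[OF x] sm_at_const[OF a atlas_euclid x]] x open_UNIV UNIV_I flat_fun_smooth]) simp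
 define E where "E x = (\<Sum>c<?m. \<eta> c x * \<eta> c x)" for x
 have Epos: "E x > 0" if x: "x \<in> pts N" for x
 proof -
  have "\<exists>c<?m. \<psi> c x > \<delta>"
  proof (rule ccontr)
   assume "\<not> ?thesis"
   then have "(\<Sum>c<?m. \<psi> c x) \<le> (\<Sum>c<?m. \<delta>)" by (intro sum_mono) auto
   also have "\<dots> = 1 / 2" by (simp add: \<delta>_def)
   finally show False using sum\<psi>[OF x] by simp
  qed
  then obtain c where c: "c < ?m" "\<psi> c x > \<delta>" by blast
  then have "0 < \<eta> c x * \<eta> c x" by (simp add: \<eta>_def flat_pos_iff)
  also have "\<dots> \<le> E x" unfolding E_def using c(1) by (intro member_le_sum) auto
  finally show ?thesis .
 qed
 have Es: "sma N euclid E x" if x: "x \<in> pts N" for x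
  unfolding E_def by (rule sm_at_sum[OF a x x sm_at_mult[OF a x \<eta>s[OF x] \<eta>s[OF x]]])
 define \<mu> where "\<mu> c x = \<eta> c x * inverse (E x)" for c x
 have \<mu>s: "sma N euclid (\<mu> c) x" if x: "x \<in> pts N" for c x
  unfolding \<mu>_def by (rule sm_at_mult[OF a x \<eta>s[OF x] inv_s[OF x Es[OF x] Epos[OF x]]])
 have sum1: "(\<Sum>c<?m. \<eta> c x * \<mu> c x) = 1" if x: "x \<in> pts N" for x
 proof -
  have "(\<Sum>c<?m. \<eta> c x * \<mu> c x) = E x * inverse (E x)"
   unfolding \<mu>_def E_def sum_distrib_right by (simp add: mult.assoc)
  then show ?thesis using Epos[OF x] by simp
 qed
 have pre_open: "\<exists>W. openin (mtop N) W & x \<in> W & W \<subseteq> pts N & (\<forall>y\<in>W. f y \<in> A)"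
  if "x \<in> pts N" "sma N euclid f x" "open A" "f x \<in> A" for f :: "'p => real" and A x
 proof -
  have "openin (mtop euclid) A" using that by simp
  from sm_at_continuous[OF a atlas_euclid that(2,1) this that(4)]
  obtain W where W: "openin (mtop N) W" "x \<in> W" "f ` (pts N \<inter> W) \<subseteq> A" by blast
  moreover have "W \<subseteq> pts N" using openin_subset[OF W(1)] by simp
  ultimately show ?thesis by (intro exI[of _ W]) auto
 qed
 define \<kappa> where "\<kappa> c x = U (Min (idx c x))" for c x
 have dich: "\<exists>W. openin (mtop N) W & x \<in> W &
    ((\<exists>V. G V & W \<subseteq> V & (\<forall>y\<in>W. \<kappa> c y = V)) \<or> (\<forall>y\<in>W. \<eta> c y = 0 & \<mu> c y = 0))" if x: "x \<in> pts N" for c x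
 proof (cases "\<psi> c x < \<delta>")
  case True
  then obtain W where W: "openin (mtop N) W" "x \<in> W" "\<forall>y\<in>W. \<psi> c y \<in> {..<\<delta>}"
   using pre_open[OF x \<psi>s[OF x], of "{..<\<delta>}" c] by auto
  then have "\<forall>y\<in>W. \<eta> c y = 0 & \<mu> c y = 0" by (auto simp: \<eta>_def \<mu>_def flat_zero_iff)
  then show ?thesis using W by blast
 next
  case False
  have "\<delta> > 0" by (simp add: \<delta>_def)
  then have "\<Phi> c x > 0" using False \<Phi>0[of c x] by (cases "\<Phi> c x = 0") (auto simp: \<psi>_def)
  then obtain J where J: "finite J" "card J = Suc c" "P J x > 0" using \<Phi>pos by (auto simp: Q_def)
  then obtain W where W: "openin (mtop N) W" "x \<in> W" "\<forall>y\<in>W. P J y \<in> {0<..}"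
   using pre_open[OF x Ps[OF x], of "{0<..}" J] by auto
  have ki: "\<kappa> c y = U (Min J)" if "y \<in> W" for y using idx[OF J(1,2), of y] W(3) that by (simp add: \<kappa>_def)
  have "J \<noteq> {}" using J by auto
  then have "Min J \<in> J" using J by simp
  have "y \<in> U (Min J)" if y: "y \<in> W" for y
  proof -
   have "h (Min J) y > 0" using Ppos[OF J(1), of y] W(3) y \<open>Min J \<in> J\<close> by auto
   then show ?thesis using K(4)[of y "Min J"] K(2)[of "Min J"] hpos[of "Min J" y] by force
  qed
  then show ?thesis using W(1,2) ki K(3)[of "Min J"] by (intro exI[of _ W]) blast
 qed
 show ?thesis
  by (intro exI[of _ ?m] exI[of _ \<eta>] exI[of _ \<mu>] exI[of _ \<kappa>] conjI allI ballI)
   (rule \<eta>s \<mu>s sum1 dich; assumption)+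
qed

section \<open>Global frames of vector bundles\<close>

lemma subspace_frame:
 assumes "subspace (F :: 'z::euclidean_space set)"
 shows "\<exists>B. finite B & B \<subseteq> F & (\<forall>f\<in>F. f = (\<Sum>b\<in>B. (f \<bullet> b) *\<^sub>R b))"
proof -
 obtain B where B: "B \<subseteq> F" "pairwise orthogonal B" "!!x. x \<in> B ==> norm x = 1" "independent B" "span B = F"
  by (rule orthonormal_basis_subspace[OF assms]) blast
 have fin: "finite B" using B(4) by (rule independent_imp_finite)
 have "f = (\<Sum>b\<in>B. (f \<bullet> b) *\<^sub>R b)" if f: "f \<in> F" for f
 proof -
  let ?g = "(\<Sum>b\<in>B. (f \<bullet> b) *\<^sub>R b) - f"
  have "?g \<in> span B" using f B by (intro span_diff span_sum span_scale) (auto intro: span_base)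
  moreover have "orthogonal ?g b" if b: "b \<in> B" for b
  proof -
   have "(\<Sum>a\<in>B. (f \<bullet> a) *\<^sub>R a) \<bullet> b = (\<Sum>a\<in>B. if a = b then f \<bullet> b else 0)"
    unfolding inner_sum_left
   proof (rule sum.cong[OF refl])
    fix a assume a: "a \<in> B"
    have "a \<bullet> b = 0" if "a \<noteq> b" using B(2) a b that by (auto simp: pairwise_def orthogonal_def)
    moreover have "b \<bullet> b = 1" using B(3)[OF b] by (simp add: norm_eq_1)
    ultimately show "(f \<bullet> a) *\<^sub>R a \<bullet> b = (if a = b then f \<bullet> b else 0)" by auto
   qed
   then show ?thesis using b fin by (simp add: orthogonal_def inner_diff_left)
  qed
  ultimately have "orthogonal ?g ?g" using orthogonal_to_span by blast
  then show ?thesis by (simp add: orthogonal_self)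
 qed
 then show ?thesis using fin B(1) by blast
qed

context vector_bundle
begin

lemma atN: "atlas N" and atW: "atlas (vtot W)"
 using smooth_manifold_atlas base_manifold total_manifold by auto

lemma vproj_smooth: "w \<in> pts (vtot W) ==> sma (vtot W) N (vproj W) w"
 using proj_smooth smooth_map_iff[OF atW atN] by blast

lemma linear_triv_triv: "linear_triv N W F U \<Psi> ==> triv N (vtot W) (vproj W) F U \<Psi>"
 using base_manifold total_manifold vproj_smooth by (intro triv.intro) (auto simp: linear_triv_def)

definition flin :: "'p => ('w => real) => bool" where
 "flin x l \<longleftrightarrow> (\<forall>u\<in>vfibre W x. \<forall>w\<in>vfibre W x. l (vadd W u w) = l u + l w) &
   (\<forall>u\<in>vfibre W x. \<forall>c. l (vscale W c u) = c * l u)"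

lemma flin_triv: "linear_triv N W F U \<Psi> ==> x \<in> U ==> flin x (%w. snd (\<Psi> w) \<bullet> b)"
 by (auto simp: linear_triv_def flin_def inner_add_left)

lemma fibreD: "v \<in> vfibre W x ==> v \<in> pts (vtot W)" "v \<in> vfibre W x ==> vproj W v = x"
 by (auto simp: vfibre_def)

lemma fibre_add: "x \<in> pts N ==> u \<in> vfibre W x ==> v \<in> vfibre W x ==> vadd W u v \<in> vfibre W x"
 and fibre_scale: "x \<in> pts N ==> u \<in> vfibre W x ==> vscale W c u \<in> vfibre W x"
 by (rule real_vector_space_on.add_closed[OF fibre_vector_space]; assumption)
  (rule real_vector_space_on.scale_closed[OF fibre_vector_space]; assumption)

lemma lincomb_ex:
 assumes x: "x \<in> pts N" and "finite I" "!!i. i \<in> I ==> s i \<in> vfibre W x"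
 shows "\<exists>v\<in>vfibre W x. \<forall>l. flin x l --> l v = (\<Sum>i\<in>I. c i * l (s i))"
 using assms(2,3)
proof (induction I rule: finite_induct)
 case empty
 from real_vector_space_on.zero_neg[OF fibre_vector_space[OF x]]
 obtain z where z0: "z \<in> vfibre W x" "\<forall>u\<in>vfibre W x. vadd W u z = u" by (elim bexE conjE)
 then have z: "z \<in> vfibre W x" "vadd W z z = z" by auto
 have "l z = 0" if "flin x l" for l
 proof -
  have "l (vadd W z z) = l z + l z" using that z(1) by (auto simp: flin_def)
  then show ?thesis using z(2) by simp
 qed
 then show ?case using z(1) by (intro bexI[of _ z]) auto
next
 case (insert i I)
 then obtain v where v: "v \<in> vfibre W x" "\<forall>l. flin x l --> l v = (\<Sum>i\<in>I. c i * l (s i))" by auto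
 have si: "s i \<in> vfibre W x" "vscale W (c i) (s i) \<in> vfibre W x" using insert fibre_scale[OF x] by auto
 show ?case
 proof (intro bexI[of _ "vadd W (vscale W (c i) (s i)) v"] allI impI)
  show "vadd W (vscale W (c i) (s i)) v \<in> vfibre W x" by (rule fibre_add[OF x si(2) v(1)])
  fix l assume "flin x l"
  then show "l (vadd W (vscale W (c i) (s i)) v) = (\<Sum>i\<in>insert i I. c i * l (s i))"
   using v si insert(1,2) by (simp add: flin_def)
 qed
qed

text \<open>The fibres carry no type-class structure. Tests by linear functionals turn their identities into
  identities between real numbers.\<close>

lemma fibre_eqI:
 assumes x: "x \<in> pts N" and uv: "u \<in> vfibre W x" "v \<in> vfibre W x" and eq: "!!l. flin x l ==> l u = l v"
 shows "u = v"
proof -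
 obtain F :: "'d set" and U \<Psi> where U: "x \<in> U" "linear_triv N W F U \<Psi>" using trivial x by blast
 interpret triv N "vtot W" "vproj W" F U \<Psi> by (rule linear_triv_triv[OF U(2)])
 have "y u = y v" by (rule euclidean_eqI) (rule eq[OF flin_triv[OF U(2,1)]])
 then show ?thesis using U(1) uv by (intro triv_eqI) (auto dest: fibreD)
qed

text \<open>Continuity of the projected map keeps nearby values in the same trivialisation.\<close>

lemma sm_at_fibreI:
 assumes P: "atlas P" and p: "p \<in> S" and s: "!!z. z \<in> S ==> s z \<in> pts (vtot W)"
  and b: "sm_at P S N (%z. vproj W (s z)) p"
  and v: "!!F U \<Psi>. linear_triv N W (F :: 'd set) U \<Psi> ==> vproj W (s p) \<in> U ==> sm_at P S euclid (%z. snd (\<Psi> (s z))) p"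
 shows "sm_at P S (vtot W) s p"
proof -
 have "vproj W (s p) \<in> pts N" by (rule sm_at_pts[OF atN b])
 then obtain F :: "'d set" and U \<Psi> where U: "vproj W (s p) \<in> U" "linear_triv N W F U \<Psi>" using trivial by blast
 interpret triv N "vtot W" "vproj W" F U \<Psi> by (rule linear_triv_triv[OF U(2)])
 obtain Q where Q: "openin (mtop P) Q" "p \<in> Q" "(%z. vproj W (s z)) ` (S \<inter> Q) \<subseteq> U"
  using sm_at_continuous[OF P atN b p openU U(1)] by blast
 show ?thesis
  by (rule sm_at_trivI[OF P p Q(1,2) _ b v[OF U(2,1)]]) (use s Q(3) in auto)
qed

end

text \<open>The second alternative covers the points where no good set is selected.\<close>

lemma smooth_extend_zero:
 assumes P: "atlas P" and x: "x \<in> pts P" and W: "openin (mtop P) W" "x \<in> W"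
  and m: "sma P euclid \<mu> x"
  and d: "(\<forall>z\<in>W. f z = \<mu> z *\<^sub>R g z) & sma P euclid g x \<or> (\<forall>z\<in>W. f z = 0)"
 shows "sma P euclid f x"
 using d
proof
 assume d: "(\<forall>z\<in>W. f z = \<mu> z *\<^sub>R g z) & sma P euclid g x"
 then have "sma P euclid (%z. \<mu> z *\<^sub>R g z) x" by (intro sm_at_scaleR[OF P x m]) simp
 then show ?thesis by (rule sm_at_eq_near[OF P _ W x]) (use d in simp)
next
 assume "\<forall>z\<in>W. f z = 0"
 then show ?thesis by (intro sm_at_eq_near[OF P sm_at_const[OF P atlas_euclid x, of 0] W x]) auto
qed

text \<open>A frame in the sense of frame theory: the sections need not be linearly independent and the
  coefficients \<open>\<theta> i v\<close> are a choice among many. In return it is finite and global, so that sections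
  can be decomposed without localising brackets. The indices pair a function of the finite partition of
  unity with a basis vector of the typical fibre.\<close>

locale frame = vector_bundle N W
 for N :: "('p, 'b::euclidean_space) manifold" and W :: "('w, 'd::euclidean_space, 'p) vec_bundle" +
 fixes I :: "(nat \<times> 'd) set" and \<sigma> :: "nat \<times> 'd => 'p => 'w" and \<theta> :: "nat \<times> 'd => 'w => real"
 assumes finI: "finite I" and \<sigma>_sec: "!!i. \<sigma> i \<in> vsec N W"
  and \<theta>_smooth: "!!i w. w \<in> pts (vtot W) ==> sma (vtot W) euclid (\<theta> i) w"
  and \<theta>_lin: "!!i x. x \<in> pts N ==> flin x (\<theta> i)"
  and expand: "!!x v l. x \<in> pts N ==> v \<in> vfibre W x ==> flin x l ==> l v = (\<Sum>i\<in>I. \<theta> i v * l (\<sigma> i x))"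

lemma (in vector_bundle) vsec_iff:
 "s \<in> vsec N W \<longleftrightarrow> s \<in> extensional (pts N) & (\<forall>x\<in>pts N. s x \<in> vfibre W x & sma N (vtot W) s x)"
 using sm_at_pts[OF atW, of N "pts N" s] by (auto simp: vsec_def sections_def smooth_map_iff[OF atN atW] vfibre_def)

text \<open>Multiply the local frames by \<open>\<eta> c\<close> and the local coordinates by \<open>\<mu> c\<close>. For fixed \<open>c\<close> the trivialisation may
  vary from point to point, but it is constant near every point where one of the two does not vanish.\<close>

lemma (in vector_bundle) frame_exists: "\<exists>I \<sigma> \<theta>. frame N W I \<sigma> \<theta>"
proof -
 obtain F :: "'d set" where F: "subspace F" "!!x. x \<in> pts N ==> \<exists>U \<Psi>. x \<in> U & linear_triv N W F U \<Psi>"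
  using trivial by blast
 obtain B where B: "finite B" "B \<subseteq> F" "!!f. f \<in> F ==> f = (\<Sum>b\<in>B. (f \<bullet> b) *\<^sub>R b)"
  using subspace_frame[OF F(1)] by blast
 define G where "G U \<longleftrightarrow> (\<exists>\<Psi>. linear_triv N W F U \<Psi>)" for U
 define \<Psi> where "\<Psi> U = (SOME \<Psi>. linear_triv N W F U \<Psi>)" for U
 have G: "linear_triv N W F U (\<Psi> U)" if "G U" for U using that unfolding G_def \<Psi>_def by (rule someI_ex)
 have "\<forall>x\<in>pts N. \<exists>U. openin (mtop N) U & x \<in> U & G U"
  using F(2) by (force simp: G_def linear_triv_def local_triv_def)
 from finite_partition[OF base_manifold this]
 obtain m :: nat and \<eta> \<mu> \<kappa> where s: "\<forall>c. \<forall>x\<in>pts N. sma N euclid (\<eta> c) x & sma N euclid (\<mu> c) x"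
  and one: "\<forall>x\<in>pts N. (\<Sum>c<m. \<eta> c x * \<mu> c x) = (1::real)"
  and dich: "\<forall>c. \<forall>x\<in>pts N. \<exists>Q. openin (mtop N) Q & x \<in> Q &
    ((\<exists>U. G U & Q \<subseteq> U & (\<forall>y\<in>Q. \<kappa> c y = U)) \<or> (\<forall>y\<in>Q. \<eta> c y = 0 & \<mu> c y = 0))"
  by (elim exE conjE) rule
 have good: "G (\<kappa> c x)" "x \<in> \<kappa> c x" if "x \<in> pts N" "\<eta> c x \<noteq> 0 \<or> \<mu> c x \<noteq> 0" for c x
  using dich[rule_format, OF that(1), of c] that(2) by auto
 define \<Theta> where "\<Theta> U = triv.\<Theta> (vtot W) (vproj W) U (\<Psi> U)" for U
 have tr: "triv N (vtot W) (vproj W) F U (\<Psi> U)" if "G U" for U by (rule linear_triv_triv[OF G[OF that]])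
 have \<Theta>: "\<Theta> U x f \<in> vfibre W x" "snd (\<Psi> U (\<Theta> U x f)) = f" if "G U" "x \<in> U" "f \<in> F" for U x f
  using triv.\<Theta>[OF tr[OF that(1)] that(2,3)] by (auto simp: \<Theta>_def vfibre_def)
 \<comment> \<open>The vector \<open>\<eta> c x\<close> times a basis vector, with value zero where no trivialisation is selected.\<close>
 define \<sigma> where "\<sigma> i = (\<lambda>x\<in>pts N. SOME v. v \<in> vfibre W x &
   (\<forall>l. flin x l --> l v = (if \<eta> (fst i) x = 0 then 0 else \<eta> (fst i) x * l (\<Theta> (\<kappa> (fst i) x) x (if snd i \<in> F then snd i else 0)))))" for i :: "nat \<times> 'd"
 define \<theta> where "\<theta> i w = (if \<mu> (fst i) (vproj W w) = 0 then 0 else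
   \<mu> (fst i) (vproj W w) * (snd (\<Psi> (\<kappa> (fst i) (vproj W w)) w) \<bullet> snd i))" for i :: "nat \<times> 'd" and w
 have \<sigma>: "\<sigma> i x \<in> vfibre W x & (\<forall>l. flin x l --> l (\<sigma> i x) = (if \<eta> (fst i) x = 0 then 0 else
   \<eta> (fst i) x * l (\<Theta> (\<kappa> (fst i) x) x (if snd i \<in> F then snd i else 0))))" if x: "x \<in> pts N" for i x
 proof -
  let ?f = "if snd i \<in> F then snd i else 0"
  have f: "?f \<in> F" using subspace_0[OF F(1)] by auto
  have "\<exists>v. v \<in> vfibre W x & (\<forall>l. flin x l --> l v = (if \<eta> (fst i) x = 0 then 0 else \<eta> (fst i) x * l (\<Theta> (\<kappa> (fst i) x) x ?f)))"
  proof (cases "\<eta> (fst i) x = 0")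
   case True
   then show ?thesis using lincomb_ex[OF x, of "{}"] by auto
  next
   case False
   then have g: "G (\<kappa> (fst i) x)" "x \<in> \<kappa> (fst i) x" using good[OF x] by auto
   then show ?thesis using False lincomb_ex[OF x, of "{i}" "%_. \<Theta> (\<kappa> (fst i) x) x ?f" "%_. \<eta> (fst i) x"] \<Theta>(1)[OF g f] by auto
  qed
  from someI_ex[OF this] show ?thesis unfolding \<sigma>_def restrict_apply if_P[OF x] .
 qed
 have "frame N W ({..<m} \<times> B) \<sigma> \<theta>"
 proof (intro frame.intro frame_axioms.intro vector_bundle_axioms)
  show "finite ({..<m} \<times> B)" using B by simp
  show "\<sigma> i \<in> vsec N W" for i
   unfolding vsec_iff
  proof (intro conjI ballI)
   show "\<sigma> i \<in> extensional (pts N)" by (simp add: \<sigma>_def)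
   fix x assume x: "x \<in> pts N"
   show "\<sigma> i x \<in> vfibre W x" using \<sigma>[OF x] by blast
   let ?f = "if snd i \<in> F then snd i else 0"
   have f: "?f \<in> F" using subspace_0[OF F(1)] by auto
   show "sma N (vtot W) (\<sigma> i) x"
   proof (rule sm_at_fibreI[OF atN x])
    show "\<sigma> i z \<in> pts (vtot W)" if "z \<in> pts N" for z using \<sigma>[OF that] fibreD by blast
    show "sma N N (%z. vproj W (\<sigma> i z)) x"
     by (rule sm_at_cong[OF sm_at_id[OF atN x] x]) (use \<sigma> fibreD in metis)
    fix F' :: "'d set" and V \<Psi>' assume V: "linear_triv N W F' V \<Psi>'" "vproj W (\<sigma> i x) \<in> V"
    have xV: "x \<in> V" using V(2) \<sigma>[OF x] fibreD by metis
    interpret T: triv N "vtot W" "vproj W" F' V \<Psi>' by (rule linear_triv_triv[OF V(1)])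
    from dich[rule_format, OF x, of "fst i"] obtain Q where Q: "openin (mtop N) Q" "x \<in> Q"
     "(\<exists>U. G U & Q \<subseteq> U & (\<forall>y\<in>Q. \<kappa> (fst i) y = U)) \<or> (\<forall>y\<in>Q. \<eta> (fst i) y = 0 & \<mu> (fst i) y = 0)" by blast
    have QV: "openin (mtop N) (Q \<inter> V)" "x \<in> Q \<inter> V" using Q T.openU xV by auto
    have QN: "z \<in> pts N" if "z \<in> Q \<inter> V" for z using openin_subset[OF QV(1)] atlas.topspace_mtop[OF atN] that by auto
    show "sma N euclid (%z. snd (\<Psi>' (\<sigma> i z))) x"
    proof (rule smooth_extend_zero[OF atN x QV, of "\<eta> (fst i)" _ "%z. snd (\<Psi>' (\<Theta> (\<kappa> (fst i) x) z ?f))"])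
     show "sma N euclid (\<eta> (fst i)) x" using s x by blast
     have co: "snd (\<Psi>' (\<sigma> i z)) = (if \<eta> (fst i) z = 0 then 0 else \<eta> (fst i) z *\<^sub>R snd (\<Psi>' (\<Theta> (\<kappa> (fst i) z) z ?f)))"
      if z: "z \<in> Q \<inter> V" for z
     proof (rule euclidean_eqI)
      fix b :: 'd
      have "flin z (%w. snd (\<Psi>' w) \<bullet> b)" using flin_triv[OF V(1)] z by blast
      then show "snd (\<Psi>' (\<sigma> i z)) \<bullet> b = (if \<eta> (fst i) z = 0 then 0 else \<eta> (fst i) z *\<^sub>R snd (\<Psi>' (\<Theta> (\<kappa> (fst i) z) z ?f))) \<bullet> b"
       using conjunct2[OF \<sigma>[OF QN[OF z], of i], rule_format] by (auto split: if_splits)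
     qed
     show "(\<forall>z\<in>Q \<inter> V. snd (\<Psi>' (\<sigma> i z)) = \<eta> (fst i) z *\<^sub>R snd (\<Psi>' (\<Theta> (\<kappa> (fst i) x) z ?f))) &
       sma N euclid (%z. snd (\<Psi>' (\<Theta> (\<kappa> (fst i) x) z ?f))) x \<or> (\<forall>z\<in>Q \<inter> V. snd (\<Psi>' (\<sigma> i z)) = 0)"
      using Q(3)
     proof
      assume "\<forall>y\<in>Q. \<eta> (fst i) y = 0 & \<mu> (fst i) y = 0"
      then show ?thesis using co by auto
     next
      assume "\<exists>U. G U & Q \<subseteq> U & (\<forall>y\<in>Q. \<kappa> (fst i) y = U)"
      then obtain U where U: "G U" "Q \<subseteq> U" "\<forall>y\<in>Q. \<kappa> (fst i) y = U" by blast
      interpret T': triv N "vtot W" "vproj W" F U "\<Psi> U" by (rule tr[OF U(1)])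
      have c: "sm_at N (Q \<inter> V) (vtot W) (%z. \<Theta> U z ?f) x"
       unfolding \<Theta>_def
       by (rule T'.\<Theta>_smooth[OF atN QV(2) sm_at_id[OF atN x] sm_at_const[OF atN atlas_euclid x]]) (use U(2) f in auto)
      have "sm_at N (Q \<inter> V) euclid (%z. snd (\<Psi>' (\<Theta> U z ?f))) x"
       by (rule T.y_comp[OF QV(2) c]) (use \<Theta>(1)[OF U(1) _ f] U(2) QV(2) in \<open>auto simp: vfibre_def\<close>)
      then have "sma N euclid (%z. snd (\<Psi>' (\<Theta> U z ?f))) x" using sm_at_open[OF atN QV] by blast
      moreover have "\<kappa> (fst i) x = U" using U(3) Q(2) by blast
      ultimately show ?thesis using co U(3) by auto
     qed
    qed
   qed
  qed
  show "flin x (\<theta> i)" if x: "x \<in> pts N" for i x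
  proof (cases "\<mu> (fst i) x = 0")
   case True
   then show ?thesis by (simp add: flin_def \<theta>_def fibreD(2) fibreD(2)[OF fibre_add[OF x]] fibreD(2)[OF fibre_scale[OF x]])
  next
   case False
   then have g: "G (\<kappa> (fst i) x)" "x \<in> \<kappa> (fst i) x" using good[OF x] by auto
   from flin_triv[OF G[OF g(1)] g(2), of "snd i"] show ?thesis
    using False by (simp add: flin_def \<theta>_def fibreD(2) fibreD(2)[OF fibre_add[OF x]] fibreD(2)[OF fibre_scale[OF x]] algebra_simps)
  qed
  show "sma (vtot W) euclid (\<theta> i) w" if w: "w \<in> pts (vtot W)" for i w
  proof -
   have x: "vproj W w \<in> pts N" by (rule sm_at_pts[OF atN vproj_smooth[OF w]])
   from dich[rule_format, OF x, of "fst i"] obtain Q where Q: "openin (mtop N) Q" "vproj W w \<in> Q"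
     "(\<exists>U. G U & Q \<subseteq> U & (\<forall>y\<in>Q. \<kappa> (fst i) y = U)) \<or> (\<forall>y\<in>Q. \<eta> (fst i) y = 0 & \<mu> (fst i) y = 0)" by blast
   obtain Q' where Q': "openin (mtop (vtot W)) Q'" "w \<in> Q'" "vproj W ` (pts (vtot W) \<inter> Q') \<subseteq> Q"
    using sm_at_continuous[OF atW atN vproj_smooth[OF w] w Q(1,2)] by blast
   have Qp: "z \<in> pts (vtot W) & vproj W z \<in> Q" if "z \<in> Q'" for z
    using Q'(3) openin_subset[OF Q'(1)] atlas.topspace_mtop[OF atW] that by auto
   have m: "sma (vtot W) euclid (%z. \<mu> (fst i) (vproj W z)) w"
    by (rule sm_at_compose[OF atN atlas_euclid vproj_smooth[OF w] _ w])
     (use s x sm_at_pts[OF atN vproj_smooth] in auto)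
   show ?thesis
   proof (rule smooth_extend_zero[OF atW w Q'(1,2) m, of _ "%z. snd (\<Psi> (\<kappa> (fst i) (vproj W w)) z) \<bullet> snd i"])
    show "(\<forall>z\<in>Q'. \<theta> i z = \<mu> (fst i) (vproj W z) *\<^sub>R (snd (\<Psi> (\<kappa> (fst i) (vproj W w)) z) \<bullet> snd i)) &
      sma (vtot W) euclid (%z. snd (\<Psi> (\<kappa> (fst i) (vproj W w)) z) \<bullet> snd i) w \<or> (\<forall>z\<in>Q'. \<theta> i z = 0)"
     using Q(3)
    proof
     assume "\<forall>y\<in>Q. \<eta> (fst i) y = 0 & \<mu> (fst i) y = 0"
     then show ?thesis using Qp by (auto simp: \<theta>_def)
    next
     assume "\<exists>U. G U & Q \<subseteq> U & (\<forall>y\<in>Q. \<kappa> (fst i) y = U)"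
     then obtain U where U: "G U" "Q \<subseteq> U" "\<forall>y\<in>Q. \<kappa> (fst i) y = U" by blast
     interpret T': triv N "vtot W" "vproj W" F U "\<Psi> U" by (rule tr[OF U(1)])
     have "sma (vtot W) euclid (%z. snd (\<Psi> U z) \<bullet> snd i) w"
      by (rule sm_at_blin[OF bounded_linear_inner_left w T'.y_smooth]) (use w U(2) Q(2) in auto)
     then show ?thesis using U(3) Q(2) Qp by (auto simp: \<theta>_def)
    qed
   qed
  qed
  fix x v l assume x: "x \<in> pts N" and v: "v \<in> vfibre W x" and l: "flin x l"
  have c: "(\<Sum>b\<in>B. \<theta> (c, b) v * l (\<sigma> (c, b) x)) = \<eta> c x * \<mu> c x * l v" for c
  proof (cases "\<eta> c x = 0 \<or> \<mu> c x = 0")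
   case True
   then have "\<theta> (c, b) v * l (\<sigma> (c, b) x) = 0" for b
    using conjunct2[OF \<sigma>[OF x, of "(c, b)"], rule_format, OF l] fibreD(2)[OF v] by (auto simp: \<theta>_def)
   then have "(\<Sum>b\<in>B. \<theta> (c, b) v * l (\<sigma> (c, b) x)) = 0" by (intro sum.neutral ballI)
   then show ?thesis using True by auto
  next
   case False
   let ?U = "\<kappa> c x"
   have g: "G ?U" "x \<in> ?U" using good[OF x] False by auto
   interpret T: triv N "vtot W" "vproj W" F ?U "\<Psi> ?U" by (rule tr[OF g(1)])
   have yadd: "snd (\<Psi> ?U (vadd W u w)) = snd (\<Psi> ?U u) + snd (\<Psi> ?U w)" "snd (\<Psi> ?U (vscale W k u)) = k *\<^sub>R snd (\<Psi> ?U u)"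
    if "u \<in> vfibre W x" "w \<in> vfibre W x" for u w k
    using G[OF g(1)] g(2) that by (auto simp: linear_triv_def)
   let ?L = "%f. l (\<Theta> ?U x f)"
   have inj: "u = w" if "u \<in> vfibre W x" "w \<in> vfibre W x" "snd (\<Psi> ?U u) = snd (\<Psi> ?U w)" for u w
    using that g(2) by (intro T.triv_eqI) (auto dest: fibreD)
   have Ladd: "?L (f + h) = ?L f + ?L h" if "f \<in> F" "h \<in> F" for f h
   proof -
    have "\<Theta> ?U x (f + h) = vadd W (\<Theta> ?U x f) (\<Theta> ?U x h)"
     using \<Theta>[OF g] that subspace_add[OF F(1) that] yadd fibre_add[OF x] by (intro inj) auto
    then show ?thesis using l \<Theta>(1)[OF g] that by (simp add: flin_def)
   qed
   have Lsc: "?L (k *\<^sub>R f) = k * ?L f" if "f \<in> F" for f k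
   proof -
    have "\<Theta> ?U x (k *\<^sub>R f) = vscale W k (\<Theta> ?U x f)"
     using \<Theta>[OF g] that subspace_scale[OF F(1) that] yadd(2)[of "\<Theta> ?U x f" "\<Theta> ?U x f" k] fibre_scale[OF x]
     by (intro inj) auto
    then show ?thesis using l \<Theta>(1)[OF g] that by (simp add: flin_def)
   qed
   have Lsum: "?L (\<Sum>b\<in>B'. k b *\<^sub>R b) = (\<Sum>b\<in>B'. k b * ?L b)" if "finite B'" "B' \<subseteq> F" for B' k
    using that
   proof (induction B' rule: finite_induct)
    case empty
    show ?case using Lsc[OF subspace_0[OF F(1)], of 0] by simp
   next
    case (insert b B')
    then have "(\<Sum>b\<in>B'. k b *\<^sub>R b) \<in> F" "b \<in> F" using F(1) by (auto intro!: subspace_sum subspace_scale)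
    then show ?case using insert Ladd[of "k b *\<^sub>R b"] Lsc[of b] subspace_scale[OF F(1)] by simp
   qed
   have vU: "v \<in> T.XU" using v g by (auto dest: fibreD)
   let ?f = "snd (\<Psi> ?U v)"
   have "l v = ?L ?f" using T.\<Theta>_y[OF vU] fibreD(2)[OF v] by (simp add: \<Theta>_def)
   also have "\<dots> = ?L (\<Sum>b\<in>B. (?f \<bullet> b) *\<^sub>R b)" using B(3)[OF T.y_in[OF vU]] by simp
   also have "\<dots> = (\<Sum>b\<in>B. (?f \<bullet> b) * ?L b)" by (rule Lsum[OF B(1,2)])
   finally have lv: "l v = (\<Sum>b\<in>B. (?f \<bullet> b) * ?L b)" .
   have "(\<Sum>b\<in>B. \<theta> (c, b) v * l (\<sigma> (c, b) x)) = (\<Sum>b\<in>B. \<eta> c x * \<mu> c x * ((?f \<bullet> b) * ?L b))"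
   proof (rule sum.cong[OF refl])
    fix b assume "b \<in> B"
    then have "b \<in> F" using B by blast
    then show "\<theta> (c, b) v * l (\<sigma> (c, b) x) = \<eta> c x * \<mu> c x * ((?f \<bullet> b) * ?L b)"
     using conjunct2[OF \<sigma>[OF x, of "(c, b)"], rule_format, OF l] False fibreD(2)[OF v] by (simp add: \<theta>_def)
   qed
   then show ?thesis unfolding lv by (simp add: sum_distrib_left)
  qed
  have "(\<Sum>i\<in>{..<m} \<times> B. \<theta> i v * l (\<sigma> i x)) = (\<Sum>c<m. \<Sum>b\<in>B. \<theta> (c, b) v * l (\<sigma> (c, b) x))"
   by (simp add: sum.cartesian_product case_prod_unfold)
  also have "\<dots> = l v" unfolding c sum_distrib_right[symmetric] using one x by simp
  finally show "l v = (\<Sum>i\<in>{..<m} \<times> B. \<theta> i v * l (\<sigma> i x))" ..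
 qed
 then show ?thesis by blast
qed

section \<open>Smooth operations on bundles\<close>

context vector_bundle
begin

lemma vadd_coord:
 assumes "linear_triv N W F U \<Psi>" "x \<in> U" "u \<in> vfibre W x" "v \<in> vfibre W x"
 shows "snd (\<Psi> (vadd W u v)) = snd (\<Psi> u) + snd (\<Psi> v)" "snd (\<Psi> (vscale W c u)) = c *\<^sub>R snd (\<Psi> u)"
 using assms by (auto simp: linear_triv_def)

lemma coord_smooth:
 assumes "linear_triv N W F U \<Psi>" "p \<in> S" "sm_at P S (vtot W) s p" "e p \<in> U" "!!z. z \<in> S ==> s z \<in> vfibre W (e z)"
 shows "sm_at P S euclid (%z. snd (\<Psi> (s z))) p"
proof -
 interpret T: triv N "vtot W" "vproj W" F U \<Psi> by (rule linear_triv_triv[OF assms(1)])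
 show ?thesis by (rule T.y_comp[OF assms(2,3)]) (use assms(4) fibreD[OF assms(5)] assms(2) in auto)
qed

text \<open>The candidate \<open>c\<close> for the coordinates has to agree with them only over the trivialising set, because
  that set is open.\<close>

lemma sm_at_fibre_coordI:
 assumes P: "atlas P" and p: "p \<in> S" and e: "sm_at P S N e p" and s: "!!z. z \<in> S ==> s z \<in> vfibre W (e z)"
  and v: "!!F U \<Psi>. linear_triv N W (F :: 'd set) U \<Psi> ==> e p \<in> U ==>
   \<exists>c. sm_at P S euclid c p & (\<forall>z\<in>S. e z \<in> U --> snd (\<Psi> (s z)) = c z)"
 shows "sm_at P S (vtot W) s p"
proof (rule sm_at_fibreI[OF P p])
 show "s z \<in> pts (vtot W)" if "z \<in> S" for z using s[OF that] fibreD by blast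
 have pe: "vproj W (s z) = e z" if "z \<in> S" for z using s[OF that] fibreD by blast
 show "sm_at P S N (%z. vproj W (s z)) p" by (rule sm_at_cong[OF e p]) (simp add: pe)
 fix F :: "'d set" and U \<Psi> assume U: "linear_triv N W F U \<Psi>" "vproj W (s p) \<in> U"
 then have eU: "e p \<in> U" using pe[OF p] by simp
 interpret T: triv N "vtot W" "vproj W" F U \<Psi> by (rule linear_triv_triv[OF U(1)])
 obtain c where c: "sm_at P S euclid c p" "\<forall>z\<in>S. e z \<in> U --> snd (\<Psi> (s z)) = c z" using v[OF U(1) eU] by blast
 obtain Q where Q: "openin (mtop P) Q" "p \<in> Q" "e ` (S \<inter> Q) \<subseteq> U"
  using sm_at_continuous[OF P atN e p T.openU eU] by blast
 show "sm_at P S euclid (%z. snd (\<Psi> (s z))) p"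
  by (rule sm_at_eq_near[OF P c(1) Q(1,2) p]) (use c(2) Q(3) in auto)
qed

lemma vadd_smooth:
 assumes P: "atlas P" and p: "p \<in> S" and e: "sm_at P S N e p"
  and u: "sm_at P S (vtot W) u p" "!!z. z \<in> S ==> u z \<in> vfibre W (e z)"
  and v: "sm_at P S (vtot W) v p" "!!z. z \<in> S ==> v z \<in> vfibre W (e z)"
  and eN: "!!z. z \<in> S ==> e z \<in> pts N"
 shows "sm_at P S (vtot W) (%z. vadd W (u z) (v z)) p"
proof (rule sm_at_fibre_coordI[OF P p e])
 show "vadd W (u z) (v z) \<in> vfibre W (e z)" if "z \<in> S" for z using fibre_add eN u v that by blast
 fix F :: "'d set" and U \<Psi> assume U: "linear_triv N W F U \<Psi>" "e p \<in> U"
 from sm_at_add[OF P p coord_smooth[OF U(1) p u(1) U(2) u(2)] coord_smooth[OF U(1) p v(1) U(2) v(2)]] show "\<exists>c. sm_at P S euclid c p & (\<forall>z\<in>S. e z \<in> U --> snd (\<Psi> (vadd W (u z) (v z))) = c z)"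
  using vadd_coord(1)[OF U(1)] u(2) v(2) by blast
qed

lemma vscale_smooth:
 assumes P: "atlas P" and p: "p \<in> S" and e: "sm_at P S N e p"
  and u: "sm_at P S (vtot W) u p" "!!z. z \<in> S ==> u z \<in> vfibre W (e z)"
  and f: "sm_at P S euclid f p" and eN: "!!z. z \<in> S ==> e z \<in> pts N"
 shows "sm_at P S (vtot W) (%z. vscale W (f z) (u z)) p"
proof (rule sm_at_fibre_coordI[OF P p e])
 show "vscale W (f z) (u z) \<in> vfibre W (e z)" if "z \<in> S" for z using fibre_scale eN u that by blast
 fix F :: "'d set" and U \<Psi> assume U: "linear_triv N W F U \<Psi>" "e p \<in> U"
 from sm_at_scaleR[OF P p f coord_smooth[OF U(1) p u(1) U(2) u(2)]] show "\<exists>c. sm_at P S euclid c p & (\<forall>z\<in>S. e z \<in> U --> snd (\<Psi> (vscale W (f z) (u z))) = c z)"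
  using vadd_coord(2)[OF U(1) _ u(2) u(2)] by blast
qed

lemma vsecD:
 assumes "s \<in> vsec N W" "x \<in> pts N" shows "s x \<in> vfibre W x" "sma N (vtot W) s x"
 using assms vsec_iff by auto

lemma vsecI: "s \<in> extensional (pts N) ==> (!!x. x \<in> pts N ==> s x \<in> vfibre W x) ==>
  (!!x. x \<in> pts N ==> sma N (vtot W) s x) ==> s \<in> vsec N W"
 using vsec_iff by auto

lemma sec_add_closed: assumes "s \<in> vsec N W" "r \<in> vsec N W" shows "sec_add N W s r \<in> vsec N W"
proof (rule vsecI)
 fix x assume x: "x \<in> pts N"
 show "sec_add N W s r x \<in> vfibre W x" using x assms vsecD fibre_add by (simp add: sec_add_def)
 have "sma N (vtot W) (%x. vadd W (s x) (r x)) x"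
  by (rule vadd_smooth[OF atN x sm_at_id[OF atN x]]) (use x assms vsecD in auto)
 then show "sma N (vtot W) (sec_add N W s r) x" by (rule sm_at_cong) (use x in \<open>auto simp: sec_add_def\<close>)
qed (simp add: sec_add_def)

lemma sec_scale_closed: assumes "s \<in> vsec N W" "!!x. x \<in> pts N ==> sma N euclid f x" shows "sec_scale N W f s \<in> vsec N W"
proof (rule vsecI)
 fix x assume x: "x \<in> pts N"
 show "sec_scale N W f s x \<in> vfibre W x" using x assms vsecD fibre_scale by (simp add: sec_scale_def)
 have "sma N (vtot W) (%x. vscale W (f x) (s x)) x"
  by (rule vscale_smooth[OF atN x sm_at_id[OF atN x]]) (use x assms vsecD in auto)
 then show "sma N (vtot W) (sec_scale N W f s) x" by (rule sm_at_cong) (use x in \<open>auto simp: sec_scale_def\<close>)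
qed (simp add: sec_scale_def)

end

context frame
begin

lemma frame_eqI:
 assumes "x \<in> pts N" "u \<in> vfibre W x" "v \<in> vfibre W x" "!!i. i \<in> I ==> \<theta> i u = \<theta> i v"
 shows "u = v"
 using assms by (intro fibre_eqI[OF assms(1-3)]) (simp add: expand)

text \<open>Linear combinations of the frame sections in the fibre over \<open>x\<close>, characterised by linear functionals.\<close>

definition lc :: "'p => (nat \<times> 'd => real) => 'w" where
 "lc x u = (SOME v. v \<in> vfibre W x & (\<forall>l. flin x l --> l v = (\<Sum>i\<in>I. u i * l (\<sigma> i x))))"

lemma lc:
 assumes x: "x \<in> pts N"
 shows "lc x u \<in> vfibre W x" "flin x l ==> l (lc x u) = (\<Sum>i\<in>I. u i * l (\<sigma> i x))"
proof -
 have "\<exists>v. v \<in> vfibre W x & (\<forall>l. flin x l --> l v = (\<Sum>i\<in>I. u i * l (\<sigma> i x)))"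
  using lincomb_ex[OF x finI, of "%i. \<sigma> i x" u] vsecD[OF \<sigma>_sec x] by blast
 from someI_ex[OF this] show "lc x u \<in> vfibre W x" "flin x l ==> l (lc x u) = (\<Sum>i\<in>I. u i * l (\<sigma> i x))"
  unfolding lc_def by blast+
qed

lemma lc_\<theta>: assumes x: "x \<in> pts N" and v: "v \<in> vfibre W x" shows "lc x (%i. \<theta> i v) = v"
proof (rule fibre_eqI[OF x lc(1)[OF x] v])
 fix l assume l: "flin x l"
 show "l (lc x (%i. \<theta> i v)) = l v" using lc(2)[OF x l] expand[OF x v l] by simp
qed

lemma lc_smooth:
 assumes P: "atlas P" and p: "p \<in> S" "p \<in> pts P" and e: "sm_at P S N e p" and eN: "!!z. z \<in> S ==> e z \<in> pts N"
  and u: "!!i. i \<in> I ==> sm_at P S euclid (%z. u z i) p"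
 shows "sm_at P S (vtot W) (%z. lc (e z) (u z)) p"
proof (rule sm_at_fibre_coordI[OF P p(1) e])
 show "lc (e z) (u z) \<in> vfibre W (e z)" if "z \<in> S" for z by (rule lc(1)[OF eN[OF that]])
 fix F :: "'d set" and U \<Psi> assume U: "linear_triv N W F U \<Psi>" "e p \<in> U"
 have "sm_at P S euclid (%z. \<Sum>i\<in>I. u z i *\<^sub>R snd (\<Psi> (\<sigma> i (e z)))) p"
 proof (intro sm_at_sum[OF P p] sm_at_scaleR[OF P p(1)] u)
  fix i
  have "sm_at P S (vtot W) (%z. \<sigma> i (e z)) p"
   by (rule sm_at_compose[OF atN atW e vsecD(2)[OF \<sigma>_sec eN[OF p(1)]] p(1) eN])
  then show "sm_at P S euclid (%z. snd (\<Psi> (\<sigma> i (e z)))) p"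
   by (rule coord_smooth[where e = e, OF U(1) p(1) _ U(2) vsecD(1)[OF \<sigma>_sec eN]])
 qed
 moreover have "snd (\<Psi> (lc (e z) (u z))) = (\<Sum>i\<in>I. u z i *\<^sub>R snd (\<Psi> (\<sigma> i (e z))))" if z: "z \<in> S" "e z \<in> U" for z
  by (rule euclidean_eqI) (simp add: lc(2)[OF eN[OF z(1)] flin_triv[OF U(1) z(2)]] inner_sum_left)
 ultimately show "\<exists>c. sm_at P S euclid c p & (\<forall>z\<in>S. e z \<in> U --> snd (\<Psi> (lc (e z) (u z))) = c z)" by blast
qed

lemma \<theta>_comp:
 assumes "p \<in> S" "sm_at P S (vtot W) s p" "!!z. z \<in> S ==> s z \<in> pts (vtot W)"
 shows "sm_at P S euclid (%z. \<theta> i (s z)) p"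
 by (rule sm_at_compose[OF atW atlas_euclid assms(2) \<theta>_smooth[OF assms(3)[OF assms(1)]] assms(1,3)])

lemma \<theta>_add: "x \<in> pts N ==> u \<in> vfibre W x ==> v \<in> vfibre W x ==> \<theta> i (vadd W u v) = \<theta> i u + \<theta> i v"
 and \<theta>_scale: "x \<in> pts N ==> u \<in> vfibre W x ==> \<theta> i (vscale W c u) = c * \<theta> i u"
 using \<theta>_lin[of x i] by (auto simp: flin_def)

end

section \<open>Affine bundles have global sections\<close>

context affine_bundle
begin

lemma atA: "atlas (atot A)"
 using smooth_manifold_atlas atotal_manifold by auto

lemma aproj_sm: "a \<in> pts (atot A) ==> sma (atot A) N (aproj A) a"
 using aproj_smooth smooth_map_iff[OF atA atN] by blast

definition aff_triv :: "'c set => 'p set => ('a => 'p \<times> 'c) => ('w => 'p \<times> 'c) => bool" where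
 "aff_triv F U \<Phi> \<Psi> \<longleftrightarrow> subspace F & local_triv N (atot A) (aproj A) F U \<Phi> & linear_triv N W F U \<Psi> &
   (\<forall>y\<in>U. \<forall>a\<in>afibre A y. \<forall>v\<in>vfibre W y. snd (\<Phi> (aplus A a v)) = snd (\<Phi> a) + snd (\<Psi> v))"

lemma aff_triv_ex: "\<exists>F. \<forall>x\<in>pts N. \<exists>U \<Phi> \<Psi>. x \<in> U & aff_triv F U \<Phi> \<Psi>"
proof -
 from affine_trivial obtain F :: "'c set" where F: "subspace F"
  "\<forall>x\<in>pts N. \<exists>U \<Phi> \<Psi>. x \<in> U & local_triv N (atot A) (aproj A) F U \<Phi> & linear_triv N W F U \<Psi> &
    (\<forall>y\<in>U. \<forall>a\<in>afibre A y. \<forall>v\<in>vfibre W y. snd (\<Phi> (aplus A a v)) = snd (\<Phi> a) + snd (\<Psi> v))"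
  by (elim exE conjE)
 then show ?thesis by (intro exI[of _ F]) (simp add: aff_triv_def)
qed

lemma aff_triv_triv: "aff_triv F U \<Phi> \<Psi> ==> triv N (atot A) (aproj A) F U \<Phi>"
 using base_manifold atotal_manifold aproj_sm by (intro triv.intro) (auto simp: aff_triv_def)

lemma afibreD: "a \<in> afibre A x ==> a \<in> pts (atot A)" "a \<in> afibre A x ==> aproj A a = x"
 by (auto simp: afibre_def)

text \<open>The difference \<open>b - a\<close> of two points of an affine fibre.\<close>

definition adiff :: "'a => 'a => 'w" where
 "adiff a b = (THE v. v \<in> vfibre W (aproj A a) & aplus A a v = b)"

lemma adiff:
 assumes "x \<in> pts N" "a \<in> afibre A x" "b \<in> afibre A x"
 shows "adiff a b \<in> vfibre W x" "aplus A a (adiff a b) = b"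
 using theI'[OF plus_simply_transitive[OF assms]] afibreD(2)[OF assms(2)] by (simp_all add: adiff_def)

lemma adiff_aplus:
 assumes "x \<in> pts N" "a \<in> afibre A x" "v \<in> vfibre W x" shows "adiff a (aplus A a v) = v"
 using plus_simply_transitive[OF assms(1,2) plus_closed[OF assms]] adiff[OF assms(1,2) plus_closed[OF assms]] assms(3) by blast

lemma adiff_coord:
 assumes "aff_triv F U \<Phi> \<Psi>" "x \<in> pts N" "x \<in> U" "a \<in> afibre A x" "b \<in> afibre A x"
 shows "snd (\<Psi> (adiff a b)) = snd (\<Phi> b) - snd (\<Phi> a)"
proof -
 note d = adiff[OF assms(2,4,5)]
 have "snd (\<Phi> (aplus A a (adiff a b))) = snd (\<Phi> a) + snd (\<Psi> (adiff a b))"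
  using assms d(1) by (simp add: aff_triv_def)
 then show ?thesis using d(2) by simp
qed

lemma aff_coord_smooth:
 assumes "aff_triv F U \<Phi> \<Psi>" "p \<in> S" "sm_at P S (atot A) s p" "e p \<in> U" "!!z. z \<in> S ==> s z \<in> afibre A (e z)"
 shows "sm_at P S euclid (%z. snd (\<Phi> (s z))) p"
proof -
 interpret T: triv N "atot A" "aproj A" F U \<Phi> by (rule aff_triv_triv[OF assms(1)])
 show ?thesis by (rule T.y_comp[OF assms(2,3)]) (use assms(4) afibreD[OF assms(5)] assms(2) in auto)
qed

lemma sm_at_afibre_coordI:
 assumes P: "atlas P" and p: "p \<in> S" and e: "sm_at P S N e p" and s: "!!z. z \<in> S ==> s z \<in> afibre A (e z)"
  and v: "!!F U \<Phi> \<Psi>. aff_triv F U \<Phi> \<Psi> ==> e p \<in> U ==>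
   \<exists>c. sm_at P S euclid c p & (\<forall>z\<in>S. e z \<in> U --> snd (\<Phi> (s z)) = c z)"
 shows "sm_at P S (atot A) s p"
proof -
 have sp: "s z \<in> pts (atot A)" "aproj A (s z) = e z" if "z \<in> S" for z using s[OF that] afibreD by auto
 have "e p \<in> pts N" by (rule sm_at_pts[OF atN e])
 then obtain F U \<Phi> \<Psi> where U: "e p \<in> U" "aff_triv F U \<Phi> \<Psi>" using aff_triv_ex by blast
 interpret T: triv N "atot A" "aproj A" F U \<Phi> by (rule aff_triv_triv[OF U(2)])
 obtain c where c: "sm_at P S euclid c p" "\<forall>z\<in>S. e z \<in> U --> snd (\<Phi> (s z)) = c z" using v[OF U(2,1)] by blast
 obtain Q where Q: "openin (mtop P) Q" "p \<in> Q" "e ` (S \<inter> Q) \<subseteq> U"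
  using sm_at_continuous[OF P atN e p T.openU U(1)] by blast
 show ?thesis
 proof (rule T.sm_at_trivI[OF P p Q(1,2)])
  show "sm_at P S N (%z. aproj A (s z)) p" by (rule sm_at_cong[OF e p]) (simp add: sp)
  show "sm_at P S euclid (%z. snd (\<Phi> (s z))) p"
   by (rule sm_at_eq_near[OF P c(1) Q(1,2) p]) (use c(2) Q(3) in auto)
 qed (use sp Q(3) in auto)
qed

lemma aplus_smooth:
 assumes P: "atlas P" and p: "p \<in> S" and e: "sm_at P S N e p"
  and a: "sm_at P S (atot A) a p" "!!z. z \<in> S ==> a z \<in> afibre A (e z)"
  and v: "sm_at P S (vtot W) v p" "!!z. z \<in> S ==> v z \<in> vfibre W (e z)"
  and eN: "!!z. z \<in> S ==> e z \<in> pts N"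
 shows "sm_at P S (atot A) (%z. aplus A (a z) (v z)) p"
proof (rule sm_at_afibre_coordI[OF P p e])
 show "aplus A (a z) (v z) \<in> afibre A (e z)" if "z \<in> S" for z using plus_closed eN a v that by blast
 fix F U \<Phi> \<Psi> assume U: "aff_triv F U \<Phi> \<Psi>" "e p \<in> U"
 have "linear_triv N W F U \<Psi>" using U(1) by (simp add: aff_triv_def)
 from coord_smooth[OF this p v(1) U(2) v(2)] aff_coord_smooth[OF U(1) p a(1) U(2) a(2)] have "sm_at P S euclid (%z. snd (\<Phi> (a z)) + snd (\<Psi> (v z))) p" by (intro sm_at_add[OF P p])
 then show "\<exists>c. sm_at P S euclid c p & (\<forall>z\<in>S. e z \<in> U --> snd (\<Phi> (aplus A (a z) (v z))) = c z)"
  using U(1) a(2) v(2) unfolding aff_triv_def by blast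
qed

lemma adiff_smooth:
 assumes P: "atlas P" and p: "p \<in> S" and e: "sm_at P S N e p"
  and a: "sm_at P S (atot A) a p" "!!z. z \<in> S ==> a z \<in> afibre A (e z)"
  and b: "sm_at P S (atot A) b p" "!!z. z \<in> S ==> b z \<in> afibre A (e z)"
  and eN: "!!z. z \<in> S ==> e z \<in> pts N"
 shows "sm_at P S (vtot W) (%z. adiff (a z) (b z)) p"
proof -
 have sp: "adiff (a z) (b z) \<in> vfibre W (e z)" if "z \<in> S" for z using adiff(1)[OF eN a(2) b(2)] that by blast
 obtain F U \<Phi> \<Psi> where U: "e p \<in> U" "aff_triv F U \<Phi> \<Psi>" using aff_triv_ex eN[OF p] by blast
 then have lt: "linear_triv N W F U \<Psi>" by (simp add: aff_triv_def)
 interpret T: triv N "vtot W" "vproj W" F U \<Psi> by (rule linear_triv_triv[OF lt])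
 obtain Q where Q: "openin (mtop P) Q" "p \<in> Q" "e ` (S \<inter> Q) \<subseteq> U"
  using sm_at_continuous[OF P atN e p T.openU U(1)] by blast
 note c = sm_at_diff[OF P p aff_coord_smooth[OF U(2) p b(1) U(1) b(2)] aff_coord_smooth[OF U(2) p a(1) U(1) a(2)]]
 show ?thesis
 proof (rule T.sm_at_trivI[OF P p Q(1,2)])
  show "sm_at P S N (%z. vproj W (adiff (a z) (b z))) p" by (rule sm_at_cong[OF e p]) (simp add: fibreD(2)[OF sp])
  show "sm_at P S euclid (%z. snd (\<Psi> (adiff (a z) (b z)))) p"
   by (rule sm_at_eq_near[OF P c Q(1,2) p]) (use Q(3) adiff_coord[OF U(2) eN _ a(2) b(2)] in auto)
 qed (use fibreD[OF sp] Q(3) in auto)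
qed

lemma asec_iff:
 "s \<in> asec N A \<longleftrightarrow> s \<in> extensional (pts N) & (\<forall>x\<in>pts N. s x \<in> afibre A x & sma N (atot A) s x)"
 using sm_at_pts[OF atA, of N "pts N" s] by (auto simp: asec_def sections_def smooth_map_iff[OF atN atA] afibre_def)

lemma asecD:
 assumes "s \<in> asec N A" "x \<in> pts N" shows "s x \<in> afibre A x" "sma N (atot A) s x"
 using assms asec_iff by auto

lemma asecI: "s \<in> extensional (pts N) ==> (!!x. x \<in> pts N ==> s x \<in> afibre A x) ==>
  (!!x. x \<in> pts N ==> sma N (atot A) s x) ==> s \<in> asec N A"
 using asec_iff by auto

lemma sec_plus_closed: assumes "s \<in> asec N A" "r \<in> vsec N W" shows "sec_plus N A s r \<in> asec N A"
proof (rule asecI)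
 fix x assume x: "x \<in> pts N"
 show "sec_plus N A s r x \<in> afibre A x" using x assms vsecD asecD plus_closed by (simp add: sec_plus_def)
 have "sma N (atot A) (%x. aplus A (s x) (r x)) x"
  by (rule aplus_smooth[OF atN x sm_at_id[OF atN x]]) (use x assms vsecD asecD in auto)
 then show "sma N (atot A) (sec_plus N A s r) x" by (rule sm_at_cong) (use x in \<open>auto simp: sec_plus_def\<close>)
qed (simp add: sec_plus_def)

text \<open>Local sections are combined by weights that sum to one. The arbitrary, non-smooth origin \<open>a0\<close> only
  expresses the affine combination and cancels in coordinates.\<close>

lemma global_section: "asec N A \<noteq> {}"
proof -
 obtain F where F: "\<forall>x\<in>pts N. \<exists>U \<Phi> \<Psi>. x \<in> U & aff_triv F U \<Phi> \<Psi>" using aff_triv_ex by blast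
 define G where "G U \<longleftrightarrow> (\<exists>\<Phi> \<Psi>. aff_triv F U \<Phi> \<Psi>)" for U
 define \<Phi> where "\<Phi> U = (SOME \<Phi>. \<exists>\<Psi>. aff_triv F U \<Phi> \<Psi>)" for U
 have G: "\<exists>\<Psi>. aff_triv F U (\<Phi> U) \<Psi>" if "G U" for U using that unfolding G_def \<Phi>_def by (rule someI_ex)
 have "\<forall>x\<in>pts N. \<exists>U. openin (mtop N) U & x \<in> U & G U"
 proof
  fix x assume "x \<in> pts N"
  then obtain U \<Phi> \<Psi> where U: "x \<in> U" "aff_triv F U \<Phi> \<Psi>" using F by blast
  then have "openin (mtop N) U" by (simp add: aff_triv_def local_triv_def)
  then show "\<exists>U. openin (mtop N) U & x \<in> U & G U" using U G_def by blast
 qed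
 from finite_partition[OF base_manifold this]
 obtain m :: nat and \<eta> \<mu> \<kappa> where s: "\<forall>c. \<forall>x\<in>pts N. sma N euclid (\<eta> c) x & sma N euclid (\<mu> c) x"
  and one: "\<forall>x\<in>pts N. (\<Sum>c<m. \<eta> c x * \<mu> c x) = (1::real)"
  and dich: "\<forall>c. \<forall>x\<in>pts N. \<exists>Q. openin (mtop N) Q & x \<in> Q &
    ((\<exists>U. G U & Q \<subseteq> U & (\<forall>y\<in>Q. \<kappa> c y = U)) \<or> (\<forall>y\<in>Q. \<eta> c y = 0 & \<mu> c y = 0))"
  by (elim exE conjE) rule
 define w where "w c x = \<eta> c x * \<mu> c x" for c x
 have tr: "triv N (atot A) (aproj A) F U (\<Phi> U)" if "G U" for U using aff_triv_triv G[OF that] by blast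
 have F0: "0 \<in> F" if "G U" for U using G[OF that] by (auto simp: aff_triv_def subspace_0)
 define \<Theta> where "\<Theta> U x = triv.\<Theta> (atot A) (aproj A) U (\<Phi> U) x 0" for U x
 have \<Theta>: "\<Theta> U x \<in> afibre A x" if "G U" "x \<in> U" for U x
  using triv.\<Theta>[OF tr[OF that(1)] that(2) F0[OF that(1)]] by (auto simp: \<Theta>_def afibre_def)
 define a0 where "a0 x = (SOME a. a \<in> afibre A x)" for x
 have a0: "a0 x \<in> afibre A x" if "x \<in> pts N" for x using fibre_nonempty[OF that] unfolding a0_def by (simp add: some_in_eq)
 define z where "z c x = (if G (\<kappa> c x) & x \<in> \<kappa> c x then \<Theta> (\<kappa> c x) x else a0 x)" for c x
 have z: "z c x \<in> afibre A x" if "x \<in> pts N" for c x using \<Theta> a0[OF that] by (simp add: z_def)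
 have "\<exists>v\<in>vfibre W x. \<forall>l. flin x l --> l v = (\<Sum>c<m. w c x * l (adiff (a0 x) (z c x)))" if x: "x \<in> pts N" for x
  using adiff(1)[OF x a0[OF x] z[OF x]] by (intro lincomb_ex[OF x]) auto
 then obtain v where v: "!!x. x \<in> pts N ==> v x \<in> vfibre W x"
  "!!x l. x \<in> pts N ==> flin x l ==> l (v x) = (\<Sum>c<m. w c x * l (adiff (a0 x) (z c x)))" by metis
 define \<zeta> where "\<zeta> = (\<lambda>x\<in>pts N. aplus A (a0 x) (v x))"
 have fib: "\<zeta> x \<in> afibre A x" if "x \<in> pts N" for x using plus_closed[OF that a0 v(1)] that by (simp add: \<zeta>_def)
 have "\<zeta> \<in> asec N A"
 proof (rule asecI)
  fix x assume x: "x \<in> pts N"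
  show "sma N (atot A) \<zeta> x"
  proof (rule sm_at_afibre_coordI[OF atN x sm_at_id[OF atN x] fib])
   fix F' U \<Phi>' \<Psi>' assume U: "aff_triv F' U \<Phi>' \<Psi>'" "x \<in> U"
   then have lt: "linear_triv N W F' U \<Psi>'" by (simp add: aff_triv_def)
   interpret T: triv N "atot A" "aproj A" F' U \<Phi>' by (rule aff_triv_triv[OF U(1)])
   have "sma N euclid (%y. w c y *\<^sub>R snd (\<Phi>' (z c y))) x" for c
   proof -
    have ws: "sma N euclid (w c) x" unfolding w_def using s x by (intro sm_at_mult[OF atN x]) auto
    from dich[rule_format, OF x, of c] obtain Q where Q: "openin (mtop N) Q" "x \<in> Q"
     "(\<exists>U. G U & Q \<subseteq> U & (\<forall>y\<in>Q. \<kappa> c y = U)) \<or> (\<forall>y\<in>Q. \<eta> c y = 0 & \<mu> c y = 0)" by blast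
    have QU: "openin (mtop N) (Q \<inter> U)" "x \<in> Q \<inter> U" using Q T.openU U(2) by auto
    show ?thesis
    proof (rule smooth_extend_zero[OF atN x QU ws, of _ "%y. snd (\<Phi>' (\<Theta> (\<kappa> c x) y))"])
     show "(\<forall>y\<in>Q \<inter> U. w c y *\<^sub>R snd (\<Phi>' (z c y)) = w c y *\<^sub>R snd (\<Phi>' (\<Theta> (\<kappa> c x) y))) &
       sma N euclid (%y. snd (\<Phi>' (\<Theta> (\<kappa> c x) y))) x \<or> (\<forall>y\<in>Q \<inter> U. w c y *\<^sub>R snd (\<Phi>' (z c y)) = 0)"
      using Q(3)
     proof
      assume "\<forall>y\<in>Q. \<eta> c y = 0 & \<mu> c y = 0"
      then show ?thesis by (auto simp: w_def)
     next
      assume "\<exists>U. G U & Q \<subseteq> U & (\<forall>y\<in>Q. \<kappa> c y = U)"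
      then obtain V where V: "G V" "Q \<subseteq> V" "\<forall>y\<in>Q. \<kappa> c y = V" by blast
      interpret T': triv N "atot A" "aproj A" F V "\<Phi> V" by (rule tr[OF V(1)])
      have c: "sm_at N (Q \<inter> U) (atot A) (%y. \<Theta> V y) x"
       unfolding \<Theta>_def
       by (rule T'.\<Theta>_smooth[OF atN QU(2) sm_at_id[OF atN x] sm_at_const[OF atN atlas_euclid x]]) (use V F0 in auto)
      have "sm_at N (Q \<inter> U) euclid (%y. snd (\<Phi>' (\<Theta> V y))) x"
       by (rule aff_coord_smooth[where e = "%y. y", OF U(1) QU(2) c U(2)]) (use \<Theta>[OF V(1)] V(2) in auto)
      then have "sma N euclid (%y. snd (\<Phi>' (\<Theta> V y))) x" using sm_at_open[OF atN QU] by blast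
      moreover have "\<kappa> c x = V" using V(3) Q(2) by blast
      moreover have "z c y = \<Theta> V y" if "y \<in> Q" for y using V that by (auto simp: z_def)
      ultimately show ?thesis by auto
     qed
    qed
   qed
   then have "sma N euclid (%y. \<Sum>c<m. w c y *\<^sub>R snd (\<Phi>' (z c y))) x" by (rule sm_at_sum[OF atN x x])
   moreover have "snd (\<Phi>' (\<zeta> y)) = (\<Sum>c<m. w c y *\<^sub>R snd (\<Phi>' (z c y)))" if y: "y \<in> pts N" "y \<in> U" for y
   proof -
    have "snd (\<Psi>' (v y)) = (\<Sum>c<m. w c y *\<^sub>R (snd (\<Phi>' (z c y)) - snd (\<Phi>' (a0 y))))"
     by (rule euclidean_eqI)
      (simp add: v(2)[OF y(1) flin_triv[OF lt y(2)]] inner_sum_left adiff_coord[OF U(1) y a0[OF y(1)] z[OF y(1)]])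
    also have "\<dots> = (\<Sum>c<m. w c y *\<^sub>R snd (\<Phi>' (z c y))) - (\<Sum>c<m. w c y) *\<^sub>R snd (\<Phi>' (a0 y))"
     by (simp add: scaleR_diff_right sum_subtractf scaleR_sum_left)
    also have "(\<Sum>c<m. w c y) = 1" using one y(1) by (simp add: w_def)
    finally show ?thesis using U(1) y a0[OF y(1)] v(1)[OF y(1)] by (simp add: aff_triv_def \<zeta>_def)
   qed
   ultimately show "\<exists>c. sma N euclid c x & (\<forall>z\<in>pts N. z \<in> U --> snd (\<Phi>' (\<zeta> z)) = c z)" by blast
  qed
 qed (use fib in \<open>auto simp: \<zeta>_def\<close>)
 then show ?thesis by blast
qed

end

section \<open>Vector fields depending on parameters, and determination by global functions\<close>

lemma sm_at_cvec:
 assumes P: "atlas P" and N: "smooth_manifold N" and p: "p \<in> S" "p \<in> pts P" and Y: "sm_at P S (TB N) Y p"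
  and YT: "!!z. z \<in> S ==> Y z \<in> pts (TB N)" and c: "(U, \<phi>) \<in> charts N" "fst (Y p) \<in> U"
 shows "sm_at P S euclid (%z. cvec \<phi> (snd (Y z))) p"
 unfolding cvec_def
proof (rule sm_at_sum[OF P p])
 fix i
 note at = smooth_manifold_atlas[OF N]
 have "sma N euclid (%q. \<phi> q \<bullet> i) (fst (Y p))"
  by (rule sm_at_blin[OF bounded_linear_inner_left _ sm_at_chart[OF at c]]) (use c atlas.chart_sub[OF at c(1)] in auto)
 from sma_apply[OF N Y YT p(1) this]
 show "sm_at P S euclid (%z. snd (Y z) (%q. \<phi> q \<bullet> i) *\<^sub>R i) p"
  by (rule sm_at_blin[OF bounded_linear_scaleR_left p(1)])
qed

text \<open>In charts this is the partial derivative of \<open>G\<close> in the direction \<open>Y z\<close>, evaluated on the graph of the foot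
  point map.\<close>

lemma sm_at_partial:
 fixes N :: "('p, 'b::euclidean_space) manifold" and P :: "('q, 'c::euclidean_space) manifold"
 assumes P: "atlas P" and N: "smooth_manifold N" and p: "p \<in> pts P" and Y: "sma P (TB N) Y p"
  and YT: "!!z. z \<in> pts P ==> Y z \<in> pts (TB N)"
  and G: "sma (prod_mfd N P) euclid (%q. G (fst q) (snd q) :: real) (fst (Y p), p)"
 shows "sma P euclid (%z. snd (Y z) (%x. G x z)) p"
proof -
 note at = smooth_manifold_atlas[OF N]
 have x0: "fst (Y p) \<in> pts N" using YT[OF p] by auto
 obtain U \<phi> where c: "(U, \<phi>) \<in> charts N" "fst (Y p) \<in> U" using atlas.chart_at[OF at x0] by blast
 obtain V \<psi> where d: "(V, \<psi>) \<in> charts P" "p \<in> V" using atlas.chart_at[OF P p] by blast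
 obtain H where H: "gchart N U \<phi> H" using chart_gchartE[OF N c(1)] by blast
 have cd: "(U \<times> V, map_prod \<phi> \<psi>) \<in> charts (prod_mfd N P)" using c d by (auto simp: charts_prod)
 have "\<exists>A g. open A & map_prod \<phi> \<psi> (fst (Y p), p) \<in> A & Cinf A g & (\<forall>y\<in>pts (prod_mfd N P) \<inter> U \<times> V.
   map_prod \<phi> \<psi> y \<in> A --> G (fst y) (snd y) \<in> UNIV & id (G (fst y) (snd y)) = g (map_prod \<phi> \<psi> y))"
  by (rule sm_at_charts[OF atlas_prod[OF at P] atlas_euclid G _ cd]) (use x0 p c d in auto)
 then obtain A g where A: "open A" "(\<phi> (fst (Y p)), \<psi> p) \<in> A" "Cinf A g"
  and Ag: "\<forall>y\<in>pts (prod_mfd N P) \<inter> U \<times> V. map_prod \<phi> \<psi> y \<in> A --> G (fst y) (snd y) = g (map_prod \<phi> \<psi> y)"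
  by auto
 have YTb: "fst (Y z) \<in> pts N" "snd (Y z) \<in> tangent_space N (fst (Y z))" if "z \<in> pts P" for z using YT[OF that] by auto
 have Yb: "sma P N (%z. fst (Y z)) p"
  by (rule sm_at_compose[OF atlas_tangent[OF N] at Y sma_tangent_fst[OF N YT[OF p]] p YT])
 have ph: "sma P euclid (%z. \<phi> (fst (Y z))) p"
  by (rule sm_at_compose[OF at atlas_euclid Yb sm_at_chart[OF at c] p YTb(1)])
 note pp = sm_at_Pair_euclid[OF P p ph sm_at_chart[OF P d]]
 obtain Q1 where Q1: "openin (mtop P) Q1" "p \<in> Q1" "(%z. fst (Y z)) ` (pts P \<inter> Q1) \<subseteq> U"
  using sm_at_continuous[OF P at Yb p atlas.openin_chart_dom[OF at c(1)] c(2)] by blast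
 have oA: "openin (mtop euclid) A" using A by simp
 obtain Q2 where Q2: "openin (mtop P) Q2" "p \<in> Q2" "(%z. (\<phi> (fst (Y z)), \<psi> z)) ` (pts P \<inter> Q2) \<subseteq> A"
  using sm_at_continuous[OF P atlas_euclid pp p oA A(2)] by blast
 let ?Q = "Q1 \<inter> Q2 \<inter> V"
 have Q: "openin (mtop P) ?Q" "p \<in> ?Q" using Q1 Q2 d atlas.openin_chart_dom[OF P d(1)] by auto
 let ?z = "%z. ((\<phi> (fst (Y z)), \<psi> z), (cvec \<phi> (snd (Y z)), 0 :: 'c))"
 have "sma P euclid ?z p"
  by (intro sm_at_Pair_euclid[OF P p] ph sm_at_chart[OF P d] sm_at_cvec[OF P N p p Y YT c] sm_at_const[OF P atlas_euclid p]) auto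
 from sm_at_Cinf[OF this p open_Times[OF A(1) open_UNIV] _ Cinf_frechet_apply[OF A(1,3)]] A(2)
 have "sma P euclid (%z. FD g (at (\<phi> (fst (Y z)), \<psi> z)) (cvec \<phi> (snd (Y z)), 0)) p" by simp
 then show ?thesis
 proof (rule sm_at_eq_near[OF P _ Q p])
  fix z assume z: "z \<in> pts P" "z \<in> ?Q"
  then have zU: "fst (Y z) \<in> U" "(\<phi> (fst (Y z)), \<psi> z) \<in> A" "z \<in> V" using Q1(3) Q2(3) by auto
  let ?j = "%u. (u, \<psi> z)"
  have Cj: "Cinf UNIV ?j" by (auto intro!: Ck_on_Pair Ck_on_id Ck_on_const)
  have Aj: "open (?j -` A)" using Cinf_compose(1)[OF open_UNIV A(1) Cj A(3)] by simp
  have gj: "Cinf (?j -` A) (%u. g (u, \<psi> z))" using Cinf_compose(2)[OF open_UNIV A(1) Cj A(3)] by simp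
  have "snd (Y z) (%x. G x z) = FD (%u. g (u, \<psi> z)) (at (\<phi> (fst (Y z)))) (cvec \<phi> (snd (Y z)))"
  proof (rule tan_gchart[OF at H zU(1) YTb(2)[OF z(1)] Aj _ gj])
   fix y assume y: "y \<in> U" "\<phi> y \<in> ?j -` A"
   then have "(y, z) \<in> pts (prod_mfd N P) \<inter> U \<times> V" using zU(3) z(1) atlas.chart_sub[OF at c(1)] by auto
   from bspec[OF Ag this] y show "G y z = g (\<phi> y, \<psi> z)" by simp
  qed (use zU in simp)
  also have "\<dots> = FD g (at (\<phi> (fst (Y z)), \<psi> z)) (cvec \<phi> (snd (Y z)), 0)"
  proof -
   have j: "(?j has_derivative (%v. (v, 0))) (at (\<phi> (fst (Y z))))" by (auto intro!: derivative_eq_intros)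
   from has_derivative_compose[where f = ?j and g = g, OF j Cinf_has_derivative[OF A(3,1) zU(2)]]
   have "(%v. FD g (at (\<phi> (fst (Y z)), \<psi> z)) (v, 0)) = FD (%u. g (u, \<psi> z)) (at (\<phi> (fst (Y z))))"
    by (rule frechet_derivative_at)
   from fun_cong[OF this] show ?thesis by simp
  qed
  finally show "FD g (at (\<phi> (fst (Y z)), \<psi> z)) (cvec \<phi> (snd (Y z)), 0) = snd (Y z) (%x. G x z)" ..
 qed
qed

text \<open>A bump function with support in the domain of smoothness. With the Leibniz rule it reduces germs to global
  functions in \<open>tan_eq_global\<close>, which is what the Leibniz rule of an algebroid can test.\<close>

lemma cutoff:
 assumes N: "smooth_manifold N" and p: "p \<in> pts N" and g: "g \<in> smooth_near N p"
 shows "\<exists>b. b \<in> smooth_funs N & b p \<noteq> 0 & (%y. b y * g y) \<in> smooth_funs N"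
proof -
 note at = smooth_manifold_atlas[OF N]
 obtain W where W: "openin (mtop N) W" "p \<in> W" "\<forall>y\<in>W. sma N euclid g y"
  using sm_at_nbhd[OF at g[unfolded smooth_near_iff[OF at p]]] by blast
 from bump_function[OF N W(1,2)] obtain b K where b: "\<forall>x\<in>pts N. sma N euclid b x" "\<forall>x. b x \<ge> (0::real)" "b p > 0"
  "compactin (mtop N) K" "K \<subseteq> W" "\<forall>x. x \<notin> K --> b x = 0" by (elim exE conjE) rule
 have cl: "openin (mtop N) (pts N - K)"
  using compactin_imp_closedin[OF smooth_manifold.hausdorff[OF N] b(4)] atlas.topspace_mtop[OF at] by (simp add: closedin_def)
 have "sma N euclid (%y. b y * g y) x" if x: "x \<in> pts N" for x
 proof (cases "x \<in> W")
  case True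
  then show ?thesis using b(1) W(3) x by (intro sm_at_mult[OF at x]) auto
 next
  case False
  then have "x \<in> pts N - K" using b(5) x by blast
  then show ?thesis
   by (intro sm_at_eq_near[OF at sm_at_const[OF at atlas_euclid x, of 0] cl _ x]) (use b(6) in auto)
 qed
 then show ?thesis using b(1,3) smooth_funs_iff[OF at] by (intro exI[of _ b]) auto
qed

lemma smooth_funs_near: "atlas N ==> p \<in> pts N ==> f \<in> smooth_funs N ==> f \<in> smooth_near N p"
 by (simp add: smooth_funs_iff smooth_near_iff)

lemma tan_eq_global:
 assumes N: "smooth_manifold N" and p: "p \<in> pts N" and D: "D \<in> tangent_space N p" "D' \<in> tangent_space N p"
  and eq: "!!f. f \<in> smooth_funs N ==> D f = D' f"
 shows "D = D'"
proof
 fix g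
 note at = smooth_manifold_atlas[OF N]
 show "D g = D' g"
 proof (cases "g \<in> smooth_near N p")
  case True
  obtain b where b: "b \<in> smooth_funs N" "b p \<noteq> 0" "(%y. b y * g y) \<in> smooth_funs N" using cutoff[OF N p True] by blast
  note bn = smooth_funs_near[OF at p b(1)]
  have "D b * g p + b p * D g = D' b * g p + b p * D' g"
   using tan_mult[OF D(1) bn True] tan_mult[OF D(2) bn True] eq[OF b(3)] by simp
  then show ?thesis using eq[OF b(1)] b(2) by simp
 qed (simp add: tan_zero[OF D(1)] tan_zero[OF D(2)])
qed

text \<open>On a function all six compositions of three derivations occur twice with opposite signs.\<close>

lemma lie_jacobi:
 assumes N: "smooth_manifold N" and X: "vector_field N X" and Y: "vector_field N Y" and Z: "vector_field N Z" and p: "p \<in> pts N"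
 shows "lie_bracket N X (lie_bracket N Y Z) p =
  tadd (lie_bracket N (lie_bracket N X Y) Z p) (lie_bracket N Y (lie_bracket N X Z) p)"
proof -
 note at = smooth_manifold_atlas[OF N] and vf = vector_field_lie_bracket[OF N]
 have lb: "snd (A p) (%x. snd (lie_bracket N B C x) f) = snd (A p) (%x. snd (B x) (%x. snd (C x) f)) - snd (A p) (%x. snd (C x) (%x. snd (B x) f))"
  if A: "vector_field N A" and B: "vector_field N B" and C: "vector_field N C" and f: "f \<in> smooth_near N p" for A B C f
 proof -
  note near = near_apply[OF N _ p] and Ap = vector_fieldD(3)[OF A p]
  obtain W where W: "openin (mtop N) W" "p \<in> W" "W \<subseteq> pts N" "\<forall>y\<in>W. f \<in> smooth_near N y"
   using near_nbhd[OF at p f] by blast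
  have 1: "(%x. (- 1) * snd (C x) (%x. snd (B x) f)) \<in> smooth_near N p"
   by (rule near_mult[OF at p near_const[OF at p] near[OF C near[OF B f]]])
  have "snd (A p) (%x. snd (lie_bracket N B C x) f) =
    snd (A p) (%x. snd (B x) (%x. snd (C x) f) + (- 1) * snd (C x) (%x. snd (B x) f))"
   by (rule tan_local[OF at p Ap near[OF vf[OF B C] f] near_add[OF at p near[OF B near[OF C f]] 1] W(1,2)])
    (use W(3,4) lie_bracket_apply in fastforce)
  also have "\<dots> = snd (A p) (%x. snd (B x) (%x. snd (C x) f)) + (- 1) * snd (A p) (%x. snd (C x) (%x. snd (B x) f))"
   unfolding tan_add[OF Ap near[OF B near[OF C f]] 1] tan_scale[OF Ap near[OF C near[OF B f]]] ..
  finally show ?thesis by simp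
 qed
 have "snd (lie_bracket N X (lie_bracket N Y Z) p) f = snd (lie_bracket N (lie_bracket N X Y) Z p) f + snd (lie_bracket N Y (lie_bracket N X Z) p) f" for f
 proof (cases "f \<in> smooth_near N p")
  case True
  note near = near_apply[OF N _ p True]
  show ?thesis
   unfolding lie_bracket_apply[OF p True] lie_bracket_apply[OF p near[OF X]] lie_bracket_apply[OF p near[OF Y]] lie_bracket_apply[OF p near[OF Z]]
    lb[OF X Y Z True] lb[OF Z X Y True] lb[OF Y X Z True] by simp
 qed (simp add: lie_bracket_def p)
 then show ?thesis by (intro prod_eqI ext) (simp_all add: tadd_def fst_lie_bracket p)
qed

section \<open>Consequences of the algebroid axioms\<close>

locale alg_frame = affine_lie_algebroid M t V E br act lam rho + frame M V I \<sigma> \<theta>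
 for M :: "('p, 'b::euclidean_space) manifold" and t :: "'p => real"
  and V :: "('v, 'd::euclidean_space, 'p) vec_bundle" and E :: "('e, 'c::euclidean_space, 'v, 'p) aff_bundle"
  and br :: "('p => 'v) => ('p => 'v) => 'p => 'v" and act :: "('p => 'e) => ('p => 'v) => 'p => 'v"
  and lam :: "'e => 'p tvec" and rho :: "'v => 'p tvec" and I :: "(nat \<times> 'd) set"
  and \<sigma> :: "nat \<times> 'd => 'p => 'v" and \<theta> :: "nat \<times> 'd => 'v => real" +
 fixes \<zeta>0 :: "'p => 'e"
 assumes \<zeta>0: "\<zeta>0 \<in> asec M E"
begin

lemma smM: "smooth_manifold M" by (rule base_manifold)

lemma lamD:
 assumes "a \<in> afibre E x"
 shows "lam a \<in> pts (TB M)" "fst (lam a) = x" "sma (atot E) (TB M) lam a" "snd (lam a) t = 1"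
  "snd (lam a) \<in> tangent_space M x"
proof -
 show 1: "lam a \<in> pts (TB M)" "fst (lam a) = x" "snd (lam a) t = 1"
  using lam_jet[OF afibreD(1)[OF assms]] afibreD(2)[OF assms] by (auto simp: first_jet_def)
 show "sma (atot E) (TB M) lam a"
  using lam_smooth afibreD(1)[OF assms] by (simp add: smooth_map_iff[OF atA atlas_tangent[OF smM]])
 show "snd (lam a) \<in> tangent_space M x" using 1 by auto
qed

lemma rhoD:
 assumes "v \<in> vfibre V x"
 shows "rho v \<in> pts (TB M)" "fst (rho v) = x" "sma (vtot V) (TB M) rho v" "snd (rho v) t = 0"
  "snd (rho v) \<in> tangent_space M x"
proof -
 show 1: "rho v \<in> pts (TB M)" "fst (rho v) = x" "snd (rho v) t = 0"
  using rho_vertical[OF fibreD(1)[OF assms]] fibreD(2)[OF assms] by (auto simp: vertical_def)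
 show "sma (vtot V) (TB M) rho v"
  using rho_smooth fibreD(1)[OF assms] by (simp add: smooth_map_iff[OF atW atlas_tangent[OF smM]])
 show "snd (rho v) \<in> tangent_space M x" using 1 by auto
qed

lemma vf_lam: assumes z: "z \<in> asec M E" shows "vector_field M (%x. lam (z x))"
 unfolding vector_field_def
proof (intro ballI conjI)
 fix x assume x: "x \<in> pts M"
 note zx = asecD[OF z]
 show "lam (z x) \<in> pts (TB M)" "fst (lam (z x)) = x" using lamD[OF zx(1)[OF x]] by auto
 show "sma M (TB M) (%x. lam (z x)) x"
  by (rule sm_at_compose[OF atA atlas_tangent[OF smM] zx(2)[OF x] lamD(3)[OF zx(1)[OF x]] x]) (use afibreD zx in blast)
qed

lemma vf_rho: assumes z: "s \<in> vsec M V" shows "vector_field M (%x. rho (s x))"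
 unfolding vector_field_def
proof (intro ballI conjI)
 fix x assume x: "x \<in> pts M"
 note zx = vsecD[OF z]
 show "rho (s x) \<in> pts (TB M)" "fst (rho (s x)) = x" using rhoD[OF zx(1)[OF x]] by auto
 show "sma M (TB M) (%x. rho (s x)) x"
  by (rule sm_at_compose[OF atW atlas_tangent[OF smM] zx(2)[OF x] rhoD(3)[OF zx(1)[OF x]] x]) (use fibreD zx in blast)
qed

lemma vf_funs:
 assumes "vector_field M X" "f \<in> smooth_funs M" shows "(%x. snd (X x) f) \<in> smooth_funs M"
 using near_apply[OF smM assms(1)] smooth_funs_near[OF atN _ assms(2)] unfolding smooth_funs_iff[OF atN]
 by (simp add: smooth_near_iff[OF atN])

lemma flin_rho: "x \<in> pts M ==> flin x (%v. snd (rho v) g)"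
 by (simp add: flin_def rho_add rho_scale tadd_def tscale_def)

lemma \<theta>_sec_add: "x \<in> pts M ==> s \<in> vsec M V ==> r \<in> vsec M V ==> \<theta> i (sec_add M V s r x) = \<theta> i (s x) + \<theta> i (r x)"
 and \<theta>_sec_scale: "x \<in> pts M ==> s \<in> vsec M V ==> \<theta> i (sec_scale M V f s x) = f x * \<theta> i (s x)"
 by (simp_all add: sec_add_def sec_scale_def \<theta>_add \<theta>_scale vsecD(1))

lemma scale_funs: "s \<in> vsec M V ==> f \<in> smooth_funs M ==> sec_scale M V f s \<in> vsec M V"
 using sec_scale_closed smooth_funs_iff[OF atN] by blast

lemma \<theta>_fun: "s \<in> vsec M V ==> (%x. \<theta> i (s x)) \<in> smooth_funs M"
 unfolding smooth_funs_iff[OF atN] using \<theta>_comp[where S = "pts M" and P = M and s = s] vsecD fibreD(1) by blast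

lemma act_leib:
 assumes "z \<in> asec M E" "s \<in> vsec M V" "f \<in> smooth_funs M" "x \<in> pts M"
 shows "\<theta> i (act z (sec_scale M V f s) x) = f x * \<theta> i (act z s x) + snd (lam (z x)) f * \<theta> i (s x)"
 unfolding leibniz[OF assms(1-3)]
 using assms act_closed vf_funs[OF vf_lam] by (simp add: \<theta>_sec_add \<theta>_sec_scale scale_funs)

lemma lam_sec_plus:
 assumes "z \<in> asec M E" "s \<in> vsec M V" "x \<in> pts M"
 shows "snd (lam (sec_plus M E z s x)) f = snd (lam (z x)) f + snd (rho (s x)) f"
 using lam_plus[OF assms(3) asecD(1)[OF assms(1,3)] vsecD(1)[OF assms(2,3)]] assms(3) by (simp add: sec_plus_def tadd_def)

lemma act_sum:
 assumes "z \<in> asec M E" "s \<in> vsec M V" "r \<in> vsec M V" "x \<in> pts M"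
 shows "\<theta> i (act (sec_plus M E z s) r x) = \<theta> i (act z r x) + \<theta> i (br s r x)"
 unfolding act_plus[OF assms(1-3)] using assms act_closed br_closed by (simp add: \<theta>_sec_add)

lemma br_leib:
 assumes s: "s \<in> vsec M V" "r \<in> vsec M V" "f \<in> smooth_funs M" "x \<in> pts M"
 shows "\<theta> i (br s (sec_scale M V f r) x) = f x * \<theta> i (br s r x) + snd (rho (s x)) f * \<theta> i (r x)"
 using act_sum[OF \<zeta>0 s(1) scale_funs[OF s(2,3)] s(4), of i] act_leib[OF sec_plus_closed[OF \<zeta>0 s(1)] s(2-4), of i]
  act_sum[OF \<zeta>0 s(1,2,4), of i] act_leib[OF \<zeta>0 s(2-4), of i] lam_sec_plus[OF \<zeta>0 s(1,4)]
 by (simp add: algebra_simps)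

lemma br_sk: "s \<in> vsec M V ==> r \<in> vsec M V ==> x \<in> pts M ==> \<theta> i (br r s x) = - \<theta> i (br s r x)"
 using br_skew[of s r] br_closed[of s r] by (simp add: \<theta>_sec_scale)

lemma jac:
 assumes "z \<in> asec M E" "s \<in> vsec M V" "r \<in> vsec M V" "x \<in> pts M"
 shows "\<theta> i (act z (br s r) x) = \<theta> i (br (act z s) r x) + \<theta> i (br s (act z r) x)"
 unfolding jacobi[OF assms(1-3)] using assms act_closed br_closed by (simp add: \<theta>_sec_add)

text \<open>The anchors are morphisms of brackets: apply the Jacobi identity to \<open>s\<close> and \<open>f r\<close>, expand with the
  Leibniz rules and compare the coefficients of \<open>r\<close>. This says nothing in a zero fibre, which is treated
  separately.\<close>

lemma lam_act:
 assumes z: "z \<in> asec M E" and s: "s \<in> vsec M V" and x: "x \<in> pts M"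
 shows "rho (act z s x) = lie_bracket M (%x. lam (z x)) (%x. rho (s x)) x"
proof -
 note zs = act_closed[OF z s]
 note lf = vf_funs[OF vf_lam[OF z]] and rf = vf_funs[OF vf_rho]
 have key: "(snd (rho (act z s x)) f + snd (rho (s x)) (%y. snd (lam (z y)) f) - snd (lam (z x)) (%y. snd (rho (s y)) f)) * \<theta> i (r x) = 0"
  if f: "f \<in> smooth_funs M" and r: "r \<in> vsec M V" for f r i
 proof -
  note fr = scale_funs[OF r f]
  have e1: "br s (sec_scale M V f r) = sec_add M V (sec_scale M V f (br s r)) (sec_scale M V (%y. snd (rho (s y)) f) r)"
  proof
   fix y
   show "br s (sec_scale M V f r) y = sec_add M V (sec_scale M V f (br s r)) (sec_scale M V (%y. snd (rho (s y)) f) r) y"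
   proof (cases "y \<in> pts M")
    case True
    have c: "sec_scale M V f (br s r) \<in> vsec M V" "sec_scale M V (%y. snd (rho (s y)) f) r \<in> vsec M V"
     using scale_funs br_closed[OF s r] f r rf[OF s f] by auto
    show ?thesis
     by (rule frame_eqI[OF True vsecD(1)[OF br_closed[OF s fr] True] vsecD(1)[OF sec_add_closed[OF c] True]])
      (simp add: br_leib[OF s r f True] \<theta>_sec_add[OF True c] \<theta>_sec_scale[OF True] br_closed[OF s r] r)
   next
    case False
    have "br s (sec_scale M V f r) \<in> extensional (pts M)" using br_closed[OF s fr] vsec_iff by blast
    from extensional_arb[OF this False] show ?thesis unfolding sec_add_def restrict_def using False by (simp only: if_False)
   qed
  qed
  have c: "sec_scale M V f (br s r) \<in> vsec M V" "sec_scale M V (%y. snd (rho (s y)) f) r \<in> vsec M V"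
   using scale_funs br_closed[OF s r] f r rf[OF s f] by auto
  have "\<theta> i (act z (br s (sec_scale M V f r)) x) = f x * \<theta> i (act z (br s r) x) + snd (lam (z x)) f * \<theta> i (br s r x)
    + (snd (rho (s x)) f * \<theta> i (act z r x) + snd (lam (z x)) (%y. snd (rho (s y)) f) * \<theta> i (r x))"
   unfolding e1 act_add[OF z c] \<theta>_sec_add[OF x act_closed[OF z c(1)] act_closed[OF z c(2)]]
   using act_leib[OF z br_closed[OF s r] f x] act_leib[OF z r rf[OF s f] x] by simp
  moreover have "\<theta> i (br s (act z (sec_scale M V f r)) x) = f x * \<theta> i (br s (act z r) x) + snd (rho (s x)) f * \<theta> i (act z r x)
    + (snd (lam (z x)) f * \<theta> i (br s r x) + snd (rho (s x)) (%y. snd (lam (z y)) f) * \<theta> i (r x))"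
  proof -
   have c: "sec_scale M V f (act z r) \<in> vsec M V" "sec_scale M V (%y. snd (lam (z y)) f) r \<in> vsec M V"
    using scale_funs act_closed[OF z r] f r lf[OF f] by auto
   show ?thesis
    unfolding leibniz[OF z r f] br_add_right[OF s c] \<theta>_sec_add[OF x br_closed[OF s c(1)] br_closed[OF s c(2)]]
    using br_leib[OF s act_closed[OF z r] f x] br_leib[OF s r lf[OF f] x] by simp
  qed
  moreover have "\<theta> i (br (act z s) (sec_scale M V f r) x) = f x * \<theta> i (br (act z s) r x) + snd (rho (act z s x)) f * \<theta> i (r x)"
   by (rule br_leib[OF zs r f x])
  ultimately show ?thesis using jac[OF z s fr x, of i] jac[OF z s r x, of i] by (simp add: algebra_simps)
 qed
 have "snd (rho (act z s x)) = snd (lie_bracket M (%x. lam (z x)) (%x. rho (s x)) x)"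
 proof (rule tan_eq_global[OF smM x])
  show "snd (rho (act z s x)) \<in> tangent_space M x" by (rule rhoD(5)[OF vsecD(1)[OF zs x]])
  show "snd (lie_bracket M (%x. lam (z x)) (%x. rho (s x)) x) \<in> tangent_space M x"
   by (rule vector_fieldD(3)[OF vector_field_lie_bracket[OF smM vf_lam[OF z] vf_rho[OF s]] x])
  fix f assume f: "f \<in> smooth_funs M"
  note fx = smooth_funs_near[OF atN x]
  have "snd (rho (act z s x)) f = snd (lam (z x)) (%y. snd (rho (s y)) f) - snd (rho (s x)) (%y. snd (lam (z y)) f)"
  proof (cases "\<exists>i j. \<theta> i (\<sigma> j x) \<noteq> 0")
   case True
   then obtain i j where "\<theta> i (\<sigma> j x) \<noteq> 0" by blast
   then show ?thesis using key[OF f \<sigma>_sec[of j], of i] by simp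
  next
   case False
   \<comment> \<open>The fibre is zero; only the derivative of the vanishing anchor remains.\<close>
   have s0: "\<theta> i (\<sigma> j x) = 0" for i j using False by blast
   have z0: "\<theta> i v = 0" if "v \<in> vfibre V x" for i v
    by (rule trans[OF expand[OF x that \<theta>_lin[OF x]]]) (simp add: s0)
   have r0: "snd (rho v) g = 0" if "v \<in> vfibre V x" for v g
    using expand[OF x that flin_rho[OF x]] z0[OF that] by simp
   have "snd (lam (z x)) (%y. snd (rho (s y)) f) = snd (lam (z x)) (%y. \<Sum>i\<in>I. \<theta> i (s y) * snd (rho (\<sigma> i y)) f)"
    by (rule tan_local[OF atN x lamD(5)[OF asecD(1)[OF z x]] fx[OF rf[OF s f]] near_sum[OF atN x near_mult[OF atN x fx[OF \<theta>_fun[OF s]] fx[OF rf[OF \<sigma>_sec f]]]]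
      atlas.openin_pts[OF atN] x]) (rule expand[OF _ vsecD(1)[OF s] flin_rho]; assumption)
   also have "\<dots> = (\<Sum>i\<in>I. snd (lam (z x)) (%y. \<theta> i (s y) * snd (rho (\<sigma> i y)) f))"
    by (rule tan_sum[OF atN x lamD(5)[OF asecD(1)[OF z x]]]) (intro near_mult[OF atN x] fx \<theta>_fun s rf \<sigma>_sec f)
   also have "\<dots> = 0"
    by (rule sum.neutral) (simp add: tan_mult[OF lamD(5)[OF asecD(1)[OF z x]] fx[OF \<theta>_fun[OF s]] fx[OF rf[OF \<sigma>_sec f]]]
     z0[OF vsecD(1)[OF s x]] r0[OF vsecD(1)[OF \<sigma>_sec x]])
   finally show ?thesis using r0[OF vsecD(1)[OF zs x]] r0[OF vsecD(1)[OF s x]] by simp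
  qed
  then show "snd (rho (act z s x)) f = snd (lie_bracket M (%x. lam (z x)) (%x. rho (s x)) x) f"
   by (simp add: lie_bracket_apply[OF x fx[OF f]])
 qed
 then show ?thesis using rhoD(2)[OF vsecD(1)[OF zs x]] fst_lie_bracket[OF x] by (intro prod_eqI) auto
qed

lemma lam_act_apply:
 assumes "z \<in> asec M E" "s \<in> vsec M V" "x \<in> pts M" "f \<in> smooth_near M x"
 shows "snd (rho (act z s x)) f = snd (lam (z x)) (%y. snd (rho (s y)) f) - snd (rho (s x)) (%y. snd (lam (z y)) f)"
 unfolding lam_act[OF assms(1-3)] by (rule lie_bracket_apply[OF assms(3,4)])

text \<open>A bracket of sections of the vector bundle is a difference of two actions by affine sections.\<close>

lemma rho_br_apply:
 assumes s: "s \<in> vsec M V" and r: "r \<in> vsec M V" and x: "x \<in> pts M" and f: "f \<in> smooth_near M x"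
 shows "snd (rho (br s r x)) f = snd (rho (s x)) (%y. snd (rho (r y)) f) - snd (rho (r x)) (%y. snd (rho (s y)) f)"
proof -
 let ?z = "sec_plus M E \<zeta>0 s"
 note zs = sec_plus_closed[OF \<zeta>0 s]
 have "act ?z r x = vadd V (act \<zeta>0 r x) (br s r x)" using act_plus[OF \<zeta>0 s r] x by (simp add: sec_add_def)
 then have "snd (rho (act ?z r x)) f = snd (rho (act \<zeta>0 r x)) f + snd (rho (br s r x)) f"
  using rho_add[OF x vsecD(1)[OF act_closed[OF \<zeta>0 r] x] vsecD(1)[OF br_closed[OF s r] x]] by (simp add: tadd_def)
 moreover have "snd (rho (r x)) (%y. snd (lam (?z y)) f) = snd (rho (r x)) (%y. snd (lam (\<zeta>0 y)) f) + snd (rho (r x)) (%y. snd (rho (s y)) f)"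
 proof -
  note D = rhoD(5)[OF vsecD(1)[OF r x]] and n = near_apply[OF smM _ x f]
  have "snd (rho (r x)) (%y. snd (lam (?z y)) f) = snd (rho (r x)) (%y. snd (lam (\<zeta>0 y)) f + snd (rho (s y)) f)"
   by (rule tan_local[OF atN x D n[OF vf_lam[OF zs]] near_add[OF atN x n[OF vf_lam[OF \<zeta>0]] n[OF vf_rho[OF s]]] atlas.openin_pts[OF atN] x])
    (rule lam_sec_plus[OF \<zeta>0 s])
  then show ?thesis using tan_add[OF D n[OF vf_lam[OF \<zeta>0]] n[OF vf_rho[OF s]]] by simp
 qed
 ultimately show ?thesis
  using lam_act_apply[OF zs r x f] lam_act_apply[OF \<zeta>0 r x f] lam_sec_plus[OF \<zeta>0 s x] by simp
qed

text \<open>By the Leibniz rule, since \<open>s\<close> is the finite sum of the sections \<open>\<theta> l (s) \<sigma> l\<close>. This is where a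
  finite frame is needed: the bracket is only defined on global sections.\<close>

lemma act_expand:
 assumes z: "z \<in> asec M E" and s: "s \<in> vsec M V" and x: "x \<in> pts M"
 shows "\<theta> i (act z s x) = (\<Sum>l\<in>I. \<theta> l (s x) * \<theta> i (act z (\<sigma> l) x) + snd (lam (z x)) (%y. \<theta> l (s y)) * \<theta> i (\<sigma> l x))"
proof -
 have "\<exists>r\<in>vsec M V. (\<forall>y\<in>pts M. \<forall>i. \<theta> i (r y) = (\<Sum>l\<in>J. \<theta> l (s y) * \<theta> i (\<sigma> l y))) &
   \<theta> i (act z r x) = (\<Sum>l\<in>J. \<theta> l (s x) * \<theta> i (act z (\<sigma> l) x) + snd (lam (z x)) (%y. \<theta> l (s y)) * \<theta> i (\<sigma> l x))"
  if "finite J" for J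
  using that
 proof (induction J)
  case empty
  have 0: "(%_. 0) \<in> smooth_funs M" unfolding smooth_funs_iff[OF atN] by (auto intro: sm_at_const[OF atN atlas_euclid])
  have r: "sec_scale M V (%_. 0) s \<in> vsec M V" by (rule scale_funs[OF s 0])
  show ?case
   using r act_leib[OF z s 0 x, of i] tan_const[OF atN x lamD(5)[OF asecD(1)[OF z x]], of 0] \<theta>_sec_scale[OF _ s]
   by (intro bexI[OF _ r]) auto
 next
  case (insert j J)
  then obtain r where r: "r \<in> vsec M V" "\<forall>y\<in>pts M. \<forall>i. \<theta> i (r y) = (\<Sum>l\<in>J. \<theta> l (s y) * \<theta> i (\<sigma> l y))"
   "\<theta> i (act z r x) = (\<Sum>l\<in>J. \<theta> l (s x) * \<theta> i (act z (\<sigma> l) x) + snd (lam (z x)) (%y. \<theta> l (s y)) * \<theta> i (\<sigma> l x))" by blast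
  have j: "sec_scale M V (%y. \<theta> j (s y)) (\<sigma> j) \<in> vsec M V" by (rule scale_funs[OF \<sigma>_sec \<theta>_fun[OF s]])
  show ?case
  proof (intro bexI[of _ "sec_add M V (sec_scale M V (%y. \<theta> j (s y)) (\<sigma> j)) r"] conjI ballI allI)
   show "sec_add M V (sec_scale M V (%y. \<theta> j (s y)) (\<sigma> j)) r \<in> vsec M V" by (rule sec_add_closed[OF j r(1)])
   show "\<theta> i (sec_add M V (sec_scale M V (%y. \<theta> j (s y)) (\<sigma> j)) r y) = (\<Sum>l\<in>insert j J. \<theta> l (s y) * \<theta> i (\<sigma> l y))"
    if "y \<in> pts M" for y i
    using insert(1,2) by (simp add: \<theta>_sec_add[OF that j r(1)] \<theta>_sec_scale[OF that \<sigma>_sec] r(2)[rule_format, OF that])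
   show "\<theta> i (act z (sec_add M V (sec_scale M V (%y. \<theta> j (s y)) (\<sigma> j)) r) x) = (\<Sum>l\<in>insert j J.
     \<theta> l (s x) * \<theta> i (act z (\<sigma> l) x) + snd (lam (z x)) (%y. \<theta> l (s y)) * \<theta> i (\<sigma> l x))"
    unfolding act_add[OF z j r(1)] \<theta>_sec_add[OF x act_closed[OF z j] act_closed[OF z r(1)]]
     act_leib[OF z \<sigma>_sec \<theta>_fun[OF s] x] using insert(1,2) r(3) by simp
  qed
 qed
 from this[OF finI] obtain r where r: "r \<in> vsec M V" "\<forall>y\<in>pts M. \<forall>i. \<theta> i (r y) = (\<Sum>l\<in>I. \<theta> l (s y) * \<theta> i (\<sigma> l y))"
  "\<theta> i (act z r x) = (\<Sum>l\<in>I. \<theta> l (s x) * \<theta> i (act z (\<sigma> l) x) + snd (lam (z x)) (%y. \<theta> l (s y)) * \<theta> i (\<sigma> l x))" by blast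
 have "r = s"
 proof
  fix y
  show "r y = s y"
  proof (cases "y \<in> pts M")
   case True
   show ?thesis
    by (rule frame_eqI[OF True vsecD(1)[OF r(1) True] vsecD(1)[OF s True]])
     (simp add: r(2)[rule_format, OF True] expand[OF True vsecD(1)[OF s True] \<theta>_lin[OF True], symmetric])
  next
   case False
   then show ?thesis using r(1) s vsec_iff by (metis extensional_arb)
  qed
 qed
 then show ?thesis using r(3) by simp
qed

lemma br_expand:
 assumes r: "r \<in> vsec M V" and s: "s \<in> vsec M V" and x: "x \<in> pts M"
 shows "\<theta> i (br r s x) = (\<Sum>l\<in>I. \<theta> l (s x) * \<theta> i (br r (\<sigma> l) x) + snd (rho (r x)) (%y. \<theta> l (s y)) * \<theta> i (\<sigma> l x))"
proof -
 let ?z = "sec_plus M E \<zeta>0 r"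
 let ?S = "%z. \<Sum>l\<in>I. \<theta> l (s x) * \<theta> i (act z (\<sigma> l) x) + snd (lam (z x)) (%y. \<theta> l (s y)) * \<theta> i (\<sigma> l x)"
 have "?S ?z = ?S \<zeta>0 + (\<Sum>l\<in>I. \<theta> l (s x) * \<theta> i (br r (\<sigma> l) x) + snd (rho (r x)) (%y. \<theta> l (s y)) * \<theta> i (\<sigma> l x))"
  unfolding sum.distrib[symmetric] act_sum[OF \<zeta>0 r \<sigma>_sec x] lam_sec_plus[OF \<zeta>0 r x]
  by (rule sum.cong[OF refl]) (simp only: algebra_simps)
 then show ?thesis
  using act_sum[OF \<zeta>0 r s x, of i] act_expand[OF sec_plus_closed[OF \<zeta>0 r] s x, of i] act_expand[OF \<zeta>0 s x, of i] by linarith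
qed

end

section \<open>The prolonged bundles\<close>

lemma tangent_space_add: "D \<in> tangent_space N p ==> D' \<in> tangent_space N p ==> (%f. D f + D' f) \<in> tangent_space N p"
 and tangent_space_scale: "D \<in> tangent_space N p ==> (%f. c * D f) \<in> tangent_space N p"
 and tangent_space_zero: "(%f. 0) \<in> tangent_space N p"
 by (auto simp: tangent_space_def ring_distribs)

lemma cvec_add: "cvec f (%g. D g + D' g) = cvec f D + cvec f D'"
 and cvec_scale: "cvec f (%g. c * D g) = c *\<^sub>R cvec f D"
 by (simp_all add: cvec_def sum.distrib scaleR_add_left scaleR_sum_right)

context alg_frame
begin

abbreviation "mE \<equiv> atot E"
abbreviation "\<pi> \<equiv> aproj E"
abbreviation "VE \<equiv> prolong_vert M t V E rho"
abbreviation "JE \<equiv> prolong_jet M t E lam"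

lemma smE: "smooth_manifold mE"
 by (rule atotal_manifold)

lemma aproj_in: "e \<in> pts mE ==> \<pi> e \<in> pts M"
 by (rule sm_at_pts[OF atN aproj_sm])

lemma mem_fibre: "e \<in> pts mE ==> e \<in> afibre E (\<pi> e)"
 by (simp add: afibre_def)

lemma near_aproj: assumes e: "e \<in> pts mE" and g: "g \<in> smooth_near M (\<pi> e)" shows "g \<circ> \<pi> \<in> smooth_near mE e"
proof -
 have "sma M euclid g (\<pi> e)" using g smooth_near_iff[OF atN aproj_in[OF e]] by blast
 from sm_at_compose[OF atN atlas_euclid aproj_sm[OF e] this e aproj_in]
 show ?thesis using smooth_near_iff[OF atA e] by (simp add: o_def)
qed

lemma tmap_iff:
 assumes "fst X = e" "fst Y = \<pi> e" "snd Y \<in> tangent_space M (\<pi> e)"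
 shows "Y = tangent_map M \<pi> X \<longleftrightarrow> (\<forall>g\<in>smooth_near M (\<pi> e). snd Y g = snd X (g \<circ> \<pi>))"
 using assms tan_zero[OF assms(3)] by (auto simp: prod_eq_iff fun_eq_iff tangent_map_def)

text \<open>The condition on the time component in the two prolonged bundles follows from compatibility with the
  anchor, because vectors in the images of the anchors have time component one and zero. What remains is
  the pullback of tangent vectors.\<close>

lemma tmap_t:
 assumes "X \<in> pts (TB mE)" "Y = tangent_map M \<pi> X" shows "snd X (prolong_time t E) = snd Y t"
proof -
 have "fst X \<in> pts mE" using assms(1) by auto
 from smooth_funs_near[OF atN aproj_in[OF this] t_smooth] show ?thesis
  unfolding assms(2) by (simp add: tangent_map_def prolong_time_def)
qed

lemma vert_pts: "prolong_vert_pts M t V E rho = pullback_pts M mE \<pi> (vtot V) rho"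
proof -
 have "snd X (prolong_time t E) = 0" if "v \<in> pts (vtot V)" "X \<in> pts (TB mE)" "rho v = tangent_map M \<pi> X" for v X
  using tmap_t[OF that(2,3)] rho_vertical[OF that(1)] by (simp add: vertical_def)
 then show ?thesis unfolding prolong_vert_pts_def pullback_pts_def vertical_def by blast
qed

lemma jet_pts: "prolong_jet_pts M t E lam = pullback_pts M mE \<pi> mE lam"
proof -
 have "snd X (prolong_time t E) = 1" if "q \<in> pts mE" "X \<in> pts (TB mE)" "lam q = tangent_map M \<pi> X" for q X
  using tmap_t[OF that(2,3)] lam_jet[OF that(1)] by (simp add: first_jet_def)
 then show ?thesis unfolding prolong_jet_pts_def pullback_pts_def first_jet_def by blast
qed

lemma vtot_VE: "vtot VE = submfd (prod_mfd (vtot V) (TB mE)) (pullback_pts M mE \<pi> (vtot V) rho)"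
 and atot_JE: "atot JE = submfd (prod_mfd mE (TB mE)) (pullback_pts M mE \<pi> mE lam)"
 and proj_VE: "vproj VE = (%(v, X). fst X)" and proj_JE: "aproj JE = (%(v, X). fst X)"
 by (simp_all add: prolong_vert_def prolong_jet_def vert_pts jet_pts)

lemma VE_simps [simp]:
 "vproj VE q = fst (snd q)" "aproj JE q' = fst (snd q')"
 "vadd VE q r = (vadd V (fst q) (fst r), tadd (snd q) (snd r))"
 "vscale VE c q = (vscale V c (fst q), tscale c (snd q))"
 "aplus JE q' r = (aplus E (fst q') (fst r), tadd (snd q') (snd r))"
 by (simp_all add: prolong_vert_def prolong_jet_def case_prod_unfold)

text \<open>Membership is expressed by evaluation on functions of the base. In this form every condition is linear and
  local, and it is checked by computation with derivations.\<close>

lemma VE_fibre: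
 assumes e: "e \<in> pts mE"
 shows "q \<in> vfibre VE e \<longleftrightarrow> fst (snd q) = e & snd (snd q) \<in> tangent_space mE e & fst q \<in> vfibre V (\<pi> e) &
  (\<forall>g\<in>smooth_near M (\<pi> e). snd (rho (fst q)) g = snd (snd q) (g \<circ> \<pi>))"
proof -
 have "q \<in> vfibre VE e \<longleftrightarrow> fst (snd q) = e & snd (snd q) \<in> tangent_space mE e & fst q \<in> pts (vtot V) & rho (fst q) = tangent_map M \<pi> (snd q)"
  using e by (cases q) (auto simp: vfibre_def vtot_VE pullback_pts_def)
 moreover have "fst q \<in> vfibre V (\<pi> e)" if "fst (snd q) = e" "fst q \<in> pts (vtot V)" "rho (fst q) = tangent_map M \<pi> (snd q)"
  using that rho_vertical[OF that(2)] by (simp add: vfibre_def tangent_map_def)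
 ultimately show ?thesis using tmap_iff[of "snd q" e "rho (fst q)"] rhoD[of "fst q" "\<pi> e"] fibreD(1) by blast
qed

lemma JE_fibre:
 assumes e: "e \<in> pts mE"
 shows "q \<in> afibre JE e \<longleftrightarrow> fst (snd q) = e & snd (snd q) \<in> tangent_space mE e & fst q \<in> afibre E (\<pi> e) &
  (\<forall>g\<in>smooth_near M (\<pi> e). snd (lam (fst q)) g = snd (snd q) (g \<circ> \<pi>))"
proof -
 have "q \<in> afibre JE e \<longleftrightarrow> fst (snd q) = e & snd (snd q) \<in> tangent_space mE e & fst q \<in> pts mE & lam (fst q) = tangent_map M \<pi> (snd q)"
  using e by (cases q) (auto simp: afibre_def atot_JE pullback_pts_def)
 moreover have "fst q \<in> afibre E (\<pi> e)" if "fst (snd q) = e" "fst q \<in> pts mE" "lam (fst q) = tangent_map M \<pi> (snd q)"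
  using that lam_jet[OF that(2)] by (simp add: afibre_def tangent_map_def)
 ultimately show ?thesis using tmap_iff[of "snd q" e "lam (fst q)"] lamD[of "fst q" "\<pi> e"] afibreD(1) by blast
qed

lemma pull_ex:
 obtains F :: "'c set" and FV :: "'d set" where "subspace F" "subspace FV"
  "pullback M mE \<pi> F (vtot V) (vproj V) FV rho" "pullback M mE \<pi> F mE \<pi> F lam"
  "\<forall>x\<in>pts M. \<exists>U \<Phi> \<Psi>. x \<in> U & aff_triv F U \<Phi> \<Psi>" "\<forall>x\<in>pts M. \<exists>U \<Psi>. x \<in> U & linear_triv M V FV U \<Psi>"
proof -
 from affine_trivial obtain F :: "'c set" where F: "subspace F"
  "\<forall>x\<in>pts M. \<exists>U \<Phi> \<Psi>. x \<in> U & local_triv M mE \<pi> F U \<Phi> & linear_triv M V F U \<Psi> &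
    (\<forall>y\<in>U. \<forall>a\<in>afibre E y. \<forall>v\<in>vfibre V y. snd (\<Phi> (aplus E a v)) = snd (\<Phi> a) + snd (\<Psi> v))"
  by (elim exE conjE)
 from trivial obtain FV :: "'d set" where FV: "subspace FV" "\<forall>x\<in>pts M. \<exists>U \<Psi>. x \<in> U & linear_triv M V FV U \<Psi>"
  by (elim exE conjE)
 have tF: "\<exists>U \<Phi>. x \<in> U & local_triv M mE \<pi> F U \<Phi>" if "x \<in> pts M" for x
  using bspec[OF F(2) that] by (elim exE conjE) (intro exI conjI)
 have tV: "\<exists>U \<Phi>. x \<in> U & local_triv M (vtot V) (vproj V) FV U \<Phi>" if "x \<in> pts M" for x
  using bspec[OF FV(2) that] unfolding linear_triv_def by (elim exE conjE) (intro exI conjI)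
 have rA: "rho b \<in> pts (TB M) & fst (rho b) = vproj V b & sma (vtot V) (TB M) rho b" if "b \<in> pts (vtot V)" for b
  using rhoD[of b "vproj V b"] that by (simp add: vfibre_def)
 have lA: "lam b \<in> pts (TB M) & fst (lam b) = \<pi> b & sma mE (TB M) lam b" if "b \<in> pts mE" for b
  using lamD[OF mem_fibre[OF that]] by simp
 have "pullback M mE \<pi> F (vtot V) (vproj V) FV rho"
  by (intro pullback.intro) (fact smM smE total_manifold aproj_sm vproj_smooth F(1) FV(1) tF tV rA)+
 moreover have "pullback M mE \<pi> F mE \<pi> F lam"
  by (intro pullback.intro) (fact smM smE aproj_sm F(1) tF lA)+
 moreover have "\<forall>x\<in>pts M. \<exists>U \<Phi> \<Psi>. x \<in> U & aff_triv F U \<Phi> \<Psi>"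
 proof
  fix x assume "x \<in> pts M"
  from bspec[OF F(2) this] show "\<exists>U \<Phi> \<Psi>. x \<in> U & aff_triv F U \<Phi> \<Psi>"
   unfolding aff_triv_def by (elim exE conjE) (intro exI conjI; (assumption | rule F(1)))
 qed
 ultimately show thesis using F(1) FV by (intro that)
qed

lemma embV: obtains H where "embedded (prod_mfd (vtot V) (TB mE)) (pullback_pts M mE \<pi> (vtot V) rho) H"
 using pull_ex pullback.embedded_ex by metis

lemma embJ: obtains H where "embedded (prod_mfd mE (TB mE)) (pullback_pts M mE \<pi> mE lam) H"
 using pull_ex pullback.embedded_ex by metis

lemma smVE: "smooth_manifold (vtot VE)" and smJE: "smooth_manifold (atot JE)"
 unfolding vtot_VE atot_JE using embV embJ embedded.sub_manifold by metis+

lemma sm_VE_iff: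
 assumes "atlas P" "p \<in> S" "!!z. z \<in> S ==> s z \<in> pts (vtot VE)"
 shows "sm_at P S (vtot VE) s p \<longleftrightarrow> sm_at P S (vtot V) (%z. fst (s z)) p & sm_at P S (TB mE) (%z. snd (s z)) p"
proof -
 obtain H where "embedded (prod_mfd (vtot V) (TB mE)) (pullback_pts M mE \<pi> (vtot V) rho) H" by (rule embV)
 then interpret em: embedded "prod_mfd (vtot V) (TB mE)" "pullback_pts M mE \<pi> (vtot V) rho" H .
 have "sm_at P S (vtot VE) s p \<longleftrightarrow> sm_at P S (prod_mfd (vtot V) (TB mE)) s p"
  unfolding vtot_VE by (rule em.sm_at_to_sub) (use assms vtot_VE in auto)
 then show ?thesis
  using sm_at_fst[of P S "vtot V" "TB mE" s p] sm_at_snd[of P S "vtot V" "TB mE" s p]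
   sm_at_Pair[OF assms(1) atW atlas_tangent[OF smE] assms(2), of "%z. fst (s z)" "%z. snd (s z)"] by auto
qed

lemma sm_JE_iff:
 assumes "atlas P" "p \<in> S" "!!z. z \<in> S ==> s z \<in> pts (atot JE)"
 shows "sm_at P S (atot JE) s p \<longleftrightarrow> sm_at P S mE (%z. fst (s z)) p & sm_at P S (TB mE) (%z. snd (s z)) p"
proof -
 obtain H where "embedded (prod_mfd mE (TB mE)) (pullback_pts M mE \<pi> mE lam) H" by (rule embJ)
 then interpret em: embedded "prod_mfd mE (TB mE)" "pullback_pts M mE \<pi> mE lam" H .
 have "sm_at P S (atot JE) s p \<longleftrightarrow> sm_at P S (prod_mfd mE (TB mE)) s p"
  unfolding atot_JE by (rule em.sm_at_to_sub) (use assms atot_JE in auto)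
 then show ?thesis
  using sm_at_fst[of P S mE "TB mE" s p] sm_at_snd[of P S mE "TB mE" s p]
   sm_at_Pair[OF assms(1) atA atlas_tangent[OF smE] assms(2), of "%z. fst (s z)" "%z. snd (s z)"] by auto
qed

lemma atVE: "atlas (vtot VE)" and atJE: "atlas (atot JE)"
 using smooth_manifold_atlas smVE smJE by auto

lemma snd_VE:
 assumes "q \<in> pts (vtot VE)" shows "sma (vtot VE) (TB mE) snd q" "snd q \<in> pts (TB mE)"
 using sm_VE_iff[OF atVE assms, of "%z. z"] sm_at_id[OF atVE assms] assms by (auto simp: vtot_VE pullback_pts_def)

lemma snd_JE:
 assumes "q \<in> pts (atot JE)" shows "sma (atot JE) (TB mE) snd q" "snd q \<in> pts (TB mE)"
 using sm_JE_iff[OF atJE assms, of "%z. z"] sm_at_id[OF atJE assms] assms by (auto simp: atot_JE pullback_pts_def)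

lemma proj_VE_smooth: "smooth_map (vtot VE) mE (vproj VE)"
 unfolding smooth_map_iff[OF atVE atA]
proof
 fix q assume q: "q \<in> pts (vtot VE)"
 have "sma (vtot VE) mE (%q. fst (snd q)) q"
  by (rule sm_at_compose[OF atlas_tangent[OF smE] atA snd_VE(1)[OF q] sma_tangent_fst[OF smE snd_VE(2)[OF q]] q snd_VE(2)])
 then show "sma (vtot VE) mE (vproj VE) q" by (simp add: proj_VE case_prod_unfold)
qed

lemma proj_JE_smooth: "smooth_map (atot JE) mE (aproj JE)"
 unfolding smooth_map_iff[OF atJE atA]
proof
 fix q assume q: "q \<in> pts (atot JE)"
 have "sma (atot JE) mE (%q. fst (snd q)) q"
  by (rule sm_at_compose[OF atlas_tangent[OF smE] atA snd_JE(1)[OF q] sma_tangent_fst[OF smE snd_JE(2)[OF q]] q snd_JE(2)])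
 then show "sma (atot JE) mE (aproj JE) q" by (simp add: proj_JE case_prod_unfold)
qed

text \<open>The typical fibre of the trivialisation of \<open>V\<close> is arbitrary here: for the vector bundle it is the one in the
  model type of \<open>V\<close>, for the affine bundle it has to be the one shared with \<open>E\<close>.\<close>

lemma prolong_linear_triv:
 fixes FB :: "'g::euclidean_space set"
 assumes pb: "pullback M mE \<pi> F (vtot V) (vproj V) FV rho"
  and lt: "local_triv M mE \<pi> F U \<Phi>" "linear_triv M V FB U' \<Psi>" "(U0, \<phi>) \<in> charts M"
 shows "linear_triv mE VE (FB \<times> F \<times> {0::'c}) {a \<in> pts mE. \<pi> a \<in> U \<inter> U0 \<inter> U'}
   (%(b, Z). (fst Z, snd (\<Psi> b), cvec (%a. snd (\<Phi> a)) (snd Z), 0))"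
 unfolding linear_triv_def
proof (intro conjI ballI allI)
 show "local_triv mE (vtot VE) (vproj VE) (FB \<times> F \<times> {0::'c}) {a \<in> pts mE. \<pi> a \<in> U \<inter> U0 \<inter> U'}
   (%(b, Z). (fst Z, snd (\<Psi> b), cvec (%a. snd (\<Phi> a)) (snd Z), 0))"
  unfolding vtot_VE proj_VE using pullback.local_triv_at[OF pb lt(1) _ lt(3)] lt(2) unfolding linear_triv_def by blast
 fix e v assume e: "e \<in> {a \<in> pts mE. \<pi> a \<in> U \<inter> U0 \<inter> U'}" and v: "v \<in> vfibre VE e"
 then have e': "e \<in> pts mE" "\<pi> e \<in> U'" by auto
 note vV = v[unfolded VE_fibre[OF e'(1)]]
 show "snd (case vscale VE c v of (b, Z) => (fst Z, snd (\<Psi> b), cvec (%a. snd (\<Phi> a)) (snd Z), 0)) =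
   c *\<^sub>R snd (case v of (b, Z) => (fst Z, snd (\<Psi> b), cvec (%a. snd (\<Phi> a)) (snd Z), 0::'c))" for c
  using vadd_coord(2)[OF lt(2) e'(2), of "fst v" "fst v"] vV by (simp add: case_prod_unfold tscale_def cvec_scale)
 fix w assume w: "w \<in> vfibre VE e"
 show "snd (case vadd VE v w of (b, Z) => (fst Z, snd (\<Psi> b), cvec (%a. snd (\<Phi> a)) (snd Z), 0)) =
   snd (case v of (b, Z) => (fst Z, snd (\<Psi> b), cvec (%a. snd (\<Phi> a)) (snd Z), 0::'c)) +
   snd (case w of (b, Z) => (fst Z, snd (\<Psi> b), cvec (%a. snd (\<Phi> a)) (snd Z), 0::'c))"
  using vadd_coord(1)[OF lt(2) e'(2)] vV w[unfolded VE_fibre[OF e'(1)]] by (simp add: case_prod_unfold tadd_def cvec_add)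
qed

lemma VE_space: assumes e: "e \<in> pts mE" shows "real_vector_space_on (vfibre VE e) (vadd VE) (vscale VE)"
proof -
 note x = aproj_in[OF e]
 interpret VS: real_vector_space_on "vfibre V (\<pi> e)" "vadd V" "vscale V" by (rule fibre_vector_space[OF x])
 note fib = VE_fibre[OF e]
 show ?thesis
 proof (rule real_vector_space_on.intro)
  fix u v w c d
  show "vadd VE u v \<in> vfibre VE e" if "u \<in> vfibre VE e" "v \<in> vfibre VE e"
   using that by (simp add: fib VS.add_closed tadd_def tangent_space_add rho_add[OF x])
  show "vscale VE c u \<in> vfibre VE e" if "u \<in> vfibre VE e"
   using that by (simp add: fib VS.scale_closed tscale_def tangent_space_scale rho_scale[OF x])
  show "vadd VE (vadd VE u v) w = vadd VE u (vadd VE v w)" if "u \<in> vfibre VE e" "v \<in> vfibre VE e" "w \<in> vfibre VE e"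
   using that by (simp add: fib VS.add_assoc tadd_def add.assoc)
  show "vadd VE u v = vadd VE v u" if "u \<in> vfibre VE e" "v \<in> vfibre VE e"
   using that by (simp add: fib VS.add_commute[of "fst u" "fst v"] tadd_def add.commute)
  show "vscale VE c (vadd VE u v) = vadd VE (vscale VE c u) (vscale VE c v)" if "u \<in> vfibre VE e" "v \<in> vfibre VE e"
   using that by (simp add: fib VS.scale_add tadd_def tscale_def distrib_left)
  show "vscale VE (c + d) u = vadd VE (vscale VE c u) (vscale VE d u)" if "u \<in> vfibre VE e"
   using that by (simp add: fib VS.add_scale tadd_def tscale_def distrib_right)
  show "vscale VE c (vscale VE d u) = vscale VE (c * d) u" if "u \<in> vfibre VE e"
   using that by (simp add: fib VS.scale_scale tscale_def mult.assoc)
  show "vscale VE 1 u = u" if "u \<in> vfibre VE e"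
   using that by (simp add: fib VS.scale_one tscale_def prod_eq_iff)
 next
  obtain z where z: "z \<in> vfibre V (\<pi> e)" "\<forall>u\<in>vfibre V (\<pi> e). vadd V u z = u"
   "\<forall>u\<in>vfibre V (\<pi> e). \<exists>v\<in>vfibre V (\<pi> e). vadd V u v = z" using VS.zero_neg by blast
  have rz: "snd (rho z) g = 0" for g
  proof -
   have "rho z = tadd (rho z) (rho z)" using rho_add[OF x z(1) z(1)] z(2) z(1) by simp
   from arg_cong[OF this, of "%Y. snd Y g"] show ?thesis by (simp add: tadd_def)
  qed
  show "\<exists>z\<in>vfibre VE e. (\<forall>u\<in>vfibre VE e. vadd VE u z = u) & (\<forall>u\<in>vfibre VE e. \<exists>v\<in>vfibre VE e. vadd VE u v = z)"
  proof (rule bexI[of _ "(z, (e, %_. 0))"], intro conjI ballI)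
   show "(z, (e, %_. 0)) \<in> vfibre VE e" using z(1) by (simp add: fib rz tangent_space_zero)
   show "vadd VE u (z, (e, %_. 0)) = u" if "u \<in> vfibre VE e" for u
    using that z(2) by (simp add: fib tadd_def prod_eq_iff)
   show "\<exists>v\<in>vfibre VE e. vadd VE u v = (z, (e, %_. 0))" if u: "u \<in> vfibre VE e" for u
   proof -
    note uf = u[unfolded fib]
    obtain v where v: "v \<in> vfibre V (\<pi> e)" "vadd V (fst u) v = z" using z(3) uf by blast
    have "snd (rho (fst u)) g + snd (rho v) g = 0" for g
     using rho_add[OF x _ v(1), of "fst u"] uf v(2) rz[of g] by (simp add: tadd_def)
    then have rv: "snd (rho v) g = - snd (rho (fst u)) g" for g by (simp add: eq_neg_iff_add_eq_0 add.commute)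
    have "(v, tscale (- 1) (snd u)) \<in> vfibre VE e"
     using uf v(1) rv tangent_space_scale[of "snd (snd u)" mE e "- 1"] by (simp add: fib tscale_def)
    moreover have "vadd VE u (v, tscale (- 1) (snd u)) = (z, (e, %_. 0))" using uf v(2) by (simp add: tadd_def tscale_def)
    ultimately show ?thesis by blast
   qed
  qed
 qed
qed

lemma vector_bundle_VE: "vector_bundle mE VE"
proof (rule vector_bundle.intro)
 show "\<exists>F :: ('d \<times> 'c \<times> 'c) set. subspace F & (\<forall>x\<in>pts mE. \<exists>U \<Psi>. x \<in> U & linear_triv mE VE F U \<Psi>)"
 proof (rule pull_ex)
  fix F :: "'c set" and FV :: "'d set"
  assume F: "subspace F" "subspace FV" "pullback M mE \<pi> F (vtot V) (vproj V) FV rho"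
   "\<forall>x\<in>pts M. \<exists>U \<Phi> \<Psi>. x \<in> U & aff_triv F U \<Phi> \<Psi>" "\<forall>x\<in>pts M. \<exists>U \<Psi>. x \<in> U & linear_triv M V FV U \<Psi>"
  show ?thesis
  proof (intro exI[of _ "FV \<times> F \<times> {0::'c}"] conjI ballI)
   show "subspace (FV \<times> F \<times> {0::'c})" using F by (intro subspace_Times) (auto simp: subspace_def)
   fix e assume e: "e \<in> pts mE"
   note x = aproj_in[OF e]
   obtain U \<Phi> \<Psi>' where U: "\<pi> e \<in> U" "aff_triv F U \<Phi> \<Psi>'" using bspec[OF F(4) x] by (elim exE conjE) rule
   obtain U' \<Psi> where U': "\<pi> e \<in> U'" "linear_triv M V FV U' \<Psi>" using bspec[OF F(5) x] by (elim exE conjE) rule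
   obtain U0 \<phi> where c: "(U0, \<phi>) \<in> charts M" "\<pi> e \<in> U0" using atlas.chart_at[OF atN x] by blast
   have lt: "local_triv M mE \<pi> F U \<Phi>" using U(2) by (simp add: aff_triv_def)
   show "\<exists>U \<Psi>. e \<in> U & linear_triv mE VE (FV \<times> F \<times> {0::'c}) U \<Psi>"
    using prolong_linear_triv[OF F(3) lt U'(2) c(1)] e U(1) U'(1) c(2)
    by (intro exI[of _ "{a \<in> pts mE. \<pi> a \<in> U \<inter> U0 \<inter> U'}"]) auto
  qed
 qed
qed (fact smE smVE proj_VE_smooth VE_space)+

lemma affine_bundle_JE: "affine_bundle mE VE JE"
proof (intro affine_bundle.intro vector_bundle_VE affine_bundle_axioms.intro)
 show "smooth_manifold (atot JE)" "smooth_map (atot JE) mE (aproj JE)" by (fact smJE proj_JE_smooth)+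
next
 fix e assume e: "e \<in> pts mE"
 note x = aproj_in[OF e]
 show "afibre JE e \<noteq> {}"
 proof (rule pull_ex)
  fix F FV assume "pullback M mE \<pi> F mE \<pi> F lam"
  from pullback.ex_over[OF this e e refl] obtain Z where "(e, Z) \<in> pullback_pts M mE \<pi> mE lam" "fst Z = e" by blast
  then have "(e, Z) \<in> afibre JE e" by (simp add: afibre_def atot_JE)
  then show ?thesis by blast
 qed
 fix a v assume a: "a \<in> afibre JE e" and v: "v \<in> vfibre VE e"
 note a' = a[unfolded JE_fibre[OF e]] and v' = v[unfolded VE_fibre[OF e]]
 show "aplus JE a v \<in> afibre JE e"
  using a' v' by (simp add: JE_fibre[OF e] tadd_def plus_closed[OF x] tangent_space_add lam_plus[OF x])
 show "aplus JE (aplus JE a v) w = aplus JE a (vadd VE v w)" if w: "w \<in> vfibre VE e" for w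
  using a' v' w[unfolded VE_fibre[OF e]] by (simp add: tadd_def plus_assoc[OF x] add.assoc)
next
 fix e a b assume e: "e \<in> pts mE" and a: "a \<in> afibre JE e" and b: "b \<in> afibre JE e"
 note x = aproj_in[OF e]
 note a' = a[unfolded JE_fibre[OF e]] and b' = b[unfolded JE_fibre[OF e]]
 note d = adiff[OF x, of "fst a" "fst b"]
 let ?v = "(adiff (fst a) (fst b), (e, %f. snd (snd b) f + (- 1) * snd (snd a) f))"
 have "lam (fst b) = tadd (lam (fst a)) (rho (adiff (fst a) (fst b)))"
  using lam_plus[OF x _ d(1), of "fst a"] d(2) a' b' by simp
 then have "snd (rho (adiff (fst a) (fst b))) g = snd (lam (fst b)) g - snd (lam (fst a)) g" for g by (simp add: tadd_def)
 then have v: "?v \<in> vfibre VE e"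
  using a' b' d tangent_space_add[OF _ tangent_space_scale[of _ _ _ "- 1"], of "snd (snd b)" mE e "snd (snd a)"]
  by (simp add: VE_fibre[OF e])
 show "\<exists>!v. v \<in> vfibre VE e & aplus JE a v = b"
 proof (rule ex1I[of _ ?v])
  show "?v \<in> vfibre VE e & aplus JE a ?v = b" using v a' b' d by (simp add: tadd_def prod_eq_iff)
  fix w assume w: "w \<in> vfibre VE e & aplus JE a w = b"
  note w' = conjunct1[OF w, unfolded VE_fibre[OF e]]
  have b1: "fst b = aplus E (fst a) (fst w)" "snd b = tadd (snd a) (snd w)" using conjunct2[OF w] by auto
  have "adiff (fst a) (fst b) = fst w" unfolding b1 by (rule adiff_aplus[OF x]) (use a' w' in auto)
  then show "w = ?v" using w' b1(2) by (simp add: prod_eq_iff fun_eq_iff tadd_def)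
 qed
next
 show "\<exists>F :: ('c \<times> 'c \<times> 'c) set. subspace F & (\<forall>x\<in>pts mE. \<exists>U \<Phi> \<Psi>. x \<in> U & local_triv mE (atot JE) (aproj JE) F U \<Phi> &
   linear_triv mE VE F U \<Psi> & (\<forall>y\<in>U. \<forall>a\<in>afibre JE y. \<forall>v\<in>vfibre VE y. snd (\<Phi> (aplus JE a v)) = snd (\<Phi> a) + snd (\<Psi> v)))"
 proof (rule pull_ex)
  fix F :: "'c set" and FV :: "'d set"
  assume F: "subspace F" "pullback M mE \<pi> F (vtot V) (vproj V) FV rho" "pullback M mE \<pi> F mE \<pi> F lam"
   "\<forall>x\<in>pts M. \<exists>U \<Phi> \<Psi>. x \<in> U & aff_triv F U \<Phi> \<Psi>"
  show ?thesis
  proof (intro exI[of _ "F \<times> F \<times> {0::'c}"] conjI ballI)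
   show "subspace (F \<times> F \<times> {0::'c})" using F by (intro subspace_Times) (auto simp: subspace_def)
   fix e assume e: "e \<in> pts mE"
   note x = aproj_in[OF e]
   obtain U \<Phi> \<Psi> where U: "\<pi> e \<in> U" "aff_triv F U \<Phi> \<Psi>" using bspec[OF F(4) x] by (elim exE conjE) rule
   obtain U0 \<phi> where c: "(U0, \<phi>) \<in> charts M" "\<pi> e \<in> U0" using atlas.chart_at[OF atN x] by blast
   have lt: "local_triv M mE \<pi> F U \<Phi>" "linear_triv M V F U \<Psi>"
    and co: "\<forall>y\<in>U. \<forall>a\<in>afibre E y. \<forall>v\<in>vfibre V y. snd (\<Phi> (aplus E a v)) = snd (\<Phi> a) + snd (\<Psi> v)"
    using U(2) by (simp_all add: aff_triv_def)
   let ?U = "{a \<in> pts mE. \<pi> a \<in> U \<inter> U0 \<inter> U}"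
   let ?f = "%\<Psi> (b, Z). (fst Z, snd (\<Psi> b), cvec (%a. snd (\<Phi> a)) (snd Z), 0::'c)"
   have "local_triv mE (atot JE) (aproj JE) (F \<times> F \<times> {0::'c}) ?U (?f \<Phi>)"
    unfolding atot_JE proj_JE by (rule pullback.local_triv_at[OF F(3) lt(1) lt(1) c(1)])
   moreover have "linear_triv mE VE (F \<times> F \<times> {0::'c}) ?U (?f \<Psi>)" by (rule prolong_linear_triv[OF F(2) lt c(1)])
   moreover have "snd (?f \<Phi> (aplus JE a v)) = snd (?f \<Phi> a) + snd (?f \<Psi> v)"
    if y: "y \<in> ?U" and a: "a \<in> afibre JE y" and v: "v \<in> vfibre VE y" for y a v
   proof -
    have y': "y \<in> pts mE" "\<pi> y \<in> U" using y by auto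
    show ?thesis using bspec[OF co y'(2)] a[unfolded JE_fibre[OF y'(1)]] v[unfolded VE_fibre[OF y'(1)]]
     by (simp add: case_prod_unfold tadd_def cvec_add)
   qed
   moreover have "e \<in> ?U" using e U c by simp
   ultimately show "\<exists>U \<Phi> \<Psi>. e \<in> U & local_triv mE (atot JE) (aproj JE) (F \<times> F \<times> {0::'c}) U \<Phi> &
    linear_triv mE VE (F \<times> F \<times> {0::'c}) U \<Psi> & (\<forall>y\<in>U. \<forall>a\<in>afibre JE y. \<forall>v\<in>vfibre VE y. snd (\<Phi> (aplus JE a v)) = snd (\<Phi> a) + snd (\<Psi> v))"
    by (intro exI[of _ ?U] exI[of _ "?f \<Phi>"] exI[of _ "?f \<Psi>"] conjI ballI)
  qed
 qed
qed

lemma anchor_maps_prolong: "anchor_maps mE (prolong_time t E) VE JE snd snd"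
proof (rule anchor_maps.intro)
 show "smooth_map (atot JE) (TB mE) snd"
  using snd_JE(1) by (simp add: smooth_map_iff[OF atJE atlas_tangent[OF smE]])
 show "smooth_map (vtot VE) (TB mE) snd"
  using snd_VE(1) by (simp add: smooth_map_iff[OF atVE atlas_tangent[OF smE]])
 show "snd a \<in> first_jet mE (prolong_time t E) & fst (snd a) = aproj JE a" if "a \<in> pts (atot JE)" for a
  using that by (auto simp: prolong_jet_def prolong_jet_pts_def)
 show "snd a \<in> vertical mE (prolong_time t E) & fst (snd a) = vproj VE a" if "a \<in> pts (vtot VE)" for a
  using that by (auto simp: prolong_vert_def prolong_vert_pts_def)
qed simp_all

text \<open>The submersion condition holds because every \<open>lam e\<close> has time component one and lifts to a tangent vector of
  \<open>E\<close>.\<close>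

lemma fibred_E: "fibred_manifold mE (prolong_time t E)"
proof (intro fibred_manifold.intro smE fibred_manifold_axioms.intro)
 show "prolong_time t E \<in> smooth_funs mE"
  unfolding smooth_funs_iff[OF atA]
 proof
  fix e assume e: "e \<in> pts mE"
  show "sma mE euclid (prolong_time t E) e"
   using near_aproj[OF e smooth_funs_near[OF atN aproj_in[OF e] t_smooth]] smooth_near_iff[OF atA e] by (simp add: prolong_time_def)
 qed
 have "r \<in> prolong_time t E ` pts mE" for r
 proof -
  have "r \<in> t ` pts M" using t_surj by simp
  then obtain x where x: "x \<in> pts M" "t x = r" by auto
  obtain e where "e \<in> afibre E x" using fibre_nonempty[OF x(1)] by blast
  then show ?thesis using afibreD x by (intro image_eqI[of _ _ e]) (auto simp: prolong_time_def)
 qed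
 then show "prolong_time t E ` pts mE = UNIV" by blast
 fix e assume e: "e \<in> pts mE"
 obtain q where q: "q \<in> afibre JE e" using affine_bundle.fibre_nonempty[OF affine_bundle_JE e] by blast
 then have "snd (snd q) (prolong_time t E) = 1"
  using anchor_maps.lam_jet[OF anchor_maps_prolong, of q] by (simp add: afibre_def first_jet_def)
 then show "\<exists>D\<in>tangent_space mE e. D (prolong_time t E) \<noteq> 0"
  using q JE_fibre[OF e] by (intro bexI[of _ "snd (snd q)"]) auto
qed

end

section \<open>Horizontal lifts\<close>

lemma vector_field_cong: "vector_field N X ==> (!!p. p \<in> pts N ==> X p = Y p) ==> vector_field N Y"
 unfolding vector_field_def by (metis sm_at_cong)

context alg_frame
begin

sublocale PB: affine_bundle mE VE JE
 by (rule affine_bundle_JE)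

lemma vsec_comp: "s \<in> vsec M V ==> e \<in> pts mE ==> sma mE (vtot V) (%e. s (\<pi> e)) e"
 by (rule sm_at_compose[OF atN atW aproj_sm vsecD(2)]) (auto simp: aproj_in)

lemma asec_comp: "z \<in> asec M E ==> e \<in> pts mE ==> sma mE mE (%e. z (\<pi> e)) e"
 by (rule sm_at_compose[OF atN atA aproj_sm asecD(2)]) (auto simp: aproj_in)

lemma fun_comp: "f \<in> smooth_funs M ==> e \<in> pts mE ==> sma mE euclid (%e. f (\<pi> e)) e"
 by (rule sm_at_compose[OF atN atlas_euclid aproj_sm]) (auto simp: aproj_in smooth_funs_iff[OF atN])

text \<open>The section \<open>\<zeta>0\<close> plus the combination of the \<open>\<sigma> i\<close> with the constant coefficients
  \<open>\<theta> i (e - \<zeta>0 (\<pi> e))\<close> passes through \<open>e\<close> and depends smoothly on \<open>e\<close>. It replaces parallel transport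
  in the construction of lifts.\<close>

definition hor :: "'p => 'e => 'e" where
 "hor x e = aplus E (\<zeta>0 x) (lc x (%i. \<theta> i (adiff (\<zeta>0 (\<pi> e)) e)))"

lemma hor_fibre: "x \<in> pts M ==> hor x e \<in> afibre E x"
 unfolding hor_def by (rule plus_closed[OF _ asecD(1)[OF \<zeta>0] lc(1)])

lemma hor_self: assumes e: "e \<in> pts mE" shows "hor (\<pi> e) e = e"
proof -
 note x = aproj_in[OF e]
 note d = adiff[OF x asecD(1)[OF \<zeta>0 x] mem_fibre[OF e]]
 show ?thesis unfolding hor_def lc_\<theta>[OF x d(1)] by (rule d(2))
qed

lemma adiff_coeff_smooth:
 assumes e: "e \<in> pts mE" and q: "!!z. z \<in> pts mE ==> q z \<in> afibre E (\<pi> z)" "sma mE mE q e"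
 shows "sma mE euclid (%e. \<theta> i (adiff (\<zeta>0 (\<pi> e)) (q e))) e"
proof (rule \<theta>_comp[OF e])
 show "sma mE (vtot V) (%e. adiff (\<zeta>0 (\<pi> e)) (q e)) e"
  by (rule adiff_smooth[OF atA e aproj_sm[OF e] asec_comp[OF \<zeta>0 e] _ q(2)]) (auto intro: asecD(1)[OF \<zeta>0] aproj_in q(1))
 show "adiff (\<zeta>0 (\<pi> z)) (q z) \<in> pts (vtot V)" if "z \<in> pts mE" for z
  by (rule fibreD(1)[OF adiff(1)[OF aproj_in[OF that] asecD(1)[OF \<zeta>0 aproj_in[OF that]] q(1)[OF that]]])
qed

lemma hor_smooth:
 assumes q: "q \<in> pts (prod_mfd M mE)"
 shows "sma (prod_mfd M mE) mE (%q. hor (fst q) (snd q)) q"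
proof -
 note atP = atlas_prod[OF atN atA]
 note id = sm_at_id[OF atP q, of "pts (prod_mfd M mE)"]
 have q': "fst q \<in> pts M" "snd q \<in> pts mE" using q by auto
 have 1: "sma (prod_mfd M mE) mE (%q. \<zeta>0 (fst q)) q"
  by (rule sm_at_compose[OF atN atA sm_at_fst[OF id] asecD(2)[OF \<zeta>0 q'(1)] q]) auto
 have 2: "sma (prod_mfd M mE) euclid (%q. \<theta> i (adiff (\<zeta>0 (\<pi> (snd q))) (snd q))) q" for i
  by (rule sm_at_compose[OF atA atlas_euclid sm_at_snd[OF id] adiff_coeff_smooth[OF q'(2) mem_fibre sm_at_id[OF atA q'(2)]] q]) auto
 have 3: "sma (prod_mfd M mE) (vtot V) (%q. lc (fst q) (%i. \<theta> i (adiff (\<zeta>0 (\<pi> (snd q))) (snd q)))) q"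
  by (rule lc_smooth[OF atP q q sm_at_fst[OF id] _ 2]) auto
 show ?thesis unfolding hor_def
  by (rule aplus_smooth[OF atP q sm_at_fst[OF id] 1 _ 3]) (auto intro: asecD(1)[OF \<zeta>0] lc(1))
qed

text \<open>The lift of \<open>Y\<close> at \<open>e\<close> is the image of \<open>Y (\<pi> e)\<close> under the differential of the section through \<open>e\<close>.\<close>

lemma lift_ex:
 assumes Y: "vector_field M Y"
 shows "\<exists>X. vector_field mE X & (\<forall>e\<in>pts mE. \<forall>h\<in>smooth_near M (\<pi> e). snd (X e) (h \<circ> \<pi>) = snd (Y (\<pi> e)) h)"
proof -
 define X where "X e = tangent_map mE (%x. hor x e) (Y (\<pi> e))" for e
 note atP = atlas_prod[OF atN atA]
 have hs: "sma M mE (%x. hor x e) (\<pi> e)" if e: "e \<in> pts mE" for e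
 proof -
  note x = aproj_in[OF e]
  have "sma M (prod_mfd M mE) (%x. (x, e)) (\<pi> e)"
   by (rule sm_at_Pair[OF atN atN atA x sm_at_id[OF atN x] sm_at_const[OF atN atA x e]])
  from sm_at_compose[OF atP atA this hor_smooth x] e x show ?thesis by auto
 qed
 have f: "fst (X e) = e" if "e \<in> pts mE" for e
  using vector_fieldD(2)[OF Y aproj_in[OF that]] hor_self[OF that] by (simp add: X_def tangent_map_def)
 have v: "snd (X e) g = snd (Y (\<pi> e)) (%x. g (hor x e))" if "e \<in> pts mE" "g \<in> smooth_near mE e" for e g
  using vector_fieldD(2)[OF Y aproj_in[OF that(1)]] hor_self[OF that(1)] that(2) by (simp add: X_def tangent_map_def o_def)
 have m: "X e \<in> pts (TB mE)" if e: "e \<in> pts mE" for e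
  unfolding X_def by (rule tangent_map_mem[OF smM smE vector_fieldD(1)[OF Y aproj_in[OF e]]])
   (simp add: vector_fieldD(2)[OF Y aproj_in[OF e]] hs[OF e])
 have "sma mE (TB mE) X e" if e: "e \<in> pts mE" for e
 proof (rule sm_at_tangentI[OF atA smE e m _ _ e])
  show "sma mE mE (%y. fst (X y)) e"
   by (rule sm_at_cong[OF sm_at_id[OF atA e] e]) (simp add: f)
  fix g :: "'e => real" assume "sma mE euclid g (fst (X e))"
  then have g: "sma mE euclid g e" by (simp add: f[OF e])
  obtain W where W: "openin (mtop mE) W" "e \<in> W" "\<forall>y\<in>W. sma mE euclid g y" using sm_at_nbhd[OF atA g] by blast
  have "sma mE euclid (%z. snd (Y (\<pi> z)) (%x. g (hor x z))) e"
  proof (rule sm_at_partial[OF atA smM e])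
   show "sma mE (TB M) (%z. Y (\<pi> z)) e"
    by (rule sm_at_compose[OF atN atlas_tangent[OF smM] aproj_sm[OF e] vector_fieldD(4)[OF Y aproj_in[OF e]] e aproj_in])
   show "Y (\<pi> z) \<in> pts (TB M)" if "z \<in> pts mE" for z by (rule vector_fieldD(1)[OF Y aproj_in[OF that]])
   have p: "(fst (Y (\<pi> e)), e) \<in> pts (prod_mfd M mE)" using vector_fieldD(2)[OF Y aproj_in[OF e]] aproj_in[OF e] e by simp
   have "sma mE euclid g (hor (fst (fst (Y (\<pi> e)), e)) (snd (fst (Y (\<pi> e)), e)))"
    using g by (simp add: vector_fieldD(2)[OF Y aproj_in[OF e]] hor_self[OF e])
   from sm_at_compose[OF atA atlas_euclid hor_smooth[OF p] this p]
   show "sma (prod_mfd M mE) euclid (%q. g (hor (fst q) (snd q))) (fst (Y (\<pi> e)), e)"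
    using afibreD(1)[OF hor_fibre] by auto
  qed
  then show "sma mE euclid (%y. snd (X y) g) e"
   by (rule sm_at_eq_near[OF atA _ W(1,2) e]) (simp add: v smooth_near_iff[OF atA] W(3))
 qed
 then have "vector_field mE X" using m f by (simp add: vector_field_def)
 moreover have "snd (X e) (h \<circ> \<pi>) = snd (Y (\<pi> e)) h" if e: "e \<in> pts mE" and h: "h \<in> smooth_near M (\<pi> e)" for e h
 proof -
  note x = aproj_in[OF e]
  have eq: "h y = (h \<circ> \<pi>) (hor y e)" if "y \<in> pts M" for y using afibreD(2)[OF hor_fibre[OF that]] by simp
  have h': "sma M euclid h (\<pi> e)" using h smooth_near_iff[OF atN x] by blast
  have n: "(%y. (h \<circ> \<pi>) (hor y e)) \<in> smooth_near M (\<pi> e)"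
   unfolding smooth_near_iff[OF atN x] by (rule sm_at_cong[OF h' x eq])
  have "snd (Y (\<pi> e)) h = snd (Y (\<pi> e)) (%y. (h \<circ> \<pi>) (hor y e))"
   by (rule tan_local[OF atN x vector_fieldD(3)[OF Y x] h n atlas.openin_pts[OF atN] x eq])
  then show ?thesis using v[OF e near_aproj[OF e h]] by simp
 qed
 ultimately show ?thesis by blast
qed

section \<open>Sections of the prolonged bundles\<close>

lemma VE_secI:
 assumes "Z \<in> extensional (pts mE)" and f: "!!e. e \<in> pts mE ==> fst (Z e) \<in> vfibre V (\<pi> e)"
  and s: "!!e. e \<in> pts mE ==> sma mE (vtot V) (%e. fst (Z e)) e" and X: "vector_field mE (%e. snd (Z e))"
  and a: "!!e h. e \<in> pts mE ==> h \<in> smooth_near M (\<pi> e) ==> snd (rho (fst (Z e))) h = snd (snd (Z e)) (h \<circ> \<pi>)"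
 shows "Z \<in> vsec mE VE"
proof (rule PB.vsecI[OF assms(1)])
 show v: "Z e \<in> vfibre VE e" if "e \<in> pts mE" for e
  unfolding VE_fibre[OF that] using f[OF that] a[OF that] vector_fieldD[OF X that] by auto
 show "sma mE (vtot VE) Z e" if "e \<in> pts mE" for e
  using sm_VE_iff[OF atA that, of Z] PB.fibreD(1)[OF v] s[OF that] vector_fieldD(4)[OF X that] by blast
qed

lemma JE_secI:
 assumes "Z \<in> extensional (pts mE)" and f: "!!e. e \<in> pts mE ==> fst (Z e) \<in> afibre E (\<pi> e)"
  and s: "!!e. e \<in> pts mE ==> sma mE mE (%e. fst (Z e)) e" and X: "vector_field mE (%e. snd (Z e))"
  and a: "!!e h. e \<in> pts mE ==> h \<in> smooth_near M (\<pi> e) ==> snd (lam (fst (Z e))) h = snd (snd (Z e)) (h \<circ> \<pi>)"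
 shows "Z \<in> asec mE JE"
proof (rule PB.asecI[OF assms(1)])
 show v: "Z e \<in> afibre JE e" if "e \<in> pts mE" for e
  unfolding JE_fibre[OF that] using f[OF that] a[OF that] vector_fieldD[OF X that] by auto
 show "sma mE (atot JE) Z e" if "e \<in> pts mE" for e
  using sm_JE_iff[OF atA that, of Z] PB.afibreD(1)[OF v] s[OF that] vector_fieldD(4)[OF X that] by blast
qed

lemma VE_secD:
 assumes Z: "Z \<in> vsec mE VE"
 shows "e \<in> pts mE ==> fst (Z e) \<in> vfibre V (\<pi> e)"
  "e \<in> pts mE ==> sma mE (vtot V) (%e. fst (Z e)) e" "vector_field mE (snd \<circ> Z)"
  "e \<in> pts mE ==> h \<in> smooth_near M (\<pi> e) ==> snd (snd (Z e)) (h \<circ> \<pi>) = snd (rho (fst (Z e))) h"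
proof -
 note m = PB.vsecD[OF Z]
 have s: "sma mE (vtot V) (%e. fst (Z e)) e & sma mE (TB mE) (%e. snd (Z e)) e" if "e \<in> pts mE" for e
  using sm_VE_iff[OF atA that, of Z] m(2)[OF that] PB.fibreD(1)[OF m(1)] by blast
 show "e \<in> pts mE ==> fst (Z e) \<in> vfibre V (\<pi> e)" using m(1) VE_fibre by blast
 show "e \<in> pts mE ==> sma mE (vtot V) (%e. fst (Z e)) e" using s by blast
 show "e \<in> pts mE ==> h \<in> smooth_near M (\<pi> e) ==> snd (snd (Z e)) (h \<circ> \<pi>) = snd (rho (fst (Z e))) h"
  using m(1)[of e] VE_fibre[of e "Z e"] by simp
 show "vector_field mE (snd \<circ> Z)"
  using s snd_VE(2)[OF PB.fibreD(1)[OF m(1)]] m(1) VE_fibre unfolding vector_field_def o_def by blast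
qed

lemma JE_secD:
 assumes Z: "Z \<in> asec mE JE"
 shows "e \<in> pts mE ==> fst (Z e) \<in> afibre E (\<pi> e)"
  "e \<in> pts mE ==> sma mE mE (%e. fst (Z e)) e" "vector_field mE (snd \<circ> Z)"
  "e \<in> pts mE ==> h \<in> smooth_near M (\<pi> e) ==> snd (snd (Z e)) (h \<circ> \<pi>) = snd (lam (fst (Z e))) h"
proof -
 note m = PB.asecD[OF Z]
 have s: "sma mE mE (%e. fst (Z e)) e & sma mE (TB mE) (%e. snd (Z e)) e" if "e \<in> pts mE" for e
  using sm_JE_iff[OF atA that, of Z] m(2)[OF that] PB.afibreD(1)[OF m(1)] by blast
 show "e \<in> pts mE ==> fst (Z e) \<in> afibre E (\<pi> e)" using m(1) JE_fibre by blast
 show "e \<in> pts mE ==> sma mE mE (%e. fst (Z e)) e" using s by blast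
 show "e \<in> pts mE ==> h \<in> smooth_near M (\<pi> e) ==> snd (snd (Z e)) (h \<circ> \<pi>) = snd (lam (fst (Z e))) h"
  using m(1)[of e] JE_fibre[of e "Z e"] by simp
 show "vector_field mE (snd \<circ> Z)"
  using s snd_JE(2)[OF PB.afibreD(1)[OF m(1)]] m(1) JE_fibre unfolding vector_field_def o_def by blast
qed

lemma vert_lift: assumes s: "s \<in> vsec M V" shows "\<exists>P\<in>vsec mE VE. projects_onto E P s"
proof -
 obtain X where X: "vector_field mE X" "\<forall>e\<in>pts mE. \<forall>h\<in>smooth_near M (\<pi> e). snd (X e) (h \<circ> \<pi>) = snd (rho (s (\<pi> e))) h"
  using lift_ex[OF vf_rho[OF s]] by blast
 let ?P = "\<lambda>e\<in>pts mE. (s (\<pi> e), X e)"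
 have "?P \<in> vsec mE VE"
 proof (rule VE_secI)
  show "vector_field mE (%e. snd (?P e))" by (rule vector_field_cong[OF X(1)]) simp
  show "sma mE (vtot V) (%e. fst (?P e)) e" if "e \<in> pts mE" for e
   by (rule sm_at_cong[OF vsec_comp[OF s that] that]) simp
 qed (use X(2) vsecD(1)[OF s aproj_in] in auto)
 then show ?thesis by (intro bexI) (auto simp: projects_onto_def)
qed

lemma jet_lift: "\<exists>P\<in>asec mE JE. projects_onto E P \<zeta>0"
proof -
 obtain X where X: "vector_field mE X" "\<forall>e\<in>pts mE. \<forall>h\<in>smooth_near M (\<pi> e). snd (X e) (h \<circ> \<pi>) = snd (lam (\<zeta>0 (\<pi> e))) h"
  using lift_ex[OF vf_lam[OF \<zeta>0]] by blast
 let ?P = "\<lambda>e\<in>pts mE. (\<zeta>0 (\<pi> e), X e)"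
 have "?P \<in> asec mE JE"
 proof (rule JE_secI)
  show "vector_field mE (%e. snd (?P e))" by (rule vector_field_cong[OF X(1)]) simp
  show "sma mE mE (%e. fst (?P e)) e" if "e \<in> pts mE" for e
   by (rule sm_at_cong[OF asec_comp[OF \<zeta>0 that] that]) simp
 qed (use X(2) asecD(1)[OF \<zeta>0 aproj_in] in auto)
 then show ?thesis by (intro bexI) (auto simp: projects_onto_def)
qed

text \<open>Equality of sections becomes two families of equations between real functions. All identities of the new
  bracket are proved in this way.\<close>

lemma VE_sec_eqI:
 assumes A: "A \<in> vsec mE VE" and B: "B \<in> vsec mE VE"
  and f: "!!e i. e \<in> pts mE ==> \<theta> i (fst (A e)) = \<theta> i (fst (B e))"
  and s: "!!e h. e \<in> pts mE ==> h \<in> smooth_near mE e ==> snd (snd (A e)) h = snd (snd (B e)) h"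
 shows "A = B"
proof
 fix e
 show "A e = B e"
 proof (cases "e \<in> pts mE")
  case True
  note vA = vector_fieldD[OF VE_secD(3)[OF A] True] and vB = vector_fieldD[OF VE_secD(3)[OF B] True]
  have "fst (A e) = fst (B e)"
   by (rule frame_eqI[OF aproj_in[OF True] VE_secD(1)[OF A True] VE_secD(1)[OF B True] f[OF True]])
  moreover have "snd (snd (A e)) h = snd (snd (B e)) h" for h
   using s[OF True, of h] tan_zero[OF vA(3), of h] tan_zero[OF vB(3), of h] by (cases "h \<in> smooth_near mE e") auto
  ultimately show ?thesis using vA(2) vB(2) by (simp add: prod_eq_iff fun_eq_iff)
 next
  case False
  have "A \<in> extensional (pts mE)" "B \<in> extensional (pts mE)" using A B PB.vsec_iff by auto
  from extensional_arb[OF this(1) False] extensional_arb[OF this(2) False] show ?thesis by (rule trans[OF _ sym])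
 qed
qed

end

section \<open>The bracket of the prolonged bundle\<close>

text \<open>The next six identities are the bookkeeping of frame coefficients, detached from the geometry.\<close>

lemma sum_swap_lin:
 fixes g :: "'i => real"
 shows "(\<Sum>k\<in>I. (\<Sum>l\<in>J. g l * h l k) * m k) = (\<Sum>l\<in>J. g l * (\<Sum>k\<in>I. h l k * m k))"
 unfolding sum_distrib_left sum_distrib_right by (subst sum.swap) (simp add: mult.assoc)

lemma anchor_sums:
 fixes g :: "'i => real"
 shows "(\<Sum>l\<in>I. dg l * r l + g l * (a * p l + (\<Sum>j\<in>I. f j * w j l))) -
   (a * (\<Sum>l\<in>I. g l * q l) + (\<Sum>j\<in>I. df j * r j + f j * (\<Sum>l\<in>I. g l * v l j))) =
  (\<Sum>k\<in>I. (dg k - df k) * r k) + (\<Sum>l\<in>I. g l * (a * (p l - q l) + (\<Sum>j\<in>I. f j * (w j l - v l j))))"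
proof -
 have "(\<Sum>j\<in>I. f j * (\<Sum>l\<in>I. g l * v l j)) = (\<Sum>l\<in>I. g l * (\<Sum>j\<in>I. f j * v l j))"
  unfolding sum_distrib_left by (subst sum.swap) (simp add: mult.left_commute)
 then show ?thesis
  by (simp add: sum.distrib sum_subtractf left_diff_distrib right_diff_distrib distrib_left)
   (simp add: sum_distrib_left mult.left_commute)
qed

lemma leib_sums:
 fixes g :: "'i => real"
 shows "(\<Sum>k\<in>I. (d * g k + f * dg k - f * yf k) * m k) + (\<Sum>l\<in>I. f * g l * h l) =
  f * ((\<Sum>k\<in>I. (dg k - yf k) * m k) + (\<Sum>l\<in>I. g l * h l)) + d * (\<Sum>k\<in>I. g k * m k)"
 by (simp add: sum_distrib_left distrib_left distrib_right left_diff_distrib right_diff_distrib sum.distrib sum_subtractf mult.assoc)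

lemma plus_sums:
 fixes g :: "'i => real"
 shows "(\<Sum>k\<in>I. (dx k + dc k - (yf k + yc k)) * m k) + (\<Sum>l\<in>I. g l * (a * p l + (\<Sum>j\<in>I. (f j + c j) * w j l))) =
  ((\<Sum>k\<in>I. (dx k - yf k) * m k) + (\<Sum>l\<in>I. g l * (a * p l + (\<Sum>j\<in>I. f j * w j l)))) +
  ((\<Sum>k\<in>I. (dc k - yc k) * m k) + (\<Sum>l\<in>I. g l * (\<Sum>j\<in>I. c j * w j l)))"
 by (simp add: distrib_left distrib_right left_diff_distrib sum.distrib sum_subtractf)

lemma skew_sums:
 fixes x :: "'i => real"
 assumes "!!j l. w l j = - w j l"
 shows "(\<Sum>k\<in>I. (xy k - yx k) * m k) + (\<Sum>l\<in>I. y l * (\<Sum>j\<in>I. x j * w j l)) =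
  - ((\<Sum>k\<in>I. (yx k - xy k) * m k) + (\<Sum>l\<in>I. x l * (\<Sum>j\<in>I. y j * w j l)))"
proof -
 have "(\<Sum>l\<in>I. y l * (\<Sum>j\<in>I. x j * w j l)) = (\<Sum>l\<in>I. x l * (\<Sum>j\<in>I. y j * w l j))"
  unfolding sum_distrib_left by (subst sum.swap) (simp add: mult.left_commute)
 also have "\<dots> = - (\<Sum>l\<in>I. x l * (\<Sum>j\<in>I. y j * w j l))"
 proof -
  have "(\<Sum>j\<in>I. y j * w l j) = (\<Sum>j\<in>I. - (y j * w j l))" for l
   by (rule sum.cong[OF refl]) (subst assms, rule mult_minus_right)
  then show ?thesis by (simp add: sum_negf)
 qed
 finally show ?thesis by (simp add: left_diff_distrib sum_subtractf)
qed

lemma proj_sums: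
 fixes u :: "'i => real"
 shows "(\<Sum>k\<in>I. (a * L k + R k - (\<Sum>l\<in>I. u l * q l k)) * m k) + (\<Sum>l\<in>I. u l * (a * p l + (\<Sum>j\<in>I. v j * w j l))) =
  a * (\<Sum>l\<in>I. u l * p l + L l * m l) + (\<Sum>l\<in>I. u l * ((\<Sum>j\<in>I. v j * w j l) - (\<Sum>j\<in>I. q l j * m j)) + R l * m l)"
proof -
 have "(\<Sum>k\<in>I. (a * L k + R k - (\<Sum>l\<in>I. u l * q l k)) * m k) =
   a * (\<Sum>k\<in>I. L k * m k) + (\<Sum>k\<in>I. R k * m k) - (\<Sum>l\<in>I. u l * (\<Sum>k\<in>I. q l k * m k))"
  unfolding sum_swap_lin[symmetric] by (simp add: distrib_right left_diff_distrib sum.distrib sum_subtractf sum_distrib_left mult.assoc)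
 then show ?thesis
  by (simp add: distrib_left right_diff_distrib sum.distrib sum_subtractf sum_distrib_left[of a] mult.left_commute)
qed

context alg_frame
begin

lemma vf_funsE:
 assumes "vector_field mE X" "f \<in> smooth_funs mE" shows "(%x. snd (X x) f) \<in> smooth_funs mE"
 using near_apply[OF smE assms(1)] smooth_funs_near[OF atA _ assms(2)] unfolding smooth_funs_iff[OF atA]
 by (simp add: smooth_near_iff[OF atA])

lemma scale_funsE: "A \<in> vsec mE VE ==> f \<in> smooth_funs mE ==> sec_scale mE VE f A \<in> vsec mE VE"
 using PB.sec_scale_closed smooth_funs_iff[OF atA] by blast

lemma tan_pts:
 assumes e: "e \<in> pts mE" and D: "D \<in> tangent_space mE e" and f: "f \<in> smooth_near mE e"
  and eq: "!!y. y \<in> pts mE ==> f y = g y"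
 shows "D f = D g"
proof -
 have "sma mE euclid g e" by (rule sm_at_cong[OF f[unfolded smooth_near_iff[OF atA e]] e eq])
 then have "g \<in> smooth_near mE e" using smooth_near_iff[OF atA e] by blast
 from tan_local[OF atA e D f this atlas.openin_pts[OF atA] e eq] show ?thesis .
qed

lemma obs_near:
 assumes A: "A \<in> vsec mE VE" and e: "e \<in> pts mE"
 shows "(%e. \<theta> k (fst (A e))) \<in> smooth_near mE e"
  "h \<in> smooth_near mE e ==> (%e. snd (snd (A e)) h) \<in> smooth_near mE e"
proof -
 show "(%e. \<theta> k (fst (A e))) \<in> smooth_near mE e"
  unfolding smooth_near_iff[OF atA e] by (rule \<theta>_comp[OF e VE_secD(2)[OF A e]]) (rule fibreD(1)[OF VE_secD(1)[OF A]])
 show "h \<in> smooth_near mE e ==> (%e. snd (snd (A e)) h) \<in> smooth_near mE e"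
  using near_apply[OF smE VE_secD(3)[OF A] e, of h] by simp
qed

lemma VE_add_apply:
 assumes "A \<in> vsec mE VE" "B \<in> vsec mE VE" "e \<in> pts mE"
 shows "\<theta> i (fst (sec_add mE VE A B e)) = \<theta> i (fst (A e)) + \<theta> i (fst (B e))"
  "snd (snd (sec_add mE VE A B e)) h = snd (snd (A e)) h + snd (snd (B e)) h"
 using assms VE_secD(1) by (simp_all add: sec_add_def \<theta>_add[OF aproj_in[OF assms(3)]] tadd_def)

lemma VE_scale_apply:
 assumes "A \<in> vsec mE VE" "e \<in> pts mE"
 shows "\<theta> i (fst (sec_scale mE VE f A e)) = f e * \<theta> i (fst (A e))"
  "snd (snd (sec_scale mE VE f A e)) h = f e * snd (snd (A e)) h"
 using assms VE_secD(1) by (simp_all add: sec_scale_def \<theta>_scale[OF aproj_in[OF assms(2)]] tscale_def)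

lemma D_add:
 assumes A: "A \<in> vsec mE VE" and B: "B \<in> vsec mE VE" and e: "e \<in> pts mE" and D: "D \<in> tangent_space mE e"
 shows "D (%y. \<theta> i (fst (sec_add mE VE A B y))) = D (%y. \<theta> i (fst (A y))) + D (%y. \<theta> i (fst (B y)))"
  "h \<in> smooth_near mE e ==> D (%y. snd (snd (sec_add mE VE A B y)) h) = D (%y. snd (snd (A y)) h) + D (%y. snd (snd (B y)) h)"
 using obs_near[OF A e] obs_near[OF B e]
 by (simp_all add: tan_add[OF D, symmetric] tan_pts[OF e D obs_near(1)[OF PB.sec_add_closed[OF A B] e] VE_add_apply(1)[OF A B]]
  tan_pts[OF e D obs_near(2)[OF PB.sec_add_closed[OF A B] e] VE_add_apply(2)[OF A B]])

lemma D_scale: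
 assumes A: "A \<in> vsec mE VE" and f: "f \<in> smooth_funs mE" and e: "e \<in> pts mE" and D: "D \<in> tangent_space mE e"
 shows "D (%y. \<theta> i (fst (sec_scale mE VE f A y))) = D f * \<theta> i (fst (A e)) + f e * D (%y. \<theta> i (fst (A y)))"
  "h \<in> smooth_near mE e ==>
    D (%y. snd (snd (sec_scale mE VE f A y)) h) = D f * snd (snd (A e)) h + f e * D (%y. snd (snd (A y)) h)"
 using obs_near[OF A e] smooth_funs_near[OF atA e f]
 by (simp_all add: tan_mult[OF D] tan_pts[OF e D obs_near(1)[OF scale_funsE[OF A f] e] VE_scale_apply(1)[OF A]]
  tan_pts[OF e D obs_near(2)[OF scale_funsE[OF A f] e] VE_scale_apply(2)[OF A]])

text \<open>Coefficients and anchor of a section: \<open>a = 1\<close> for the sections \<open>P0 + F\<^sup>j P\<^sub>j\<close> of the affine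
  bundle, \<open>a = 0\<close> for the sections \<open>F\<^sup>j P\<^sub>j\<close> of its model.\<close>

definition gdat :: "real => (nat \<times> 'd => 'e => real) => ('e => 'e tvec) => bool" where
 "gdat a F X \<longleftrightarrow> vector_field mE X & (\<forall>k. \<forall>e\<in>pts mE. F k \<in> smooth_near mE e) &
   (\<forall>e\<in>pts mE. \<forall>h\<in>smooth_near M (\<pi> e).
    snd (X e) (h \<circ> \<pi>) = a * snd (lam (\<zeta>0 (\<pi> e))) h + (\<Sum>j\<in>I. F j e * snd (rho (\<sigma> j (\<pi> e))) h))"

lemma gdatD:
 assumes "gdat a F X"
 shows "vector_field mE X" "e \<in> pts mE ==> F k \<in> smooth_near mE e"
  "e \<in> pts mE ==> h \<in> smooth_near M (\<pi> e) ==>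
    snd (X e) (h \<circ> \<pi>) = a * snd (lam (\<zeta>0 (\<pi> e))) h + (\<Sum>j\<in>I. F j e * snd (rho (\<sigma> j (\<pi> e))) h)"
 using assms unfolding gdat_def by blast+

definition co :: "('e => 'v \<times> 'e tvec) => nat \<times> 'd => 'e => real" where "co Z k e = \<theta> k (fst (Z e))"
definition aco :: "('e => 'e \<times> 'e tvec) => nat \<times> 'd => 'e => real" where "aco Z k e = \<theta> k (adiff (\<zeta>0 (\<pi> e)) (fst (Z e)))"

lemma co_abs: "co Z k = (%e. \<theta> k (fst (Z e)))"
 by (simp add: fun_eq_iff co_def)

lemma gdat_vert: assumes Z: "Z \<in> vsec mE VE" shows "gdat 0 (co Z) (snd \<circ> Z)"
 unfolding gdat_def co_abs
proof (intro conjI allI ballI)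
 fix e h assume e: "e \<in> pts mE" and h: "h \<in> smooth_near M (\<pi> e)"
 show "snd ((snd \<circ> Z) e) (h \<circ> \<pi>) = 0 * snd (lam (\<zeta>0 (\<pi> e))) h + (\<Sum>j\<in>I. \<theta> j (fst (Z e)) * snd (rho (\<sigma> j (\<pi> e))) h)"
  using VE_secD(4)[OF Z e h] expand[OF aproj_in[OF e] VE_secD(1)[OF Z e] flin_rho[OF aproj_in[OF e]], of h] by simp
qed (fact VE_secD(3)[OF Z] obs_near(1)[OF Z])+

lemma gdat_jet: assumes Z: "Z \<in> asec mE JE" shows "gdat 1 (aco Z) (snd \<circ> Z)"
 unfolding gdat_def
proof (intro conjI allI ballI)
 fix e assume e: "e \<in> pts mE"
 note x = aproj_in[OF e]
 show "aco Z k \<in> smooth_near mE e" for k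
  using adiff_coeff_smooth[OF e JE_secD(1)[OF Z] JE_secD(2)[OF Z e]] smooth_near_iff[OF atA e] by (simp add: aco_def[abs_def])
 fix h assume h: "h \<in> smooth_near M (\<pi> e)"
 note d = adiff[OF x asecD(1)[OF \<zeta>0 x] JE_secD(1)[OF Z e]]
 have "lam (fst (Z e)) = tadd (lam (\<zeta>0 (\<pi> e))) (rho (adiff (\<zeta>0 (\<pi> e)) (fst (Z e))))"
  using lam_plus[OF x asecD(1)[OF \<zeta>0 x] d(1)] d(2) by simp
 then show "snd ((snd \<circ> Z) e) (h \<circ> \<pi>) = 1 * snd (lam (\<zeta>0 (\<pi> e))) h + (\<Sum>j\<in>I. aco Z j e * snd (rho (\<sigma> j (\<pi> e))) h)"
  using JE_secD(4)[OF Z e h] expand[OF x d(1) flin_rho[OF x], of h] by (simp add: tadd_def aco_def)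
qed (rule JE_secD(3)[OF Z])

text \<open>Near \<open>e\<close> the function \<open>X (h \<circ> \<pi>)\<close> is the combination of functions of the base given by the coefficients, so
  the product rule applies.\<close>

lemma base_apply:
 assumes g: "gdat a F X" and e: "e \<in> pts mE" and D: "D \<in> tangent_space mE e" and h: "h \<in> smooth_near M (\<pi> e)"
 shows "D (%y. snd (X y) (h \<circ> \<pi>)) = a * D ((%y. snd (lam (\<zeta>0 y)) h) \<circ> \<pi>) +
  (\<Sum>j\<in>I. D (F j) * snd (rho (\<sigma> j (\<pi> e))) h + F j e * D ((%y. snd (rho (\<sigma> j y)) h) \<circ> \<pi>))"
proof -
 note x = aproj_in[OF e]
 let ?L = "(%y. snd (lam (\<zeta>0 y)) h) \<circ> \<pi>" and ?R = "%j. (%y. snd (rho (\<sigma> j y)) h) \<circ> \<pi>"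
 note nL = near_aproj[OF e near_apply[OF smM vf_lam[OF \<zeta>0] x h]]
 note nR = near_aproj[OF e near_apply[OF smM vf_rho[OF \<sigma>_sec] x h]]
 note nF = gdatD(2)[OF g e]
 note nFR = near_mult[OF atA e nF nR] and naL = near_mult[OF atA e near_const[OF atA e] nL]
 obtain W where W: "openin (mtop M) W" "\<pi> e \<in> W" "\<forall>y\<in>W. h \<in> smooth_near M y" using near_nbhd[OF atN x h] by blast
 obtain Q where Q: "openin (mtop mE) Q" "e \<in> Q" "\<pi> ` (pts mE \<inter> Q) \<subseteq> W"
  using sm_at_continuous[OF atA atN aproj_sm[OF e] e W(1,2)] by blast
 have QE: "Q \<subseteq> pts mE" using openin_subset[OF Q(1)] atlas.topspace_mtop[OF atA] by simp
 have "D (%y. snd (X y) (h \<circ> \<pi>)) = D (%y. a * ?L y + (\<Sum>j\<in>I. F j y * ?R j y))"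
 proof (rule tan_local[OF atA e D near_apply[OF smE gdatD(1)[OF g] e near_aproj[OF e h]]
   near_add[OF atA e naL near_sum[OF atA e nFR]] Q(1,2)])
  fix y assume "y \<in> Q"
  then have "y \<in> pts mE" "h \<in> smooth_near M (\<pi> y)" using Q(3) QE W(3) by auto
  from gdatD(3)[OF g this] show "snd (X y) (h \<circ> \<pi>) = a * ?L y + (\<Sum>j\<in>I. F j y * ?R j y)" by simp
 qed
 also have "\<dots> = a * D ?L + (\<Sum>j\<in>I. D (%y. F j y * ?R j y))"
  unfolding tan_add[OF D naL near_sum[OF atA e nFR]] tan_scale[OF D nL] tan_sum[OF atA e D nFR] ..
 also have "\<dots> = a * D ?L + (\<Sum>j\<in>I. D (F j) * ?R j e + F j e * D (?R j))"
  unfolding tan_mult[OF D nF nR] ..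
 finally show ?thesis by simp
qed

text \<open>The coefficients of the bracket of \<open>a P0 + F\<^sup>j P\<^sub>j\<close> with \<open>G\<^sup>l P\<^sub>l\<close> that the Leibniz rule and the brackets of
  the frame impose. They depend on the chosen coefficients, the resulting vector does not.\<close>

definition cf where
 "cf a F X G Y e k = snd (X e) (G k) - snd (Y e) (F k) +
   (\<Sum>l\<in>I. G l e * (a * \<theta> k (act \<zeta>0 (\<sigma> l) (\<pi> e)) + (\<Sum>j\<in>I. F j e * \<theta> k (br (\<sigma> j) (\<sigma> l) (\<pi> e)))))"

definition res :: "real => (nat \<times> 'd => 'e => real) => ('e => 'e tvec) => (nat \<times> 'd => 'e => real) =>
  ('e => 'e tvec) => 'e => 'v \<times> 'e tvec" where
 "res a F X G Y = (\<lambda>e\<in>pts mE. (lc (\<pi> e) (cf a F X G Y e), lie_bracket mE X Y e))"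

lemma res_flin:
 assumes e: "e \<in> pts mE" and m: "flin (\<pi> e) m"
 shows "m (fst (res a F X G Y e)) = (\<Sum>k\<in>I. (snd (X e) (G k) - snd (Y e) (F k)) * m (\<sigma> k (\<pi> e))) +
  (\<Sum>l\<in>I. G l e * (a * m (act \<zeta>0 (\<sigma> l) (\<pi> e)) + (\<Sum>j\<in>I. F j e * m (br (\<sigma> j) (\<sigma> l) (\<pi> e)))))"
proof -
 note x = aproj_in[OF e]
 have ex: "(\<Sum>k\<in>I. \<theta> k v * m (\<sigma> k (\<pi> e))) = m v" if "v \<in> vfibre V (\<pi> e)" for v by (rule expand[OF x that m, symmetric])
 have 1: "(\<Sum>k\<in>I. (a * \<theta> k u + (\<Sum>j\<in>I. F j e * \<theta> k (v j))) * m (\<sigma> k (\<pi> e))) = a * m u + (\<Sum>j\<in>I. F j e * m (v j))"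
  if "u \<in> vfibre V (\<pi> e)" "!!j. v j \<in> vfibre V (\<pi> e)" for u v
  unfolding distrib_right sum.distrib sum_swap_lin ex[OF that(2)] ex[OF that(1), symmetric] mult.assoc sum_distrib_left[symmetric] ..
 have cfm: "cf a F X G Y e k * m (\<sigma> k (\<pi> e)) = (snd (X e) (G k) - snd (Y e) (F k)) * m (\<sigma> k (\<pi> e)) +
   (\<Sum>l\<in>I. G l e * (a * \<theta> k (act \<zeta>0 (\<sigma> l) (\<pi> e)) + (\<Sum>j\<in>I. F j e * \<theta> k (br (\<sigma> j) (\<sigma> l) (\<pi> e))))) * m (\<sigma> k (\<pi> e))" for k
  unfolding cf_def by (rule distrib_right)
 have "m (fst (res a F X G Y e)) = (\<Sum>k\<in>I. cf a F X G Y e k * m (\<sigma> k (\<pi> e)))" using e lc(2)[OF x m] by (simp add: res_def)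
 also have "\<dots> = (\<Sum>k\<in>I. (snd (X e) (G k) - snd (Y e) (F k)) * m (\<sigma> k (\<pi> e))) +
   (\<Sum>l\<in>I. G l e * (\<Sum>k\<in>I. (a * \<theta> k (act \<zeta>0 (\<sigma> l) (\<pi> e)) + (\<Sum>j\<in>I. F j e * \<theta> k (br (\<sigma> j) (\<sigma> l) (\<pi> e)))) * m (\<sigma> k (\<pi> e))))"
  by (simp only: cfm sum.distrib sum_swap_lin)
 finally show ?thesis using 1[OF vsecD(1)[OF act_closed[OF \<zeta>0 \<sigma>_sec] x] vsecD(1)[OF br_closed[OF \<sigma>_sec \<sigma>_sec] x]] by simp
qed

text \<open>The anchor sends the new bracket to the Lie bracket of vector fields because the given anchors do
  so on the frame, and the derivative terms in both agree.\<close>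

lemma res_anchor:
 assumes f: "gdat a F X" and g: "gdat 0 G Y" and e: "e \<in> pts mE" and h: "h \<in> smooth_near M (\<pi> e)"
 shows "snd (rho (fst (res a F X G Y e))) h = snd (lie_bracket mE X Y e) (h \<circ> \<pi>)"
proof -
 note x = aproj_in[OF e]
 note DX = vector_fieldD(3)[OF gdatD(1)[OF f] e] and DY = vector_fieldD(3)[OF gdatD(1)[OF g] e]
 note nR = near_apply[OF smM vf_rho[OF \<sigma>_sec] x h] and nL = near_apply[OF smM vf_lam[OF \<zeta>0] x h]
 have gY: "snd (Y e) (k \<circ> \<pi>) = (\<Sum>l\<in>I. G l e * snd (rho (\<sigma> l (\<pi> e))) k)" if "k \<in> smooth_near M (\<pi> e)" for k
  using gdatD(3)[OF g e that] by simp
 have "snd (lie_bracket mE X Y e) (h \<circ> \<pi>) =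
   snd (X e) (%y. snd (Y y) (h \<circ> \<pi>)) - snd (Y e) (%y. snd (X y) (h \<circ> \<pi>))"
  by (rule lie_bracket_apply[OF e near_aproj[OF e h]])
 also have "\<dots> = (\<Sum>k\<in>I. (snd (X e) (G k) - snd (Y e) (F k)) * snd (rho (\<sigma> k (\<pi> e))) h) +
  (\<Sum>l\<in>I. G l e * (a * snd (rho (act \<zeta>0 (\<sigma> l) (\<pi> e))) h + (\<Sum>j\<in>I. F j e * snd (rho (br (\<sigma> j) (\<sigma> l) (\<pi> e))) h)))"
  unfolding base_apply[OF g e DX h] base_apply[OF f e DY h] gdatD(3)[OF f e nR] gY[OF nR] gY[OF nL]
   lam_act_apply[OF \<zeta>0 \<sigma>_sec x h] rho_br_apply[OF \<sigma>_sec \<sigma>_sec x h] anchor_sums[symmetric] by simp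
 also have "\<dots> = snd (rho (fst (res a F X G Y e))) h"
  by (rule res_flin[OF e flin_rho[OF x], symmetric])
 finally show ?thesis by simp
qed

lemma res_closed:
 assumes f: "gdat a F X" and g: "gdat 0 G Y" shows "res a F X G Y \<in> vsec mE VE"
proof (rule VE_secI)
 show "res a F X G Y \<in> extensional (pts mE)" by (simp add: res_def)
 show "vector_field mE (%e. snd (res a F X G Y e))"
  by (rule vector_field_cong[OF vector_field_lie_bracket[OF smE gdatD(1)[OF f] gdatD(1)[OF g]]]) (simp add: res_def)
 fix e assume e: "e \<in> pts mE"
 note x = aproj_in[OF e]
 show "fst (res a F X G Y e) \<in> vfibre V (\<pi> e)" using e lc(1)[OF x] by (simp add: res_def)
 have sc: "sma mE euclid (%z. cf a F X G Y z k) e" for k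
 proof -
  note n = smooth_near_iff[OF atA e, THEN iffD1]
  note s = n[OF gdatD(2)[OF f e]] n[OF gdatD(2)[OF g e]] n[OF near_apply[OF smE gdatD(1)[OF f] e gdatD(2)[OF g e]]]
   n[OF near_apply[OF smE gdatD(1)[OF g] e gdatD(2)[OF f e]]]
   fun_comp[OF \<theta>_fun[OF act_closed[OF \<zeta>0 \<sigma>_sec]] e] fun_comp[OF \<theta>_fun[OF br_closed[OF \<sigma>_sec \<sigma>_sec]] e]
  show ?thesis unfolding cf_def
   by (intro sm_at_add[OF atA e] sm_at_diff[OF atA e] sm_at_sum[OF atA e e] sm_at_mult[OF atA e] s sm_at_const[OF atA atlas_euclid e]) auto
 qed
 have "sma mE (vtot V) (%z. lc (\<pi> z) (cf a F X G Y z)) e"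
  by (rule lc_smooth[OF atA e e aproj_sm[OF e] aproj_in sc])
 then show "sma mE (vtot V) (%e. fst (res a F X G Y e)) e"
  by (rule sm_at_cong[OF _ e]) (simp add: res_def)
 show "snd (rho (fst (res a F X G Y e))) h = snd (snd (res a F X G Y e)) (h \<circ> \<pi>)" if "h \<in> smooth_near M (\<pi> e)" for h
  unfolding res_anchor[OF f g e that] using e by (simp add: res_def)
qed

text \<open>The bracket with a section that is given by its coefficients and anchor.\<close>

definition op :: "real => (nat \<times> 'd => 'e => real) => ('e => 'e tvec) => ('e => 'v \<times> 'e tvec) => 'e => 'v \<times> 'e tvec" where
 "op a F X A = res a F X (co A) (snd \<circ> A)"

lemma op_closed: "gdat a F X ==> A \<in> vsec mE VE ==> op a F X A \<in> vsec mE VE"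
 unfolding op_def by (rule res_closed[OF _ gdat_vert])

lemma op_\<theta>:
 assumes e: "e \<in> pts mE"
 shows "\<theta> i (fst (op a F X A e)) = (\<Sum>k\<in>I. (snd (X e) (%y. \<theta> k (fst (A y))) - snd (snd (A e)) (F k)) * \<theta> i (\<sigma> k (\<pi> e))) +
  (\<Sum>l\<in>I. \<theta> l (fst (A e)) * (a * \<theta> i (act \<zeta>0 (\<sigma> l) (\<pi> e)) + (\<Sum>j\<in>I. F j e * \<theta> i (br (\<sigma> j) (\<sigma> l) (\<pi> e)))))"
 unfolding op_def res_flin[OF e \<theta>_lin[OF aproj_in[OF e]]] co_abs by simp

lemma op_snd: "e \<in> pts mE ==> snd (op a F X A e) = lie_bracket mE X (snd \<circ> A) e"
 by (simp add: op_def res_def)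

lemma op_apply: "e \<in> pts mE ==> h \<in> smooth_near mE e ==>
  snd (snd (op a F X A e)) h = snd (X e) (%y. snd (snd (A y)) h) - snd (snd (A e)) (%y. snd (X y) h)"
 by (simp add: op_snd lie_bracket_apply)

lemma op_add:
 assumes g: "gdat a F X" and A: "A \<in> vsec mE VE" and B: "B \<in> vsec mE VE"
 shows "op a F X (sec_add mE VE A B) = sec_add mE VE (op a F X A) (op a F X B)"
proof (rule VE_sec_eqI[OF op_closed[OF g PB.sec_add_closed[OF A B]] PB.sec_add_closed[OF op_closed[OF g A] op_closed[OF g B]]])
 fix e assume e: "e \<in> pts mE"
 note D = vector_fieldD(3)[OF gdatD(1)[OF g] e]
 note c = VE_add_apply[OF op_closed[OF g A] op_closed[OF g B] e]
 show "\<theta> i (fst (op a F X (sec_add mE VE A B) e)) = \<theta> i (fst (sec_add mE VE (op a F X A) (op a F X B) e))" for i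
  unfolding c op_\<theta>[OF e] D_add(1)[OF A B e D] VE_add_apply[OF A B e]
  by (simp add: distrib_right left_diff_distrib sum.distrib sum_subtractf)
 show "snd (snd (op a F X (sec_add mE VE A B) e)) h = snd (snd (sec_add mE VE (op a F X A) (op a F X B) e)) h"
  if "h \<in> smooth_near mE e" for h
  unfolding c op_apply[OF e that] D_add(2)[OF A B e D that] VE_add_apply[OF A B e] by simp
qed

lemma op_leib:
 assumes g: "gdat a F X" and A: "A \<in> vsec mE VE" and f: "f \<in> smooth_funs mE"
 shows "op a F X (sec_scale mE VE f A) =
  sec_add mE VE (sec_scale mE VE f (op a F X A)) (sec_scale mE VE (%e. snd (X e) f) A)"
proof -
 note o = op_closed[OF g A] and Xf = vf_funsE[OF gdatD(1)[OF g] f]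
 note s = scale_funsE[OF o f] scale_funsE[OF A Xf]
 show ?thesis
 proof (rule VE_sec_eqI[OF op_closed[OF g scale_funsE[OF A f]] PB.sec_add_closed[OF s]])
  fix e assume e: "e \<in> pts mE"
  note D = vector_fieldD(3)[OF gdatD(1)[OF g] e]
  note c = VE_add_apply[OF s e] VE_scale_apply[OF o e] VE_scale_apply[OF A e]
  have ex: "(\<Sum>k\<in>I. \<theta> k (fst (A e)) * \<theta> i (\<sigma> k (\<pi> e))) = \<theta> i (fst (A e))" for i
   by (rule expand[OF aproj_in[OF e] VE_secD(1)[OF A e] \<theta>_lin[OF aproj_in[OF e]], symmetric])
  show "\<theta> i (fst (op a F X (sec_scale mE VE f A) e)) = \<theta> i (fst (sec_add mE VE (sec_scale mE VE f (op a F X A))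
    (sec_scale mE VE (%e. snd (X e) f) A) e))" for i
   unfolding c op_\<theta>[OF e] D_scale(1)[OF A f e D] leib_sums ex ..
  show "snd (snd (op a F X (sec_scale mE VE f A) e)) h = snd (snd (sec_add mE VE (sec_scale mE VE f (op a F X A))
    (sec_scale mE VE (%e. snd (X e) f) A) e)) h" if "h \<in> smooth_near mE e" for h
   unfolding c op_apply[OF e that] D_scale(2)[OF A f e D that] by (simp add: right_diff_distrib)
 qed
qed

text \<open>The bracket is affine in the data of its first argument. Additivity of the bracket and compatibility of the
  action with addition are both instances.\<close>

lemma op_plus:
 assumes g: "gdat a F X" and g': "gdat a F' X'" and C: "C \<in> vsec mE VE" and A: "A \<in> vsec mE VE"
  and F: "!!k e. e \<in> pts mE ==> F' k e = F k e + co C k e"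
  and X: "!!e. e \<in> pts mE ==> X' e = tadd (X e) (snd (C e))"
 shows "op a F' X' A = sec_add mE VE (op a F X A) (op 0 (co C) (snd \<circ> C) A)"
proof -
 note gC = gdat_vert[OF C]
 note o = op_closed[OF g A] op_closed[OF gC A]
 show ?thesis
 proof (rule VE_sec_eqI[OF op_closed[OF g' A] PB.sec_add_closed[OF o]])
  fix e assume e: "e \<in> pts mE"
  note D = vector_fieldD(3)[OF VE_secD(3)[OF A] e]
  have DF: "snd (snd (A e)) (F' k) = snd (snd (A e)) (F k) + snd (snd (A e)) (co C k)" for k
   using tan_pts[OF e D gdatD(2)[OF g' e] F] tan_add[OF D gdatD(2)[OF g e] gdatD(2)[OF gC e]] by simp
  have DX: "snd (X' e) f = snd (X e) f + snd (snd (C e)) f" for f using X[OF e] by (simp add: tadd_def)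
  show "\<theta> i (fst (op a F' X' A e)) = \<theta> i (fst (sec_add mE VE (op a F X A) (op 0 (co C) (snd \<circ> C) A) e))" for i
   unfolding VE_add_apply[OF o e] op_\<theta>[OF e] DF DX F[OF e] plus_sums by simp
  fix h assume h: "h \<in> smooth_near mE e"
  have "snd (snd (A e)) (%y. snd (X' y) h) = snd (snd (A e)) (%y. snd (X y) h) + snd (snd (A e)) (%y. snd (snd (C y)) h)"
   using tan_pts[OF e D near_apply[OF smE gdatD(1)[OF g'] e h], of "%y. snd (X y) h + snd (snd (C y)) h"] X
    tan_add[OF D near_apply[OF smE gdatD(1)[OF g] e h] obs_near(2)[OF C e h]] by (simp add: tadd_def)
  then show "snd (snd (op a F' X' A e)) h = snd (snd (sec_add mE VE (op a F X A) (op 0 (co C) (snd \<circ> C) A) e)) h"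
   unfolding VE_add_apply[OF o e] op_apply[OF e h] DX by simp
 qed
qed

lemma op_skew:
 assumes A: "A \<in> vsec mE VE" and B: "B \<in> vsec mE VE"
 shows "op 0 (co B) (snd \<circ> B) A = sec_scale mE VE (%_. - 1) (op 0 (co A) (snd \<circ> A) B)"
proof -
 have c: "(%_. - 1) \<in> smooth_funs mE" unfolding smooth_funs_iff[OF atA] by (auto intro: sm_at_const[OF atA atlas_euclid])
 note o = op_closed[OF gdat_vert[OF B] A] op_closed[OF gdat_vert[OF A] B]
 show ?thesis
 proof (rule VE_sec_eqI[OF o(1) scale_funsE[OF o(2) c]])
  fix e assume e: "e \<in> pts mE"
  have w: "\<theta> i (br (\<sigma> l) (\<sigma> j) (\<pi> e)) = - \<theta> i (br (\<sigma> j) (\<sigma> l) (\<pi> e))" for i j l by (rule br_sk[OF \<sigma>_sec \<sigma>_sec aproj_in[OF e]])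
  show "\<theta> i (fst (op 0 (co B) (snd \<circ> B) A e)) = \<theta> i (fst (sec_scale mE VE (%_. - 1) (op 0 (co A) (snd \<circ> A) B) e))" for i
   unfolding VE_scale_apply[OF o(2) e] op_\<theta>[OF e] co_abs
   by (simp only: mult_zero_left add_0_left o_apply mult_minus1) (rule skew_sums[where w = "%l j. \<theta> i (br (\<sigma> l) (\<sigma> j) (\<pi> e))", OF w])
  show "snd (snd (op 0 (co B) (snd \<circ> B) A e)) h = snd (snd (sec_scale mE VE (%_. - 1) (op 0 (co A) (snd \<circ> A) B) e)) h"
   if "h \<in> smooth_near mE e" for h
   unfolding VE_scale_apply[OF o(2) e] op_apply[OF e that] by simp
 qed
qed

text \<open>Although the frame coefficients are redundant, on projectable sections the formula returns the bracket of
  \<open>E\<close>: the derivative terms are those of its own Leibniz rule.\<close>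

lemma op_proj:
 assumes g: "gdat a F X" and F: "!!k e. e \<in> pts mE ==> F k e = \<theta> k (s (\<pi> e))" and s: "s \<in> vsec M V"
  and A: "A \<in> vsec mE VE" and r: "r \<in> vsec M V" and Ar: "projects_onto E A r" and e: "e \<in> pts mE"
 shows "\<theta> i (fst (op a F X A e)) = a * \<theta> i (act \<zeta>0 r (\<pi> e)) + \<theta> i (br s r (\<pi> e))"
proof -
 note x = aproj_in[OF e]
 have fA: "fst (A y) = r (\<pi> y)" if "y \<in> pts mE" for y using Ar that by (simp add: projects_onto_def)
 note DX = vector_fieldD(3)[OF gdatD(1)[OF g] e] and DA = vector_fieldD(3)[OF VE_secD(3)[OF A] e]
 note n = smooth_funs_near[OF atN x \<theta>_fun[OF r]] and ns = smooth_funs_near[OF atN x \<theta>_fun[OF s]]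
 have 1: "snd (X e) (%y. \<theta> k (fst (A y))) = a * snd (lam (\<zeta>0 (\<pi> e))) (%y. \<theta> k (r y)) + snd (rho (s (\<pi> e))) (%y. \<theta> k (r y))" for k
 proof -
  have "snd (X e) (%y. \<theta> k (fst (A y))) = snd (X e) ((%y. \<theta> k (r y)) \<circ> \<pi>)"
   by (rule tan_pts[OF e DX obs_near(1)[OF A e]]) (simp add: fA)
  then show ?thesis using gdatD(3)[OF g e n, of k] expand[OF x vsecD(1)[OF s x] flin_rho[OF x], of "%y. \<theta> k (r y)"]
   by (simp add: F[OF e])
 qed
 have 2: "snd (snd (A e)) (F k) = (\<Sum>l\<in>I. \<theta> l (r (\<pi> e)) * snd (rho (\<sigma> l (\<pi> e))) (%y. \<theta> k (s y)))" for k
 proof -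
  have "snd (snd (A e)) (F k) = snd (snd (A e)) ((%y. \<theta> k (s y)) \<circ> \<pi>)"
   using tan_pts[OF e _ gdatD(2)[OF g e], of "snd (snd (A e))" k "(%y. \<theta> k (s y)) \<circ> \<pi>"] DA F by simp
  also have "\<dots> = snd (rho (r (\<pi> e))) (%y. \<theta> k (s y))" using VE_secD(4)[OF A e ns] fA[OF e] by simp
  also have "\<dots> = (\<Sum>l\<in>I. \<theta> l (r (\<pi> e)) * snd (rho (\<sigma> l (\<pi> e))) (%y. \<theta> k (s y)))" by (rule expand[OF x vsecD(1)[OF r x] flin_rho[OF x]])
  finally show ?thesis .
 qed
 have 3: "(\<Sum>j\<in>I. \<theta> j (s (\<pi> e)) * \<theta> i (br (\<sigma> j) (\<sigma> l) (\<pi> e))) - (\<Sum>j\<in>I. snd (rho (\<sigma> l (\<pi> e))) (%y. \<theta> j (s y)) * \<theta> i (\<sigma> j (\<pi> e))) =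
   \<theta> i (br s (\<sigma> l) (\<pi> e))" for l
 proof -
  have b: "\<theta> j (s (\<pi> e)) * \<theta> i (br (\<sigma> l) (\<sigma> j) (\<pi> e)) = - (\<theta> j (s (\<pi> e)) * \<theta> i (br (\<sigma> j) (\<sigma> l) (\<pi> e)))" for j
   unfolding br_sk[OF \<sigma>_sec[of j] \<sigma>_sec[of l] x, of i] by (rule mult_minus_right)
  have "\<theta> i (br s (\<sigma> l) (\<pi> e)) = - \<theta> i (br (\<sigma> l) s (\<pi> e))" by (rule br_sk[OF \<sigma>_sec s x])
  then show ?thesis unfolding br_expand[OF \<sigma>_sec s x] b sum.distrib sum_negf by simp
 qed
 show ?thesis
  unfolding op_\<theta>[OF e] 1 2 F[OF e] fA[OF e] proj_sums 3 act_expand[OF \<zeta>0 r x] br_expand[OF s r x] ..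
qed

end

section \<open>The Jacobi identity and uniqueness\<close>

lemma (in affine_bundle) sec_diff_ex:
 assumes z: "z \<in> asec N A" and w: "w \<in> asec N A"
 shows "\<exists>s\<in>vsec N W. w = sec_plus N A z s"
proof -
 let ?s = "\<lambda>x\<in>pts N. adiff (z x) (w x)"
 have d: "adiff (z x) (w x) \<in> vfibre W x" "aplus A (z x) (adiff (z x) (w x)) = w x" if "x \<in> pts N" for x
  using adiff[OF that asecD(1)[OF z that] asecD(1)[OF w that]] by auto
 have "?s \<in> vsec N W"
 proof (rule vsecI)
  fix x assume x: "x \<in> pts N"
  show "?s x \<in> vfibre W x" using d x by simp
  have "sma N (vtot W) (%x. adiff (z x) (w x)) x"
   by (rule adiff_smooth[OF atN x sm_at_id[OF atN x] asecD(2)[OF z x] _ asecD(2)[OF w x]]) (auto intro: asecD(1)[OF z] asecD(1)[OF w])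
  then show "sma N (vtot W) ?s x" by (rule sm_at_cong[OF _ x]) simp
 qed simp
 moreover have "w = sec_plus N A z ?s"
 proof (rule extensionalityI[of _ "pts N"])
  show "w \<in> extensional (pts N)" using w asec_iff by blast
 qed (simp_all add: sec_plus_def d)
 ultimately show ?thesis by blast
qed

context alg_frame
begin

lemma constE: "(%_. c) \<in> smooth_funs mE"
 unfolding smooth_funs_iff[OF atA] by (auto intro: sm_at_const[OF atA atlas_euclid])

definition br1 :: "('e => 'v \<times> 'e tvec) => ('e => 'v \<times> 'e tvec) => 'e => 'v \<times> 'e tvec" where
 "br1 A = op 0 (co A) (snd \<circ> A)"

definition act1 :: "('e => 'e \<times> 'e tvec) => ('e => 'v \<times> 'e tvec) => 'e => 'v \<times> 'e tvec" where
 "act1 Z = op 1 (aco Z) (snd \<circ> Z)"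

abbreviation "SV \<equiv> vsec mE VE"
abbreviation "sadd \<equiv> sec_add mE VE"
abbreviation "sscale \<equiv> sec_scale mE VE"

lemma br1_closed: "A \<in> SV ==> B \<in> SV ==> br1 A B \<in> SV"
 unfolding br1_def by (rule op_closed[OF gdat_vert])

lemma br1_skew: "A \<in> SV ==> B \<in> SV ==> br1 B A = sscale (%_. - 1) (br1 A B)"
 unfolding br1_def by (rule op_skew)

lemma br1_add_right: "A \<in> SV ==> B \<in> SV ==> C \<in> SV ==> br1 A (sadd B C) = sadd (br1 A B) (br1 A C)"
 unfolding br1_def by (rule op_add[OF gdat_vert])

lemma br1_add_left:
 assumes "A \<in> SV" "B \<in> SV" "C \<in> SV" shows "br1 (sadd A B) C = sadd (br1 A C) (br1 B C)"
 unfolding br1_def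
 by (rule op_plus[OF gdat_vert[OF assms(1)] gdat_vert[OF PB.sec_add_closed[OF assms(1,2)]] assms(2,3)])
  (simp_all add: co_def VE_add_apply(1)[OF assms(1,2)], simp add: sec_add_def)

lemma op_const:
 assumes g: "gdat a F X" and A: "A \<in> SV" shows "op a F X (sscale (%_. c) A) = sscale (%_. c) (op a F X A)"
proof (rule VE_sec_eqI[OF op_closed[OF g scale_funsE[OF A constE]] scale_funsE[OF op_closed[OF g A] constE]])
 note o = op_closed[OF g A] and Xf = vf_funsE[OF gdatD(1)[OF g] constE]
 note s = scale_funsE[OF o constE] scale_funsE[OF A Xf]
 fix e assume e: "e \<in> pts mE"
 have 0: "snd (X e) (%_. c) = 0" by (rule tan_const[OF atA e vector_fieldD(3)[OF gdatD(1)[OF g] e]])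
 show "\<theta> i (fst (op a F X (sscale (%_. c) A) e)) = \<theta> i (fst (sscale (%_. c) (op a F X A) e))" for i
  unfolding op_leib[OF g A constE] VE_add_apply[OF s e] VE_scale_apply[OF A e] 0 by simp
 show "snd (snd (op a F X (sscale (%_. c) A) e)) h = snd (snd (sscale (%_. c) (op a F X A) e)) h" for h
  unfolding op_leib[OF g A constE] VE_add_apply[OF s e] VE_scale_apply[OF A e] 0 by simp
qed

lemma br1_scale_right: "A \<in> SV ==> B \<in> SV ==> br1 A (sscale (%_. c) B) = sscale (%_. c) (br1 A B)"
 unfolding br1_def by (rule op_const[OF gdat_vert])

lemma br1_scale_left:
 assumes A: "A \<in> SV" and B: "B \<in> SV" shows "br1 (sscale (%_. c) A) B = sscale (%_. c) (br1 A B)"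
proof -
 note cA = scale_funsE[OF A constE] and BA = br1_closed[OF B A]
 note s = scale_funsE[OF BA constE]
 show ?thesis
  unfolding br1_skew[OF B cA] br1_scale_right[OF B A] br1_skew[OF B A]
  by (rule VE_sec_eqI[OF scale_funsE[OF s constE] scale_funsE[OF s constE]]) (simp_all add: VE_scale_apply[OF s] VE_scale_apply[OF BA])
qed

lemma aco_plus:
 assumes Z: "Z \<in> asec mE JE" and C: "C \<in> SV" and e: "e \<in> pts mE"
 shows "aco (sec_plus mE JE Z C) k e = aco Z k e + co C k e"
proof -
 note x = aproj_in[OF e]
 note z = asecD(1)[OF \<zeta>0 x] and d = adiff[OF x asecD(1)[OF \<zeta>0 x] JE_secD(1)[OF Z e]] and c = VE_secD(1)[OF C e]
 have "aplus E (fst (Z e)) (fst (C e)) = aplus E (\<zeta>0 (\<pi> e)) (vadd V (adiff (\<zeta>0 (\<pi> e)) (fst (Z e))) (fst (C e)))"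
  using plus_assoc[OF x z d(1) c] d(2) by simp
 then show ?thesis
  using e adiff_aplus[OF x z fibre_add[OF x d(1) c]] by (simp add: aco_def co_def sec_plus_def \<theta>_add[OF x d(1) c])
qed

lemma act1_plus:
 assumes Z: "Z \<in> asec mE JE" and C: "C \<in> SV" and A: "A \<in> SV"
 shows "act1 (sec_plus mE JE Z C) A = sadd (act1 Z A) (br1 C A)"
 unfolding act1_def br1_def
 by (rule op_plus[OF gdat_jet[OF Z] gdat_jet[OF PB.sec_plus_closed[OF Z C]] C A aco_plus[OF Z C]]) (simp_all add: sec_plus_def)

lemma act1_closed: "Z \<in> asec mE JE ==> A \<in> SV ==> act1 Z A \<in> SV"
 unfolding act1_def by (rule op_closed[OF gdat_jet])

lemma act1_add: "Z \<in> asec mE JE ==> A \<in> SV ==> B \<in> SV ==> act1 Z (sadd A B) = sadd (act1 Z A) (act1 Z B)"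
 unfolding act1_def by (rule op_add[OF gdat_jet])

lemma br1_bracket: "skew_bilinear_bracket mE VE br1"
 by (intro skew_bilinear_bracket.intro br1_closed br1_skew br1_add_left br1_add_right br1_scale_left br1_scale_right)

lemma act1_action: "biadditive_action mE VE JE br1 act1"
 by (intro biadditive_action.intro act1_closed act1_add act1_plus)

lemma projects_ontoI:
 assumes A: "A \<in> SV" and r: "r \<in> vsec M V" and eq: "!!e i. e \<in> pts mE ==> \<theta> i (fst (A e)) = \<theta> i (r (\<pi> e))"
 shows "projects_onto E A r"
 unfolding projects_onto_def
proof
 fix e assume e: "e \<in> pts mE"
 note x = aproj_in[OF e]
 show "fst (A e) = r (\<pi> e)" by (rule frame_eqI[OF x VE_secD(1)[OF A e] vsecD(1)[OF r x] eq[OF e]])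
qed

lemma br1_proj:
 assumes A: "A \<in> SV" and s: "s \<in> vsec M V" "projects_onto E A s" and B: "B \<in> SV" and r: "r \<in> vsec M V" "projects_onto E B r"
 shows "projects_onto E (br1 A B) (br s r)"
proof (rule projects_ontoI[OF br1_closed[OF A B] br_closed[OF s(1) r(1)]])
 fix e i assume e: "e \<in> pts mE"
 show "\<theta> i (fst (br1 A B e)) = \<theta> i (br s r (\<pi> e))"
  unfolding br1_def using op_proj[OF gdat_vert[OF A] _ s(1) B r e] s(2) by (simp add: co_def projects_onto_def)
qed

lemma act1_proj:
 assumes Z: "Z \<in> asec mE JE" and z: "z \<in> asec M E" "projects_onto E Z z" and B: "B \<in> SV" and r: "r \<in> vsec M V" "projects_onto E B r"
 shows "projects_onto E (act1 Z B) (act z r)"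
proof (rule projects_ontoI[OF act1_closed[OF Z B] act_closed[OF z(1) r(1)]])
 fix e i assume e: "e \<in> pts mE"
 obtain s where s: "s \<in> vsec M V" "z = sec_plus M E \<zeta>0 s" using sec_diff_ex[OF \<zeta>0 z(1)] by blast
 have "aco Z k y = \<theta> k (s (\<pi> y))" if "y \<in> pts mE" for k y
 proof -
  note x = aproj_in[OF that]
  show ?thesis using z(2) that x adiff_aplus[OF x asecD(1)[OF \<zeta>0 x] vsecD(1)[OF s(1) x]]
   by (simp add: aco_def projects_onto_def s(2) sec_plus_def)
 qed
 from op_proj[OF gdat_jet[OF Z] this s(1) B r e]
 show "\<theta> i (fst (act1 Z B e)) = \<theta> i (act z r (\<pi> e))"
  unfolding act1_def s(2) act_sum[OF \<zeta>0 s(1) r(1) aproj_in[OF e]] by simp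
qed

text \<open>Projectable sections generate all sections as a module: subtracting \<open>\<theta>\<^sup>i(v) P\<^sub>i\<close>, where
  \<open>P\<^sub>i\<close> lifts \<open>\<sigma>\<^sub>i\<close>, leaves a section that projects onto zero.\<close>

lemma gen_induct [consumes 1, case_names base add]:
 assumes A: "A \<in> SV"
  and base: "!!P s f. P \<in> SV ==> s \<in> vsec M V ==> projects_onto E P s ==> f \<in> smooth_funs mE ==> Q (sscale f P)"
  and add: "!!A B. A \<in> SV ==> B \<in> SV ==> Q A ==> Q B ==> Q (sadd A B)"
 shows "Q A"
proof -
 have "\<forall>i. \<exists>P. P \<in> SV & projects_onto E P (\<sigma> i)" using vert_lift[OF \<sigma>_sec] by blast
 from choice[OF this] obtain P where P: "!!i. P i \<in> SV" "!!i. projects_onto E (P i) (\<sigma> i)" by blast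
 have coA: "co A j \<in> smooth_funs mE" for j
  using obs_near(1)[OF A] smooth_near_iff[OF atA] by (simp add: smooth_funs_iff[OF atA] co_abs)
 have "\<exists>S\<in>SV. Q S & (\<forall>e\<in>pts mE. \<forall>k. \<theta> k (fst (S e)) = (\<Sum>i\<in>J. \<theta> i (fst (A e)) * \<theta> k (\<sigma> i (\<pi> e))))" if "finite J" for J
  using that
 proof (induction J)
  case empty
  show ?case
  proof (rule bexI[OF _ scale_funsE[OF P(1)[of undefined] constE[of 0]]], intro conjI ballI allI)
   show "Q (sscale (%_. 0) (P undefined))" by (rule base[OF P(1) \<sigma>_sec P(2) constE])
  qed (simp add: VE_scale_apply[OF P(1)])
 next
  case (insert j J)
  then obtain S where S: "S \<in> SV" "Q S" "\<forall>e\<in>pts mE. \<forall>k. \<theta> k (fst (S e)) = (\<Sum>i\<in>J. \<theta> i (fst (A e)) * \<theta> k (\<sigma> i (\<pi> e)))"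
   by blast
  note fP = scale_funsE[OF P(1)[of j] coA[of j]]
  show ?case
  proof (rule bexI[OF _ PB.sec_add_closed[OF fP S(1)]], intro conjI ballI allI)
   show "Q (sadd (sscale (co A j) (P j)) S)" by (rule add[OF fP S(1) base[OF P(1) \<sigma>_sec P(2) coA] S(2)])
   fix e k assume e: "e \<in> pts mE"
   show "\<theta> k (fst (sadd (sscale (co A j) (P j)) S e)) = (\<Sum>i\<in>insert j J. \<theta> i (fst (A e)) * \<theta> k (\<sigma> i (\<pi> e)))"
    unfolding VE_add_apply[OF fP S(1) e] VE_scale_apply[OF P(1) e] S(3)[rule_format, OF e]
    using insert(1,2) P(2)[of j] e by (simp add: co_def projects_onto_def)
  qed
 qed
 from this[OF finI] obtain S where S: "S \<in> SV" "Q S"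
  "\<forall>e\<in>pts mE. \<forall>k. \<theta> k (fst (S e)) = (\<Sum>i\<in>I. \<theta> i (fst (A e)) * \<theta> k (\<sigma> i (\<pi> e)))" by blast
 let ?R = "sadd A (sscale (%_. - 1) S)"
 note nS = scale_funsE[OF S(1) constE[of "- 1"]]
 note R = PB.sec_add_closed[OF A nS]
 have z: "sec_scale M V (%_. 0) (\<sigma> undefined) \<in> vsec M V"
  by (rule scale_funs[OF \<sigma>_sec]) (auto simp: smooth_funs_iff[OF atN] intro: sm_at_const[OF atN atlas_euclid])
 have "projects_onto E ?R (sec_scale M V (%_. 0) (\<sigma> undefined))"
 proof (rule projects_ontoI[OF R z])
  fix e k assume e: "e \<in> pts mE"
  note x = aproj_in[OF e]
  have "\<theta> k (fst (A e)) = \<theta> k (fst (S e))"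
   unfolding S(3)[rule_format, OF e] by (rule expand[OF x VE_secD(1)[OF A e] \<theta>_lin[OF x]])
  then show "\<theta> k (fst (?R e)) = \<theta> k (sec_scale M V (%_. 0) (\<sigma> undefined) (\<pi> e))"
   unfolding VE_add_apply[OF A nS e] VE_scale_apply[OF S(1) e] \<theta>_sec_scale[OF x \<sigma>_sec] by simp
 qed
 from base[OF R z this constE[of 1]] have "Q (sscale (%_. 1) ?R)" .
 moreover have "sscale (%_. 1) ?R = ?R"
  by (rule VE_sec_eqI[OF scale_funsE[OF R constE] R]) (simp_all add: VE_scale_apply[OF R])
 ultimately have "Q (sadd S ?R)" using add[OF S(1) R S(2)] by simp
 moreover have "sadd S ?R = A"
  by (rule VE_sec_eqI[OF PB.sec_add_closed[OF S(1) R] A])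
   (simp_all add: VE_add_apply[OF S(1) R] VE_add_apply[OF A nS] VE_scale_apply[OF S(1)])
 ultimately show ?thesis by simp
qed

text \<open>The failure of the operator with the given data to be a derivation of the bracket.\<close>

definition J where
 "J a F X A B i e = \<theta> i (fst (op a F X (br1 A B) e)) - \<theta> i (fst (br1 (op a F X A) B e)) - \<theta> i (fst (br1 A (op a F X B) e))"

text \<open>All terms that differentiate \<open>f\<close> cancel. For the second derivatives this uses that the anchor of the bracket
  is the Lie bracket.\<close>

lemma J_scale:
 assumes g: "gdat a F X" and B: "B \<in> SV" and A: "A \<in> SV" and f: "f \<in> smooth_funs mE" and e: "e \<in> pts mE"
 shows "J a F X B (sscale f A) i e = f e * J a F X B A i e"
proof -
 let ?T = "op a F X"
 note gB = gdat_vert[OF B] and TB = op_closed[OF g B] and TA = op_closed[OF g A] and BA = br1_closed[OF B A]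
 note gTB = gdat_vert[OF TB]
 note Xf = vf_funsE[OF gdatD(1)[OF g] f] and Bf = vf_funsE[OF gdatD(1)[OF gB] f]
 have leib: "br1 C (sscale u D) = sadd (sscale u (br1 C D)) (sscale (%e. snd ((snd \<circ> C) e) u) D)"
  if "C \<in> SV" "D \<in> SV" "u \<in> smooth_funs mE" for C D u
  unfolding br1_def by (rule op_leib[OF gdat_vert[OF that(1)] that(2,3)])
 have c: "\<theta> i (fst (op a' F' X' (sscale u D) e)) = u e * \<theta> i (fst (op a' F' X' D e)) + snd (X' e) u * \<theta> i (fst (D e))"
  if g': "gdat a' F' X'" and D: "D \<in> SV" and u: "u \<in> smooth_funs mE" for a' F' X' D u
  unfolding op_leib[OF g' D u] VE_add_apply[OF scale_funsE[OF op_closed[OF g' D] u] scale_funsE[OF D vf_funsE[OF gdatD(1)[OF g'] u]] e]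
   VE_scale_apply[OF op_closed[OF g' D] e] VE_scale_apply[OF D e] ..
 note cb = c[OF gdat_vert, folded br1_def]
 have cadd: "\<theta> i (fst (op a' F' X' (sadd D D') e)) = \<theta> i (fst (op a' F' X' D e)) + \<theta> i (fst (op a' F' X' D' e))"
  if g': "gdat a' F' X'" and D: "D \<in> SV" "D' \<in> SV" for a' F' X' D D'
  unfolding op_add[OF g' D] by (rule VE_add_apply[OF op_closed[OF g' D(1)] op_closed[OF g' D(2)] e])
 note cbadd = cadd[OF gdat_vert, folded br1_def]
 have TBf: "snd ((snd \<circ> ?T B) e) f = snd (X e) (%e. snd ((snd \<circ> B) e) f) - snd ((snd \<circ> B) e) (%e. snd (X e) f)"
  using op_apply[OF e smooth_funs_near[OF atA e f], of a F X B] by simp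
 have 1: "\<theta> i (fst (?T (br1 B (sscale f A)) e)) = f e * \<theta> i (fst (?T (br1 B A) e)) + snd (X e) f * \<theta> i (fst (br1 B A e)) +
   (snd ((snd \<circ> B) e) f * \<theta> i (fst (?T A e)) + snd (X e) (%e. snd ((snd \<circ> B) e) f) * \<theta> i (fst (A e)))"
  unfolding leib[OF B A f] cadd[OF g scale_funsE[OF BA f] scale_funsE[OF A Bf]] c[OF g BA f] c[OF g A Bf] ..
 have 2: "\<theta> i (fst (br1 B (?T (sscale f A)) e)) = f e * \<theta> i (fst (br1 B (?T A) e)) + snd ((snd \<circ> B) e) f * \<theta> i (fst (?T A e)) +
   (snd (X e) f * \<theta> i (fst (br1 B A e)) + snd ((snd \<circ> B) e) (%e. snd (X e) f) * \<theta> i (fst (A e)))"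
  unfolding op_leib[OF g A f] cbadd[OF B scale_funsE[OF TA f] scale_funsE[OF A Xf]] cb[OF B TA f] cb[OF B A Xf] ..
 show ?thesis unfolding J_def 1 2 cb[OF TB A f] TBf by (simp add: algebra_simps)
qed

lemma J_add:
 assumes g: "gdat a F X" and B: "B \<in> SV" and A: "A \<in> SV" and A': "A' \<in> SV" and e: "e \<in> pts mE"
 shows "J a F X B (sadd A A') i e = J a F X B A i e + J a F X B A' i e"
proof -
 note T = op_closed[OF g] and TB = op_closed[OF g B]
 note c = br1_closed[OF B A] br1_closed[OF B A']
 show ?thesis
  unfolding J_def br1_add_right[OF B A A'] op_add[OF g c] op_add[OF g A A'] br1_add_right[OF TB A A'] br1_add_right[OF B T[OF A] T[OF A']]
   VE_add_apply(1)[OF T[OF c(1)] T[OF c(2)] e] VE_add_apply(1)[OF br1_closed[OF TB A] br1_closed[OF TB A'] e]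
   VE_add_apply(1)[OF br1_closed[OF B T[OF A]] br1_closed[OF B T[OF A']] e] by simp
qed

lemma c_skew: "A \<in> SV ==> B \<in> SV ==> e \<in> pts mE ==> \<theta> i (fst (br1 B A e)) = - \<theta> i (fst (br1 A B e))"
 using br1_skew[of A B] VE_scale_apply(1)[OF br1_closed] by simp

lemma J_sym:
 assumes g: "gdat a F X" and A: "A \<in> SV" and B: "B \<in> SV" and e: "e \<in> pts mE"
 shows "J a F X B A i e = - J a F X A B i e"
proof -
 note T = op_closed[OF g]
 have "\<theta> i (fst (op a F X (br1 B A) e)) = - \<theta> i (fst (op a F X (br1 A B) e))"
  unfolding br1_skew[OF A B] op_const[OF g br1_closed[OF A B]] VE_scale_apply(1)[OF T[OF br1_closed[OF A B]] e] by simp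
 then show ?thesis using c_skew[OF A T[OF B] e, of i] c_skew[OF T[OF A] B e, of i] by (simp add: J_def)
qed

lemma J_all:
 assumes g: "gdat a F X"
  and P: "!!P s R r e. P \<in> SV ==> s \<in> vsec M V ==> projects_onto E P s ==> R \<in> SV ==> r \<in> vsec M V ==>
   projects_onto E R r ==> e \<in> pts mE ==> J a F X P R i e = 0"
  and A: "A \<in> SV" and B: "B \<in> SV" and e: "e \<in> pts mE"
 shows "J a F X A B i e = 0"
 using B
proof (induction rule: gen_induct)
 case (base R r f)
 have "J a F X R A i e = 0"
  using A
 proof (induction rule: gen_induct)
  case (base P s u)
  then show ?case using J_scale[OF g \<open>R \<in> SV\<close> base(1,4) e] P[OF \<open>R \<in> SV\<close> \<open>r \<in> vsec M V\<close> \<open>projects_onto E R r\<close> base(1-3) e] by simp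
 next
  case (add A A')
  then show ?case using J_add[OF g \<open>R \<in> SV\<close> add(1,2) e] by simp
 qed
 then show ?case using J_sym[OF g A base(1) e] J_scale[OF g A base(1,4) e] by simp
next
 case (add B B')
 then show ?case using J_add[OF g A add(1,2) e] by simp
qed

lemma J_plus:
 assumes g: "gdat a F X" and g': "gdat a F' X'" and C: "C \<in> SV" and A: "A \<in> SV" and B: "B \<in> SV" and e: "e \<in> pts mE"
  and T: "!!D. D \<in> SV ==> op a F' X' D = sadd (op a F X D) (br1 C D)"
 shows "J a F' X' A B i e = J a F X A B i e + J 0 (co C) (snd \<circ> C) A B i e"
proof -
 note o = op_closed[OF g] and b = br1_closed
 note AB = b[OF A B]
 show ?thesis
  unfolding J_def T[OF A] T[OF B] T[OF AB] br1_def[of C, symmetric]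
   br1_add_left[OF o[OF A] b[OF C A] B] br1_add_right[OF A o[OF B] b[OF C B]]
   VE_add_apply(1)[OF o[OF AB] b[OF C AB] e] VE_add_apply(1)[OF b[OF o[OF A] B] b[OF b[OF C A] B] e]
   VE_add_apply(1)[OF b[OF A o[OF B]] b[OF A b[OF C B]] e] by simp
qed

text \<open>The Jacobi expression of three sections changes sign when the first two are exchanged, so a statement about
  projectable first arguments gives one about projectable second arguments.\<close>

lemma J_cyclic:
 assumes C: "C \<in> SV" and A: "A \<in> SV" and B: "B \<in> SV" and e: "e \<in> pts mE"
 shows "J 0 (co C) (snd \<circ> C) A B i e = - J 0 (co A) (snd \<circ> A) C B i e"
proof -
 note AC = br1_closed[OF A C]
 have "\<theta> i (fst (br1 (br1 C A) B e)) = - \<theta> i (fst (br1 (br1 A C) B e))"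
  unfolding br1_skew[OF A C] br1_scale_left[OF AC B] VE_scale_apply(1)[OF br1_closed[OF AC B] e] by simp
 then show ?thesis unfolding J_def br1_def[symmetric] by simp
qed

text \<open>For projectable sections the Jacobi identity is that of \<open>E\<close>; tensoriality extends it to all
  sections in the last two arguments. For the first argument, the difference of two affine sections is
  treated by the cyclic symmetry.\<close>

lemma J_jet_proj:
 assumes Z: "Z \<in> asec mE JE" and z: "z \<in> asec M E" "projects_onto E Z z" and A: "A \<in> SV" and B: "B \<in> SV" and e: "e \<in> pts mE"
 shows "J 1 (aco Z) (snd \<circ> Z) A B i e = 0"
proof (rule J_all[OF gdat_jet[OF Z] _ A B e])
 fix P s R r e
 assume P: "P \<in> SV" "s \<in> vsec M V" "projects_onto E P s" and R: "R \<in> SV" "r \<in> vsec M V" "projects_onto E R r" and e: "e \<in> pts mE"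
 have "projects_onto E (act1 Z (br1 P R)) (act z (br s r))"
  by (rule act1_proj[OF Z z br1_closed[OF P(1) R(1)] br_closed[OF P(2) R(2)] br1_proj[OF P R]])
 moreover have "projects_onto E (br1 (act1 Z P) R) (br (act z s) r)"
  by (rule br1_proj[OF act1_closed[OF Z P(1)] act_closed[OF z(1) P(2)] act1_proj[OF Z z P] R])
 moreover have "projects_onto E (br1 P (act1 Z R)) (br s (act z r))"
  by (rule br1_proj[OF P act1_closed[OF Z R(1)] act_closed[OF z(1) R(2)] act1_proj[OF Z z R]])
 ultimately show "J 1 (aco Z) (snd \<circ> Z) P R i e = 0"
  using jac[OF z(1) P(2) R(2) aproj_in[OF e], of i] e unfolding J_def act1_def[symmetric] by (simp add: projects_onto_def)
qed

lemma J_vert: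
 assumes C: "C \<in> SV" and A: "A \<in> SV" and B: "B \<in> SV" and e: "e \<in> pts mE"
 shows "J 0 (co C) (snd \<circ> C) A B i e = 0"
proof -
 obtain P0 where P0: "P0 \<in> asec mE JE" "projects_onto E P0 \<zeta>0" using jet_lift by blast
 have proj: "J 0 (co D) (snd \<circ> D) A B i e = 0"
  if D: "D \<in> SV" and s: "s \<in> vsec M V" "projects_onto E D s" and A: "A \<in> SV" and B: "B \<in> SV" and e: "e \<in> pts mE" for D s A B e
 proof -
  note PD = PB.sec_plus_closed[OF P0(1) D]
  have "projects_onto E (sec_plus mE JE P0 D) (sec_plus M E \<zeta>0 s)"
   using P0(2) s(2) aproj_in by (simp add: projects_onto_def sec_plus_def)
  from J_jet_proj[OF PD sec_plus_closed[OF \<zeta>0 s(1)] this A B e] J_jet_proj[OF P0(1) \<zeta>0 P0(2) A B e]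
  show ?thesis
   using J_plus[OF gdat_jet[OF P0(1)] gdat_jet[OF PD] D A B e act1_plus[OF P0(1) D, unfolded act1_def], of i] by simp
 qed
 show ?thesis
 proof (rule J_all[OF gdat_vert[OF C] _ A B e])
  fix P s R r e
  assume P: "P \<in> SV" "s \<in> vsec M V" "projects_onto E P s" and R: "R \<in> SV" and e: "e \<in> pts mE"
  show "J 0 (co C) (snd \<circ> C) P R i e = 0"
   unfolding J_cyclic[OF C P(1) R e] proj[OF P C R e] by simp
 qed
qed

lemma J_jet:
 assumes Z: "Z \<in> asec mE JE" and A: "A \<in> SV" and B: "B \<in> SV" and e: "e \<in> pts mE"
 shows "J 1 (aco Z) (snd \<circ> Z) A B i e = 0"
proof -
 obtain P0 where P0: "P0 \<in> asec mE JE" "projects_onto E P0 \<zeta>0" using jet_lift by blast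
 obtain C where C: "C \<in> SV" "Z = sec_plus mE JE P0 C" using PB.sec_diff_ex[OF P0(1) Z] by blast
 note g = gdat_jet[OF Z, unfolded C(2)]
 show ?thesis
  using J_plus[OF gdat_jet[OF P0(1)] g C(1) A B e act1_plus[OF P0(1) C(1), unfolded act1_def], of i]
   J_jet_proj[OF P0(1) \<zeta>0 P0(2) A B e] J_vert[OF C(1) A B e] C(2) by simp
qed

lemma lie_cong:
 assumes X: "vector_field mE X" and Y: "vector_field mE Y" and e: "e \<in> pts mE"
  and eq: "!!y. y \<in> pts mE ==> X y = X' y" "!!y. y \<in> pts mE ==> Y y = Y' y" and h: "h \<in> smooth_near mE e"
 shows "snd (lie_bracket mE X Y e) h = snd (lie_bracket mE X' Y' e) h"
 unfolding lie_bracket_apply[OF e h] eq(1)[OF e, symmetric] eq(2)[OF e, symmetric]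
 using tan_pts[OF e vector_fieldD(3)[OF X e] near_apply[OF smE Y e h], of "%y. snd (Y' y) h"]
  tan_pts[OF e vector_fieldD(3)[OF Y e] near_apply[OF smE X e h], of "%y. snd (X' y) h"] eq by simp

text \<open>The second component is the Jacobi identity of vector fields, the first one is the vanishing of \<open>J\<close>.\<close>

lemma act1_jacobi:
 assumes Z: "Z \<in> asec mE JE" and A: "A \<in> SV" and B: "B \<in> SV"
 shows "act1 Z (br1 A B) = sadd (br1 (act1 Z A) B) (br1 A (act1 Z B))"
proof -
 note ZA = act1_closed[OF Z A] and ZB = act1_closed[OF Z B] and AB = br1_closed[OF A B]
 note c = br1_closed[OF ZA B] br1_closed[OF A ZB]
 note vZ = JE_secD(3)[OF Z] and v = VE_secD(3)
 have act_snd: "snd (act1 Z D y) = lie_bracket mE (snd \<circ> Z) (snd \<circ> D) y" if "y \<in> pts mE" for D y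
  unfolding act1_def by (rule op_snd[OF that])
 have br_snd: "snd (br1 C D y) = lie_bracket mE (snd \<circ> C) (snd \<circ> D) y" if "y \<in> pts mE" for C D y
  unfolding br1_def by (rule op_snd[OF that])
 show ?thesis
 proof (rule VE_sec_eqI[OF act1_closed[OF Z AB] PB.sec_add_closed[OF c]])
  fix e assume e: "e \<in> pts mE"
  show "\<theta> i (fst (act1 Z (br1 A B) e)) = \<theta> i (fst (sadd (br1 (act1 Z A) B) (br1 A (act1 Z B)) e))" for i
   using J_jet[OF Z A B e, of i] unfolding VE_add_apply[OF c e] J_def act1_def[symmetric] by simp
  fix h assume h: "h \<in> smooth_near mE e"
  let ?L = "lie_bracket mE"
  have "snd (?L (snd \<circ> Z) (snd \<circ> br1 A B) e) h = snd (?L (snd \<circ> Z) (?L (snd \<circ> A) (snd \<circ> B)) e) h"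
   by (rule lie_cong[OF vZ v[OF AB] e refl _ h]) (simp add: br_snd)
  moreover have "snd (?L (snd \<circ> act1 Z A) (snd \<circ> B) e) h = snd (?L (?L (snd \<circ> Z) (snd \<circ> A)) (snd \<circ> B) e) h"
   by (rule lie_cong[OF v[OF ZA] v[OF B] e _ refl h]) (simp add: act_snd)
  moreover have "snd (?L (snd \<circ> A) (snd \<circ> act1 Z B) e) h = snd (?L (snd \<circ> A) (?L (snd \<circ> Z) (snd \<circ> B)) e) h"
   by (rule lie_cong[OF v[OF A] v[OF ZB] e refl _ h]) (simp add: act_snd)
  ultimately show "snd (snd (act1 Z (br1 A B) e)) h = snd (snd (sadd (br1 (act1 Z A) B) (br1 A (act1 Z B)) e)) h"
   unfolding VE_add_apply[OF c e] act_snd[OF e] br_snd[OF e] using lie_jacobi[OF smE vZ v[OF A] v[OF B] e] by (simp add: tadd_def)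
 qed
qed

lemma algebroid_prolong: "affine_lie_algebroid mE (prolong_time t E) VE JE br1 act1 snd snd"
proof (intro affine_lie_algebroid.intro affine_lie_algebroid_axioms.intro fibred_E affine_bundle_JE br1_bracket act1_action anchor_maps_prolong act1_jacobi)
 fix Z A f assume "Z \<in> asec mE JE" "A \<in> SV" "f \<in> smooth_funs mE"
 from op_leib[OF gdat_jet[OF this(1)] this(2,3)]
 show "act1 Z (sscale f A) = sadd (sscale f (act1 Z A)) (sscale (%x. snd (snd (Z x)) f) A)" by (simp add: act1_def)
qed

lemma prolonged_br1: "prolonged_bracket M t V E br act lam rho br1 act1"
proof (intro prolonged_bracket.intro prolonged_bracket_axioms.intro br1_bracket act1_action)
 show "snd (br1 A B e) = lie_bracket mE (snd \<circ> A) (snd \<circ> B) e" if "e \<in> pts mE" for A B e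
  unfolding br1_def by (rule op_snd[OF that])
 show "snd (act1 Z B e) = lie_bracket mE (snd \<circ> Z) (snd \<circ> B) e" if "e \<in> pts mE" for Z B e
  unfolding act1_def by (rule op_snd[OF that])
next
 fix A B s r f g e
 assume A: "A \<in> SV" "s \<in> vsec M V" "projects_onto E A s" and B: "B \<in> SV" "r \<in> vsec M V" "projects_onto E B r"
  and f: "f \<in> smooth_funs mE" and g: "g \<in> smooth_funs mE" and e: "e \<in> pts mE"
 note x = aproj_in[OF e]
 note fA = scale_funsE[OF A(1) f] and BA = br1_closed[OF B(1) A(1)]
 note fa = VE_secD(1)[OF A(1) e] VE_secD(1)[OF B(1) e] vsecD(1)[OF br_closed[OF A(2) B(2)] x]
 note sc = fibre_scale[OF x fa(1)] fibre_scale[OF x fa(2)] fibre_scale[OF x fa(3)]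
 note leib = op_leib[OF gdat_vert, folded br1_def]
 note o1 = br1_closed[OF fA B(1)]
 have 1: "\<theta> i (fst (br1 (sscale f A) (sscale g B) e)) = g e * \<theta> i (fst (br1 (sscale f A) B e)) + (f e * snd (snd (A e)) g) * \<theta> i (fst (B e))" for i
  unfolding leib[OF fA B(1) g] VE_add_apply[OF scale_funsE[OF o1 g] scale_funsE[OF B(1) vf_funsE[OF VE_secD(3)[OF fA] g]] e]
   VE_scale_apply[OF o1 e] VE_scale_apply[OF B(1) e] using VE_scale_apply(2)[OF A(1) e] by simp
 have 2: "\<theta> i (fst (br1 B (sscale f A) e)) = f e * \<theta> i (fst (br1 B A e)) + snd (snd (B e)) f * \<theta> i (fst (A e))" for i
  unfolding leib[OF B(1) A(1) f] VE_add_apply[OF scale_funsE[OF BA f] scale_funsE[OF A(1) vf_funsE[OF VE_secD(3)[OF B(1)] f]] e]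
   VE_scale_apply[OF BA e] VE_scale_apply[OF A(1) e] by simp
 have 3: "fst (br1 B A e) = br r s (\<pi> e)" using br1_proj[OF B A] e by (simp add: projects_onto_def)
 show "fst (br1 (sscale f A) (sscale g B) e) = vadd V (vadd V (vscale V (f e * g e) (br s r (\<pi> e)))
   (vscale V (f e * snd (snd (A e)) g) (fst (B e)))) (vscale V (- (g e * snd (snd (B e)) f)) (fst (A e)))"
 proof (rule frame_eqI[OF x VE_secD(1)[OF br1_closed[OF fA scale_funsE[OF B(1) g]] e] fibre_add[OF x fibre_add[OF x sc(3) sc(2)] sc(1)]])
  fix i
  show "\<theta> i (fst (br1 (sscale f A) (sscale g B) e)) = \<theta> i (vadd V (vadd V (vscale V (f e * g e) (br s r (\<pi> e)))
   (vscale V (f e * snd (snd (A e)) g) (fst (B e)))) (vscale V (- (g e * snd (snd (B e)) f)) (fst (A e))))"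
   unfolding 1 c_skew[OF B(1) fA e] 2 3 br_sk[OF A(2) B(2) x] \<theta>_add[OF x fibre_add[OF x sc(3) sc(2)] sc(1)] \<theta>_add[OF x sc(3) sc(2)]
    \<theta>_scale[OF x fa(1)] \<theta>_scale[OF x fa(2)] \<theta>_scale[OF x fa(3)] by (simp add: algebra_simps)
 qed
next
 fix Z z B r f e
 assume Z: "Z \<in> asec mE JE" "z \<in> asec M E" "projects_onto E Z z" and B: "B \<in> SV" "r \<in> vsec M V" "projects_onto E B r"
  and f: "f \<in> smooth_funs mE" and e: "e \<in> pts mE"
 note x = aproj_in[OF e] and o = act1_closed[OF Z(1) B(1)]
 note fa = VE_secD(1)[OF B(1) e] vsecD(1)[OF act_closed[OF Z(2) B(2)] x]
 note sc = fibre_scale[OF x fa(1)] fibre_scale[OF x fa(2)]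
 have 3: "fst (act1 Z B e) = act z r (\<pi> e)" using act1_proj[OF Z B] e by (simp add: projects_onto_def)
 show "fst (act1 Z (sscale f B) e) = vadd V (vscale V (f e) (act z r (\<pi> e))) (vscale V (snd (snd (Z e)) f) (fst (B e)))"
 proof (rule frame_eqI[OF x VE_secD(1)[OF act1_closed[OF Z(1) scale_funsE[OF B(1) f]] e] fibre_add[OF x sc(2) sc(1)]])
  fix i
  show "\<theta> i (fst (act1 Z (sscale f B) e)) = \<theta> i (vadd V (vscale V (f e) (act z r (\<pi> e))) (vscale V (snd (snd (Z e)) f) (fst (B e))))"
   unfolding op_leib[OF gdat_jet[OF Z(1)] B(1) f, folded act1_def]
    VE_add_apply[OF scale_funsE[OF o f] scale_funsE[OF B(1) vf_funsE[OF JE_secD(3)[OF Z(1)] f]] e]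
    VE_scale_apply[OF o e] VE_scale_apply[OF B(1) e] 3 \<theta>_add[OF x sc(2) sc(1)] \<theta>_scale[OF x fa(1)] \<theta>_scale[OF x fa(2)] by simp
 qed
qed

text \<open>Requirement (i) fixes the second component of a bracket. On multiples of projectable sections requirement
  (ii) fixes the first one, and these generate.\<close>

lemma prolonged_unique:
 assumes pb: "prolonged_bracket M t V E br act lam rho br2 act2"
 shows "A \<in> SV ==> B \<in> SV ==> br2 A B = br1 A B" "Z \<in> asec mE JE ==> B \<in> SV ==> act2 Z B = act1 Z B"
proof -
 interpret p2: prolonged_bracket M t V E br act lam rho br2 act2 by (rule pb)
 interpret p1: prolonged_bracket M t V E br act lam rho br1 act1 by (rule prolonged_br1)
 have eqI: "C = D" if "C \<in> SV" "D \<in> SV" "!!e. e \<in> pts mE ==> fst (C e) = fst (D e)" "!!e. e \<in> pts mE ==> snd (C e) = snd (D e)" for C D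
  by (rule VE_sec_eqI[OF that(1,2)]) (simp_all add: that(3,4))
 show br: "br2 A B = br1 A B" if A: "A \<in> SV" and B: "B \<in> SV" for A B
  using B
 proof (induction rule: gen_induct)
  case (base R r g)
  note gR = scale_funsE[OF base(1,4)]
  show ?case
   using A
  proof (induction rule: gen_induct)
   case (base P s f)
   note fP = scale_funsE[OF base(1,4)]
   show ?case
    by (rule eqI[OF p2.br_closed[OF fP gR] p1.br_closed[OF fP gR]])
     (simp_all add: p1.proj_br[OF base(1-3) \<open>R \<in> SV\<close> \<open>r \<in> vsec M V\<close> \<open>projects_onto E R r\<close> base(4) \<open>g \<in> smooth_funs mE\<close>]
      p2.proj_br[OF base(1-3) \<open>R \<in> SV\<close> \<open>r \<in> vsec M V\<close> \<open>projects_onto E R r\<close> base(4) \<open>g \<in> smooth_funs mE\<close>]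
      p1.anchor_br[OF fP gR] p2.anchor_br[OF fP gR])
  next
   case (add A A')
   then show ?case using p1.br_add_left[OF add(1,2) gR] p2.br_add_left[OF add(1,2) gR] by simp
  qed
 next
  case (add B B')
  then show ?case using p1.br_add_right[OF A add(1,2)] p2.br_add_right[OF A add(1,2)] by simp
 qed
 obtain P0 where P0: "P0 \<in> asec mE JE" "projects_onto E P0 \<zeta>0" using jet_lift by blast
 have act: "act2 P0 B = act1 P0 B" if B: "B \<in> SV" for B
  using B
 proof (induction rule: gen_induct)
  case (base R r g)
  note gR = scale_funsE[OF base(1,4)]
  show ?case
   by (rule eqI[OF p2.act_closed[OF P0(1) gR] p1.act_closed[OF P0(1) gR]])
    (simp_all add: p1.proj_act[OF P0(1) \<zeta>0 P0(2) base] p2.proj_act[OF P0(1) \<zeta>0 P0(2) base]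
     p1.anchor_act[OF P0(1) gR] p2.anchor_act[OF P0(1) gR])
 next
  case (add B B')
  then show ?case using p1.act_add[OF P0(1) add(1,2)] p2.act_add[OF P0(1) add(1,2)] by simp
 qed
 show "act2 Z B = act1 Z B" if Z: "Z \<in> asec mE JE" and B: "B \<in> SV"
 proof -
  obtain C where C: "C \<in> SV" "Z = sec_plus mE JE P0 C" using PB.sec_diff_ex[OF P0(1) Z] by blast
  show ?thesis unfolding C(2) p2.act_plus[OF P0(1) C(1) B] p1.act_plus[OF P0(1) C(1) B] act[OF B] br[OF C(1) B] ..
 qed
qed

end

theorem mainTheorem5:
  fixes M :: "('p, 'b::euclidean_space) manifold" and t :: "'p \<Rightarrow> real"
    and V :: "('v, 'd::euclidean_space, 'p) vec_bundle"
    and E :: "('e, 'c::euclidean_space, 'v, 'p) aff_bundle"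
    and br :: "('p \<Rightarrow> 'v) \<Rightarrow> ('p \<Rightarrow> 'v) \<Rightarrow> 'p \<Rightarrow> 'v"
    and act :: "('p \<Rightarrow> 'e) \<Rightarrow> ('p \<Rightarrow> 'v) \<Rightarrow> 'p \<Rightarrow> 'v"
    and lam :: "'e \<Rightarrow> 'p tvec" and rho :: "'v \<Rightarrow> 'p tvec"
  assumes "affine_lie_algebroid M t V E br act lam rho"
  shows "\<exists>br1 act1.
    affine_lie_algebroid (atot E) (prolong_time t E) (prolong_vert M t V E rho)
      (prolong_jet M t E lam) br1 act1 snd snd \<and>
    prolonged_bracket M t V E br act lam rho br1 act1 \<and>
    (\<forall>br2 act2. prolonged_bracket M t V E br act lam rho br2 act2 \<longrightarrow>
      (\<forall>Z\<^sub>1\<in>vsec (atot E) (prolong_vert M t V E rho).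
         \<forall>Z\<^sub>2\<in>vsec (atot E) (prolong_vert M t V E rho). br2 Z\<^sub>1 Z\<^sub>2 = br1 Z\<^sub>1 Z\<^sub>2) \<and>
      (\<forall>Z\<in>asec (atot E) (prolong_jet M t E lam).
         \<forall>Y\<in>vsec (atot E) (prolong_vert M t V E rho). act2 Z Y = act1 Z Y))"
proof -
 interpret affine_lie_algebroid M t V E br act lam rho by (rule assms)
 obtain I \<sigma> \<theta> where "frame M V I \<sigma> \<theta>" using frame_exists by blast
 moreover obtain \<zeta> where "\<zeta> \<in> asec M E" using global_section by blast
 ultimately interpret F: alg_frame M t V E br act lam rho I \<sigma> \<theta> \<zeta>
  by (intro alg_frame.intro assms alg_frame_axioms.intro)
 show ?thesis
  by (intro exI[of _ F.br1] exI[of _ F.act1] conjI F.algebroid_prolong F.prolonged_br1 allI impI ballI F.prolonged_unique)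
qed

end
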